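(* Let $\theta\in(0,1)$, $k\in\mathbb N$, let $u_\eta\in L^2(Q)$ and $u_c\in BV(Q)$, and let $\Sigma\subset\Pi^k$ be a nonempty training set. Consider the two-level scheme $(\mathcal T_\theta^{k+1})$: Level 1: $(\tilde\alpha,\tilde{\mathscr B}[k])\in\operatorname{arg\,min}\{\|u_c-u_{\alpha,\mathscr B[k]}\|^2_{L^2(Q)}:\ \alpha\in[\theta,1/\theta]^{k+1},\ \mathscr B[k]\in\Sigma\}$; Level 2: $u_{\alpha,\mathscr B[k]}:=\operatorname{arg\,min}\{\|u-u_\eta\|^2_{L^2(Q)}+PGV^{k+1}_{\alpha,\mathscr B[k]}(u):\ u\in BV(Q)\}$. Then $(\mathcal T^{k+1}_\theta)$ admits at least one solution $(\tilde\alpha,\tilde{\mathscr B}[k])\in[\theta,1/\theta]^{k+1}\times\Sigma$, and provides an associated optimally reconstructed image $u_{\tilde\alpha,\tilde{\mathscr B}[k]}\in BV(Q)$.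
   Context: Let $N\in\mathbb N$, $Q:=(-1/2,1/2)^N$. $\mathbb M^{N^l}$ is the space of real tensors of order $N\times\cdots\times N$ ($l$ times), with $\mathbb M^{N}=\mathbb R^N$, $\mathbb M^{N^2}=\mathbb R^{N\times N}$. $\mathcal M_b(Q;X)$ denotes bounded Radon measures with values in $X$, $|\cdot|_{\mathcal M_b}$ the total variation, $Du$ the distributional gradient, $\mathbb R^m_+$ the vectors with positive entries. A first order operator on $\mathbb M^{N^l}$-valued distributions is $\mathscr Bv=\sum_{i=1}^N B^i\frac{\partial}{\partial x_i}v\in\mathcal D'(Q;\mathbb M^{N^{l+1}})$, $v\in\mathcal D'(Q;\mathbb M^{N^l})$, where each $B^i$ is a constant tensor acting as a linear map $\mathbb M^{N^l}\to\mathbb M^{N^{l+1}}$. $\|\mathscr B\|_{\ell^\infty}:=\sum_i\|B^i\|$ (Euclidean norms); $\mathscr B_n\to\mathscr B$ in $\ell^\infty$ means $\sum_i\|B_n^i-B^i\|\to0$ (componentwise for tuples). $BV_{\mathscr B}(Q;\mathbb M^{N^l}):=\{u\in L^1(Q;\mathbb M^{N^l}):\mathscr Bu\in\mathcal M_b(Q;\mathbb M^{N^{l+1}})\}$ with norm $\|u\|_{L^1}+|\mathscr Bu|_{\mathcal M_b}$. $\Pi_l$ is the collection of such $\mathscr B$ with finite dimensional null-space and such that: (1) $BV_{\mathscr B}(Q;\mathbb M^{N^l})$ is a Banach space; (2) for each $u\in BV_{\mathscr B}(Q;\mathbb M^{N^l})$ there is $\{u_n\}\subset C^\infty(\overline Q;\mathbb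 M^{N^l})$ with $u_n\to u$ in $L^1$ and $|\mathscr Bu_n|_{\mathcal M_b}\to|\mathscr Bu|_{\mathcal M_b}$; (3) the injection of $BV_{\mathscr B}(Q;\mathbb M^{N^l})$ into $L^1(Q;\mathbb M^{N^l})$ is compact. $\Pi:=\Pi_1$ and $\Pi^k:=\Pi\times\Pi_2\times\cdots\times\Pi_k$; elements are written $\mathscr B[k]=(\mathscr B^0,\dots,\mathscr B^{k-1})$ with $\mathscr B^l\in\Pi_{l+1}$. Compactness property (C) for a sequence of operators $\mathscr B_n$ in $\Pi_l$: whenever $\sup_n\{\|\mathscr B_n\|_{\ell^\infty}+\|v_n\|_{BV_{\mathscr B_n}(Q;\mathbb M^{N^l})}\}<+\infty$, there exist $\mathscr B$ and $v\in BV_{\mathscr B}(Q;\mathbb M^{N^l})$ such that, up to a subsequence, $v_n\to v$ in $L^1(Q;\mathbb M^{N^l})$ and $\mathscr B_nv_n\rightharpoonup^*\mathscr Bv$ weakly* in $\mathcal M_b(Q;\mathbb M^{N^{l+1}})$. For sequences in $\Pi^k$ it is required of each component. A set $\Sigma\subset\Pi^k$ is a training set if its operators satisfy (C) (every sequence of elements of $\Sigma$ has property (C)) and $\Sigma$ is closed and bounded in $\ell^\infty$. For $u\in L^1(Q)$, $\alpha=(\alpha_0,\dots,\alpha_k)\in\mathbb R^{k+1}_+$, $$PGV^{k+1}_{\alpha,\mathscr B[k]}(u):=\inf\Big\{\alpha_0|Du-v_0|_{\mathcal M_b(Q;\mathbb R^N)}+\sum_{l=1}^{k-1}\alpha_l|v_l-\mathscr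 B^{l-1}v_{l-1}|_{\mathcal M_b(Q;\mathbb M^{N^{l+1}})}+\alpha_k|\mathscr B^{k-1}v_{k-1}|_{\mathcal M_b(Q;\mathbb M^{N^{k+1}})}\Big\},$$ the infimum over $v_l\in BV_{\mathscr B^l}(Q;\mathbb M^{N^{l+1}})$, $l=0,\dots,k-1$. *)

theory Defs
  imports "HOL-Analysis.Analysis"
begin

text \<open>
  The dimension \<open>N\<close> is \<open>CARD('n)\<close>. A tensor of order \<open>l\<close> is given by its entries, indexed by the
  lists of length \<open>l\<close> over \<open>'n\<close>. As the order varies within the statements below, all orders share
  one type, and a tensor of order \<open>l\<close> is used only through its entries in \<open>tidx l\<close>; entries at
  lists of any other length are irrelevant. In the same way functions and set functions matter
  only through their restrictions to \<open>Q\<close> and to the Borel subsets of \<open>Q\<close>, and elements of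
  \<open>L\<^sup>1\<close>, \<open>L\<^sup>2\<close>, \<open>BV\<close> are represented by functions identified when equal almost everywhere on \<open>Q\<close>.
\<close>

type_synonym 'n tensor = "'n list \<Rightarrow> real"
type_synonym 'n tfun = "real ^ 'n \<Rightarrow> 'n tensor"
type_synonym 'n tmeas = "(real ^ 'n) set \<Rightarrow> 'n tensor"
type_synonym 'n oper = "'n \<Rightarrow> 'n list \<Rightarrow> 'n list \<Rightarrow> real"

definition cube :: "(real ^ 'n::finite) set" where
  "cube = {x. \<forall>i. - 1/2 < x $ i \<and> x $ i < 1/2}"

definition tidx :: "nat \<Rightarrow> 'n list set" where
  "tidx l = {I. length I = l}"

definition tnorm :: "nat \<Rightarrow> 'n::finite tensor \<Rightarrow> real" where
  "tnorm l t = sqrt (\<Sum>I\<in>tidx l. (t I)\<^sup>2)"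


section \<open>Test functions\<close>

definition pd :: "'n \<Rightarrow> (real ^ 'n::finite \<Rightarrow> real) \<Rightarrow> real ^ 'n \<Rightarrow> real" where
  "pd i f x = frechet_derivative f (at x) (axis i 1)"

text \<open>\<open>f \<in> C\<^sup>\<infinity>(\<real>\<^sup>N)\<close>: every iterated partial derivative is differentiable everywhere.\<close>

definition smooth :: "(real ^ 'n::finite \<Rightarrow> real) \<Rightarrow> bool" where
  "smooth f \<longleftrightarrow> (\<forall>is x. foldr pd is f differentiable (at x))"

definition test_fun :: "(real ^ 'n::finite \<Rightarrow> real) set" where
  "test_fun = {\<phi>. smooth \<phi> \<and> (\<exists>K. compact K \<and> K \<subseteq> cube \<and> (\<forall>x. x \<notin> K \<longrightarrow> \<phi> x = 0))}"

text \<open>Continuous functions on \<open>Q\<close> vanishing on the boundary.\<close>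

definition C0_fun :: "(real ^ 'n::finite \<Rightarrow> real) set" where
  "C0_fun = {\<phi>. continuous_on cube \<phi> \<and> (\<forall>e>0. compact {x \<in> cube. e \<le> \<bar>\<phi> x\<bar>})}"

text \<open>Smooth functions on the closure of \<open>Q\<close> are understood as restrictions of functions in \<open>C\<^sup>\<infinity>(\<real>\<^sup>N)\<close>.\<close>

definition smooth_tfun :: "nat \<Rightarrow> 'n::finite tfun set" where
  "smooth_tfun l = {v. \<forall>I\<in>tidx l. smooth (\<lambda>x. v x I)}"


section \<open>Bounded Radon measures on \<open>Q\<close>\<close>

text \<open>
  On the open set \<open>Q\<close> of \<open>\<real>\<^sup>N\<close> the bounded Radon measures with values in a finite dimensional space
  are the countably additive set functions on the Borel sets; regularity and finiteness
  of the total variation are automatic.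
\<close>

definition borelQ :: "(real ^ 'n::finite) measure" where
  "borelQ = restrict_space borel cube"

definition Mb :: "nat \<Rightarrow> 'n::finite tmeas set" where
  "Mb l = {\<mu>. \<forall>I\<in>tidx l. \<forall>A::nat \<Rightarrow> (real ^ 'n) set.
     range A \<subseteq> sets borelQ \<longrightarrow> disjoint_family A \<longrightarrow> (\<lambda>n. \<mu> (A n) I) sums \<mu> (\<Union>n. A n) I}"

definition total_variation :: "nat \<Rightarrow> 'n::finite tmeas \<Rightarrow> ennreal" where
  "total_variation l \<mu> =
     (SUP P \<in> {P. finite P \<and> partition_on cube P \<and> P \<subseteq> sets borelQ}. \<Sum>A\<in>P. ennreal (tnorm l (\<mu> A)))"

text \<open>
  Integration against a real valued measure \<open>m\<close> through its Jordan decomposition: the positive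
  variation of \<open>m\<close> is \<open>A \<mapsto> sup {m(B) | B \<subseteq> A}\<close>, the negative variation is that of \<open>-m\<close>.
\<close>

definition pos_variation :: "((real ^ 'n::finite) set \<Rightarrow> real) \<Rightarrow> (real ^ 'n) measure" where
  "pos_variation m =
     measure_of cube (sets borelQ) (\<lambda>A. SUP B \<in> {B \<in> sets borelQ. B \<subseteq> A}. ennreal (m B))"

definition signed_integral :: "((real ^ 'n::finite) set \<Rightarrow> real) \<Rightarrow> (real ^ 'n \<Rightarrow> real) \<Rightarrow> real" where
  "signed_integral m \<phi> =
     integral\<^sup>L (pos_variation m) \<phi> - integral\<^sup>L (pos_variation (\<lambda>A. - m A)) \<phi>"

text \<open>Convergence of all entries in duality with \<open>C\<^sub>0(Q)\<close>.\<close>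

definition weak_star :: "nat \<Rightarrow> (nat \<Rightarrow> 'n::finite tmeas) \<Rightarrow> 'n tmeas \<Rightarrow> bool" where
  "weak_star l \<mu>n \<mu> \<longleftrightarrow> (\<forall>J\<in>tidx l. \<forall>\<phi>\<in>C0_fun.
     (\<lambda>n. signed_integral (\<lambda>A. \<mu>n n A J) \<phi>) \<longlonglongrightarrow> signed_integral (\<lambda>A. \<mu> A J) \<phi>)"


section \<open>First order operators and the spaces \<open>BV\<^sub>B\<close>\<close>

definition L1 :: "nat \<Rightarrow> 'n::finite tfun set" where
  "L1 l = {v. \<forall>I\<in>tidx l. integrable (lebesgue_on cube) (\<lambda>x. v x I)}"

definition L1_norm :: "nat \<Rightarrow> 'n::finite tfun \<Rightarrow> ennreal" where
  "L1_norm l v = (\<integral>\<^sup>+ x. ennreal (tnorm l (v x)) \<partial>lebesgue_on cube)"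

text \<open>
  \<open>B i J I\<close> is the coefficient of \<open>B\<^sup>i\<close> taking the entry \<open>I\<close> of a tensor of order \<open>l\<close> to the
  entry \<open>J\<close> of a tensor of order \<open>l + 1\<close>. Coefficients at other positions are fixed to be zero, so
  that an operator is determined by its coefficients.
\<close>

definition operators :: "nat \<Rightarrow> 'n::finite oper set" where
  "operators l = {B. \<forall>i J I. \<not> (J \<in> tidx (Suc l) \<and> I \<in> tidx l) \<longrightarrow> B i J I = 0}"

definition op_norm :: "nat \<Rightarrow> 'n::finite oper \<Rightarrow> real" where
  "op_norm l B = (\<Sum>i\<in>UNIV. sqrt (\<Sum>J\<in>tidx (Suc l). \<Sum>I\<in>tidx l. (B i J I)\<^sup>2))"

text \<open>The entry \<open>J\<close> of the distribution \<open>B v = \<Sum>\<^sub>i B\<^sup>i \<partial>\<^sub>i v\<close>.\<close>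

definition dist_op :: "nat \<Rightarrow> 'n::finite oper \<Rightarrow> 'n tfun \<Rightarrow> 'n list \<Rightarrow> (real ^ 'n \<Rightarrow> real) \<Rightarrow> real" where
  "dist_op l B v J \<phi> =
     - (\<Sum>i\<in>UNIV. \<Sum>I\<in>tidx l. B i J I * (LINT x|lebesgue_on cube. v x I * pd i \<phi> x))"

definition represents :: "nat \<Rightarrow> 'n::finite oper \<Rightarrow> 'n tfun \<Rightarrow> 'n tmeas \<Rightarrow> bool" where
  "represents l B v \<mu> \<longleftrightarrow> \<mu> \<in> Mb (Suc l) \<and>
     (\<forall>J\<in>tidx (Suc l). \<forall>\<phi>\<in>test_fun. dist_op l B v J \<phi> = signed_integral (\<lambda>A. \<mu> A J) \<phi>)"

definition BVB :: "nat \<Rightarrow> 'n::finite oper \<Rightarrow> 'n tfun set" where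
  "BVB l B = {v \<in> L1 l. \<exists>\<mu>. represents l B v \<mu>}"

text \<open>The measure \<open>B v\<close>, for \<open>v \<in> BVB l B\<close>; its entries on the Borel subsets of \<open>Q\<close> are unique.\<close>

definition op_meas :: "nat \<Rightarrow> 'n::finite oper \<Rightarrow> 'n tfun \<Rightarrow> 'n tmeas" where
  "op_meas l B v = (SOME \<mu>. represents l B v \<mu>)"

definition BVB_norm :: "nat \<Rightarrow> 'n::finite oper \<Rightarrow> 'n tfun \<Rightarrow> ennreal" where
  "BVB_norm l B v = L1_norm l v + total_variation (Suc l) (op_meas l B v)"


section \<open>The classes \<open>\<Pi>\<^sub>l\<close>, property (C) and training sets\<close>

text \<open>The null-space is taken among functions. Mollification and rescaling of \<open>Q\<close> show that it is
  finite dimensional iff the null-space in the distributions is.\<close>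

definition null_space :: "nat \<Rightarrow> 'n::finite oper \<Rightarrow> 'n tfun set" where
  "null_space l B =
     {v \<in> BVB l B. \<forall>J\<in>tidx (Suc l). \<forall>\<phi>\<in>test_fun. dist_op l B v J \<phi> = 0}"

definition finite_dim_null :: "nat \<Rightarrow> 'n::finite oper \<Rightarrow> bool" where
  "finite_dim_null l B \<longleftrightarrow> (\<exists>(d::nat) e. (\<forall>j<d. e j \<in> null_space l B) \<and>
     (\<forall>v\<in>null_space l B. \<exists>c. AE x in lebesgue_on cube. \<forall>I\<in>tidx l. v x I = (\<Sum>j<d. c j * e j x I)))"

text \<open>\<open>BVB l B\<close> is a normed space by construction; the Banach property is its completeness.\<close>

definition BVB_complete :: "nat \<Rightarrow> 'n::finite oper \<Rightarrow> bool" where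
  "BVB_complete l B \<longleftrightarrow> (\<forall>u. (\<forall>n::nat. u n \<in> BVB l B) \<longrightarrow>
     (\<forall>e::real. e > 0 \<longrightarrow> (\<exists>M. \<forall>m\<ge>M. \<forall>n\<ge>M. BVB_norm l B (\<lambda>x I. u m x I - u n x I) < ennreal e)) \<longrightarrow>
     (\<exists>w\<in>BVB l B. (\<lambda>n. BVB_norm l B (\<lambda>x I. u n x I - w x I)) \<longlonglongrightarrow> 0))"

definition smooth_approx :: "nat \<Rightarrow> 'n::finite oper \<Rightarrow> bool" where
  "smooth_approx l B \<longleftrightarrow> (\<forall>u\<in>BVB l B. \<exists>w. (\<forall>n::nat. w n \<in> smooth_tfun l) \<and>
     (\<lambda>n. L1_norm l (\<lambda>x I. w n x I - u x I)) \<longlonglongrightarrow> 0 \<and>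
     (\<lambda>n. total_variation (Suc l) (op_meas l B (w n))) \<longlonglongrightarrow> total_variation (Suc l) (op_meas l B u))"

definition compact_injection :: "nat \<Rightarrow> 'n::finite oper \<Rightarrow> bool" where
  "compact_injection l B \<longleftrightarrow> (\<forall>u. (\<forall>n::nat. u n \<in> BVB l B) \<longrightarrow> (SUP n. BVB_norm l B (u n)) < \<infinity> \<longrightarrow>
     (\<exists>w\<in>L1 l. \<exists>r::nat \<Rightarrow> nat. strict_mono r \<and> (\<lambda>n. L1_norm l (\<lambda>x I. u (r n) x I - w x I)) \<longlonglongrightarrow> 0))"

definition Pi_op :: "nat \<Rightarrow> 'n::finite oper set" where
  "Pi_op l = {B \<in> operators l.
     finite_dim_null l B \<and> BVB_complete l B \<and> smooth_approx l B \<and> compact_injection l B}"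

text \<open>
  A tuple \<open>(B\<^sup>0, \<dots>, B\<^sup>k\<^sup>-\<^sup>1)\<close> is a function on \<open>{..<k}\<close>, undefined elsewhere; \<open>B\<^sup>l\<close> acts on tensors
  of order \<open>l + 1\<close>.
\<close>

definition Pi_tuple :: "nat \<Rightarrow> (nat \<Rightarrow> 'n::finite oper) set" where
  "Pi_tuple k = (\<Pi>\<^sub>E l\<in>{..<k}. Pi_op (Suc l))"

definition property_C :: "nat \<Rightarrow> (nat \<Rightarrow> 'n::finite oper) \<Rightarrow> bool" where
  "property_C l Bn \<longleftrightarrow> (\<forall>v. (\<forall>n. v n \<in> BVB l (Bn n)) \<longrightarrow>
     (SUP n. ennreal (op_norm l (Bn n)) + BVB_norm l (Bn n) (v n)) < \<infinity> \<longrightarrow>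
     (\<exists>B\<in>operators l. \<exists>w\<in>BVB l B. \<exists>r::nat \<Rightarrow> nat. strict_mono r \<and>
        (\<lambda>n. L1_norm l (\<lambda>x I. v (r n) x I - w x I)) \<longlonglongrightarrow> 0 \<and>
        weak_star (Suc l) (\<lambda>n. op_meas l (Bn (r n)) (v (r n))) (op_meas l B w)))"

definition bounded_tuples :: "nat \<Rightarrow> (nat \<Rightarrow> 'n::finite oper) set \<Rightarrow> bool" where
  "bounded_tuples k S \<longleftrightarrow> (\<exists>C. \<forall>B\<in>S. \<forall>l<k. op_norm (Suc l) (B l) \<le> C)"

text \<open>Sequential closedness in the space of all tuples of operators, not relative to \<open>Pi_tuple k\<close>.\<close>

definition closed_tuples :: "nat \<Rightarrow> (nat \<Rightarrow> 'n::finite oper) set \<Rightarrow> bool" where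
  "closed_tuples k S \<longleftrightarrow> (\<forall>Bn. \<forall>B \<in> (\<Pi>\<^sub>E l\<in>{..<k}. operators (Suc l)). (\<forall>n::nat. Bn n \<in> S) \<longrightarrow>
     (\<forall>l<k. (\<lambda>n. op_norm (Suc l) (\<lambda>i J I. Bn n l i J I - B l i J I)) \<longlonglongrightarrow> 0) \<longrightarrow> B \<in> S)"

definition training_set :: "nat \<Rightarrow> (nat \<Rightarrow> 'n::finite oper) set \<Rightarrow> bool" where
  "training_set k S \<longleftrightarrow> S \<subseteq> Pi_tuple k \<and>
     (\<forall>Bn. (\<forall>n::nat. Bn n \<in> S) \<longrightarrow> (\<forall>l<k. property_C (Suc l) (\<lambda>n. Bn n l))) \<and>
     closed_tuples k S \<and> bounded_tuples k S"


section \<open>The regularizer and the two-level scheme\<close>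

text \<open>A scalar function is a tensor field of order 0, and \<open>D\<close> is a first order operator from
  order 0 to order 1.\<close>

definition scalar :: "(real ^ 'n::finite \<Rightarrow> real) \<Rightarrow> 'n tfun" where
  "scalar u = (\<lambda>x I. u x)"

definition grad_op :: "'n::finite oper" where
  "grad_op = (\<lambda>i J I. if J = [i] \<and> I = [] then 1 else 0)"

definition BV :: "(real ^ 'n::finite \<Rightarrow> real) set" where
  "BV = {u. scalar u \<in> BVB 0 grad_op}"

text \<open>The measure \<open>f \<L>\<^sup>N\<close> with density \<open>f\<close>.\<close>

definition density_meas :: "'n::finite tfun \<Rightarrow> 'n tmeas" where
  "density_meas f = (\<lambda>A I. LINT x:A|lebesgue. f x I)"

text \<open>If \<open>u\<close> is not in \<open>BV\<close>, then \<open>Du - v\<^sub>0\<close> is not a measure for any integrable \<open>v\<^sub>0\<close>.\<close>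

definition PGV :: "nat \<Rightarrow> (nat \<Rightarrow> real) \<Rightarrow> (nat \<Rightarrow> 'n::finite oper) \<Rightarrow> (real ^ 'n \<Rightarrow> real) \<Rightarrow> ennreal" where
  "PGV k \<alpha> B u = (if u \<notin> BV then \<infinity> else
     (INF v \<in> {v. \<forall>l<k. v l \<in> BVB (Suc l) (B l)}.
        ennreal (\<alpha> 0) * total_variation 1 (\<lambda>A I. op_meas 0 grad_op (scalar u) A I - density_meas (v 0) A I)
      + (\<Sum>l = 1..k - 1. ennreal (\<alpha> l) * total_variation (Suc l)
           (\<lambda>A I. density_meas (v l) A I - op_meas l (B (l - 1)) (v (l - 1)) A I))
      + ennreal (\<alpha> k) * total_variation (Suc k) (op_meas k (B (k - 1)) (v (k - 1)))))"

text \<open>The squared \<open>L\<^sup>2\<close> norm, infinite outside \<open>L\<^sup>2\<close>; functions in \<open>BV\<close> need not lie in \<open>L\<^sup>2\<close>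
  when \<open>N > 2\<close>.\<close>

definition L2_sq :: "(real ^ 'n::finite \<Rightarrow> real) \<Rightarrow> ennreal" where
  "L2_sq f = (\<integral>\<^sup>+ x. ennreal ((f x)\<^sup>2) \<partial>lebesgue_on cube)"

definition L2 :: "(real ^ 'n::finite \<Rightarrow> real) set" where
  "L2 = {f \<in> borel_measurable (lebesgue_on cube). L2_sq f < \<infinity>}"

text \<open>The minimizers of the second level; \<open>u\<close> is (a representative of) the image
  \<open>u\<^sub>\<alpha>\<^sub>,\<^sub>B\<close> when \<open>u \<in> level2 u\<^sub>\<eta> k \<alpha> B\<close>.\<close>

definition level2 ::
  "(real ^ 'n::finite \<Rightarrow> real) \<Rightarrow> nat \<Rightarrow> (nat \<Rightarrow> real) \<Rightarrow> (nat \<Rightarrow> 'n oper) \<Rightarrow> (real ^ 'n \<Rightarrow> real) set" where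
  "level2 u\<^sub>\<eta> k \<alpha> B = {u \<in> BV. \<forall>w\<in>BV.
     L2_sq (\<lambda>x. u x - u\<^sub>\<eta> x) + PGV k \<alpha> B u \<le> L2_sq (\<lambda>x. w x - u\<^sub>\<eta> x) + PGV k \<alpha> B w}"

definition param_box :: "real \<Rightarrow> nat \<Rightarrow> (nat \<Rightarrow> real) set" where
  "param_box \<theta> k = (\<Pi>\<^sub>E l\<in>{..k}. {\<theta>..1/\<theta>})"

text \<open>\<open>level1\<close>: pairs minimizing the distance of the reconstructed image to \<open>u\<^sub>c\<close>.\<close>

definition level1 ::
  "(real ^ 'n::finite \<Rightarrow> real) \<Rightarrow> (real ^ 'n \<Rightarrow> real) \<Rightarrow> real \<Rightarrow> nat \<Rightarrow> (nat \<Rightarrow> 'n oper) set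
     \<Rightarrow> ((nat \<Rightarrow> real) \<times> (nat \<Rightarrow> 'n oper)) set" where
  "level1 u\<^sub>c u\<^sub>\<eta> \<theta> k S = {(\<alpha>, B) \<in> param_box \<theta> k \<times> S.
     \<forall>u\<in>level2 u\<^sub>\<eta> k \<alpha> B. \<forall>(\<alpha>', B') \<in> param_box \<theta> k \<times> S. \<forall>u'\<in>level2 u\<^sub>\<eta> k \<alpha>' B'.
       L2_sq (\<lambda>x. u\<^sub>c x - u x) \<le> L2_sq (\<lambda>x. u\<^sub>c x - u' x)}"

end

theory Submission
  imports Defs "HOL-Probability.Helly_Selection"
begin

text \<open>
  The scheme is solved by the direct method on both levels, so all the work lies in one compactness
  and one approximation property of the regularizer under simultaneous variation of the weights
  \<open>\<alpha>\<close>, the operators \<open>B\<close> and the image \<open>u\<close>.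

  \<^bold>\<open>The functional as a chain.\<close> Put \<open>w\<^sub>0 = u\<close>, \<open>w\<^sub>l\<^sub>+\<^sub>1 = v\<^sub>l\<close> for \<open>l < k\<close> and \<open>w\<^sub>k\<^sub>+\<^sub>1 = 0\<close>,
  and let \<open>A\<^sub>0 = D\<close>, \<open>A\<^sub>l\<^sub>+\<^sub>1 = B\<^sup>l\<close>. Then the regularizer is the infimum of
  \<open>\<Sum>\<^sub>l \<alpha>\<^sub>l |A\<^sub>l w\<^sub>l - w\<^sub>l\<^sub>+\<^sub>1|(Q)\<close> (\<open>PGV_eq_chain_cost\<close>). Each total variation is the supremum of
  \<open>\<langle>A\<^sub>l w\<^sub>l - w\<^sub>l\<^sub>+\<^sub>1, \<Phi>\<rangle>\<close> over smooth compactly supported \<open>\<Phi>\<close> with \<open>|\<Phi>| \<le> 1\<close>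
  (\<open>total_variation_eq_SUP_pairing\<close>). This supremum, called the defect below, makes sense for all
  integrable fields, is convex, and is lower semicontinuous jointly in the operator and in both
  fields, since every single pairing is continuous (\<open>defect_lsc\<close>). Moreover bounded defects force
  the limit field into the space \<open>BV\<^sub>B\<close> of the limit operator (\<open>BVB_closed\<close>), by weak* sequential
  compactness of measures (\<open>Mb_weakly_compact\<close>).

  \<^bold>\<open>Compactness.\<close> Suppose the energies of \<open>u\<^sub>n\<close> with parameters \<open>\<alpha>\<^sub>n \<rightarrow> \<alpha>\<close>, \<open>B\<^sub>n \<rightarrow> B\<close> are bounded and
  take almost optimal chains. The defects are bounded because \<open>\<alpha>\<^sub>n \<ge> \<theta>\<close>. If the \<open>L\<^sup>1\<close> norms of the
  inner fields were unbounded, dividing by them would give, by property (C), a limit chain that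
  starts and ends with zero, has zero defects and unit norm; but a chain with zero defects that starts
  with zero vanishes step by step (\<open>chain_bounded\<close>). So the norms are bounded and (C) yields
  \<open>L\<^sup>1\<close> limits of the inner fields (\<open>chain_compact\<close>). The images \<open>u\<^sub>n\<close> are bounded in \<open>L\<^sup>2\<close> only; a limit
  is extracted by convexity: among the images satisfying, up to an error that tends to 0, the bounds on
  the data term, on the distance to \<open>u\<^sub>c\<close> and on the first defect, almost minimizers of the data term
  form a Cauchy sequence (\<open>nested_midpoint_convex_Cauchy\<close>, \<open>BV_limit\<close>). This gives
  \<open>energy_compact\<close>: some \<open>u\<close> has energy at most the limit of the energies, and at the same time a distance
  to \<open>u\<^sub>c\<close> at most the limit of the distances.

  \<^bold>\<open>Approximation.\<close> For fixed \<open>z\<close>, an almost optimal chain for \<open>B\<close> consists of fields in spaces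
  that depend on \<open>B\<close> and may differ from those for \<open>B\<^sub>n\<close>. Dilating and mollifying a field raises its
  defects arbitrarily little and produces a field with an integrable gradient, which is admissible for all
  operators and whose defect is continuous in the operator (\<open>recovery_competitor\<close>). Hence the
  regularizer is upper semicontinuous in the parameters (\<open>PGV_limsup\<close>).

  \<^bold>\<open>Conclusion.\<close> With constant parameters, \<open>energy_compact\<close> gives minimizers of the second level; they
  are unique by strict convexity of the data term (\<open>level2_unique\<close>). For the first level,
  parameters range in a compact set (\<open>parameters_compact\<close>), and both properties together show that limits of
  minimizers are minimizers, with no increase of the distance to \<open>u\<^sub>c\<close> (\<open>level2_closed\<close>).
\<close>

section \<open>Smooth bump functions\<close>

text \<open>
  The family is closed under differentiation up to linear combinations, which is what makes an
  algebra of bump functions generated by it closed under partial derivatives.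
\<close>

definition expinv :: "nat \<Rightarrow> real \<Rightarrow> real" where
  "expinv j t = (if t > 0 then exp (- 1 / t) / t ^ j else 0)"

lemma expinv_nonneg: "0 \<le> expinv j t"
  by (simp add: expinv_def)

lemma expinv_le_square:
  assumes "0 < t"
  shows "expinv j t \<le> fact (j + 2) * t\<^sup>2"
proof -
  have "(1/t) ^ (j+2) /\<^sub>R fact (j+2) \<le> (\<Sum>n. (1/t) ^ n /\<^sub>R fact n)"
    using sum_le_suminf[OF summable_exp_generic[of "1/t"], of "{j+2}"] assms
    by (auto simp: field_simps)
  then have *: "(1/t) ^ (j+2) / fact (j+2) \<le> exp (1/t)"
    by (simp add: exp_def divide_inverse mult.commute del: fact_Suc)
  have **: "inverse e \<le> F * p" if "1 / p / F \<le> e" "0 < p" "0 < F" for e F p :: real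
  proof -
    have "0 < 1 / p / F" using that by simp
    then have "inverse e \<le> inverse (1 / p / F)" using that(1) by (rule le_imp_inverse_le[rotated])
    then show ?thesis by (simp add: mult.commute)
  qed
  have "exp (- (1/t)) \<le> fact (j+2) * t ^ (j+2)"
    using **[of "t ^ (j+2)" "fact (j+2)" "exp (1/t)"] * assms
    by (simp add: exp_minus power_one_over del: fact_Suc)
  then show ?thesis
    using assms by (simp add: expinv_def divide_le_eq power_add power2_eq_square mult_ac)
qed

lemma expinv_has_derivative:
  "(expinv j has_real_derivative expinv (j + 2) t - real j * expinv (j + 1) t) (at t)"
proof -
  consider "t > 0" | "t < 0" | "t = 0" by linarith
  then show ?thesis
  proof cases
    case 1
    have "((\<lambda>t. exp (- 1 / t) / t ^ j) has_real_derivative expinv (j + 2) t - real j * expinv (j + 1) t) (at t)"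
proof -
      have d: "real j * t ^ (j - 1) = real j * t ^ j / t"
        using 1 by (cases j) auto
      have "((\<lambda>t. exp (- 1 / t) / t ^ j) has_real_derivative
          (exp (- 1 / t) * (1 / t\<^sup>2) * t ^ j - exp (- 1 / t) * (real j * t ^ (j - 1))) / (t ^ j * t ^ j)) (at t)"
        using 1 by (auto intro!: derivative_eq_intros simp: power2_eq_square)
      moreover have "(exp (- 1 / t) * (1 / t\<^sup>2) * t ^ j - exp (- 1 / t) * (real j * t ^ (j - 1))) / (t ^ j * t ^ j)
          = expinv (j + 2) t - real j * expinv (j + 1) t"
        unfolding d using 1 by (simp add: expinv_def field_simps power2_eq_square)
      ultimately show ?thesis by simp
    qed
    then show ?thesis
      by (rule has_field_derivative_transform_within_open[of _ _ _ "{0<..}"])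
        (use 1 in \<open>auto simp: expinv_def\<close>)
  next
    case 2
    have "((\<lambda>t. 0) has_real_derivative 0) (at t)" by simp
    then have "(expinv j has_real_derivative 0) (at t)"
      by (rule has_field_derivative_transform_within_open[of _ _ _ "{..<0}"])
        (use 2 in \<open>auto simp: expinv_def\<close>)
    then show ?thesis using 2 by (simp add: expinv_def)
  next
    case 3
    have "(\<lambda>h. (expinv j (0 + h) - expinv j 0) / h) \<midarrow>0\<rightarrow> 0"
    proof (rule Lim_null_comparison)
      show "\<forall>\<^sub>F h in at 0. norm ((expinv j (0 + h) - expinv j 0) / h) \<le> fact (j + 2) * \<bar>h\<bar>"
      proof (rule always_eventually, rule allI)
        fix h :: real
        show "norm ((expinv j (0 + h) - expinv j 0) / h) \<le> fact (j + 2) * \<bar>h\<bar>"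
        proof (cases "h > 0")
          case True
          then have "expinv j h / h \<le> fact (j + 2) * h\<^sup>2 / h"
            by (intro divide_right_mono expinv_le_square) auto
          then show ?thesis using True
            by (simp add: expinv_def power2_eq_square)
        next
          case False
          then have "expinv j (0 + h) - expinv j 0 = 0" by (simp add: expinv_def)
          then show ?thesis by (simp del: fact_Suc)
        qed
      qed
      show "((\<lambda>h. fact (j + 2) * \<bar>h\<bar>) \<longlongrightarrow> (0::real)) (at 0)"
        by (auto intro!: tendsto_eq_intros)
    qed
    then show ?thesis using 3 by (simp add: DERIV_def expinv_def)
  qed
qed

text \<open>
  An algebra of functions on which smoothness is proved once and for all: by
  \<open>bumpalg_pd\<close> partial derivatives stay inside, so iterated derivatives are differentiable by induction. The
  real powers of positive members serve to divide by a smooth approximation of a Euclidean norm.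
\<close>

inductive bumpalg :: "(real ^ 'n::finite \<Rightarrow> real) \<Rightarrow> bool" where
  bumpalg_const: "bumpalg (\<lambda>x. c)"
| bumpalg_coord: "bumpalg (\<lambda>x. x $ i)"
| bumpalg_add: "bumpalg f \<Longrightarrow> bumpalg g \<Longrightarrow> bumpalg (\<lambda>x. f x + g x)"
| bumpalg_mult: "bumpalg f \<Longrightarrow> bumpalg g \<Longrightarrow> bumpalg (\<lambda>x. f x * g x)"
| bumpalg_expinv: "bumpalg f \<Longrightarrow> bumpalg (\<lambda>x. expinv j (f x))"
| bumpalg_powr: "bumpalg f \<Longrightarrow> (\<And>x. f x > 0) \<Longrightarrow> bumpalg (\<lambda>x. f x powr a)"

lemma bumpalg_diff: "bumpalg f \<Longrightarrow> bumpalg g \<Longrightarrow> bumpalg (\<lambda>x. f x - g x)"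
  using bumpalg_add[OF _ bumpalg_mult[OF bumpalg_const[of "-1"]], of f g] by simp

lemma bumpalg_sum: "finite I \<Longrightarrow> (\<And>i. i \<in> I \<Longrightarrow> bumpalg (f i)) \<Longrightarrow> bumpalg (\<lambda>x. \<Sum>i\<in>I. f i x)"
  by (induction I rule: finite_induct) (auto intro: bumpalg.intros)

lemma bumpalg_prod: "finite I \<Longrightarrow> (\<And>i. i \<in> I \<Longrightarrow> bumpalg (f i)) \<Longrightarrow> bumpalg (\<lambda>x. \<Prod>i\<in>I. f i x)"
  by (induction I rule: finite_induct) (auto intro: bumpalg.intros)

text \<open>
  The derivative must be found in the class in all directions at once, so that the induction
  hypothesis also covers the inner functions in the chain rule.
\<close>

lemma bumpalg_has_derivative:
  assumes "bumpalg f"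
  shows "\<exists>f'. (\<forall>x. (f has_derivative f' x) (at x)) \<and> (\<forall>v. bumpalg (\<lambda>x. f' x v))"
  using assms
proof induction
  case (bumpalg_const c)
  show ?case by (rule exI[of _ "\<lambda>x v. 0"]) (auto intro: bumpalg.intros)
next
  case (bumpalg_coord i)
  have "((\<lambda>x. x $ i) has_derivative (\<lambda>v. v $ i)) (at x)" for x :: "real ^ 'a"
    by (rule bounded_linear_imp_has_derivative[OF bounded_linear_vec_nth])
  then show ?case by (intro exI[of _ "\<lambda>x v. v $ i"]) (auto intro: bumpalg.intros)
next
  case (bumpalg_add f g)
  then obtain f' g' where "\<forall>x. (f has_derivative f' x) (at x)" "\<forall>v. bumpalg (\<lambda>x. f' x v)"
    "\<forall>x. (g has_derivative g' x) (at x)" "\<forall>v. bumpalg (\<lambda>x. g' x v)" by blast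
  then show ?case
    by (intro exI[of _ "\<lambda>x v. f' x v + g' x v"]) (auto intro: bumpalg.intros derivative_intros)
next
  case (bumpalg_mult f g)
  then obtain f' g' where "\<forall>x. (f has_derivative f' x) (at x)" "\<forall>v. bumpalg (\<lambda>x. f' x v)"
    "\<forall>x. (g has_derivative g' x) (at x)" "\<forall>v. bumpalg (\<lambda>x. g' x v)" by blast
  then show ?case using bumpalg_mult.hyps
    by (intro exI[of _ "\<lambda>x v. f x * g' x v + f' x v * g x"]) (auto intro!: bumpalg_add bumpalg.bumpalg_mult has_derivative_mult)
next
  case (bumpalg_expinv f j)
  then obtain f' where f': "\<forall>x. (f has_derivative f' x) (at x)" "\<forall>v. bumpalg (\<lambda>x. f' x v)" by blast
  have "((\<lambda>x. expinv j (f x)) has_derivative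
      (\<lambda>v. (expinv (j + 2) (f x) - real j * expinv (j + 1) (f x)) * f' x v)) (at x)" for x
    using has_derivative_compose[OF f'(1)[rule_format]
        expinv_has_derivative[of j "f x", unfolded has_field_derivative_def]] .
  then show ?case using f' bumpalg_expinv.hyps
    by (intro exI[of _ "\<lambda>x v. (expinv (j + 2) (f x) - real j * expinv (j + 1) (f x)) * f' x v"])
      (auto intro!: bumpalg.intros(3-) bumpalg_diff bumpalg.intros(1))
next
  case (bumpalg_powr f a)
  then obtain f' where f': "\<forall>x. (f has_derivative f' x) (at x)" "\<forall>v. bumpalg (\<lambda>x. f' x v)" by blast
  have "((\<lambda>x. f x powr a) has_derivative (\<lambda>v. (a * f x powr (a - 1)) * f' x v)) (at x)" for x
    using has_derivative_compose[OF f'(1)[rule_format]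
        has_real_derivative_powr[OF bumpalg_powr.hyps(2)[of x], of a, unfolded has_field_derivative_def]] .
  then show ?case using f' bumpalg_powr.hyps
    by (intro exI[of _ "\<lambda>x v. (a * f x powr (a - 1)) * f' x v"]) (auto intro!: bumpalg.intros)
qed

lemma bumpalg_pd:
  assumes "bumpalg f"
  shows "bumpalg (pd i f)"
proof -
  obtain f' where f': "\<And>x. (f has_derivative f' x) (at x)" "\<And>v. bumpalg (\<lambda>x. f' x v)"
    using bumpalg_has_derivative[OF assms] by blast
  have "pd i f = (\<lambda>x. f' x (axis i 1))"
    using frechet_derivative_at[OF f'(1)] by (auto simp: pd_def)
  then show ?thesis using f'(2) by simp
qed

lemma bumpalg_smooth:
  assumes "bumpalg f"
  shows "smooth f"
proof -
  have *: "bumpalg (foldr pd is f)" for "is"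
    using assms by (induction "is") (auto intro: bumpalg_pd)
  show ?thesis
    unfolding smooth_def
    using bumpalg_has_derivative[OF *] by (blast intro: differentiableI)
qed

lemma smooth_pd: "smooth f \<Longrightarrow> smooth (pd i f)"
  unfolding smooth_def
proof (intro allI)
  fix "is" x assume "\<forall>is x. foldr pd is f differentiable at x"
  then have "foldr pd (is @ [i]) f differentiable at x" by blast
  then show "foldr pd is (pd i f) differentiable at x" by simp
qed

lemma smooth_differentiable: "smooth f \<Longrightarrow> f differentiable (at x)"
  unfolding smooth_def by (metis foldr.simps(1) id_apply)

lemma smooth_has_derivative: "smooth f \<Longrightarrow> (f has_derivative frechet_derivative f (at x)) (at x)"
  using smooth_differentiable frechet_derivative_works by blast

lemma smooth_continuous: "smooth f \<Longrightarrow> continuous_on S f"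
  using smooth_differentiable
  by (meson continuous_at_imp_continuous_on differentiable_imp_continuous_within)

lemma frechet_derivative_eq_sum_pd:
  assumes "f differentiable (at x)"
  shows "frechet_derivative f (at x) h = (\<Sum>i\<in>UNIV. h $ i * pd i f x)"
proof -
  interpret bounded_linear "frechet_derivative f (at x)"
    using assms by (metis frechet_derivative_works has_derivative_bounded_linear)
  have "h = (\<Sum>i\<in>UNIV. h $ i *\<^sub>R axis i 1)"
    by (simp add: basis_expansion scalar_mult_eq_scaleR[symmetric])
  then have "frechet_derivative f (at x) h = frechet_derivative f (at x) (\<Sum>i\<in>UNIV. h $ i *\<^sub>R axis i 1)"
    by simp
  also have "\<dots> = (\<Sum>i\<in>UNIV. h $ i * pd i f x)"
    by (simp add: sum scaleR pd_def)
  finally show ?thesis .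
qed

lemma open_cube: "open (cube :: (real ^ 'n::finite) set)"
  and cube_eq_box: "(cube :: (real ^ 'n::finite) set) = box (\<chi> i. -1/2) (\<chi> i. 1/2)"
proof -
  show *: "(cube :: (real ^ 'n::finite) set) = box (\<chi> i. -1/2) (\<chi> i. 1/2)"
    by (auto simp: cube_def mem_box_cart)
  show "open (cube :: (real ^ 'n::finite) set)"
    by (simp add: * open_box)
qed

lemma borel_cube [measurable]: "cube \<in> sets borel"
  by (simp add: open_cube borel_open)

lemma space_borelQ [simp]: "space borelQ = cube"
  by (simp add: borelQ_def space_restrict_space)

lemma sets_borelQ: "sets borelQ = {A. A \<in> sets borel \<and> A \<subseteq> cube}"
  by (auto simp: borelQ_def sets_restrict_space_iff)

lemma pd_eq_0_outside:
  assumes "closed K" "\<And>x. x \<notin> K \<Longrightarrow> \<phi> x = (0::real)" "x \<notin> K"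
  shows "pd i \<phi> x = 0"
proof -
  have "(\<phi> has_derivative (\<lambda>_. 0)) (at x)"
  proof (rule has_derivative_transform_within_open[of "\<lambda>_. 0" _ _ _ "- K"])
    show "open (- K)" using assms by auto
  qed (use assms in auto)
  then show ?thesis
    by (metis pd_def frechet_derivative_at)
qed

lemma test_fun_pd: "\<phi> \<in> test_fun \<Longrightarrow> pd i \<phi> \<in> test_fun"
  unfolding test_fun_def
proof (safe, goal_cases)
  case (2 K)
  then show ?case
    using pd_eq_0_outside[OF compact_imp_closed[OF \<open>compact K\<close>], of \<phi>] by (intro exI[of _ K]) simp
qed (rule smooth_pd)

lemma test_fun_outside: "\<phi> \<in> test_fun \<Longrightarrow> x \<notin> cube \<Longrightarrow> \<phi> x = 0"
  unfolding test_fun_def by auto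

lemma test_fun_continuous: "\<phi> \<in> test_fun \<Longrightarrow> continuous_on S \<phi>"
  unfolding test_fun_def using smooth_continuous by blast

lemma test_fun_bounded:
  assumes "\<phi> \<in> test_fun"
  obtains C where "0 \<le> C" "\<And>x. \<bar>\<phi> x\<bar> \<le> C"
proof -
  obtain K where K: "compact K" "\<And>x. x \<notin> K \<Longrightarrow> \<phi> x = 0"
    using assms unfolding test_fun_def by auto
  have "compact (\<phi> ` K)"
    using K(1) test_fun_continuous[OF assms] by (rule compact_continuous_image[rotated])
  then obtain C where "\<And>x. x \<in> K \<Longrightarrow> \<bar>\<phi> x\<bar> \<le> C"
    using compact_imp_bounded bounded_iff by (metis imageI real_norm_def)
  then have "\<bar>\<phi> x\<bar> \<le> max C 0" for x
    using K(2)[of x] by (cases "x \<in> K") fastforce+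
  then show ?thesis using that[of "max C 0"] by auto
qed

lemma test_fun_borel [measurable_dest]: "\<phi> \<in> test_fun \<Longrightarrow> \<phi> \<in> borel_measurable borel"
  by (intro borel_measurable_continuous_onI test_fun_continuous)

definition bumps :: "(real ^ 'n::finite \<Rightarrow> real) set" where
  "bumps = {\<phi>. bumpalg \<phi> \<and> (\<exists>K. compact K \<and> K \<subseteq> cube \<and> (\<forall>x. x \<notin> K \<longrightarrow> \<phi> x = 0))}"

lemma bumps_test_fun: "\<phi> \<in> bumps \<Longrightarrow> \<phi> \<in> test_fun"
  unfolding bumps_def test_fun_def using bumpalg_smooth by blast

lemma bumps_zero: "(\<lambda>x. 0) \<in> bumps"
  unfolding bumps_def using bumpalg_const by auto

lemma bumps_mult: "\<phi> \<in> bumps \<Longrightarrow> bumpalg f \<Longrightarrow> (\<lambda>x. f x * \<phi> x) \<in> bumps"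
  unfolding bumps_def by (auto intro!: bumpalg_mult)

lemma bumps_add: "\<phi> \<in> bumps \<Longrightarrow> \<psi> \<in> bumps \<Longrightarrow> (\<lambda>x. \<phi> x + \<psi> x) \<in> bumps"
  unfolding bumps_def
proof (safe, goal_cases)
  case (2 K K')
  then show ?case by (intro exI[of _ "K \<union> K'"]) auto
qed (auto intro!: bumpalg_add)

lemma bumps_diff: "\<phi> \<in> bumps \<Longrightarrow> \<psi> \<in> bumps \<Longrightarrow> (\<lambda>x. \<phi> x - \<psi> x) \<in> bumps"
  using bumps_add[OF _ bumps_mult[OF _ bumpalg_const[of "-1"]], of \<phi> \<psi>] by simp

lemma bumps_sum:
  "finite I \<Longrightarrow> (\<And>i. i \<in> I \<Longrightarrow> \<phi> i \<in> bumps) \<Longrightarrow> (\<lambda>x. \<Sum>i\<in>I. \<phi> i x) \<in> bumps"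
  by (induction I rule: finite_induct) (auto intro: bumps_zero bumps_add)

text \<open>
  A smooth function that is positive exactly on the open box between \<open>a\<close> and \<open>b\<close>.
\<close>

definition box_bump :: "real ^ 'n::finite \<Rightarrow> real ^ 'n \<Rightarrow> real ^ 'n \<Rightarrow> real" where
  "box_bump a b x = (\<Prod>i\<in>UNIV. expinv 0 (x $ i - a $ i) * expinv 0 (b $ i - x $ i))"

lemma bumpalg_box_bump: "bumpalg (box_bump a b)"
  unfolding box_bump_def [abs_def]
  by (intro bumpalg_prod bumpalg_mult bumpalg_expinv bumpalg_diff bumpalg_coord bumpalg_const finite)

lemma box_bump_nonneg: "0 \<le> box_bump a b x"
  unfolding box_bump_def by (intro prod_nonneg mult_nonneg_nonneg expinv_nonneg)

lemma box_bump_pos: "0 < box_bump a b x \<longleftrightarrow> x \<in> box a b"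
proof
  assume "x \<in> box a b"
  then show "0 < box_bump a b x"
    unfolding box_bump_def by (intro prod_pos) (auto simp: mem_box_cart expinv_def)
next
  assume *: "0 < box_bump a b x"
  have ne: "expinv 0 (x $ i - a $ i) * expinv 0 (b $ i - x $ i) \<noteq> 0" for i
  proof
    assume "expinv 0 (x $ i - a $ i) * expinv 0 (b $ i - x $ i) = 0"
    then have "box_bump a b x = 0"
      unfolding box_bump_def by (intro prod_zero bexI[of _ i]) auto
    then show False using * by simp
  qed
  from this have "x $ i - a $ i > 0 \<and> b $ i - x $ i > 0" for i
  proof -
    have "expinv 0 (x $ i - a $ i) \<noteq> 0" "expinv 0 (b $ i - x $ i) \<noteq> 0"
      using ne[of i] by auto
    then show ?thesis unfolding expinv_def by argo
  qed
  then show "x \<in> box a b" by (auto simp: mem_box_cart)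
qed

text \<open>
  Composing a positive multiple \<open>n\<close> of the bump function of a slightly smaller box with
  \<open>exp (-1/t)\<close> gives functions below 1 whose supports are compact in the box and which tend to 1 inside.
\<close>

lemma box_indicator_approx:
  fixes a b :: "real ^ 'n::finite"
  assumes "box a b \<subseteq> cube"
  obtains \<psi> where "\<And>n. \<psi> n \<in> bumps" "\<And>n x. 0 \<le> \<psi> n x \<and> \<psi> n x \<le> 1"
    "\<And>x. (\<lambda>n. \<psi> n x) \<longlonglongrightarrow> indicat_real (box a b) x"
proof -
  define e :: "nat \<Rightarrow> real ^ 'n" where "e n = (\<chi> i. 1 / real (Suc n))" for n
  define \<psi> where "\<psi> n x = expinv 0 (real n * box_bump (a + e n) (b - e n) x)" for n x
  have zero: "\<psi> n x = 0" if "x \<notin> box (a + e n) (b - e n)" for n x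
    using that box_bump_pos[of "a + e n" "b - e n" x] box_bump_nonneg[of "a + e n" "b - e n" x]
    by (simp add: \<psi>_def expinv_def)
  have sub: "cbox (a + e n) (b - e n) \<subseteq> box a b" for n
  proof
    fix x assume "x \<in> cbox (a + e n) (b - e n)"
    then have *: "a $ i + 1 / real (Suc n) \<le> x $ i \<and> x $ i \<le> b $ i - 1 / real (Suc n)" for i
      by (simp add: mem_box_cart e_def)
    have "a $ i < x $ i \<and> x $ i < b $ i" for i
      using *[of i] zero_less_divide_1_iff[of "real (Suc n)"] by linarith
    then show "x \<in> box a b" by (simp add: mem_box_cart)
  qed
  have 1: "\<psi> n \<in> bumps" for n
  proof -
    have "bumpalg (\<psi> n)"
      unfolding \<psi>_def[abs_def]
      by (intro bumpalg_expinv bumpalg_mult bumpalg_const bumpalg_box_bump)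
    moreover have "\<forall>x. x \<notin> cbox (a + e n) (b - e n) \<longrightarrow> \<psi> n x = 0"
      using zero box_subset_cbox by blast
    ultimately show ?thesis
      unfolding bumps_def using sub[of n] assms compact_cbox[of "a + e n" "b - e n"]
      by (intro CollectI conjI exI[of _ "cbox (a + e n) (b - e n)"]) auto
  qed
  have 2: "0 \<le> \<psi> n x \<and> \<psi> n x \<le> 1" for n x
    by (auto simp: \<psi>_def expinv_def)
  have 3: "(\<lambda>n. \<psi> n x) \<longlonglongrightarrow> indicat_real (box a b) x" for x
  proof (cases "x \<in> box a b")
    case False
    then have "\<psi> n x = 0" for n
    proof -
      have "x \<notin> box (a + e n) (b - e n)"
        using False sub[of n] box_subset_cbox[of "a + e n" "b - e n"] by auto
      then show ?thesis by (rule zero)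
    qed
    then show ?thesis using False by simp
  next
    case True
    have lim: "(\<lambda>n. 1 / real (Suc n)) \<longlonglongrightarrow> 0"
      using LIMSEQ_inverse_real_of_nat by (simp add: inverse_eq_divide)
    have cont: "isCont (expinv 0) t" for t
      using expinv_has_derivative DERIV_isCont by blast
    have "(\<lambda>n. box_bump (a + e n) (b - e n) x) \<longlonglongrightarrow>
        (\<Prod>i\<in>UNIV. expinv 0 (x $ i - (a $ i + 0)) * expinv 0 ((b $ i - 0) - x $ i))"
      unfolding box_bump_def e_def vector_add_component vector_minus_component vec_lambda_beta
      by (intro tendsto_prod tendsto_mult isCont_tendsto_compose[OF cont] tendsto_intros lim)
    then have c: "(\<lambda>n. box_bump (a + e n) (b - e n) x) \<longlonglongrightarrow> box_bump a b x"
      by (simp add: box_bump_def)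
    have p: "0 < box_bump a b x" using True box_bump_pos by blast
    have "filterlim (\<lambda>n. box_bump (a + e n) (b - e n) x * real n) at_top sequentially"
      by (rule filterlim_tendsto_pos_mult_at_top[OF c p filterlim_real_sequentially])
    then have inf: "filterlim (\<lambda>n. real n * box_bump (a + e n) (b - e n) x) at_top sequentially"
      by (simp add: mult.commute)
    have "((\<lambda>t::real. exp (- 1 / t)) \<longlongrightarrow> 1) at_top"
    proof -
      have "((\<lambda>t::real. - 1 / t) \<longlongrightarrow> 0) at_top"
        by (rule real_tendsto_divide_at_top[OF tendsto_const filterlim_ident])
      from tendsto_exp[OF this] show ?thesis by simp
    qed
    then have "(expinv 0 \<longlongrightarrow> 1) at_top"
      by (rule Lim_transform_eventually)
        (auto simp: expinv_def eventually_at_top_linorder intro!: exI[of _ 1])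
    then have "(\<lambda>n. \<psi> n x) \<longlonglongrightarrow> 1"
      unfolding \<psi>_def by (rule filterlim_compose[OF _ inf])
    then show ?thesis using True by simp
  qed
  show ?thesis using that[of \<psi>] 1 2 3 by blast
qed

lemma sets_borelQ_eq_sigma_sets:
  "sets (borelQ :: (real ^ 'n::finite) measure) = sigma_sets cube {A. (\<exists>a b. A = box a b) \<and> A \<subseteq> cube}"
proof
  let ?G = "{A. (\<exists>a b. A = box a b) \<and> A \<subseteq> (cube :: (real ^ 'n) set)}"
  show "sigma_sets cube ?G \<subseteq> sets (borelQ :: (real ^ 'n) measure)"
  proof -
    have "?G \<subseteq> sets (borelQ :: (real ^ 'n) measure)" by (auto simp: sets_borelQ)
    from sets.sigma_sets_subset[OF this] show ?thesis by simp
  qed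
  show "sets (borelQ :: (real ^ 'n) measure) \<subseteq> sigma_sets cube ?G"
  proof
    fix A :: "(real ^ 'n) set" assume "A \<in> sets borelQ"
    then have "A \<in> sets borel" "A \<subseteq> cube" by (auto simp: sets_borelQ)
    have "A \<in> sigma_sets UNIV (range (\<lambda>(a, b). box a b))"
      using \<open>A \<in> sets borel\<close> unfolding borel_eq_box by simp
    then have "A \<inter> cube \<in> sigma_sets cube ?G"
    proof induction
      case (Basic X)
      then obtain a b where "X = box a b" by auto
      then have "\<exists>a b. X \<inter> cube = box a b"
        unfolding \<open>X = box a b\<close> cube_eq_box box_Int_box by metis
      then show ?case by auto
    next
      case Empty
      then show ?case by (simp add: sigma_sets.Empty)
    next
      case (Compl X)
      from Compl.IH have "cube - X \<inter> cube \<in> sigma_sets cube ?G" by (rule sigma_sets.Compl)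
      moreover have "cube - X \<inter> cube = (UNIV - X) \<inter> cube" by auto
      ultimately show ?case by simp
    next
      case (Union X)
      then have "(\<Union>i. X i \<inter> cube) \<in> sigma_sets cube ?G" by (intro sigma_sets.Union)
      moreover have "(\<Union>i. X i \<inter> cube) = (\<Union>i. X i) \<inter> cube" by auto
      ultimately show ?case by simp
    qed
    then show "A \<in> sigma_sets cube ?G" using \<open>A \<subseteq> cube\<close> by (simp add: Int_absorb2)
  qed
qed

lemma test_fun_measurable:
  "\<phi> \<in> test_fun \<Longrightarrow> sets M = sets borelQ \<Longrightarrow> \<phi> \<in> borel_measurable M"
  by (simp add: measurable_cong_sets[of M borelQ] borelQ_def measurable_restrict_space1 test_fun_borel)

lemma test_fun_integrable:
  assumes "\<phi> \<in> test_fun" "sets M = sets borelQ" "finite_measure M"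
  shows "integrable M \<phi>"
proof -
  obtain C where "\<And>x. \<bar>\<phi> x\<bar> \<le> C" using test_fun_bounded[OF assms(1)] by blast
  then show ?thesis
    by (intro finite_measure.integrable_const_bound[OF assms(3), of _ C] test_fun_measurable assms) auto
qed

text \<open>
  Density of smooth functions in \<open>L\<^sup>1\<close>, for finitely many measures at the same time: the sets with
  this property form a Dynkin system which contains the open boxes, an intersection-stable generator. Treating several
  measures simultaneously is needed because every entry of a tensor measure has its own positive and
  negative variation.
\<close>

theorem bumps_approx_indicator:
  fixes \<nu> :: "'i \<Rightarrow> (real ^ 'n::finite) measure"
  assumes I: "finite I" and fin: "\<And>i. i \<in> I \<Longrightarrow> finite_measure (\<nu> i)"
    and sets: "\<And>i. i \<in> I \<Longrightarrow> sets (\<nu> i) = sets borelQ"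
    and A: "A \<in> sets borelQ" and e: "0 < e"
  shows "\<exists>\<phi>\<in>bumps. \<forall>i\<in>I. (LINT x|\<nu> i. \<bar>\<phi> x - indicat_real A x\<bar>) < e"
proof -
  let ?G = "{A. (\<exists>a b. A = box a b) \<and> A \<subseteq> (cube :: (real ^ 'n) set)}"
  have int: "integrable (\<nu> i) \<phi>" if "i \<in> I" "\<phi> \<in> bumps" for i \<phi>
    by (rule test_fun_integrable[OF bumps_test_fun[OF that(2)] sets[OF that(1)] fin[OF that(1)]])
  have ind: "integrable (\<nu> i) (indicat_real B)" if "i \<in> I" "B \<in> sigma_sets cube ?G" for i B
  proof (rule integrable_real_indicator)
    show "B \<in> sets (\<nu> i)"
      unfolding sets[OF that(1)] sets_borelQ_eq_sigma_sets by (rule that(2))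
    show "emeasure (\<nu> i) B < \<infinity>"
      using finite_measure.emeasure_finite[OF fin[OF that(1)]] by (simp add: less_top[symmetric])
  qed
  have IG: "Int_stable ?G"
  proof (rule Int_stableI, safe)
    fix a b c d :: "real ^ 'n"
    show "\<exists>a' b'. box a b \<inter> box c d = box a' b'" unfolding box_Int_box by metis
  qed auto
  have box: "\<exists>\<phi>\<in>bumps. \<forall>i\<in>I. (LINT x|\<nu> i. \<bar>\<phi> x - indicat_real (box a b) x\<bar>) < e"
    if ab: "box a b \<subseteq> cube" and e: "0 < e" for a b :: "real ^ 'n" and e
  proof -
    obtain \<psi> where \<psi>: "\<And>n. \<psi> n \<in> bumps" "\<And>n x. 0 \<le> \<psi> n x \<and> \<psi> n x \<le> 1"
      "\<And>x. (\<lambda>n. \<psi> n x) \<longlonglongrightarrow> indicat_real (box a b) x"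
      using box_indicator_approx[OF ab] by blast
    have bG: "box a b \<in> sigma_sets cube ?G" using ab by (intro sigma_sets.Basic) auto
    have "(\<lambda>n. LINT x|\<nu> i. \<bar>\<psi> n x - indicat_real (box a b) x\<bar>) \<longlonglongrightarrow> (LINT x|\<nu> i. 0)" if i: "i \<in> I" for i
    proof (rule integral_dominated_convergence[where w = "\<lambda>_. 1"])
      interpret finite_measure "\<nu> i" using fin[OF i] .
      show "integrable (\<nu> i) (\<lambda>_. 1)" by simp
      show "(\<lambda>x. \<bar>\<psi> n x - indicat_real (box a b) x\<bar>) \<in> borel_measurable (\<nu> i)" for n
        using int[OF i \<psi>(1)[of n]] ind[OF i bG] by (intro borel_measurable_abs borel_measurable_diff) auto
      show "AE x in \<nu> i. (\<lambda>n. \<bar>\<psi> n x - indicat_real (box a b) x\<bar>) \<longlonglongrightarrow> 0"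
        using tendsto_rabs[OF LIM_zero[OF \<psi>(3)]] by simp
      show "AE x in \<nu> i. norm \<bar>\<psi> n x - indicat_real (box a b) x\<bar> \<le> 1" for n
      proof (rule AE_I2)
        fix x show "norm \<bar>\<psi> n x - indicat_real (box a b) x\<bar> \<le> 1"
          using \<psi>(2)[of n x] by (auto simp: indicator_def)
      qed
    qed simp
    then have "\<forall>\<^sub>F n in sequentially. \<forall>i\<in>I. (LINT x|\<nu> i. \<bar>\<psi> n x - indicat_real (box a b) x\<bar>) < e"
      using e by (intro eventually_ball_finite I ballI order_tendstoD(2)[of _ 0]) auto
    then show ?thesis using \<psi>(1) eventually_happens'[OF sequentially_bot] by blast
  qed
  have AG: "A \<in> sigma_sets cube ?G" using A sets_borelQ_eq_sigma_sets by blast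
  have "?G \<subseteq> Pow cube" by auto
  from IG this AG e show ?thesis
  proof (induction arbitrary: e rule: sigma_sets_induct_disjoint[consumes 3, case_names c1 c2 c3 c4])
    case (c1 A e)
    then obtain a b where "A = box a b" "box a b \<subseteq> cube" by blast
    then show ?case using box[OF _ c1.prems] by simp
  next
    case (c2 e)
    then show ?case using bumps_zero by (intro bexI[of _ "\<lambda>x. 0"]) auto
  next
    case (c3 A e)
    obtain \<phi> where \<phi>: "\<phi> \<in> bumps" "\<forall>i\<in>I. (LINT x|\<nu> i. \<bar>\<phi> x - indicat_real A x\<bar>) < e/2"
      using c3.IH[of "e/2"] c3.prems by auto
    obtain \<psi> where \<psi>: "\<psi> \<in> bumps" "\<forall>i\<in>I. (LINT x|\<nu> i. \<bar>\<psi> x - indicat_real cube x\<bar>) < e/2"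
      using box[of "\<chi> i. -1/2" "\<chi> i. 1/2" "e/2", folded cube_eq_box] c3.prems
      by auto
    have top: "cube \<in> sigma_sets cube ?G" by (rule sigma_sets_top)
    have "(LINT x|\<nu> i. \<bar>\<psi> x - \<phi> x - indicat_real (cube - A) x\<bar>) < e" if i: "i \<in> I" for i
    proof -
      have "(LINT x|\<nu> i. \<bar>\<psi> x - \<phi> x - indicat_real (cube - A) x\<bar>)
        \<le> (LINT x|\<nu> i. \<bar>\<psi> x - indicat_real cube x\<bar> + \<bar>\<phi> x - indicat_real A x\<bar>)"
      proof (rule integral_mono)
        fix x assume "x \<in> space (\<nu> i)"
        then have "x \<in> cube" using sets_eq_imp_space_eq[OF sets[OF i]] by simp
        then show "\<bar>\<psi> x - \<phi> x - indicat_real (cube - A) x\<bar> \<le> \<bar>\<psi> x - indicat_real cube x\<bar> + \<bar>\<phi> x - indicat_real A x\<bar>"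
          by (auto simp: indicator_def)
      qed (use int[OF i \<phi>(1)] int[OF i \<psi>(1)] ind[OF i c3.hyps] ind[OF i top] ind[OF i sigma_sets.Compl[OF c3.hyps]]
          in \<open>auto intro!: Bochner_Integration.integrable_diff Bochner_Integration.integrable_add integrable_abs\<close>)
      also have "\<dots> = (LINT x|\<nu> i. \<bar>\<psi> x - indicat_real cube x\<bar>) + (LINT x|\<nu> i. \<bar>\<phi> x - indicat_real A x\<bar>)"
        by (rule Bochner_Integration.integral_add) (use int[OF i \<phi>(1)] int[OF i \<psi>(1)] ind[OF i c3.hyps] ind[OF i top]
          in \<open>auto intro!: Bochner_Integration.integrable_diff integrable_abs\<close>)
      also have "\<dots> < e" using \<phi>(2) \<psi>(2) i by fastforce
      finally show ?thesis .
    qed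
    then show ?case
      by (intro bexI[of _ "\<lambda>x. \<psi> x - \<phi> x"] ballI bumps_diff[OF \<psi>(1) \<phi>(1)])
  next
    case (c4 B e)
    let ?U = "\<Union>i. B i"
    have U: "?U \<in> sigma_sets cube ?G" using c4.hyps by (intro sigma_sets.Union) auto
    have tail: "(\<lambda>n. LINT x|\<nu> i. \<bar>(\<Sum>j<n. indicat_real (B j) x) - indicat_real ?U x\<bar>) \<longlonglongrightarrow> (LINT x|\<nu> i. 0)" if i: "i \<in> I" for i
    proof (rule integral_dominated_convergence[where w = "\<lambda>_. 1"])
      interpret finite_measure "\<nu> i" using fin[OF i] .
      show "integrable (\<nu> i) (\<lambda>_. 1)" by simp
      have ile: "(\<Sum>j<n. indicat_real (B j) x) = indicat_real (\<Union>j<n. B j) x" for n x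
        using c4.hyps(1) by (subst indicator_UN_disjoint) (auto simp: disjoint_family_on_def)
      show "(\<lambda>x. \<bar>(\<Sum>j<n. indicat_real (B j) x) - indicat_real ?U x\<bar>) \<in> borel_measurable (\<nu> i)" for n
        using ind[OF i U] ind[OF i] c4.hyps
        by (intro borel_measurable_abs borel_measurable_diff borel_measurable_sum borel_measurable_integrable) auto
      show "AE x in \<nu> i. (\<lambda>n. \<bar>(\<Sum>j<n. indicat_real (B j) x) - indicat_real ?U x\<bar>) \<longlonglongrightarrow> 0"
      proof (rule AE_I2)
        fix x
        have "(\<lambda>n. indicat_real (\<Union>j<n. B j) x) \<longlonglongrightarrow> indicat_real ?U x"
          by (rule LIMSEQ_indicator_UN)
        then show "(\<lambda>n. \<bar>(\<Sum>j<n. indicat_real (B j) x) - indicat_real ?U x\<bar>) \<longlonglongrightarrow> 0"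
          unfolding ile using tendsto_rabs[OF LIM_zero] by fastforce
      qed
      show "AE x in \<nu> i. norm \<bar>(\<Sum>j<n. indicat_real (B j) x) - indicat_real ?U x\<bar> \<le> 1" for n
        unfolding ile by (auto simp: indicator_def)
    qed simp
    have "\<forall>\<^sub>F n in sequentially. \<forall>i\<in>I. (LINT x|\<nu> i. \<bar>(\<Sum>j<n. indicat_real (B j) x) - indicat_real ?U x\<bar>) < e/2"
      using tail c4.prems by (intro eventually_ball_finite I ballI order_tendstoD(2)[of _ 0]) auto
    then obtain n where n: "\<forall>i\<in>I. (LINT x|\<nu> i. \<bar>(\<Sum>j<n. indicat_real (B j) x) - indicat_real ?U x\<bar>) < e/2"
      using eventually_happens'[OF sequentially_bot] by blast
    have "\<forall>j. \<exists>\<phi>\<in>bumps. \<forall>i\<in>I. (LINT x|\<nu> i. \<bar>\<phi> x - indicat_real (B j) x\<bar>) < e / (2 * real (Suc n))"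
      using c4.IH c4.prems by auto
    then obtain \<phi> where \<phi>: "\<And>j. \<phi> j \<in> bumps"
      "\<And>j i. i \<in> I \<Longrightarrow> (LINT x|\<nu> i. \<bar>\<phi> j x - indicat_real (B j) x\<bar>) < e / (2 * real (Suc n))"
      by metis
    have "(LINT x|\<nu> i. \<bar>(\<Sum>j<n. \<phi> j x) - indicat_real ?U x\<bar>) < e" if i: "i \<in> I" for i
    proof -
      have iB: "integrable (\<nu> i) (indicat_real (B j))" for j using ind[OF i] c4.hyps by auto
      have iU: "integrable (\<nu> i) (indicat_real ?U)" using ind[OF i U] .
      have i\<phi>: "integrable (\<nu> i) (\<phi> j)" for j using int[OF i \<phi>(1)] .
      have "(LINT x|\<nu> i. \<bar>(\<Sum>j<n. \<phi> j x) - indicat_real ?U x\<bar>)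
        \<le> (LINT x|\<nu> i. (\<Sum>j<n. \<bar>\<phi> j x - indicat_real (B j) x\<bar>) + \<bar>(\<Sum>j<n. indicat_real (B j) x) - indicat_real ?U x\<bar>)"
      proof (rule integral_mono)
        fix x
        have "\<bar>(\<Sum>j<n. \<phi> j x) - (\<Sum>j<n. indicat_real (B j) x)\<bar> \<le> (\<Sum>j<n. \<bar>\<phi> j x - indicat_real (B j) x\<bar>)"
          unfolding sum_subtractf[symmetric] by (rule sum_abs)
        then show "\<bar>(\<Sum>j<n. \<phi> j x) - indicat_real ?U x\<bar> \<le> (\<Sum>j<n. \<bar>\<phi> j x - indicat_real (B j) x\<bar>) + \<bar>(\<Sum>j<n. indicat_real (B j) x) - indicat_real ?U x\<bar>"
          by linarith
      qed (use iB iU i\<phi> in \<open>auto intro!: Bochner_Integration.integrable_diff Bochner_Integration.integrable_add Bochner_Integration.integrable_sum integrable_abs\<close>)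
      also have "\<dots> = (\<Sum>j<n. LINT x|\<nu> i. \<bar>\<phi> j x - indicat_real (B j) x\<bar>) + (LINT x|\<nu> i. \<bar>(\<Sum>j<n. indicat_real (B j) x) - indicat_real ?U x\<bar>)"
        using iB iU i\<phi>
        by (subst Bochner_Integration.integral_add)
          (auto intro!: Bochner_Integration.integral_sum Bochner_Integration.integrable_diff Bochner_Integration.integrable_sum integrable_abs)
      also have "(\<Sum>j<n. LINT x|\<nu> i. \<bar>\<phi> j x - indicat_real (B j) x\<bar>) \<le> (\<Sum>j<n. e / (2 * real (Suc n)))"
        using \<phi>(2)[OF i] by (intro sum_mono) (auto intro: less_imp_le)
      also have "\<dots> \<le> e / 2" using c4.prems by (simp add: field_simps)
      finally show ?thesis using n i by fastforce
    qed
    then show ?case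
      by (intro bexI[of _ "\<lambda>x. \<Sum>j<n. \<phi> j x"] ballI bumps_sum[OF finite_lessThan \<phi>(1)])
  qed
qed

section \<open>Signed measures and their integrals\<close>

text \<open>
  The real valued measures on \<open>Q\<close>; \<open>Mb\<close> consists of the tensors of such set functions.
\<close>

definition signed :: "((real ^ 'n::finite) set \<Rightarrow> real) \<Rightarrow> bool" where
  "signed m \<longleftrightarrow> (\<forall>A::nat \<Rightarrow> (real ^ 'n) set.
     range A \<subseteq> sets borelQ \<longrightarrow> disjoint_family A \<longrightarrow> (\<lambda>n. m (A n)) sums m (\<Union>n. A n))"

lemma Mb_iff_signed: "\<mu> \<in> Mb l \<longleftrightarrow> (\<forall>J\<in>tidx l. signed (\<lambda>A. \<mu> A J))"
  by (auto simp: Mb_def signed_def)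

lemma signed_sums:
  "signed m \<Longrightarrow> (\<And>n. A n \<in> sets borelQ) \<Longrightarrow> disjoint_family A \<Longrightarrow> (\<lambda>n. m (A n)) sums m (\<Union>n. A n)"
  unfolding signed_def by auto

lemma signed_combination:
  assumes "signed m" "signed m'"
  shows "signed (\<lambda>A. s * m A + t * m' A)"
  using assms unfolding signed_def by (intro allI impI sums_add sums_mult) auto

lemma signed_uminus: "signed m \<Longrightarrow> signed (\<lambda>A. - m A)"
  unfolding signed_def by (auto intro!: sums_minus)

lemma signed_empty:
  assumes "signed m"
  shows "m {} = 0"
proof -
  have "(\<lambda>n::nat. m {}) sums m (\<Union>n::nat. {})"
    using signed_sums[OF assms, of "\<lambda>_. {}"] by (simp add: disjoint_family_on_def)
  then show ?thesis using sums_summable summable_const_iff by blast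
qed

lemma signed_Un:
  assumes "signed m" "A \<in> sets borelQ" "B \<in> sets borelQ" "A \<inter> B = {}"
  shows "m (A \<union> B) = m A + m B"
proof -
  have "(\<lambda>n. m (binaryset A B n)) sums m (\<Union>n. binaryset A B n)"
    using assms by (intro signed_sums) (auto simp: binaryset_def disjoint_family_on_def)
  moreover have "(\<lambda>n. m (binaryset A B n)) sums (\<Sum>n\<in>{0,1}. m (binaryset A B n))"
    by (rule sums_finite) (auto simp: binaryset_def signed_empty[OF assms(1)])
  ultimately show ?thesis
    by (simp add: UN_binaryset_eq sums_unique2) (simp add: binaryset_def sums_iff)
qed

lemma signed_Diff:
  assumes "signed m" "A \<in> sets borelQ" "B \<in> sets borelQ" "B \<subseteq> A"
  shows "m (A - B) = m A - m B"
proof -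
  have "B \<union> (A - B) = A" using assms(4) by auto
  then show ?thesis using signed_Un[OF assms(1,3), of "A - B"] assms by auto
qed

text \<open>
  The positive variation as a set function, before it is known to be a measure.
\<close>

definition upvar :: "((real ^ 'n::finite) set \<Rightarrow> real) \<Rightarrow> (real ^ 'n) set \<Rightarrow> ennreal" where
  "upvar m A = (SUP B \<in> {B \<in> sets borelQ. B \<subseteq> A}. ennreal (m B))"

lemma upvar_upper: "B \<in> sets borelQ \<Longrightarrow> B \<subseteq> A \<Longrightarrow> ennreal (m B) \<le> upvar m A"
  unfolding upvar_def by (rule SUP_upper) auto

lemma upvar_mono: "A \<subseteq> A' \<Longrightarrow> upvar m A \<le> upvar m A'"
  unfolding upvar_def by (rule SUP_subset_mono) auto

lemma upvar_empty: "signed m \<Longrightarrow> upvar m {} = 0"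
proof -
  assume m: "signed m"
  have "{B \<in> sets (borelQ :: (real ^ 'a) measure). B \<subseteq> {}} = {{}}" by auto
  then show ?thesis by (simp add: upvar_def signed_empty[OF m])
qed

lemma upvar_Un_ge:
  assumes m: "signed m" and "A \<inter> B = {}"
  shows "upvar m A + upvar m B \<le> upvar m (A \<union> B)"
proof -
  have ne: "{C \<in> sets borelQ. C \<subseteq> X} \<noteq> {}" for X :: "(real ^ 'a) set" by auto
  have "ennreal (m C) + ennreal (m D) \<le> upvar m (A \<union> B)"
    if "C \<in> {C \<in> sets borelQ. C \<subseteq> A}" "D \<in> {D \<in> sets borelQ. D \<subseteq> B}" for C D
  proof -
    have CD: "C \<in> sets borelQ" "C \<subseteq> A" "D \<in> sets borelQ" "D \<subseteq> B" using that by auto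
    consider "m C \<le> 0" | "m D \<le> 0" | "0 \<le> m C" "0 \<le> m D" by linarith
    then show ?thesis
    proof cases
      case 1
      then have "ennreal (m C) + ennreal (m D) = ennreal (m D)" by (simp add: ennreal_neg)
      also have "\<dots> \<le> upvar m (A \<union> B)" using CD by (intro upvar_upper) auto
      finally show ?thesis .
    next
      case 2
      then have "ennreal (m C) + ennreal (m D) = ennreal (m C)" by (simp add: ennreal_neg)
      also have "\<dots> \<le> upvar m (A \<union> B)" using CD by (intro upvar_upper) auto
      finally show ?thesis .
    next
      case 3
      then have "ennreal (m C) + ennreal (m D) = ennreal (m (C \<union> D))"
      proof -
        have "m (C \<union> D) = m C + m D" using signed_Un[OF m CD(1,3)] CD assms(2) by blast
        then show ?thesis using 3 by simp
      qed
      also have "\<dots> \<le> upvar m (A \<union> B)" using CD by (intro upvar_upper) auto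
      finally show ?thesis .
    qed
  qed
  note le = this
  have "upvar m A + ennreal (m D) \<le> upvar m (A \<union> B)" if D: "D \<in> {D \<in> sets borelQ. D \<subseteq> B}" for D
  proof -
    have "upvar m A + ennreal (m D) = (SUP C\<in>{C \<in> sets borelQ. C \<subseteq> A}. ennreal (m C) + ennreal (m D))"
      unfolding upvar_def by (rule ennreal_SUP_add_left[OF ne, symmetric])
    also have "\<dots> \<le> upvar m (A \<union> B)" by (intro SUP_least le D)
    finally show ?thesis .
  qed
  note le = this
  have "upvar m A + upvar m B = (SUP D\<in>{D \<in> sets borelQ. D \<subseteq> B}. upvar m A + ennreal (m D))"
    unfolding upvar_def[of m B] add.commute[of "upvar m A"] by (rule ennreal_SUP_add_left[OF ne, symmetric])
  also have "\<dots> \<le> upvar m (A \<union> B)" by (intro SUP_least le)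
  finally show ?thesis .
qed

lemma upvar_countably_additive:
  assumes m: "signed m"
  shows "countably_additive (sets borelQ) (upvar m)"
proof (rule countably_additiveI)
  fix A :: "nat \<Rightarrow> (real ^ 'a) set"
  assume A: "range A \<subseteq> sets borelQ" "disjoint_family A" "(\<Union>i. A i) \<in> sets borelQ"
  show "(\<Sum>i. upvar m (A i)) = upvar m (\<Union>i. A i)"
  proof (rule antisym)
    have "(\<Sum>i<n. upvar m (A i)) \<le> upvar m (\<Union>i<n. A i)" for n
    proof (induction n)
      case (Suc n)
      have "(\<Sum>i<Suc n. upvar m (A i)) \<le> upvar m (\<Union>i<n. A i) + upvar m (A n)"
        using Suc by (simp add: add_right_mono)
      also have "\<dots> \<le> upvar m ((\<Union>i<n. A i) \<union> A n)"
      proof (rule upvar_Un_ge[OF m])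
        show "(\<Union>i<n. A i) \<inter> A n = {}"
        proof -
          have "A i \<inter> A n = {}" if "i < n" for i
            using A(2) that unfolding disjoint_family_on_def by auto
          then show ?thesis by auto
        qed
      qed
      also have "(\<Union>i<n. A i) \<union> A n = (\<Union>i<Suc n. A i)" by (auto simp: lessThan_Suc)
      finally show ?case .
    qed simp
    also have "upvar m (\<Union>i<n. A i) \<le> upvar m (\<Union>i. A i)" for n
      by (rule upvar_mono) auto
    finally show "(\<Sum>i. upvar m (A i)) \<le> upvar m (\<Union>i. A i)"
      by (intro suminf_le_const summableI)
  next
    show "upvar m (\<Union>i. A i) \<le> (\<Sum>i. upvar m (A i))"
      unfolding upvar_def[of m "\<Union>i. A i"]
    proof (rule SUP_least)
      fix B assume "B \<in> {B \<in> sets borelQ. B \<subseteq> (\<Union>i. A i)}"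
      then have B: "B \<in> sets borelQ" "B \<subseteq> (\<Union>i. A i)" by auto
      have "(\<lambda>n. m (B \<inter> A n)) sums m (\<Union>n. B \<inter> A n)"
        using A B by (intro signed_sums[OF m]) (auto simp: disjoint_family_on_def)
      moreover have "(\<Union>n. B \<inter> A n) = B" using B by auto
      ultimately have "(\<lambda>n. \<Sum>i<n. m (B \<inter> A i)) \<longlonglongrightarrow> m B" by (simp add: sums_def)
      then have lim: "(\<lambda>n. ennreal (\<Sum>i<n. m (B \<inter> A i))) \<longlonglongrightarrow> ennreal (m B)"
        by (rule tendsto_ennrealI)
      have "ennreal (\<Sum>i<n. m (B \<inter> A i)) \<le> (\<Sum>i. upvar m (A i))" for n
      proof -
        have "ennreal (\<Sum>i<n. m (B \<inter> A i)) \<le> ennreal (\<Sum>i<n. max 0 (m (B \<inter> A i)))"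
          by (intro ennreal_leI sum_mono) auto
        also have "\<dots> = (\<Sum>i<n. ennreal (max 0 (m (B \<inter> A i))))" by (subst sum_ennreal) auto
        also have "\<dots> = (\<Sum>i<n. ennreal (m (B \<inter> A i)))"
          by (intro sum.cong refl) (simp add: ennreal_max_0)
        also have "\<dots> \<le> (\<Sum>i<n. upvar m (A i))"
          using A B by (intro sum_mono upvar_upper) auto
        also have "\<dots> \<le> (\<Sum>i. upvar m (A i))" by (intro sum_le_suminf summableI) auto
        finally show ?thesis .
      qed
      then show "ennreal (m B) \<le> (\<Sum>i. upvar m (A i))"
        by (intro LIMSEQ_le_const2[OF lim]) auto
    qed
  qed
qed

lemma cube_borelQ [simp]: "cube \<in> sets borelQ"
  by (simp add: sets_borelQ)

text \<open>
  If the variation of \<open>E\<close> is infinite, some \<open>B \<subseteq> E\<close> has \<open>m B > |m E| + 1\<close>, so both \<open>B\<close> and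
  \<open>E - B\<close> have measure at least 1 in modulus, and one of them carries infinite variation again; the
  set \<open>F\<close> is that one.
\<close>

lemma upvar_split_infinite:
  assumes m: "signed m" and E: "E \<in> sets borelQ" "upvar m E = \<infinity>"
  shows "\<exists>F\<in>sets borelQ. F \<subseteq> E \<and> upvar m F = \<infinity> \<and> 1 \<le> \<bar>m (E - F)\<bar>"
proof -
  have "ennreal (\<bar>m E\<bar> + 1) < upvar m E" using E by simp
  then obtain B where B: "B \<in> sets borelQ" "B \<subseteq> E" "ennreal (\<bar>m E\<bar> + 1) < ennreal (m B)"
    unfolding upvar_def less_SUP_iff by auto
  then have gt: "\<bar>m E\<bar> + 1 < m B" by (subst (asm) ennreal_less_iff) auto
  have "additive (sets borelQ) (upvar m)"
    using upvar_countably_additive[OF m] upvar_empty[OF m]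
    by (intro ring_of_sets.countably_additive_additive[of cube])
      (auto simp: positive_def intro!: sets.ring_of_sets_axioms[of borelQ, simplified])
  then have "upvar m (B \<union> (E - B)) = upvar m B + upvar m (E - B)"
    using B E by (intro additiveD) auto
  moreover have "B \<union> (E - B) = E" using B by auto
  ultimately have "upvar m B = \<infinity> \<or> upvar m (E - B) = \<infinity>" using E by (metis ennreal_add_eq_top infinity_ennreal_def)
  then show ?thesis
  proof
    assume "upvar m B = \<infinity>"
    then show ?thesis using B gt signed_Diff[OF m E(1) B(1,2)] by (intro bexI[of _ B]) auto
  next
    assume *: "upvar m (E - B) = \<infinity>"
    have "E - (E - B) = B" using B by auto
    then show ?thesis using * B E gt by (intro bexI[of _ "E - B"]) auto
  qed
qed

text \<open>
  Otherwise repeated splitting yields infinitely many disjoint sets whose measures are at least 1 in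
  modulus, against summability.
\<close>

lemma upvar_finite:
  assumes m: "signed m"
  shows "upvar m cube < \<infinity>"
proof (rule ccontr)
  assume "\<not> upvar m cube < \<infinity>"
  then have inf: "upvar m cube = \<infinity>" using less_top[of "upvar m cube"] by auto
  define X where "X E \<longleftrightarrow> E \<in> sets borelQ \<and> upvar m E = \<infinity>" for E
  have "\<exists>E. \<forall>n. X (E n) \<and> (E (Suc n) \<subseteq> E n \<and> 1 \<le> \<bar>m (E n - E (Suc n))\<bar>)"
  proof (rule dependent_nat_choice)
    show "\<exists>E. X E" using inf by (auto simp: X_def intro!: exI[of _ cube])
    fix E n assume "X E"
    then show "\<exists>F. X F \<and> F \<subseteq> E \<and> 1 \<le> \<bar>m (E - F)\<bar>"
      using upvar_split_infinite[OF m, of E] unfolding X_def by metis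
  qed
  then obtain E where E: "\<And>n. E n \<in> sets borelQ" "\<And>n. E (Suc n) \<subseteq> E n" "\<And>n. 1 \<le> \<bar>m (E n - E (Suc n))\<bar>"
    unfolding X_def by auto
  have dec: "decseq E" using E(2) by (rule decseq_SucI)
  have "disjoint_family (\<lambda>n. E n - E (Suc n))"
  proof -
    have "(E i - E (Suc i)) \<inter> (E j - E (Suc j)) = {}" if "i < j" for i j
      using decseqD[OF dec, of "Suc i" j] that by auto
    then show ?thesis unfolding disjoint_family_on_def by (intro ballI impI) (metis Int_commute linorder_neqE_nat)
  qed
  then have "(\<lambda>n. m (E n - E (Suc n))) sums m (\<Union>n. E n - E (Suc n))"
    using E(1) by (intro signed_sums[OF m]) auto
  then have "(\<lambda>n. m (E n - E (Suc n))) \<longlonglongrightarrow> 0" using summable_LIMSEQ_zero sums_summable by blast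
  then have "(\<lambda>n. \<bar>m (E n - E (Suc n))\<bar>) \<longlonglongrightarrow> 0" by (rule tendsto_rabs_zero)
  then have "1 \<le> (0::real)" by (rule LIMSEQ_le_const) (use E(3) in auto)
  then show False by simp
qed

lemma pos_variation_eq_upvar: "pos_variation m = measure_of cube (sets borelQ) (upvar m)"
  by (simp add: pos_variation_def upvar_def[abs_def])

lemma sets_pos_variation [simp]: "sets (pos_variation m) = sets borelQ"
  unfolding pos_variation_def using sets.sets_measure_of_eq[of borelQ] by simp

lemma emeasure_pos_variation:
  assumes m: "signed m" and A: "A \<in> sets borelQ"
  shows "emeasure (pos_variation m) A = upvar m A"
proof (rule emeasure_measure_of[OF pos_variation_eq_upvar])
  show "sets borelQ \<subseteq> Pow cube" by (auto simp: sets_borelQ)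
  show "positive (sets (pos_variation m)) (upvar m)"
    using upvar_empty[OF m] by (simp add: positive_def)
  show "countably_additive (sets (pos_variation m)) (upvar m)"
    using upvar_countably_additive[OF m] by simp
qed (use A in simp)

lemma finite_pos_variation:
  assumes m: "signed m"
  shows "finite_measure (pos_variation m)"
proof (rule finite_measureI)
  have "space (pos_variation m) = cube"
    using sets_eq_imp_space_eq[OF sets_pos_variation, of m] by simp
  then show "emeasure (pos_variation m) (space (pos_variation m)) \<noteq> \<infinity>"
    using upvar_finite[OF m] by (simp add: emeasure_pos_variation[OF m])
qed

lemma space_pos_variation [simp]: "space (pos_variation m) = cube"
  using sets_eq_imp_space_eq[OF sets_pos_variation, of m] by simp

lemma pos_variation_ge:
  assumes m: "signed m" and "A \<in> sets borelQ" "B \<in> sets borelQ" "B \<subseteq> A"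
  shows "m B \<le> measure (pos_variation m) A"
proof -
  interpret finite_measure "pos_variation m" by (rule finite_pos_variation[OF m])
  have "ennreal (m B) \<le> ennreal (measure (pos_variation m) A)"
    using upvar_upper[OF assms(3,4), of m] assms by (simp add: emeasure_pos_variation flip: emeasure_eq_measure)
  then show ?thesis using measure_nonneg[of "pos_variation m" A] by (auto simp: ennreal_le_iff2)
qed

lemma pos_variation_le:
  assumes m: "signed m" and A: "A \<in> sets borelQ" and c: "\<And>B. B \<in> sets borelQ \<Longrightarrow> B \<subseteq> A \<Longrightarrow> m B \<le> c"
  shows "measure (pos_variation m) A \<le> c"
proof -
  interpret finite_measure "pos_variation m" by (rule finite_pos_variation[OF m])
  have "0 \<le> c" using c[of "{}"] signed_empty[OF m] by simp
  have "upvar m A \<le> ennreal c"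
    unfolding upvar_def using c by (intro SUP_least ennreal_leI) auto
  then have "ennreal (measure (pos_variation m) A) \<le> ennreal c"
    using A m by (simp add: emeasure_pos_variation flip: emeasure_eq_measure)
  then show ?thesis using \<open>0 \<le> c\<close> by simp
qed

text \<open>
  For \<open>B \<subseteq> A\<close> one has \<open>m B = m A - m (A - B) \<le> m A + m\<^sup>- A\<close>; the supremum over \<open>B\<close>, for \<open>m\<close> and for
  \<open>-m\<close>, gives the two inequalities.
\<close>

lemma jordan_decomposition:
  assumes m: "signed m" and A: "A \<in> sets borelQ"
  shows "m A = measure (pos_variation m) A - measure (pos_variation (\<lambda>A. - m A)) A"
proof -
  have *: "measure (pos_variation m) A \<le> m A + measure (pos_variation (\<lambda>A. - m A)) A" if m: "signed m" for m
  proof (rule pos_variation_le[OF m A])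
    fix B assume B: "B \<in> sets borelQ" "B \<subseteq> A"
    have "- m (A - B) \<le> measure (pos_variation (\<lambda>A. - m A)) A"
      using A B pos_variation_ge[OF signed_uminus[OF m], of A "A - B"] by auto
    then show "m B \<le> m A + measure (pos_variation (\<lambda>A. - m A)) A"
      using signed_Diff[OF m A B] by simp
  qed
  show ?thesis using *[OF m] *[OF signed_uminus[OF m]] by simp
qed

lemma signed_measure:
  assumes "finite_measure M" "sets M = sets borelQ"
  shows "signed (measure M)"
proof -
  interpret finite_measure M by fact
  show ?thesis
    unfolding signed_def using assms(2) by (auto intro!: finite_measure_UNION)
qed

text \<open>
  Jordan decompositions do not depend linearly on the signed measure, so the linearity of signed
  integrals is derived from linear relations between finite measures.
\<close>

lemma integral_combination_eq_0:
  fixes xs :: "(real \<times> (real ^ 'n::finite) measure) list"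
  assumes fin: "\<And>c M. (c, M) \<in> set xs \<Longrightarrow> finite_measure M \<and> sets M = sets borelQ"
    and zero: "\<And>A. A \<in> sets borelQ \<Longrightarrow> (\<Sum>(c, M)\<leftarrow>xs. c * measure M A) = 0"
    and \<phi>: "\<phi> \<in> borel_measurable borelQ" "\<And>x. x \<in> cube \<Longrightarrow> \<bar>\<phi> x\<bar> \<le> K"
  shows "(\<Sum>(c, M)\<leftarrow>xs. c * (LINT x|M. \<phi> x)) = 0"
proof -
  have sp: "space M = cube" if "(c, M) \<in> set xs" for c M
    using sets_eq_imp_space_eq[of M borelQ] fin[OF that] by simp
  have int: "integrable M u" if M: "(c, M) \<in> set xs" and u: "u \<in> borel_measurable borelQ" "\<And>x. x \<in> cube \<Longrightarrow> \<bar>u x\<bar> \<le> K"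
    for c M K and u :: "real ^ 'n \<Rightarrow> real"
    using fin[OF M] u sp[OF M]
    by (intro finite_measure.integrable_const_bound[of M _ K]) (auto cong: measurable_cong_sets)
  have nonneg: "(\<Sum>(c, M)\<leftarrow>xs. c * (LINT x|M. u x)) = 0"
    if u: "u \<in> borel_measurable borelQ" "\<And>x. 0 \<le> u x" "\<And>x. x \<in> cube \<Longrightarrow> u x \<le> K" for u K
    using u
  proof (induction arbitrary: K rule: borel_measurable_induct_real)
    case (set A)
    have "(\<Sum>(c, M)\<leftarrow>xs. c * (LINT x|M. indicat_real A x)) = (\<Sum>(c, M)\<leftarrow>xs. c * measure M A)"
      using fin set(1)
      by (intro arg_cong[of _ _ sum_list] map_cong refl)
        (auto simp: finite_measure.emeasure_finite less_top[symmetric] intro!: Bochner_Integration.integral_indicator)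
    then show ?case using zero set by simp
  next
    case (mult u c)
    show ?case
    proof (cases "c = 0")
      case True then show ?thesis by (auto intro!: sum_list_0)
    next
      case False
      then have "(\<Sum>(c, M)\<leftarrow>xs. c * (LINT x|M. u x)) = 0"
        using mult by (intro mult.IH[of "K / c"]) (simp add: field_simps)
      then have "c * (\<Sum>(c, M)\<leftarrow>xs. c * (LINT x|M. u x)) = 0" by simp
      then show ?thesis
        by (simp add: sum_list_const_mult[symmetric] case_prod_unfold mult_ac)
    qed
  next
    case (add u v)
    have b: "\<bar>u x\<bar> \<le> K" "\<bar>v x\<bar> \<le> K" if "x \<in> cube" for x
    proof -
      have "0 \<le> u x" "0 \<le> v x" "v x + u x \<le> K"
        using add.hyps(2,4) add.prems[OF that] by auto
      then show "\<bar>u x\<bar> \<le> K" "\<bar>v x\<bar> \<le> K" by linarith+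
    qed
    have "(\<Sum>(c, M)\<leftarrow>xs. c * (LINT x|M. v x + u x)) =
        (\<Sum>(c, M)\<leftarrow>xs. c * (LINT x|M. v x) + c * (LINT x|M. u x))"
    proof (intro arg_cong[of _ _ sum_list] map_cong refl, safe)
      fix c M assume M: "(c, M) \<in> set xs"
      have "(LINT x|M. v x + u x) = (LINT x|M. v x) + (LINT x|M. u x)"
        using int[OF M add.hyps(3) b(2)] int[OF M add.hyps(1) b(1)] by (rule Bochner_Integration.integral_add)
      then show "c * (LINT x|M. v x + u x) = c * (LINT x|M. v x) + c * (LINT x|M. u x)"
        by (simp only: distrib_left)
    qed
    also have "\<dots> = (\<Sum>(c, M)\<leftarrow>xs. c * (LINT x|M. v x)) + (\<Sum>(c, M)\<leftarrow>xs. c * (LINT x|M. u x))"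
      by (simp add: sum_list_addf[symmetric] case_prod_unfold)
    also have "\<dots> = 0"
    proof -
      have "u x \<le> K" "v x \<le> K" if "x \<in> cube" for x using b[OF that] by auto
      then show ?thesis using add.IH(1)[of K] add.IH(2)[of K] by simp
    qed
    finally show ?case .
  next
    case (seq U)
    have le: "U i x \<le> u x" if "x \<in> cube" for i x
      using seq(3) seq(4)[of x] that by (intro incseq_le[of "\<lambda>i. U i x"]) (auto simp: incseq_def le_fun_def)
    have "(\<lambda>i. \<Sum>(c, M)\<leftarrow>xs. c * (LINT x|M. U i x)) \<longlonglongrightarrow> (\<Sum>(c, M)\<leftarrow>xs. c * (LINT x|M. u x))"
    proof -
      have "(\<lambda>i. LINT x|M. U i x) \<longlonglongrightarrow> (LINT x|M. u x)" if M: "(c, M) \<in> set xs" for c M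
      proof (rule integral_dominated_convergence[where w = "\<lambda>_. K"])
        interpret finite_measure M using fin[OF M] by simp
        show "integrable M (\<lambda>_. K)" by simp
        have [simp]: "borel_measurable M = borel_measurable borelQ"
          using fin[OF M] by (intro measurable_cong_sets) auto
        have "u \<in> borel_measurable borelQ"
          by (rule borel_measurable_LIMSEQ_real[of borelQ U]) (use seq in auto)
        then show "u \<in> borel_measurable M" "U i \<in> borel_measurable M" for i
          using seq(1) by auto
        show "AE x in M. (\<lambda>i. U i x) \<longlonglongrightarrow> u x" using seq(4) sp[OF M] by auto
        show "AE x in M. norm (U i x) \<le> K" for i
          using seq(2)[of i] le[of _ i] seq.prems sp[OF M] by (intro AE_I2) (auto intro: order_trans)
      qed
      then have "\<forall>z\<in>set xs. (\<lambda>i. (\<lambda>(c, M). c * (LINT x|M. U i x)) z) \<longlonglongrightarrow> (\<lambda>(c, M). c * (LINT x|M. u x)) z"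
        by (auto intro!: tendsto_mult)
      then show ?thesis
        by (induction xs) (auto intro!: tendsto_add)
    qed
    moreover have "(\<Sum>(c, M)\<leftarrow>xs. c * (LINT x|M. U i x)) = 0" for i
      using le seq.prems by (intro seq.IH[of _ K]) (auto intro: order_trans)
    ultimately show ?case by (simp add: LIMSEQ_const_iff)
  qed
  define K' where "K' = max K 0"
  have K': "0 \<le> K'" "\<And>x. x \<in> cube \<Longrightarrow> \<bar>\<phi> x\<bar> \<le> K'" using \<phi>(2) unfolding K'_def by force+
  define p where "p x = max 0 (\<phi> x)" for x
  define q where "q x = max 0 (- \<phi> x)" for x
  have m [measurable]: "p \<in> borel_measurable borelQ" "q \<in> borel_measurable borelQ"
    using \<phi>(1) unfolding p_def[abs_def] q_def[abs_def] by auto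
  have pb: "\<bar>p x\<bar> \<le> K'" "\<bar>q x\<bar> \<le> K'" "p x \<le> K'" "q x \<le> K'" if "x \<in> cube" for x
    using K'(1) K'(2)[OF that] by (auto simp: p_def q_def)
  have "(\<Sum>(c, M)\<leftarrow>xs. c * (LINT x|M. \<phi> x)) = (\<Sum>(c, M)\<leftarrow>xs. c * (LINT x|M. p x) - c * (LINT x|M. q x))"
  proof (intro arg_cong[of _ _ sum_list] map_cong refl, safe)
    fix c M assume M: "(c, M) \<in> set xs"
    have "(LINT x|M. \<phi> x) = (LINT x|M. p x - q x)"
      by (rule Bochner_Integration.integral_cong) (auto simp: p_def q_def)
    also have "\<dots> = (LINT x|M. p x) - (LINT x|M. q x)"
      using int[OF M m(1) pb(1)] int[OF M m(2) pb(2)] by (rule Bochner_Integration.integral_diff)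
    finally show "c * (LINT x|M. \<phi> x) = c * (LINT x|M. p x) - c * (LINT x|M. q x)"
      by (simp add: right_diff_distrib)
  qed
  also have "\<dots> = (\<Sum>(c, M)\<leftarrow>xs. c * (LINT x|M. p x)) - (\<Sum>(c, M)\<leftarrow>xs. c * (LINT x|M. q x))"
    by (simp add: sum_list_subtractf[symmetric] case_prod_unfold)
  also have "\<dots> = 0"
    using nonneg[OF m(1) _ pb(3)] nonneg[OF m(2) _ pb(4)] by (simp add: p_def q_def)
  finally show ?thesis .
qed

lemma test_fun_borelQ: "\<phi> \<in> test_fun \<Longrightarrow> \<phi> \<in> borel_measurable borelQ"
  using test_fun_measurable by blast

text \<open>
  The Jordan decomposition is one such representation, and any two of them differ by a linear relation
  between finite measures.
\<close>

lemma signed_integral_eq: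
  assumes m: "signed m" and P: "finite_measure P" "sets P = sets borelQ"
    and R: "finite_measure R" "sets R = sets borelQ"
    and eq: "\<And>A. A \<in> sets borelQ \<Longrightarrow> m A = measure P A - measure R A" and \<phi>: "\<phi> \<in> test_fun"
  shows "signed_integral m \<phi> = (LINT x|P. \<phi> x) - (LINT x|R. \<phi> x)"
proof -
  obtain K where K: "\<And>x. \<bar>\<phi> x\<bar> \<le> K" using test_fun_bounded[OF \<phi>] by blast
  have "(\<Sum>(c, M)\<leftarrow>[(1, pos_variation m), (-1, pos_variation (\<lambda>A. - m A)), (-1, P), (1, R)]. c * (LINT x|M. \<phi> x)) = 0"
  proof (intro integral_combination_eq_0[where K = K] K test_fun_borelQ[OF \<phi>])
    fix A :: "(real ^ 'a) set" assume A: "A \<in> sets borelQ"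
    show "(\<Sum>(c, M)\<leftarrow>[(1, pos_variation m), (-1, pos_variation (\<lambda>A. - m A)), (-1, P), (1, R)]. c * measure M A) = 0"
    proof -
      have arith: "p - q = P - R \<Longrightarrow> 1 * p + (- 1 * q + (- 1 * P + (1 * R + 0))) = 0" for p q P R :: real
        by simp
      show ?thesis
        unfolding list.map sum_list.Cons sum_list.Nil prod.case
        by (rule arith, rule trans[OF sym[OF jordan_decomposition[OF m A]] eq[OF A]])
    qed
  next
    fix c M assume "(c, M) \<in> set [(1, pos_variation m), (-1, pos_variation (\<lambda>A. - m A)), (-1, P), (1, R)]"
    then have "M = pos_variation m \<or> M = pos_variation (\<lambda>A. - m A) \<or> M = P \<or> M = R"
      by (simp only: list.set insert_iff prod.inject empty_iff) argo
    then show "finite_measure M \<and> sets M = sets borelQ"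
      by (elim disjE) (simp_all only: P R finite_pos_variation[OF m] finite_pos_variation[OF signed_uminus[OF m]]
          sets_pos_variation simp_thms)
  qed
  then show ?thesis by (simp add: signed_integral_def)
qed

lemma signed_integral_combination:
  assumes m: "signed m" and m': "signed m'" and \<phi>: "\<phi> \<in> test_fun"
  shows "signed_integral (\<lambda>A. s * m A + t * m' A) \<phi> = s * signed_integral m \<phi> + t * signed_integral m' \<phi>"
proof -
  let ?m = "\<lambda>A. s * m A + t * m' A"
  have c: "signed ?m" by (rule signed_combination[OF m m'])
  obtain K where K: "\<And>x. \<bar>\<phi> x\<bar> \<le> K" using test_fun_bounded[OF \<phi>] by blast
  have "(\<Sum>(c, M)\<leftarrow>[(1, pos_variation ?m), (-1, pos_variation (\<lambda>A. - ?m A)),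
      (-s, pos_variation m), (s, pos_variation (\<lambda>A. - m A)),
      (-t, pos_variation m'), (t, pos_variation (\<lambda>A. - m' A))]. c * (LINT x|M. \<phi> x)) = 0"
  proof (intro integral_combination_eq_0[where K = K] K test_fun_borelQ[OF \<phi>])
    fix A :: "(real ^ 'a) set" assume A: "A \<in> sets borelQ"
    show "(\<Sum>(c, M)\<leftarrow>[(1, pos_variation ?m), (-1, pos_variation (\<lambda>A. - ?m A)),
      (-s, pos_variation m), (s, pos_variation (\<lambda>A. - m A)),
      (-t, pos_variation m'), (t, pos_variation (\<lambda>A. - m' A))]. c * measure M A) = 0"
    proof -
      have arith: "s * (p - q) + t * (p' - q') = P - Q \<Longrightarrow> 1 * P + (- 1 * Q + (- s * p + (s * q + (- t * p' + (t * q' + 0))))) = 0"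
        for p q p' q' P Q :: real
        by (simp add: algebra_simps)
      show ?thesis
        unfolding list.map sum_list.Cons sum_list.Nil prod.case
        by (rule arith, unfold jordan_decomposition[OF m A, symmetric] jordan_decomposition[OF m' A, symmetric],
            rule jordan_decomposition[OF c A])
    qed
  next
    fix c M assume "(c, M) \<in> set [(1, pos_variation ?m), (-1, pos_variation (\<lambda>A. - ?m A)),
      (-s, pos_variation m), (s, pos_variation (\<lambda>A. - m A)),
      (-t, pos_variation m'), (t, pos_variation (\<lambda>A. - m' A))]"
    then have "M = pos_variation ?m \<or> M = pos_variation (\<lambda>A. - ?m A) \<or> M = pos_variation m
        \<or> M = pos_variation (\<lambda>A. - m A) \<or> M = pos_variation m' \<or> M = pos_variation (\<lambda>A. - m' A)"
      by (simp only: list.set insert_iff prod.inject empty_iff) argo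
    then show "finite_measure M \<and> sets M = sets borelQ"
      by (elim disjE) (simp_all only: finite_pos_variation[OF m] finite_pos_variation[OF signed_uminus[OF m]]
        finite_pos_variation[OF m'] finite_pos_variation[OF signed_uminus[OF m']]
        finite_pos_variation[OF c] finite_pos_variation[OF signed_uminus[OF c]] sets_pos_variation simp_thms)
  qed
  then show ?thesis by (simp add: signed_integral_def algebra_simps)
qed

lemma signed_integral_diff_bound:
  assumes m: "signed m"
    and fg: "\<And>M. M \<in> {pos_variation m, pos_variation (\<lambda>A. - m A)} \<Longrightarrow> integrable M f \<and> integrable M g"
  shows "\<bar>signed_integral m f - signed_integral m g\<bar> \<le>
    (LINT x|pos_variation m. \<bar>f x - g x\<bar>) + (LINT x|pos_variation (\<lambda>A. - m A). \<bar>f x - g x\<bar>)"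
proof -
  let ?p = "pos_variation m" and ?q = "pos_variation (\<lambda>A. - m A)"
  have "signed_integral m f - signed_integral m g = (LINT x|?p. f x - g x) - (LINT x|?q. f x - g x)"
    using fg[of ?p] fg[of ?q] by (simp add: signed_integral_def Bochner_Integration.integral_diff)
  also have "\<bar>\<dots>\<bar> \<le> \<bar>LINT x|?p. f x - g x\<bar> + \<bar>LINT x|?q. f x - g x\<bar>" by simp
  also have "\<dots> \<le> (LINT x|?p. \<bar>f x - g x\<bar>) + (LINT x|?q. \<bar>f x - g x\<bar>)"
    by (intro add_mono integral_abs_bound)
  finally show ?thesis .
qed

lemma integrable_indicator_borelQ:
  assumes "finite_measure M" "sets M = sets borelQ" "A \<in> sets borelQ"
  shows "integrable M (indicat_real A)"
  using assms by (auto intro!: integrable_real_indicator simp: finite_measure.emeasure_finite less_top[symmetric])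

lemma signed_integral_simple:
  assumes m: "signed m" and P: "finite P" "P \<subseteq> sets borelQ"
  shows "signed_integral m (\<lambda>x. \<Sum>A\<in>P. c A * indicat_real A x) = (\<Sum>A\<in>P. c A * m A)"
proof -
  have *: "(LINT x|M. (\<Sum>A\<in>P. c A * indicat_real A x)) = (\<Sum>A\<in>P. c A * measure M A)"
    if M: "finite_measure M" "sets M = sets borelQ" for M
  proof -
    have i: "integrable M (indicat_real A)" if "A \<in> P" for A
      using integrable_indicator_borelQ[OF M] P that by auto
    have "(LINT x|M. (\<Sum>A\<in>P. c A * indicat_real A x)) = (\<Sum>A\<in>P. LINT x|M. c A * indicat_real A x)"
      using i by (intro Bochner_Integration.integral_sum) auto
    also have "\<dots> = (\<Sum>A\<in>P. c A * measure M A)"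
    proof (intro sum.cong refl)
      fix A assume "A \<in> P"
      then have "A \<in> sets M" "A \<subseteq> space M" using P(2) M(2) sets.sets_into_space[of A M] by auto
      then show "(LINT x|M. c A * indicat_real A x) = c A * measure M A"
        by (simp add: Int_absorb2)
    qed
    finally show ?thesis .
  qed
  have "signed_integral m (\<lambda>x. \<Sum>A\<in>P. c A * indicat_real A x) =
      (\<Sum>A\<in>P. c A * (measure (pos_variation m) A - measure (pos_variation (\<lambda>A. - m A)) A))"
    unfolding signed_integral_def
    by (subst (1 2) *) (simp_all add: finite_pos_variation m signed_uminus sum_subtractf right_diff_distrib)
  also have "\<dots> = (\<Sum>A\<in>P. c A * m A)"
    using P(2) jordan_decomposition[OF m] by (intro sum.cong refl) auto
  finally show ?thesis .
qed

text \<open>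
  If \<open>m A \<noteq> 0\<close>, a bump function close to the indicator of \<open>A\<close> in \<open>L\<^sup>1\<close> of both variations has a nonzero
  integral.
\<close>

lemma signed_eq_0_of_bumps:
  assumes m: "signed m" and zero: "\<And>\<phi>. \<phi> \<in> bumps \<Longrightarrow> signed_integral m \<phi> = 0" and A: "A \<in> sets borelQ"
  shows "m A = 0"
proof (rule ccontr)
  assume "m A \<noteq> 0"
  let ?\<nu> = "\<lambda>b. pos_variation (if b then m else (\<lambda>A. - m A))"
  have fin: "finite_measure (?\<nu> b)" for b
    using finite_pos_variation[OF m] finite_pos_variation[OF signed_uminus[OF m]] by simp
  obtain \<phi> where \<phi>: "\<phi> \<in> bumps" "\<And>b. (LINT x|?\<nu> b. \<bar>\<phi> x - indicat_real A x\<bar>) < \<bar>m A\<bar> / 2"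
    using bumps_approx_indicator[of "UNIV :: bool set" ?\<nu> A "\<bar>m A\<bar> / 2"] fin A \<open>m A \<noteq> 0\<close> by auto
  have "signed_integral m (indicat_real A) = m A"
    using signed_integral_simple[OF m, of "{A}" "\<lambda>_. 1"] A by simp
  then have "\<bar>m A\<bar> = \<bar>signed_integral m \<phi> - signed_integral m (indicat_real A)\<bar>"
    using zero[OF \<phi>(1)] by simp
  also have "\<dots> \<le> (LINT x|?\<nu> True. \<bar>\<phi> x - indicat_real A x\<bar>) + (LINT x|?\<nu> False. \<bar>\<phi> x - indicat_real A x\<bar>)"
  proof -
    have "integrable M \<phi> \<and> integrable M (indicat_real A)"
      if "M \<in> {pos_variation m, pos_variation (\<lambda>A. - m A)}" for M
    proof -
      have "finite_measure M" "sets M = sets borelQ" using that fin[of True] fin[of False] by auto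
      then show ?thesis using A \<phi>(1) integrable_indicator_borelQ test_fun_integrable bumps_test_fun by blast
    qed
    from signed_integral_diff_bound[OF m this] show ?thesis by simp
  qed
  also have "\<dots> < \<bar>m A\<bar>" using \<phi>(2)[of True] \<phi>(2)[of False] by simp
  finally show False by simp
qed

section \<open>Total variation by duality\<close>

lemma finite_tidx [simp]: "finite (tidx l :: ('n::finite) list set)"
proof -
  have "finite {xs :: 'n list. set xs \<subseteq> UNIV \<and> length xs = l}"
    by (rule finite_lists_length_eq) simp
  then show ?thesis by (simp add: tidx_def)
qed

text \<open>
  The fields of test functions with Euclidean norm at most 1 everywhere.
\<close>

definition admissible :: "nat \<Rightarrow> ('n::finite list \<Rightarrow> real ^ 'n \<Rightarrow> real) \<Rightarrow> bool" where
  "admissible l \<Phi> \<longleftrightarrow> (\<forall>J\<in>tidx l. \<Phi> J \<in> test_fun) \<and> (\<forall>x. (\<Sum>J\<in>tidx l. (\<Phi> J x)\<^sup>2) \<le> 1)"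

definition pairing :: "nat \<Rightarrow> 'n::finite tmeas \<Rightarrow> ('n list \<Rightarrow> real ^ 'n \<Rightarrow> real) \<Rightarrow> real" where
  "pairing l \<mu> \<Phi> = (\<Sum>J\<in>tidx l. signed_integral (\<lambda>A. \<mu> A J) (\<Phi> J))"

lemma tnorm_nonneg: "0 \<le> tnorm l t"
  by (simp add: tnorm_def sum_nonneg)

lemma tnorm_Cauchy_Schwarz: "(\<Sum>J\<in>tidx l. s J * t J) \<le> tnorm l s * tnorm l t"
proof -
  have "(\<Sum>J\<in>tidx l. s J * t J) \<le> (\<Sum>J\<in>tidx l. \<bar>s J\<bar> * \<bar>t J\<bar>)"
    by (intro sum_mono) (simp add: abs_mult[symmetric])
  also have "\<dots> \<le> tnorm l s * tnorm l t"
    using L2_set_mult_ineq[of s t "tidx l"] by (simp add: L2_set_def tnorm_def)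
  finally show ?thesis .
qed

lemma tnorm_le_sum_abs: "tnorm l t \<le> (\<Sum>J\<in>tidx l. \<bar>t J\<bar>)"
  using L2_set_le_sum_abs[of t "tidx l"] by (simp add: L2_set_def tnorm_def)

lemma abs_le_tnorm: "J \<in> tidx l \<Longrightarrow> \<bar>t J\<bar> \<le> tnorm l t"
  unfolding tnorm_def using real_sqrt_le_mono[OF member_le_sum[of J "tidx l" "\<lambda>J. (t J)\<^sup>2"]] by simp

text \<open>
  The partition consists of the level sets of the values rounded down to multiples of \<open>\<delta>\<close>; they are
  finitely many since test functions are bounded.
\<close>

lemma test_fun_oscillation_partition:
  fixes \<Phi> :: "'n::finite list \<Rightarrow> real ^ 'n \<Rightarrow> real"
  assumes \<Phi>: "\<And>J. J \<in> tidx l \<Longrightarrow> \<Phi> J \<in> test_fun" and \<delta>: "0 < \<delta>"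
  obtains P where "finite P" "partition_on cube P" "P \<subseteq> sets borelQ"
    "\<And>A x y J. A \<in> P \<Longrightarrow> x \<in> A \<Longrightarrow> y \<in> A \<Longrightarrow> J \<in> tidx l \<Longrightarrow> \<bar>\<Phi> J x - \<Phi> J y\<bar> \<le> \<delta>"
proof -
  define f where "f x = restrict (\<lambda>J. \<lfloor>\<Phi> J x / \<delta>\<rfloor>) (tidx l)" for x
  define P where "P = (\<lambda>c. {x \<in> cube. f x = c}) ` (f ` cube)"
  have "\<exists>C. \<forall>J\<in>tidx l. \<forall>x. \<bar>\<Phi> J x\<bar> \<le> C"
  proof -
    have "\<forall>J\<in>tidx l. \<exists>C. \<forall>x. \<bar>\<Phi> J x\<bar> \<le> C" using \<Phi> test_fun_bounded by metis
    then obtain C where C: "\<And>J x. J \<in> tidx l \<Longrightarrow> \<bar>\<Phi> J x\<bar> \<le> C J" by metis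
    have "\<bar>\<Phi> J x\<bar> \<le> (\<Sum>J\<in>tidx l. \<bar>C J\<bar>)" if "J \<in> tidx l" for J x
      using C[OF that, of x] member_le_sum[OF that _ finite_tidx, of "\<lambda>J. \<bar>C J\<bar>"] by fastforce
    then show ?thesis by blast
  qed
  then obtain C where C: "\<And>J x. J \<in> tidx l \<Longrightarrow> \<bar>\<Phi> J x\<bar> \<le> C" by blast
  have "f ` cube \<subseteq> (\<Pi>\<^sub>E J\<in>tidx l. {\<lfloor>- C / \<delta>\<rfloor>..\<lfloor>C / \<delta>\<rfloor>})"
  proof safe
    fix x and J :: "'n list" assume J: "J \<in> tidx l"
    have "- C / \<delta> \<le> \<Phi> J x / \<delta>" "\<Phi> J x / \<delta> \<le> C / \<delta>"
    proof -
      have "- C \<le> \<Phi> J x" "\<Phi> J x \<le> C" using C[OF J, of x] by auto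
      then show "- C / \<delta> \<le> \<Phi> J x / \<delta>" "\<Phi> J x / \<delta> \<le> C / \<delta>"
        using \<delta> divide_right_mono[of "- C" "\<Phi> J x" \<delta>] divide_right_mono[of "\<Phi> J x" C \<delta>] by auto
    qed
    then show "f x J \<in> {\<lfloor>- C / \<delta>\<rfloor>..\<lfloor>C / \<delta>\<rfloor>}"
      using J by (simp add: f_def floor_mono)
  qed (auto simp: f_def)
  then have "finite (f ` cube)"
    by (rule finite_subset) (intro finite_PiE finite_tidx finite_atLeastAtMost_int)
  then have 1: "finite P" by (simp add: P_def)
  have 2: "partition_on cube P"
    unfolding P_def by (rule partition_onI) (auto simp: disjnt_def)
  have 3: "P \<subseteq> sets borelQ"
  proof
    fix A assume "A \<in> P"
    then obtain y where "A = {x \<in> cube. f x = f y}" by (auto simp: P_def)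
    also have "\<dots> = {x \<in> space borelQ. \<forall>J\<in>tidx l. \<lfloor>\<Phi> J x / \<delta>\<rfloor> = \<lfloor>\<Phi> J y / \<delta>\<rfloor>}"
      unfolding f_def by (auto simp: restrict_def fun_eq_iff)
    also have "\<dots> \<in> sets borelQ"
    proof (rule sets.sets_Collect_finite_All'[OF _ finite_tidx])
      fix J :: "'n list" assume "J \<in> tidx l"
      then have [measurable]: "\<Phi> J \<in> borel_measurable borelQ" by (intro test_fun_borelQ \<Phi>)
      show "{x \<in> space borelQ. \<lfloor>\<Phi> J x / \<delta>\<rfloor> = \<lfloor>\<Phi> J y / \<delta>\<rfloor>} \<in> sets borelQ"
        by measurable
    qed (auto simp: tidx_def intro: exI[of _ "replicate l undefined"])
    finally show "A \<in> sets borelQ" .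
  qed
  have 4: "\<bar>\<Phi> J x - \<Phi> J y\<bar> \<le> \<delta>" if A: "A \<in> P" and xy: "x \<in> A" "y \<in> A" and J: "J \<in> tidx l" for A x y J
  proof -
    have "f x = f y" using A xy by (auto simp: P_def)
    then have "f x J = f y J" by simp
    then have "\<lfloor>\<Phi> J x / \<delta>\<rfloor> = \<lfloor>\<Phi> J y / \<delta>\<rfloor>" using J by (simp add: f_def)
    then have "\<bar>\<Phi> J x / \<delta> - \<Phi> J y / \<delta>\<bar> \<le> 1" by linarith
    then have "\<bar>\<Phi> J x - \<Phi> J y\<bar> / \<delta> \<le> 1" using \<delta> by (simp add: diff_divide_distrib[symmetric])
    then show ?thesis using \<delta> by (simp add: divide_le_eq)
  qed
  show ?thesis using that 1 2 3 4 by blast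
qed

lemma sum_indicator_partition:
  assumes "partition_on X P" "finite P" "A \<in> P" "x \<in> A"
  shows "(\<Sum>B\<in>P. c B * indicat_real B x) = c A"
proof -
  have "c B * indicat_real B x = (if B = A then c A else 0)" if "B \<in> P" for B
    using assms partition_onD2[OF assms(1)] that by (auto simp: indicator_def disjoint_def)
  then show ?thesis using assms by (simp add: sum.delta)
qed

text \<open>
  On a partition with small oscillation \<open>\<Phi>\<close> is almost the constant \<open>\<Phi>(x\<^sub>A)\<close> on each piece \<open>A\<close>, and the
  pairing is almost \<open>\<Sum>\<^sub>A \<Phi>(x\<^sub>A) \<cdot> \<mu>(A)\<close>, which the Cauchy-Schwarz inequality bounds.
\<close>

lemma pairing_le_total_variation:
  fixes \<mu> :: "'n::finite tmeas"
  assumes \<mu>: "\<mu> \<in> Mb l" and \<Phi>: "admissible l \<Phi>"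
  shows "ennreal (pairing l \<mu> \<Phi>) \<le> total_variation l \<mu>"
proof (cases "total_variation l \<mu> = \<infinity>")
  case False
  define T where "T = enn2real (total_variation l \<mu>)"
  have T: "total_variation l \<mu> = ennreal T" using False by (simp add: T_def less_top)
  have "0 \<le> T" by (simp add: T_def)
  let ?m = "\<lambda>J A. \<mu> A J"
  have m: "signed (?m J)" if "J \<in> tidx l" for J using \<mu> that by (simp add: Mb_iff_signed)
  have tf: "\<Phi> J \<in> test_fun" if "J \<in> tidx l" for J using \<Phi> that by (simp add: admissible_def)
  define V where "V = (\<Sum>J\<in>tidx l. measure (pos_variation (?m J)) cube + measure (pos_variation (\<lambda>A. - ?m J A)) cube)"
  have "pairing l \<mu> \<Phi> \<le> T + \<delta> * V" if \<delta>: "0 < \<delta>" for \<delta>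
  proof -
    obtain P where P: "finite P" "partition_on cube P" "P \<subseteq> sets borelQ"
      "\<And>A x y J. A \<in> P \<Longrightarrow> x \<in> A \<Longrightarrow> y \<in> A \<Longrightarrow> J \<in> tidx l \<Longrightarrow> \<bar>\<Phi> J x - \<Phi> J y\<bar> \<le> \<delta>"
      using test_fun_oscillation_partition[of l \<Phi> \<delta>] tf \<delta> by metis
    have "\<forall>A\<in>P. \<exists>x. x \<in> A" using partition_onD3[OF P(2)] by (metis all_not_in_conv)
    then obtain z where z: "\<And>A. A \<in> P \<Longrightarrow> z A \<in> A" by metis
    let ?s = "\<lambda>J x. \<Sum>A\<in>P. \<Phi> J (z A) * indicat_real A x"
    have close: "\<bar>\<Phi> J x - ?s J x\<bar> \<le> \<delta>" if J: "J \<in> tidx l" and x: "x \<in> cube" for J x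
    proof -
      obtain A where A: "A \<in> P" "x \<in> A" using x partition_onD1[OF P(2)] by auto
      then show ?thesis using sum_indicator_partition[OF P(2,1) A, of "\<lambda>A. \<Phi> J (z A)"] P(4)[OF A z[OF A(1)] J] by simp
    qed
    have "signed_integral (?m J) (\<Phi> J) \<le> (\<Sum>A\<in>P. \<Phi> J (z A) * \<mu> A J) +
        \<delta> * (measure (pos_variation (?m J)) cube + measure (pos_variation (\<lambda>A. - ?m J A)) cube)"
      if J: "J \<in> tidx l" for J
    proof -
      have i: "integrable M (\<Phi> J) \<and> integrable M (?s J) \<and> (LINT x|M. \<bar>\<Phi> J x - ?s J x\<bar>) \<le> \<delta> * measure M cube"
        if M: "finite_measure M" "sets M = sets borelQ" for M
      proof -
        interpret finite_measure M by fact
        have sp: "space M = cube" using sets_eq_imp_space_eq[OF M(2)] by simp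
        have 1: "integrable M (\<Phi> J)" by (rule test_fun_integrable[OF tf[OF J] M(2,1)])
        have "integrable M (indicat_real A)" if "A \<in> P" for A
          using integrable_indicator_borelQ[OF M] that P(3) by auto
        then have 2: "integrable M (?s J)" by (intro Bochner_Integration.integrable_sum integrable_mult_right) auto
        have "(LINT x|M. \<bar>\<Phi> J x - ?s J x\<bar>) \<le> (LINT x|M. \<delta>)"
          using 1 2 close[OF J] by (intro integral_mono integrable_abs Bochner_Integration.integrable_diff) (auto simp: sp)
        then show ?thesis using 1 2 by (simp add: sp mult.commute)
      qed
      have p: "finite_measure (pos_variation (?m J))" "finite_measure (pos_variation (\<lambda>A. - ?m J A))"
        using finite_pos_variation m[OF J] signed_uminus[OF m[OF J]] by auto
      have "\<bar>signed_integral (?m J) (\<Phi> J) - signed_integral (?m J) (?s J)\<bar> \<le>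
        (LINT x|pos_variation (?m J). \<bar>\<Phi> J x - ?s J x\<bar>) + (LINT x|pos_variation (\<lambda>A. - ?m J A). \<bar>\<Phi> J x - ?s J x\<bar>)"
        using i p by (intro signed_integral_diff_bound m[OF J]) auto
      also have "\<dots> \<le> \<delta> * measure (pos_variation (?m J)) cube + \<delta> * measure (pos_variation (\<lambda>A. - ?m J A)) cube"
        using i[OF p(1)] i[OF p(2)] by (intro add_mono) auto
      finally show ?thesis
        using signed_integral_simple[OF m[OF J] P(1,3), of "\<lambda>A. \<Phi> J (z A)"] by (simp add: distrib_left)
    qed
    then have "pairing l \<mu> \<Phi> \<le> (\<Sum>J\<in>tidx l. (\<Sum>A\<in>P. \<Phi> J (z A) * \<mu> A J) +
        \<delta> * (measure (pos_variation (?m J)) cube + measure (pos_variation (\<lambda>A. - ?m J A)) cube))"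
      unfolding pairing_def by (rule sum_mono)
    also have "\<dots> = (\<Sum>A\<in>P. \<Sum>J\<in>tidx l. \<Phi> J (z A) * \<mu> A J) + \<delta> * V"
      by (simp add: sum.distrib V_def sum_distrib_left[symmetric] sum.swap[of _ P])
    also have "(\<Sum>A\<in>P. \<Sum>J\<in>tidx l. \<Phi> J (z A) * \<mu> A J) \<le> (\<Sum>A\<in>P. tnorm l (\<mu> A))"
    proof (rule sum_mono)
      fix A
      have "tnorm l (\<lambda>J. \<Phi> J (z A)) \<le> 1" using \<Phi> by (simp add: tnorm_def admissible_def)
      then have "tnorm l (\<lambda>J. \<Phi> J (z A)) * tnorm l (\<mu> A) \<le> 1 * tnorm l (\<mu> A)"
        by (intro mult_right_mono tnorm_nonneg)
      then show "(\<Sum>J\<in>tidx l. \<Phi> J (z A) * \<mu> A J) \<le> tnorm l (\<mu> A)"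
        using tnorm_Cauchy_Schwarz[of "\<lambda>J. \<Phi> J (z A)" "\<mu> A" l] by simp
    qed
    also have "(\<Sum>A\<in>P. tnorm l (\<mu> A)) \<le> T"
    proof -
      have "(\<Sum>A\<in>P. ennreal (tnorm l (\<mu> A))) \<le> total_variation l \<mu>"
        unfolding total_variation_def using P by (intro SUP_upper) auto
      then have "ennreal (\<Sum>A\<in>P. tnorm l (\<mu> A)) \<le> ennreal T"
        using T by (simp add: sum_ennreal tnorm_nonneg)
      then show ?thesis using \<open>0 \<le> T\<close> by simp
    qed
    finally show ?thesis by simp
  qed
  note le = this
  have "((\<lambda>\<delta>. T + \<delta> * V) \<longlongrightarrow> T + 0 * V) (at_right 0)" by (intro tendsto_intros)
  then have "pairing l \<mu> \<Phi> \<le> T + 0 * V"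
    by (rule tendsto_lowerbound) (auto simp: eventually_at_right_less[of 0] intro!: eventually_mono[OF eventually_at_right_less[of "0::real"]] le)
  then show ?thesis using T by (simp add: ennreal_leI)
qed simp

text \<open>
  The map \<open>y \<mapsto> y / (\<delta> + |y|\<^sup>2)\<^sup>1\<^sup>/\<^sup>2\<close> is a smooth substitute for normalization: it takes
  values in the unit ball, and being Lipschitz it preserves approximation in \<open>L\<^sup>1\<close>.
\<close>

lemma radial_squeeze_lipschitz:
  fixes G g :: "'i \<Rightarrow> real"
  assumes I: "finite I" "i \<in> I" and \<delta>: "0 < \<delta>"
  shows "\<bar>G i * (\<delta> + (\<Sum>j\<in>I. (G j)\<^sup>2)) powr (-1/2) - g i * (\<delta> + (\<Sum>j\<in>I. (g j)\<^sup>2)) powr (-1/2)\<bar>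
    \<le> 2 / sqrt \<delta> * (\<Sum>j\<in>I. \<bar>G j - g j\<bar>)"
proof -
  define N where "N f = sqrt (\<delta> + (\<Sum>j\<in>I. (f j)\<^sup>2))" for f :: "'i \<Rightarrow> real"
  have ge: "sqrt \<delta> \<le> N f" for f unfolding N_def by (simp add: sum_nonneg)
  have pos: "0 < sqrt \<delta>" using \<delta> by simp
  then have Npos: "0 < N f" for f using ge[of f] by linarith
  have powr: "(\<delta> + (\<Sum>j\<in>I. (f j)\<^sup>2)) powr (-1/2) = 1 / N f" for f :: "'i \<Rightarrow> real"
  proof -
    have "0 < \<delta> + (\<Sum>j\<in>I. (f j)\<^sup>2)" using \<delta> sum_nonneg[of I "\<lambda>j. (f j)\<^sup>2"] by (simp add: add_pos_nonneg)
    then show ?thesis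
      unfolding N_def by (simp add: powr_minus_divide powr_half_sqrt)
  qed
  have comp: "\<bar>f i\<bar> \<le> N f" for f
  proof -
    have "(f i)\<^sup>2 \<le> (\<Sum>j\<in>I. (f j)\<^sup>2)" using I by (intro member_le_sum) auto
    then have "(f i)\<^sup>2 \<le> \<delta> + (\<Sum>j\<in>I. (f j)\<^sup>2)" using \<delta> by simp
    then show ?thesis unfolding N_def by (metis real_sqrt_abs real_sqrt_le_mono)
  qed
  have L2: "N f = L2_set (case_option (sqrt \<delta>) f) (insert None (Some ` I))" for f
    unfolding N_def L2_set_def using I \<delta> by (simp add: sum.reindex image_iff)
  define D where "D = (\<Sum>j\<in>I. \<bar>G j - g j\<bar>)"
  have tri: "N f \<le> N h + (\<Sum>j\<in>I. \<bar>f j - h j\<bar>)" for f h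
  proof -
    have "N f = L2_set (\<lambda>k. case_option (sqrt \<delta>) h k + case_option 0 (\<lambda>j. f j - h j) k) (insert None (Some ` I))"
      unfolding L2 by (intro L2_set_cong refl) (auto split: option.split)
    also have "\<dots> \<le> N h + L2_set (case_option 0 (\<lambda>j. f j - h j)) (insert None (Some ` I))"
      unfolding L2 by (rule L2_set_triangle_ineq)
    also have "L2_set (case_option 0 (\<lambda>j. f j - h j)) (insert None (Some ` I)) \<le>
        (\<Sum>k\<in>insert None (Some ` I). \<bar>case_option 0 (\<lambda>j. f j - h j) k\<bar>)"
      by (rule L2_set_le_sum_abs)
    also have "\<dots> = (\<Sum>j\<in>I. \<bar>f j - h j\<bar>)"
      using I by (simp add: sum.reindex image_iff)
    finally show ?thesis by simp
  qed
  have NN: "\<bar>N G - N g\<bar> \<le> D"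
    using tri[of G g] tri[of g G] by (simp add: D_def abs_minus_commute)
  have Di: "\<bar>G i - g i\<bar> \<le> D"
    unfolding D_def using I by (intro member_le_sum) auto
  have "G i / N G - g i / N g = (G i - g i) / N G + (g i / N g) * ((N g - N G) / N G)"
    using Npos[of G] Npos[of g] by (simp add: field_simps)
  also have "\<bar>\<dots>\<bar> \<le> \<bar>(G i - g i) / N G\<bar> + \<bar>(g i / N g) * ((N g - N G) / N G)\<bar>" by (rule abs_triangle_ineq)
  also have "\<bar>(G i - g i) / N G\<bar> \<le> D / sqrt \<delta>"
  proof -
    have "\<bar>(G i - g i) / N G\<bar> = \<bar>G i - g i\<bar> / N G" using Npos[of G] by simp
    also have "\<dots> \<le> D / sqrt \<delta>" using Di ge[of G] pos by (intro frac_le) auto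
    finally show ?thesis .
  qed
  also have "\<bar>(g i / N g) * ((N g - N G) / N G)\<bar> \<le> 1 * (D / sqrt \<delta>)"
    unfolding abs_mult
  proof (rule mult_mono)
    show "\<bar>g i / N g\<bar> \<le> 1" using comp[of g] Npos[of g] by simp
    show "\<bar>(N g - N G) / N G\<bar> \<le> D / sqrt \<delta>"
    proof -
      have "\<bar>(N g - N G) / N G\<bar> = \<bar>N G - N g\<bar> / N G" using Npos[of G] by simp
      also have "\<dots> \<le> D / sqrt \<delta>" using NN ge[of G] pos by (intro frac_le) auto
      finally show ?thesis .
    qed
  qed simp_all
  finally show ?thesis unfolding powr D_def[symmetric] by (simp add: mult.commute)
qed

text \<open>
  For a partition \<open>P\<close> the sum \<open>\<Sum>\<^sub>A |\<mu>(A)|\<close> is the pairing of \<open>\<mu>\<close> with the simple field equal to the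
  direction of \<open>\<mu>(A)\<close> on \<open>A\<close>. Replacing indicators by bump functions need not preserve the bound 1 on the
  norm; the radial squeeze restores it, at the price of a factor \<open>1 / (1 + \<delta>)\<^sup>1\<^sup>/\<^sup>2\<close>.
\<close>

lemma total_variation_le_pairing:
  fixes \<mu> :: "'n::finite tmeas"
  assumes \<mu>: "\<mu> \<in> Mb l"
  shows "total_variation l \<mu> \<le> (SUP \<Phi>\<in>Collect (admissible l). ennreal (pairing l \<mu> \<Phi>))"
  unfolding total_variation_def
proof (rule SUP_least, safe)
  fix P :: "(real ^ 'n) set set"
  assume P: "finite P" "partition_on cube P" "P \<subseteq> sets borelQ"
  let ?R = "SUP \<Phi>\<in>Collect (admissible l). ennreal (pairing l \<mu> \<Phi>)"
  let ?m = "\<lambda>J A. \<mu> A J"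
  have m: "signed (?m J)" if "J \<in> tidx l" for J using \<mu> that by (simp add: Mb_iff_signed)
  define S where "S = (\<Sum>A\<in>P. tnorm l (\<mu> A))"
  have "0 \<le> S" by (simp add: S_def sum_nonneg tnorm_nonneg)
  \<comment> \<open>the direction of \<open>\<mu>(A)\<close>, which is 0 where \<open>\<mu>(A) = 0\<close>\<close>
  define d where "d A J = \<mu> A J / tnorm l (\<mu> A)" for A J
  have d1: "\<bar>d A J\<bar> \<le> 1" if "J \<in> tidx l" for A J
    using abs_le_tnorm[OF that, of "\<mu> A"] tnorm_nonneg[of l "\<mu> A"]
    by (cases "tnorm l (\<mu> A) = 0") (auto simp: d_def)
  have dsum: "(\<Sum>J\<in>tidx l. d A J * \<mu> A J) = tnorm l (\<mu> A)" for A
  proof (cases "tnorm l (\<mu> A) = 0")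
    case False
    have "(\<Sum>J\<in>tidx l. d A J * \<mu> A J) = (\<Sum>J\<in>tidx l. (\<mu> A J)\<^sup>2) / tnorm l (\<mu> A)"
      by (simp add: d_def sum_divide_distrib power2_eq_square)
    also have "(\<Sum>J\<in>tidx l. (\<mu> A J)\<^sup>2) = tnorm l (\<mu> A) * tnorm l (\<mu> A)"
      by (simp add: tnorm_def sum_nonneg)
    finally show ?thesis using False by simp
  qed (simp add: d_def)
  have dsq: "(\<Sum>J\<in>tidx l. (d A J)\<^sup>2) = 1 \<or> (\<forall>J\<in>tidx l. d A J = 0)" for A
  proof (cases "tnorm l (\<mu> A) = 0")
    case False
    have "(\<Sum>J\<in>tidx l. (d A J)\<^sup>2) = (\<Sum>J\<in>tidx l. (\<mu> A J)\<^sup>2) / (tnorm l (\<mu> A))\<^sup>2"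
      by (simp add: d_def sum_divide_distrib power_divide)
    also have "(tnorm l (\<mu> A))\<^sup>2 = (\<Sum>J\<in>tidx l. (\<mu> A J)\<^sup>2)" by (simp add: tnorm_def sum_nonneg)
    finally show ?thesis using False by (simp add: tnorm_def)
  qed (simp add: d_def)
  \<comment> \<open>the positive and the negative variation of every entry\<close>
  define \<nu> where "\<nu> z = pos_variation (if snd z then ?m (fst z) else (\<lambda>A. - ?m (fst z) A))" for z :: "'n list \<times> bool"
  have \<nu>: "finite_measure (\<nu> z)" "sets (\<nu> z) = sets borelQ" "space (\<nu> z) = cube" if "z \<in> tidx l \<times> UNIV" for z
  proof -
    have "signed (?m (fst z))" "signed (\<lambda>A. - ?m (fst z) A)"
      using m[of "fst z"] signed_uminus[OF m[of "fst z"]] that by auto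
    then show "finite_measure (\<nu> z)"
      unfolding \<nu>_def by (cases "snd z") (simp_all only: if_True if_False finite_pos_variation)
  qed (simp_all add: \<nu>_def)
  define card where "card = (\<Sum>J\<in>(tidx l :: 'n list set). (1::real))"
  have approx: "ennreal (S / sqrt (1 + \<delta>) - \<epsilon>) \<le> ?R" if \<delta>: "0 < \<delta>" and \<epsilon>: "0 < \<epsilon>" for \<delta> \<epsilon>
  proof -
    \<comment> \<open>the factor by which the squeezed approximation multiplies the error of the indicators\<close>
    define K where "K = 2 * card * (2 / sqrt \<delta> * card) * (\<Sum>A\<in>P. 1) + 1"
    have "1 \<le> K" using \<delta> by (simp add: K_def card_def)
    have "\<forall>A\<in>P. \<exists>\<phi>\<in>bumps. \<forall>z\<in>tidx l \<times> UNIV. (LINT x|\<nu> z. \<bar>\<phi> x - indicat_real A x\<bar>) < \<epsilon> / K"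
      using P(3) \<open>1 \<le> K\<close> \<epsilon> \<nu> by (intro ballI bumps_approx_indicator) auto
    then obtain \<phi> where \<phi>: "\<And>A. A \<in> P \<Longrightarrow> \<phi> A \<in> bumps"
      "\<And>A z. A \<in> P \<Longrightarrow> z \<in> tidx l \<times> UNIV \<Longrightarrow> (LINT x|\<nu> z. \<bar>\<phi> A x - indicat_real A x\<bar>) < \<epsilon> / K"
      by metis
    define G where "G J x = (\<Sum>A\<in>P. d A J * \<phi> A x)" for J x
    define g where "g J x = (\<Sum>A\<in>P. d A J * indicat_real A x)" for J x
    define \<Phi> where "\<Phi> J x = (\<delta> + (\<Sum>I\<in>tidx l. (G I x)\<^sup>2)) powr (-1/2) * G J x" for J x
    have G: "G J \<in> bumps" for J
      unfolding G_def[abs_def] by (intro bumps_sum P bumps_mult bumpalg_const \<phi>)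
    have pos: "0 < \<delta> + (\<Sum>I\<in>tidx l. (f I)\<^sup>2)" for f :: "'n list \<Rightarrow> real"
      using \<delta> by (simp add: add_pos_nonneg sum_nonneg)
    have \<Phi>: "\<Phi> J \<in> bumps" for J
      unfolding \<Phi>_def[abs_def]
    proof (intro bumps_mult G bumpalg_powr pos bumpalg_add bumpalg_const)
      show "bumpalg (\<lambda>x. \<Sum>I\<in>tidx l. (G I x)\<^sup>2)"
        unfolding power2_eq_square using G by (intro bumpalg_sum bumpalg_mult) (auto simp: bumps_def)
    qed
    have adm: "admissible l \<Phi>"
      unfolding admissible_def
    proof (intro conjI ballI allI)
      show "\<Phi> J \<in> test_fun" for J using \<Phi> by (rule bumps_test_fun)
      fix x
      have "(\<Sum>J\<in>tidx l. (\<Phi> J x)\<^sup>2) = ((\<delta> + (\<Sum>I\<in>tidx l. (G I x)\<^sup>2)) powr (-1/2))\<^sup>2 * (\<Sum>J\<in>tidx l. (G J x)\<^sup>2)"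
        by (simp add: \<Phi>_def power_mult_distrib sum_distrib_left)
      also have "((\<delta> + (\<Sum>I\<in>tidx l. (G I x)\<^sup>2)) powr (-1/2))\<^sup>2 = 1 / (\<delta> + (\<Sum>I\<in>tidx l. (G I x)\<^sup>2))"
        using pos[of "\<lambda>I. G I x"] by (simp add: powr_minus_divide powr_half_sqrt power_divide)
      also have "1 / (\<delta> + (\<Sum>I\<in>tidx l. (G I x)\<^sup>2)) * (\<Sum>J\<in>tidx l. (G J x)\<^sup>2) \<le> 1"
        using pos[of "\<lambda>I. G I x"] \<delta> by (simp add: divide_le_eq)
      finally show "(\<Sum>J\<in>tidx l. (\<Phi> J x)\<^sup>2) \<le> 1" .
    qed
    have gA: "g J x = d A J" if "A \<in> P" "x \<in> A" for J A x
      unfolding g_def by (rule sum_indicator_partition[OF P(2,1) that])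
    have squeeze_g: "g J x * (\<delta> + (\<Sum>I\<in>tidx l. (g I x)\<^sup>2)) powr (-1/2) = (\<Sum>A\<in>P. (d A J / sqrt (1 + \<delta>)) * indicat_real A x)"
      if J: "J \<in> tidx l" and x: "x \<in> cube" for J x
    proof -
      obtain A where A: "A \<in> P" "x \<in> A" using x partition_onD1[OF P(2)] by auto
      have "(\<delta> + 1) powr (-1/2) = 1 / sqrt (1 + \<delta>)"
        using \<delta> by (simp add: powr_minus_divide powr_half_sqrt add.commute)
      then have "d A J * (\<delta> + (\<Sum>I\<in>tidx l. (d A I)\<^sup>2)) powr (-1/2) = d A J / sqrt (1 + \<delta>)"
        using dsq[of A] J by auto
      then show ?thesis
        using gA[OF A] sum_indicator_partition[OF P(2,1) A, of "\<lambda>A. d A J / sqrt (1 + \<delta>)"] by simp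
    qed
    have near: "\<bar>\<Phi> J x - (\<Sum>A\<in>P. (d A J / sqrt (1 + \<delta>)) * indicat_real A x)\<bar>
        \<le> (2 / sqrt \<delta> * card) * (\<Sum>A\<in>P. \<bar>\<phi> A x - indicat_real A x\<bar>)"
      if J: "J \<in> tidx l" and x: "x \<in> cube" for J x
    proof -
      have "\<bar>\<Phi> J x - (\<Sum>A\<in>P. (d A J / sqrt (1 + \<delta>)) * indicat_real A x)\<bar> \<le> 2 / sqrt \<delta> * (\<Sum>I\<in>tidx l. \<bar>G I x - g I x\<bar>)"
        using radial_squeeze_lipschitz[OF finite_tidx J \<delta>, of "\<lambda>I. G I x" "\<lambda>I. g I x"]
        unfolding squeeze_g[OF J x, symmetric] \<Phi>_def by (simp add: mult.commute)
      also have "\<dots> \<le> 2 / sqrt \<delta> * (\<Sum>I\<in>(tidx l :: 'n list set). \<Sum>A\<in>P. \<bar>\<phi> A x - indicat_real A x\<bar>)"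
      proof (intro mult_left_mono sum_mono)
        fix I :: "'n list" assume I: "I \<in> tidx l"
        have "\<bar>G I x - g I x\<bar> = \<bar>\<Sum>A\<in>P. d A I * (\<phi> A x - indicat_real A x)\<bar>"
          by (simp add: G_def g_def sum_subtractf right_diff_distrib)
        also have "\<dots> \<le> (\<Sum>A\<in>P. \<bar>d A I * (\<phi> A x - indicat_real A x)\<bar>)" by (rule sum_abs)
        also have "\<dots> \<le> (\<Sum>A\<in>P. 1 * \<bar>\<phi> A x - indicat_real A x\<bar>)"
          unfolding abs_mult by (intro sum_mono mult_right_mono d1 I) auto
        finally show "\<bar>G I x - g I x\<bar> \<le> (\<Sum>A\<in>P. \<bar>\<phi> A x - indicat_real A x\<bar>)" by simp
      qed (use \<delta> in auto)
      also have "\<dots> = (2 / sqrt \<delta> * card) * (\<Sum>A\<in>P. \<bar>\<phi> A x - indicat_real A x\<bar>)"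
        by (simp add: card_def)
      finally show ?thesis .
    qed
    have SI: "signed_integral (?m J) (\<Phi> J) \<ge> (\<Sum>A\<in>P. (d A J / sqrt (1 + \<delta>)) * \<mu> A J) - 2 * ((2 / sqrt \<delta> * card) * (\<Sum>A\<in>P. \<epsilon> / K))"
      if J: "J \<in> tidx l" for J
    proof -
      let ?s = "\<lambda>x. \<Sum>A\<in>P. (d A J / sqrt (1 + \<delta>)) * indicat_real A x"
      have i: "integrable (\<nu> z) (\<Phi> J) \<and> integrable (\<nu> z) ?s \<and>
          (LINT x|\<nu> z. \<bar>\<Phi> J x - ?s x\<bar>) \<le> (2 / sqrt \<delta> * card) * (\<Sum>A\<in>P. \<epsilon> / K)"
        if z: "z \<in> tidx l \<times> UNIV" for z
      proof -
        have 1: "integrable (\<nu> z) (\<Phi> J)" by (rule test_fun_integrable[OF bumps_test_fun[OF \<Phi>] \<nu>(2,1)[OF z]])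
        have iA: "integrable (\<nu> z) (indicat_real A)" if "A \<in> P" for A
          using integrable_indicator_borelQ[OF \<nu>(1,2)[OF z]] that P(3) by auto
        then have 2: "integrable (\<nu> z) ?s" by (intro Bochner_Integration.integrable_sum integrable_mult_right) auto
        have i\<phi>: "integrable (\<nu> z) (\<phi> A)" if "A \<in> P" for A
          by (rule test_fun_integrable[OF bumps_test_fun[OF \<phi>(1)[OF that]] \<nu>(2,1)[OF z]])
        have "(LINT x|\<nu> z. \<bar>\<Phi> J x - ?s x\<bar>) \<le> (LINT x|\<nu> z. (2 / sqrt \<delta> * card) * (\<Sum>A\<in>P. \<bar>\<phi> A x - indicat_real A x\<bar>))"
          using 1 2 near[OF J] iA i\<phi> \<nu>(3)[OF z]
          by (intro integral_mono integrable_abs Bochner_Integration.integrable_diff integrable_mult_right Bochner_Integration.integrable_sum) auto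
        also have "\<dots> = (2 / sqrt \<delta> * card) * (\<Sum>A\<in>P. LINT x|\<nu> z. \<bar>\<phi> A x - indicat_real A x\<bar>)"
          using iA i\<phi> by (subst Bochner_Integration.integral_mult_right_zero, subst Bochner_Integration.integral_sum) auto
        also have "\<dots> \<le> (2 / sqrt \<delta> * card) * (\<Sum>A\<in>P. \<epsilon> / K)"
          using \<phi>(2)[OF _ z] \<delta> by (intro mult_left_mono sum_mono) (auto simp: card_def intro: less_imp_le)
        finally show ?thesis using 1 2 by simp
      qed
      have \<nu>12: "\<nu> (J, True) = pos_variation (?m J)" "\<nu> (J, False) = pos_variation (\<lambda>A. - ?m J A)"
        by (simp_all add: \<nu>_def)
      have z: "(J, True) \<in> tidx l \<times> UNIV" "(J, False) \<in> tidx l \<times> UNIV" using J by auto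
      have "\<bar>signed_integral (?m J) (\<Phi> J) - signed_integral (?m J) ?s\<bar> \<le>
        (LINT x|\<nu> (J, True). \<bar>\<Phi> J x - ?s x\<bar>) + (LINT x|\<nu> (J, False). \<bar>\<Phi> J x - ?s x\<bar>)"
        unfolding \<nu>12
      proof (rule signed_integral_diff_bound[OF m[OF J]])
        fix M assume "M \<in> {pos_variation (?m J), pos_variation (\<lambda>A. - ?m J A)}"
        then have "M = \<nu> (J, True) \<or> M = \<nu> (J, False)" unfolding \<nu>12 by simp
        then show "integrable M (\<Phi> J) \<and> integrable M ?s"
          by (elim disjE) (simp_all only: i[OF z(1)] i[OF z(2)] simp_thms)
      qed
      moreover have "signed_integral (?m J) ?s = (\<Sum>A\<in>P. (d A J / sqrt (1 + \<delta>)) * \<mu> A J)"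
        by (rule signed_integral_simple[OF m[OF J] P(1,3)])
      moreover note i[OF z(1), THEN conjunct2, THEN conjunct2] i[OF z(2), THEN conjunct2, THEN conjunct2]
      ultimately show ?thesis by argo
    qed
    have "S / sqrt (1 + \<delta>) - \<epsilon> \<le> pairing l \<mu> \<Phi>"
    proof -
      have "(\<Sum>J\<in>tidx l. (\<Sum>A\<in>P. (d A J / sqrt (1 + \<delta>)) * \<mu> A J) - 2 * ((2 / sqrt \<delta> * card) * (\<Sum>A\<in>P. \<epsilon> / K))) \<le> pairing l \<mu> \<Phi>"
        unfolding pairing_def by (intro sum_mono SI)
      moreover have "(\<Sum>J\<in>tidx l. (\<Sum>A\<in>P. (d A J / sqrt (1 + \<delta>)) * \<mu> A J)) = S / sqrt (1 + \<delta>)"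
        unfolding S_def dsum[symmetric] by (subst sum.swap) (simp add: sum_divide_distrib)
      moreover have "(\<Sum>J\<in>(tidx l :: 'n list set). 2 * ((2 / sqrt \<delta> * card) * (\<Sum>A\<in>P. \<epsilon> / K))) = (K - 1) * (\<epsilon> / K)"
        by (simp add: K_def card_def)
      moreover have "(K - 1) * (\<epsilon> / K) \<le> \<epsilon>" using \<open>1 \<le> K\<close> \<epsilon> by (simp add: field_simps)
      ultimately show ?thesis by (simp add: sum_subtractf)
    qed
    then have "ennreal (S / sqrt (1 + \<delta>) - \<epsilon>) \<le> ennreal (pairing l \<mu> \<Phi>)" by (rule ennreal_leI)
    also have "\<dots> \<le> ?R" using adm by (intro SUP_upper) auto
    finally show ?thesis .
  qed
  have "(\<lambda>n. ennreal (S / sqrt (1 + 1 / real (Suc n)) - 1 / real (Suc n))) \<longlonglongrightarrow> ennreal (S / sqrt (1 + 0) - 0)"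
    using LIMSEQ_inverse_real_of_nat
    by (intro tendsto_ennrealI tendsto_intros) (auto simp: inverse_eq_divide)
  then have "ennreal (S / sqrt (1 + 0) - 0) \<le> ?R"
    by (rule LIMSEQ_le_const2) (use approx in auto)
  then show "(\<Sum>A\<in>P. ennreal (tnorm l (\<mu> A))) \<le> ?R"
    by (simp add: S_def sum_ennreal tnorm_nonneg)
qed

theorem total_variation_eq_SUP_pairing:
  assumes "\<mu> \<in> Mb l"
  shows "total_variation l \<mu> = (SUP \<Phi>\<in>Collect (admissible l). ennreal (pairing l \<mu> \<Phi>))"
  using total_variation_le_pairing[OF assms] pairing_le_total_variation[OF assms]
  by (intro antisym SUP_least) auto

section \<open>Weak* compactness of measures on the cube\<close>

text \<open>
  A continuous periodic function that reads off a ternary digit: it is 0 on \<open>[0, 1/3]\<close> and 1 on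
  \<open>[2/3, 1]\<close>, modulo 2.
\<close>

definition ternary_digit :: "real \<Rightarrow> real" where
  "ternary_digit t = max 0 (min 1 (1/2 - cos (pi * t)))"

lemma ternary_digit_bounds: "0 \<le> ternary_digit t" "ternary_digit t \<le> 1"
  by (auto simp: ternary_digit_def)

lemma ternary_digit_eq:
  assumes "d = 0 \<or> d = 1" "0 \<le> r" "r \<le> 1/3"
  shows "ternary_digit (2 * of_int k + (2 * d / 3 + r)) = d"
proof -
  have "pi * (2 * of_int k + (2 * d / 3 + r)) = pi * (2 * d / 3 + r) + of_int k * (2 * pi)"
    by (simp add: algebra_simps)
  then have eq: "cos (pi * (2 * of_int k + (2 * d / 3 + r))) = cos (pi * (2 * d / 3 + r))"
    using cos.plus_of_int[of "pi * (2 * d / 3 + r)" k] by simp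
  have "pi / 3 \<le> pi" using pi_gt_zero by simp
  from assms(1) show ?thesis
  proof
    assume d: "d = 0"
    have "pi * r \<le> pi * (1/3)" using assms by (intro mult_left_mono) auto
    then have "cos (pi / 3) \<le> cos (pi * r)"
      using assms \<open>pi / 3 \<le> pi\<close> by (intro cos_monotone_0_pi_le) auto
    then show ?thesis unfolding ternary_digit_def eq using d by (simp add: cos_60)
  next
    assume d: "d = 1"
    have "pi * (2/3) \<le> pi * (2 / 3 + r)" "pi * (2 / 3 + r) \<le> pi * 1"
      using assms by (intro mult_left_mono, auto)+
    then have "cos (pi * (2 / 3 + r)) \<le> cos (pi * (2/3))"
      by (intro cos_monotone_0_pi_le) auto
    moreover have "cos (pi * (2/3)) = - 1/2"
      using cos_120 by (simp add: mult.commute)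
    ultimately show ?thesis unfolding ternary_digit_def eq using d by simp
  qed
qed

lemma summable_ternary:
  assumes "\<And>m. d m = 0 \<or> d m = (1::real)"
  shows "summable (\<lambda>m. 2 * d m / 3 ^ Suc m)"
proof (rule summable_comparison_test')
  show "summable (\<lambda>m. 2 / 3 * (1/3::real) ^ m)" by (intro summable_mult summable_geometric) simp
  fix m :: nat
  show "norm (2 * d m / 3 ^ Suc m) \<le> 2 / 3 * (1/3::real) ^ m"
    using assms[of m] by (auto simp: power_one_over)
qed

text \<open>
  Multiplication by \<open>3\<^sup>m\<close> turns the first \<open>m\<close> terms into an even integer, and the terms after the
  \<open>m\<close>-th contribute at most \<open>1/3\<close>.
\<close>

lemma ternary_digit_expansion:
  assumes d: "\<And>m. d m = 0 \<or> d m = (1::real)"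
  shows "ternary_digit (3 ^ m * (\<Sum>m. 2 * d m / 3 ^ Suc m)) = d m"
proof -
  let ?f = "\<lambda>m. 2 * d m / 3 ^ Suc m"
  let ?r = "\<Sum>j. 2 * d (j + Suc m) / 3 ^ (j + 2)"
  have s: "summable ?f" by (rule summable_ternary[OF d])
  have s': "summable (\<lambda>j. 2 * d (j + Suc m) / 3 ^ (j + 2))"
    using summable_mult[OF summable_ternary[of "\<lambda>j. d (j + Suc m)"], of "1/3"] d by simp
  have "suminf ?f = (\<Sum>j. ?f (j + Suc m)) + sum ?f {..<Suc m}"
    by (rule suminf_split_initial_segment[OF s])
  then have "3 ^ m * suminf ?f = 3 ^ m * (\<Sum>j. ?f (j + Suc m)) + (\<Sum>j<m. 3 ^ m * ?f j) + 3 ^ m * ?f m"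
    by (simp add: distrib_left sum_distrib_left)
  also have "3 ^ m * (\<Sum>j. ?f (j + Suc m)) = (\<Sum>j. 3 ^ m * ?f (j + Suc m))"
    by (rule suminf_mult[symmetric, OF summable_ignore_initial_segment[OF s]])
  also have "(\<lambda>j. 3 ^ m * ?f (j + Suc m)) = (\<lambda>j. 2 * d (j + Suc m) / 3 ^ (j + 2))"
    by (rule ext) (simp add: power_add field_simps)
  also have "(\<Sum>j<m. 3 ^ m * ?f j) = 2 * of_int (\<Sum>j<m. \<lfloor>d j\<rfloor> * 3 ^ (m - Suc j))"
  proof -
    have "3 ^ m * ?f j = 2 * of_int (\<lfloor>d j\<rfloor> * 3 ^ (m - Suc j))" if "j < m" for j
    proof -
      have "(3::real) ^ m = 3 ^ (m - Suc j) * 3 ^ Suc j" using that by (simp only: power_add[symmetric]) simp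
      then show ?thesis using d[of j] by auto
    qed
    then show ?thesis by (simp add: sum_distrib_left)
  qed
  also have "3 ^ m * ?f m = 2 * d m / 3" by simp
  finally have eq: "3 ^ m * suminf ?f = 2 * of_int (\<Sum>j<m. \<lfloor>d j\<rfloor> * 3 ^ (m - Suc j)) + (2 * d m / 3 + ?r)" by simp
  have "0 \<le> ?r"
  proof (rule suminf_nonneg[OF s'])
    show "0 \<le> 2 * d (j + Suc m) / 3 ^ (j + 2)" for j using d[of "j + Suc m"] by auto
  qed
  moreover have "?r \<le> 1 / 3"
  proof -
    have g: "summable (\<lambda>j. 2 / 9 * (1/3::real) ^ j)" by (intro summable_mult summable_geometric) simp
    have "?r \<le> (\<Sum>j. 2 / 9 * (1/3::real) ^ j)"
    proof (rule suminf_le[OF _ s' g])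
      show "2 * d (j + Suc m) / 3 ^ (j + 2) \<le> 2 / 9 * (1/3::real) ^ j" for j
        using d[of "j + Suc m"] by (auto simp: power_one_over)
    qed
    also have "\<dots> = 2 / 9 * (1 / (1 - 1/3))"
      by (subst suminf_mult) (auto intro: summable_geometric simp: suminf_geometric)
    finally show ?thesis by simp
  qed
  ultimately show ?thesis unfolding eq using d by (intro ternary_digit_eq) auto
qed

definition binary_digit :: "nat \<Rightarrow> real \<Rightarrow> real" where
  "binary_digit n y = of_int (\<lfloor>2 ^ Suc n * y\<rfloor> - 2 * \<lfloor>2 ^ n * y\<rfloor>)"

lemma binary_digit: "binary_digit n y = 0 \<or> binary_digit n y = 1"
proof -
  have eq: "2 ^ Suc n * y = 2 * (2 ^ n * y)" by simp
  have "\<lfloor>2 * z\<rfloor> - 2 * \<lfloor>z\<rfloor> = 0 \<or> \<lfloor>2 * z\<rfloor> - 2 * \<lfloor>z\<rfloor> = 1" for z :: real by linarith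
  then have "\<lfloor>2 ^ Suc n * y\<rfloor> - 2 * \<lfloor>2 ^ n * y\<rfloor> = 0 \<or> \<lfloor>2 ^ Suc n * y\<rfloor> - 2 * \<lfloor>2 ^ n * y\<rfloor> = 1"
    unfolding eq by blast
  then show ?thesis unfolding binary_digit_def by (metis of_int_0 of_int_1)
qed

lemma binary_expansion:
  assumes "0 \<le> y" "y < 1"
  shows "(\<lambda>n. binary_digit n y / 2 ^ Suc n) sums y"
proof -
  have "(\<Sum>n<M. binary_digit n y / 2 ^ Suc n) = of_int \<lfloor>2 ^ M * y\<rfloor> / 2 ^ M" for M
  proof (induction M)
    case 0
    have "\<lfloor>y\<rfloor> = 0" using assms by linarith
    then show ?case by simp
  next
    case (Suc M)
    then show ?case by (simp add: binary_digit_def field_simps)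
  qed
  moreover have "(\<lambda>M. of_int \<lfloor>2 ^ M * y\<rfloor> / 2 ^ M) \<longlonglongrightarrow> y"
  proof (rule tendsto_sandwich)
    show "(\<lambda>M. y - (1/2) ^ M) \<longlonglongrightarrow> y"
      using tendsto_diff[OF tendsto_const LIMSEQ_realpow_zero[of "1/2"], of y] by simp
    show "\<forall>\<^sub>F M in sequentially. y - (1/2) ^ M \<le> of_int \<lfloor>2 ^ M * y\<rfloor> / 2 ^ M"
    proof (rule always_eventually, rule allI)
      fix M
      have "2 ^ M * y - 1 \<le> of_int \<lfloor>2 ^ M * y\<rfloor>" by linarith
      then have "(2 ^ M * y - 1) / 2 ^ M \<le> of_int \<lfloor>2 ^ M * y\<rfloor> / 2 ^ M" by (rule divide_right_mono) simp
      then show "y - (1/2) ^ M \<le> of_int \<lfloor>2 ^ M * y\<rfloor> / 2 ^ M" by (simp add: diff_divide_distrib power_one_over)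
    qed
    show "\<forall>\<^sub>F M in sequentially. of_int \<lfloor>2 ^ M * y\<rfloor> / 2 ^ M \<le> y"
    proof (rule always_eventually, rule allI)
      fix M
      have "of_int \<lfloor>2 ^ M * y\<rfloor> \<le> 2 ^ M * y" by linarith
      then show "of_int \<lfloor>2 ^ M * y\<rfloor> / 2 ^ M \<le> y" by (simp add: divide_le_eq mult.commute)
    qed
  qed simp
  ultimately show ?thesis by (simp add: sums_def)
qed

text \<open>
  Schoenberg's space filling curve. It reduces weak compactness of measures on the cube to Helly's
  theorem on the line: pushing forward along a Borel right inverse of the curve loses nothing, and continuous functions
  on the cube become continuous functions on the line by composition with the curve.
\<close>

definition schoenberg :: "real \<Rightarrow> real ^ 'n::finite" where
  "schoenberg t = (\<chi> i. (\<Sum>n. ternary_digit (3 ^ to_nat (n, i) * t) / 2 ^ Suc n) - 1/2)"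

text \<open>
  The binary digits of all coordinates, interleaved as the ternary digits 0 and 2 of one number.
\<close>

definition schoenberg_section :: "real ^ 'n::finite \<Rightarrow> real" where
  "schoenberg_section x =
    (\<Sum>m. 2 * (case from_nat m of (n, i) \<Rightarrow> binary_digit n (x $ i + 1/2)) / 3 ^ Suc m)"

lemma continuous_schoenberg: "continuous_on UNIV (schoenberg :: real \<Rightarrow> real ^ 'n::finite)"
proof -
  have "continuous_on UNIV (\<lambda>t. (\<Sum>n. ternary_digit (3 ^ to_nat (n, i) * t) / 2 ^ Suc n) - 1/2)" for i :: 'n
  proof (intro continuous_on_diff continuous_on_const)
    have "uniform_limit UNIV (\<lambda>N t. \<Sum>n<N. ternary_digit (3 ^ to_nat (n, i) * t) / 2 ^ Suc n)
        (\<lambda>t. \<Sum>n. ternary_digit (3 ^ to_nat (n, i) * t) / 2 ^ Suc n) sequentially"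
    proof (rule Weierstrass_m_test)
      show "summable (\<lambda>n. 1/2 * (1/2::real) ^ n)" by (intro summable_mult summable_geometric) simp
      show "norm (ternary_digit (3 ^ to_nat (n, i) * t) / 2 ^ Suc n) \<le> 1/2 * (1/2::real) ^ n" for n t
        using ternary_digit_bounds[of "3 ^ to_nat (n, i) * t"] by (simp add: power_one_over divide_right_mono)
    qed
    then show "continuous_on UNIV (\<lambda>t. \<Sum>n. ternary_digit (3 ^ to_nat (n, i) * t) / 2 ^ Suc n)"
      by (rule uniform_limit_theorem[rotated])
        (auto simp: ternary_digit_def intro!: always_eventually continuous_intros)
  qed
  then show ?thesis unfolding schoenberg_def[abs_def] by (rule continuous_on_vec_lambda)
qed

lemma schoenberg_section_measurable: "schoenberg_section \<in> borel_measurable borel"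
  unfolding schoenberg_section_def[abs_def] binary_digit_def
  by (intro borel_measurable_suminf) (simp add: case_prod_unfold)

lemma schoenberg_section:
  fixes x :: "real ^ 'n::finite"
  assumes "x \<in> cube"
  shows "schoenberg (schoenberg_section x) = x"
proof -
  define d where "d m = (case from_nat m of (n, i) \<Rightarrow> binary_digit n (x $ i + 1/2))" for m
  have d: "d m = 0 \<or> d m = 1" for m
    unfolding d_def using binary_digit by (auto split: prod.split)
  have "ternary_digit (3 ^ to_nat (n, i) * schoenberg_section x) = binary_digit n (x $ i + 1/2)" for n and i :: 'n
    using ternary_digit_expansion[of d "to_nat (n, i)", OF d] unfolding schoenberg_section_def
    by (simp add: d_def)
  moreover have "(\<lambda>n. binary_digit n (x $ i + 1/2) / 2 ^ Suc n) sums (x $ i + 1/2)" for i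
    using assms by (intro binary_expansion) (auto simp: cube_def dest: spec[of _ i])
  ultimately show ?thesis
    by (simp add: schoenberg_def vec_eq_iff sums_iff)
qed

lemma schoenberg_section_bounds: "0 \<le> schoenberg_section x" "schoenberg_section x \<le> 1"
proof -
  define d where "d m = (case from_nat m of (n, i) \<Rightarrow> binary_digit n (x $ i + 1/2))" for m
  have d: "d m = 0 \<or> d m = 1" for m
    unfolding d_def using binary_digit by (auto split: prod.split)
  have eq: "schoenberg_section x = (\<Sum>m. 2 * d m / 3 ^ Suc m)"
    by (simp add: schoenberg_section_def d_def)
  have pos: "0 \<le> 2 * d m / 3 ^ Suc m" for m using d[of m] by auto
  show "0 \<le> schoenberg_section x"
    unfolding eq by (intro suminf_nonneg summable_ternary d pos)
  have g: "summable (\<lambda>j. 2 / 3 * (1/3::real) ^ j)" by (intro summable_mult summable_geometric) simp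
  have "(\<Sum>m. 2 * d m / 3 ^ Suc m) \<le> (\<Sum>j. 2 / 3 * (1/3::real) ^ j)"
  proof (rule suminf_le[OF _ summable_ternary[OF d] g])
    show "2 * d m / 3 ^ Suc m \<le> 2 / 3 * (1/3::real) ^ m" for m
      using d[of m] by (auto simp: power_one_over)
  qed
  also have "\<dots> = 2 / 3 * (1 / (1 - 1/3))"
    by (subst suminf_mult) (auto intro: summable_geometric simp: suminf_geometric)
  finally show "schoenberg_section x \<le> 1" by (simp add: eq)
qed

text \<open>
  After passing to a subsequence the masses converge. If the limit is 0, the limit measure
  is 0. Otherwise the normalized measures are pushed to \<open>[0, 1]\<close> by the section of the curve, where they are tight, and the
  weak limit is pulled back by the curve. Mass may end up on the boundary of the cube, where test functions
  vanish; so the limit is restricted to the open cube.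
\<close>

theorem cube_measures_weakly_compact:
  fixes p :: "nat \<Rightarrow> (real ^ 'n::finite) measure"
  assumes fin: "\<And>n. finite_measure (p n)" and sets: "\<And>n. sets (p n) = sets borelQ"
    and bound: "\<And>n. measure (p n) cube \<le> C"
  obtains r P where "strict_mono r" "finite_measure P" "sets P = sets borelQ"
    "\<And>\<phi>. \<phi> \<in> test_fun \<Longrightarrow> (\<lambda>n. LINT x|p (r n). \<phi> x) \<longlonglongrightarrow> (LINT x|P. \<phi> x)"
proof -
  have sp: "space (p n) = cube" for n using sets_eq_imp_space_eq[OF sets] by simp
  have int: "integrable (p n) \<phi>" if "\<phi> \<in> test_fun" for n \<phi>
    by (rule test_fun_integrable[OF that sets fin])
  have "bounded (range (\<lambda>n. measure (p n) cube))"
    using bound by (auto simp: bounded_iff intro!: exI[of _ C])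
  then obtain c r0 where r0: "strict_mono r0" and c: "((\<lambda>n. measure (p n) cube) \<circ> r0) \<longlonglongrightarrow> c"
    using bounded_imp_convergent_subsequence by blast
  have "0 \<le> c" using c by (rule LIMSEQ_le_const) auto
  show ?thesis
  proof (cases "c = 0")
    case True
    show ?thesis
    proof (rule that[OF r0, of "null_measure borelQ"])
      show "finite_measure (null_measure borelQ)" by (rule finite_measureI) simp
      fix \<phi> :: "real ^ 'n \<Rightarrow> real" assume \<phi>: "\<phi> \<in> test_fun"
      obtain K where K: "\<And>x. \<bar>\<phi> x\<bar> \<le> K" using test_fun_bounded[OF \<phi>] by blast
      have "(\<lambda>n. LINT x|p (r0 n). \<phi> x) \<longlonglongrightarrow> 0"
      proof (rule Lim_null_comparison)
        show "(\<lambda>n. K * measure (p (r0 n)) cube) \<longlonglongrightarrow> 0"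
          using tendsto_mult_right_zero[of "\<lambda>n. measure (p (r0 n)) cube" sequentially K] c True by (simp add: o_def)
        have "norm (LINT x|p n. \<phi> x) \<le> K * measure (p n) cube" for n
        proof -
          interpret finite_measure "p n" by (rule fin)
          have "norm (LINT x|p n. \<phi> x) \<le> (LINT x|p n. \<bar>\<phi> x\<bar>)" using integral_abs_bound by simp
          also have "\<dots> \<le> (LINT x|p n. K)" using K int[OF \<phi>] by (intro integral_mono) auto
          finally show ?thesis by (simp add: sp mult.commute)
        qed
        then show "\<forall>\<^sub>F n in sequentially. norm (LINT x|p (r0 n). \<phi> x) \<le> K * measure (p (r0 n)) cube" by simp
      qed
      then show "(\<lambda>n. LINT x|p (r0 n). \<phi> x) \<longlonglongrightarrow> (LINT x|null_measure borelQ. \<phi> x)"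
        by (simp add: integral_null_measure)
    qed simp
  next
    case False
    with \<open>0 \<le> c\<close> have "0 < c" by simp
    then have "\<forall>\<^sub>F n in sequentially. 0 < measure (p (r0 n)) cube"
      using order_tendstoD(1)[OF c, of 0] by (simp add: o_def)
    then obtain N where N: "\<And>n. N \<le> n \<Longrightarrow> 0 < measure (p (r0 n)) cube"
      by (auto simp: eventually_sequentially)
    \<comment> \<open>from here on the masses are positive, as normalization requires\<close>
    define q where "q n = p (r0 (n + N))" for n
    define c' where "c' n = measure (q n) cube" for n
    have c'pos: "0 < c' n" for n using N by (simp add: c'_def q_def)
    have c'lim: "c' \<longlonglongrightarrow> c"
      using LIMSEQ_ignore_initial_segment[OF c, of N] by (simp add: c'_def[abs_def] q_def o_def)
    have qfin: "finite_measure (q n)" and qsets: "sets (q n) = sets borelQ" and qsp: "space (q n) = cube" for n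
      by (auto simp: q_def fin sets sp)
    define \<mu> where "\<mu> n = distr (density (q n) (\<lambda>_. ennreal (1 / c' n))) borel (schoenberg_section)" for n
    have smeas: "schoenberg_section \<in> measurable (q n) borel" for n
      unfolding measurable_cong_sets[OF qsets refl] borelQ_def
      by (rule measurable_restrict_space1[OF schoenberg_section_measurable])
    have prob: "prob_space (\<mu> n)" for n
    proof -
      interpret finite_measure "q n" by (rule qfin)
      have "prob_space (density (q n) (\<lambda>_. ennreal (1 / c' n)))"
      proof (rule prob_spaceI)
        have "emeasure (q n) (space (q n)) = ennreal (c' n)"
          by (simp add: emeasure_eq_measure c'_def qsp)
        then show "emeasure (density (q n) (\<lambda>_. ennreal (1 / c' n))) (space (density (q n) (\<lambda>_. ennreal (1 / c' n)))) = 1"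
          using c'pos[of n] by (simp add: emeasure_density nn_integral_cmult_indicator flip: ennreal_mult')
      qed
      then show ?thesis
        unfolding \<mu>_def using smeas by (intro prob_space.prob_space_distr) simp_all
    qed
    have rd: "real_distribution (\<mu> n)" for n
      using prob by (simp add: real_distribution_def real_distribution_axioms_def \<mu>_def)
    have full: "measure (\<mu> n) {-1<..1} = 1" for n
    proof -
      interpret prob_space "\<mu> n" by (rule prob)
      have "AE t in \<mu> n. t \<in> {-1<..1}"
        unfolding \<mu>_def
      proof (subst AE_distr_iff)
        show "AE x in density (q n) (\<lambda>_. ennreal (1 / c' n)). schoenberg_section x \<in> {-1<..1}"
        proof (rule AE_I2)
          fix x :: "real ^ 'n"
          show "schoenberg_section x \<in> {-1<..1}"
            using schoenberg_section_bounds[of x] by simp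
        qed
      qed (use smeas in auto)
      then show ?thesis by (subst prob_eq_1) (auto simp: \<mu>_def)
    qed
    have "tight \<mu>"
      unfolding tight_def using rd full by (intro conjI allI impI exI[of _ "-1"] exI[of _ 1]) auto
    then obtain r M where r: "strict_mono (r :: nat \<Rightarrow> nat)" and M: "real_distribution M" and conv: "weak_conv_m (\<mu> \<circ> id \<circ> r) M"
      using tight_imp_convergent_subsubsequence[of \<mu> id] strict_mono_id by blast
    interpret M: real_distribution M by fact
    have gmeas: "schoenberg \<in> measurable M (borel :: (real ^ 'n) measure)"
      unfolding measurable_cong_sets[OF M.events_eq_borel refl]
      by (rule borel_measurable_continuous_onI[OF continuous_schoenberg])
    define P where "P = density (restrict_space (distr M borel schoenberg) cube) (\<lambda>_ :: real ^ 'n. ennreal c)"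
    have Pset: "sets P = sets borelQ"
      unfolding P_def borelQ_def sets_density by (rule sets_restrict_space_cong) simp
    have P0: "finite_measure (restrict_space (distr M borel schoenberg) (cube :: (real ^ 'n) set))"
      using gmeas by (intro finite_measure_restrict_space M.finite_measure_distr) auto
    have Pfin: "finite_measure P"
    proof (rule finite_measureI)
      interpret P0: finite_measure "restrict_space (distr M borel schoenberg) (cube :: (real ^ 'n) set)" by (rule P0)
      show "emeasure P (space P) \<noteq> \<infinity>"
        unfolding P_def space_density emeasure_density_const[OF sets.top]
        using P0.emeasure_finite by (simp only: ennreal_mult_eq_top_iff infinity_ennreal_def) simp
    qed
    define r' where "r' n = r0 (r n + N)" for n
    show ?thesis
    proof (rule that[of r' P])
      show "strict_mono r'"
        using r0 r by (simp add: r'_def strict_mono_def)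
      fix \<phi> :: "real ^ 'n \<Rightarrow> real" assume \<phi>: "\<phi> \<in> test_fun"
      obtain K where K: "\<And>x. \<bar>\<phi> x\<bar> \<le> K" using test_fun_bounded[OF \<phi>] by blast
      define h where "h t = \<phi> (schoenberg t)" for t
      have hcont: "isCont h t" for t
        unfolding h_def
        using continuous_on_compose2[OF test_fun_continuous[OF \<phi>, of UNIV] continuous_schoenberg]
        by (auto simp: continuous_on_eq_continuous_at)
      have hmeas: "h \<in> borel_measurable borel"
        by (intro borel_measurable_continuous_onI continuous_at_imp_continuous_on ballI hcont)
      have \<mu>h: "(LINT t|\<mu> n. h t) = (LINT x|q n. \<phi> x) / c' n" for n
      proof -
        have "(LINT t|\<mu> n. h t) = (LINT x|density (q n) (\<lambda>_. ennreal (1 / c' n)). h (schoenberg_section x))"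
          unfolding \<mu>_def using smeas hmeas by (intro integral_distr) simp_all
        also have "\<dots> = (LINT x|q n. (1 / c' n) *\<^sub>R h (schoenberg_section x))"
          using smeas hmeas c'pos[of n] by (intro integral_density) (auto intro!: measurable_compose[OF smeas hmeas])
        also have "\<dots> = (LINT x|q n. \<phi> x / c' n)"
          by (rule Bochner_Integration.integral_cong) (auto simp: h_def qsp schoenberg_section)
        finally show ?thesis by simp
      qed
      have "(\<lambda>n. LINT t|(\<mu> \<circ> id \<circ> r) n. h t) \<longlonglongrightarrow> (LINT t|M. h t)"
      proof (rule weak_conv_imp_integral_bdd_continuous_conv[OF _ M conv hcont])
        show "real_distribution ((\<mu> \<circ> id \<circ> r) n)" for n by (simp add: rd)
        show "norm (h t) \<le> K" for t by (simp add: h_def K)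
      qed
      then have "(\<lambda>n. c' (r n) * (LINT t|\<mu> (r n). h t)) \<longlonglongrightarrow> c * (LINT t|M. h t)"
        using LIMSEQ_subseq_LIMSEQ[OF c'lim r] by (intro tendsto_mult) (simp_all add: o_def)
      moreover have "c' (r n) * (LINT t|\<mu> (r n). h t) = (LINT x|p (r' n). \<phi> x)" for n
        using c'pos[of "r n"] by (simp add: \<mu>h q_def r'_def)
      moreover have "c * (LINT t|M. h t) = (LINT x|P. \<phi> x)"
      proof -
        have \<phi>m: "\<phi> \<in> borel_measurable (restrict_space (distr M borel schoenberg) cube)"
          using test_fun_borel[OF \<phi>] by (intro measurable_restrict_space1) simp
        have "(LINT x|P. \<phi> x) = (LINT x|restrict_space (distr M borel schoenberg) cube. c *\<^sub>R \<phi> x)"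
          unfolding P_def using \<phi>m \<open>0 < c\<close> by (intro integral_density) auto
        also have "\<dots> = c * (LINT x|restrict_space (distr M borel schoenberg) cube. \<phi> x)" by simp
        also have "(LINT x|restrict_space (distr M borel schoenberg) cube. \<phi> x)
            = (LINT x|distr M borel schoenberg. indicat_real cube x *\<^sub>R \<phi> x)"
          by (rule integral_restrict_space) simp
        also have "\<dots> = (LINT x|distr M borel schoenberg. \<phi> x)"
          using test_fun_outside[OF \<phi>] by (intro Bochner_Integration.integral_cong) (auto simp: indicator_def)
        also have "\<dots> = (LINT t|M. h t)"
          unfolding h_def using gmeas test_fun_borel[OF \<phi>] by (intro integral_distr) auto
        finally show ?thesis by simp
      qed
      ultimately show "(\<lambda>n. LINT x|p (r' n). \<phi> x) \<longlonglongrightarrow> (LINT x|P. \<phi> x)" by simp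
    qed (use Pset Pfin in auto)
  qed
qed

text \<open>
  Weak compactness is applied to the positive and to the negative variations, along a common subsequence;
  as the integrals converge by assumption, the subsequence determines their limit.
\<close>

lemma signed_weakly_compact:
  fixes m :: "nat \<Rightarrow> (real ^ 'n::finite) set \<Rightarrow> real"
  assumes m: "\<And>n. signed (m n)"
    and bound: "\<And>n A. A \<in> sets borelQ \<Longrightarrow> \<bar>m n A\<bar> \<le> C"
    and lim: "\<And>\<phi>. \<phi> \<in> test_fun \<Longrightarrow> (\<lambda>n. signed_integral (m n) \<phi>) \<longlonglongrightarrow> T \<phi>"
  shows "\<exists>m'. signed m' \<and> (\<forall>\<phi>\<in>test_fun. signed_integral m' \<phi> = T \<phi>)"
proof -
  have b: "measure (pos_variation (m n)) cube \<le> C" "measure (pos_variation (\<lambda>A. - m n A)) cube \<le> C" for n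
    using bound[of _ n] by (auto intro!: pos_variation_le m signed_uminus simp: abs_le_iff)
  obtain r P where P: "strict_mono r" "finite_measure P" "sets P = sets borelQ"
    "\<And>\<phi>. \<phi> \<in> test_fun \<Longrightarrow> (\<lambda>n. LINT x|pos_variation (m (r n)). \<phi> x) \<longlonglongrightarrow> (LINT x|P. \<phi> x)"
    using cube_measures_weakly_compact[of "\<lambda>n. pos_variation (m n)" C]
      finite_pos_variation[OF m] b(1) sets_pos_variation by metis
  obtain s Q where Q: "strict_mono s" "finite_measure Q" "sets Q = sets borelQ"
    "\<And>\<phi>. \<phi> \<in> test_fun \<Longrightarrow> (\<lambda>n. LINT x|pos_variation (\<lambda>A. - m (r (s n)) A). \<phi> x) \<longlonglongrightarrow> (LINT x|Q. \<phi> x)"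
    using cube_measures_weakly_compact[of "\<lambda>n. pos_variation (\<lambda>A. - m (r n) A)" C]
      finite_pos_variation[OF signed_uminus[OF m]] b(2) sets_pos_variation by metis
  define m' where "m' A = 1 * measure P A + (-1) * measure Q A" for A
  have m': "signed m'"
    unfolding m'_def by (intro signed_combination signed_measure P Q)
  have "signed_integral m' \<phi> = T \<phi>" if \<phi>: "\<phi> \<in> test_fun" for \<phi>
  proof -
    have "signed_integral m' \<phi> = (LINT x|P. \<phi> x) - (LINT x|Q. \<phi> x)"
      by (rule signed_integral_eq[OF m' P(2,3) Q(2,3) _ \<phi>]) (simp add: m'_def)
    moreover have "(\<lambda>n. signed_integral (m (r (s n))) \<phi>) \<longlonglongrightarrow> (LINT x|P. \<phi> x) - (LINT x|Q. \<phi> x)"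
      unfolding signed_integral_def
      using LIMSEQ_subseq_LIMSEQ[OF P(4)[OF \<phi>] Q(1)] Q(4)[OF \<phi>]
      by (intro tendsto_diff) (simp_all add: o_def)
    moreover have "(\<lambda>n. signed_integral (m (r (s n))) \<phi>) \<longlonglongrightarrow> T \<phi>"
      using LIMSEQ_subseq_LIMSEQ[OF lim[OF \<phi>] strict_mono_o[OF P(1) Q(1)]] by (simp add: o_def)
    ultimately show ?thesis using LIMSEQ_unique by metis
  qed
  with m' show ?thesis by blast
qed

lemma tnorm_le_total_variation:
  fixes \<mu> :: "'n::finite tmeas"
  assumes \<mu>: "\<mu> \<in> Mb l" and A: "A \<in> sets borelQ"
  shows "ennreal (tnorm l (\<mu> A)) \<le> total_variation l \<mu>"
proof (cases "A = {}")
  case True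
  have "\<mu> {} J = 0" if "J \<in> tidx l" for J
    using \<mu> that signed_empty[of "\<lambda>A. \<mu> A J"] by (simp add: Mb_iff_signed)
  then have "tnorm l (\<mu> {}) = 0" by (simp add: tnorm_def)
  then show ?thesis using True by simp
next
  case False
  let ?P = "{A, cube - A} - {{}}"
  have "A \<subseteq> cube" using A by (simp add: sets_borelQ)
  have "partition_on cube ?P"
    using \<open>A \<subseteq> cube\<close> by (intro partition_onI) (auto simp: disjnt_def)
  moreover have "?P \<subseteq> sets borelQ" using A sets.compl_sets[OF A] by auto
  ultimately have "(\<Sum>A\<in>?P. ennreal (tnorm l (\<mu> A))) \<le> total_variation l \<mu>"
    unfolding total_variation_def by (intro SUP_upper) auto
  moreover have "ennreal (tnorm l (\<mu> A)) \<le> (\<Sum>A\<in>?P. ennreal (tnorm l (\<mu> A)))"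
    using False by (intro member_le_sum) auto
  ultimately show ?thesis by (rule order_trans[rotated])
qed

theorem Mb_weakly_compact:
  fixes \<mu> :: "nat \<Rightarrow> 'n::finite tmeas"
  assumes \<mu>: "\<And>n. \<mu> n \<in> Mb l" and bound: "\<And>n. total_variation l (\<mu> n) \<le> ennreal C"
    and lim: "\<And>J \<phi>. J \<in> tidx l \<Longrightarrow> \<phi> \<in> test_fun \<Longrightarrow> (\<lambda>n. signed_integral (\<lambda>A. \<mu> n A J) \<phi>) \<longlonglongrightarrow> T J \<phi>"
  shows "\<exists>\<mu>'\<in>Mb l. \<forall>J\<in>tidx l. \<forall>\<phi>\<in>test_fun. signed_integral (\<lambda>A. \<mu>' A J) \<phi> = T J \<phi>"
proof -
  have "\<exists>m'. signed m' \<and> (\<forall>\<phi>\<in>test_fun. signed_integral m' \<phi> = T J \<phi>)" if J: "J \<in> tidx l" for J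
  proof (rule signed_weakly_compact[of "\<lambda>n A. \<mu> n A J" "max C 0"])
    show "signed (\<lambda>A. \<mu> n A J)" for n using \<mu> J by (simp add: Mb_iff_signed)
    fix n and A :: "(real ^ 'n) set" assume A: "A \<in> sets borelQ"
    have "ennreal (tnorm l (\<mu> n A)) \<le> ennreal C"
      using tnorm_le_total_variation[OF \<mu> A] bound by (rule order_trans)
    then have "tnorm l (\<mu> n A) \<le> max C 0" by (auto simp: ennreal_le_iff2)
    then show "\<bar>\<mu> n A J\<bar> \<le> max C 0" using abs_le_tnorm[OF J, of "\<mu> n A"] by simp
  qed (rule lim[OF J])
  then obtain m' where "\<And>J. J \<in> tidx l \<Longrightarrow> signed (m' J)"
    "\<And>J \<phi>. J \<in> tidx l \<Longrightarrow> \<phi> \<in> test_fun \<Longrightarrow> signed_integral (m' J) \<phi> = T J \<phi>"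
    by metis
  then show ?thesis
    by (intro bexI[of _ "\<lambda>A J. m' J A"]) (auto simp: Mb_iff_signed)
qed

section \<open>Integrable densities\<close>

abbreviation lebQ :: "(real ^ 'n::finite) measure" where
  "lebQ \<equiv> lebesgue_on cube"

lemma cube_lmeasurable: "cube \<in> lmeasurable"
  by (simp add: cube_eq_box)

lemma finite_lebQ: "finite_measure (lebQ :: (real ^ 'n::finite) measure)"
  by (rule finite_measure_lebesgue_on[OF cube_lmeasurable])

lemma space_lebQ [simp]: "space lebQ = cube"
  by (simp add: space_restrict_space)

lemma cube_sets_lebesgue: "cube \<in> sets lebesgue"
  using cube_lmeasurable by (rule fmeasurableD)

lemma borelQ_subset_lebQ: "A \<in> sets borelQ \<Longrightarrow> A \<in> sets lebQ"
  by (auto simp: sets_borelQ sets_restrict_space_iff cube_sets_lebesgue)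

lemma borel_measurable_lebQ: "f \<in> borel_measurable borel \<Longrightarrow> f \<in> borel_measurable lebQ"
  by (intro measurable_restrict_space1) (simp add: measurable_completion)

lemma test_fun_lebQ: "\<phi> \<in> test_fun \<Longrightarrow> \<phi> \<in> borel_measurable lebQ"
  by (intro borel_measurable_lebQ test_fun_borel)

lemma integrable_mult_bounded:
  assumes f: "integrable M f" and \<phi>: "\<phi> \<in> borel_measurable M" "\<And>x. \<bar>\<phi> x\<bar> \<le> (K::real)"
  shows "integrable M (\<lambda>x. f x * \<phi> x)"
proof (rule Bochner_Integration.integrable_bound)
  show "integrable M (\<lambda>x. K * f x)" using f by simp
  show "(\<lambda>x. f x * \<phi> x) \<in> borel_measurable M" using f \<phi> by auto
  have "0 \<le> K" using \<phi>(2)[of undefined] by simp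
  then show "AE x in M. norm (f x * \<phi> x) \<le> norm (K * f x)"
    using \<phi>(2) by (auto simp: abs_mult mult.commute[of K] intro!: mult_left_mono)
qed

lemma integrable_mult_test_fun:
  assumes "integrable lebQ f" "\<phi> \<in> test_fun"
  shows "integrable lebQ (\<lambda>x. f x * \<phi> x)"
  using test_fun_bounded[OF assms(2)] integrable_mult_bounded[OF assms(1) test_fun_lebQ[OF assms(2)]]
  by metis

lemma integral_mult_bound:
  fixes f :: "'a \<Rightarrow> real"
  assumes f: "integrable M f" and \<phi>: "\<phi> \<in> borel_measurable M" "\<And>x. \<bar>\<phi> x\<bar> \<le> K"
  shows "\<bar>LINT x|M. f x * \<phi> x\<bar> \<le> K * (LINT x|M. \<bar>f x\<bar>)"
proof -
  have "\<bar>LINT x|M. f x * \<phi> x\<bar> \<le> (LINT x|M. \<bar>f x * \<phi> x\<bar>)" by (rule integral_abs_bound)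
  also have "\<dots> \<le> (LINT x|M. K * \<bar>f x\<bar>)"
    using integrable_mult_bounded[OF f \<phi>] f \<phi>(2)
    by (intro integral_mono integrable_abs integrable_mult_right)
      (auto simp: abs_mult mult.commute[of K] intro!: mult_left_mono)
  finally show ?thesis by simp
qed

text \<open>
  The positive part of the measure with density \<open>f\<close>, built as a measure on the Borel sets although \<open>f\<close> is
  only Lebesgue measurable.
\<close>

lemma density_part:
  assumes f: "integrable lebQ f"
  defines "P \<equiv> distr (density lebQ (\<lambda>x. ennreal (f x))) borelQ (\<lambda>x. x)"
  shows "finite_measure P" "sets P = sets borelQ"
    "A \<in> sets borelQ \<Longrightarrow> measure P A = (LINT x|lebQ. max 0 (f x) * indicat_real A x)"
    "\<phi> \<in> test_fun \<Longrightarrow> (LINT x|P. \<phi> x) = (LINT x|lebQ. max 0 (f x) * \<phi> x)"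
proof -
  have fm: "f \<in> borel_measurable lebQ" using f by auto
  have id: "(\<lambda>x. x) \<in> measurable lebQ borelQ"
    by (rule measurableI) (auto intro: borelQ_subset_lebQ dest: sets.sets_into_space simp: Int_absorb2 vimage_def)
  have ep: "ennreal (f x) = ennreal (max 0 (f x))" for x by (cases "0 \<le> f x") (simp_all add: ennreal_neg max_def)
  have pf: "integrable lebQ (\<lambda>x. max 0 (f x))" using f by auto
  show sets: "sets P = sets borelQ" by (simp add: P_def)
  have em: "emeasure P A = ennreal (LINT x|lebQ. max 0 (f x) * indicat_real A x)" if A: "A \<in> sets borelQ" for A
  proof -
    have "emeasure P A = emeasure (density lebQ (\<lambda>x. ennreal (f x))) A"
      using A id sets.sets_into_space[OF A] unfolding P_def by (subst emeasure_distr) (auto simp: Int_absorb2 vimage_def)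
    also have "\<dots> = (\<integral>\<^sup>+x. ennreal (f x) * indicator A x \<partial>lebQ)"
      using fm borelQ_subset_lebQ[OF A] by (intro emeasure_density) auto
    also have "\<dots> = (\<integral>\<^sup>+x. ennreal (max 0 (f x) * indicat_real A x) \<partial>lebQ)"
      by (intro nn_integral_cong) (simp add: ep ennreal_mult' ennreal_indicator)
    also have "\<dots> = ennreal (LINT x|lebQ. max 0 (f x) * indicat_real A x)"
      using pf borelQ_subset_lebQ[OF A] by (intro nn_integral_eq_integral integrable_real_mult_indicator) auto
    finally show ?thesis .
  qed
  have sp: "space P = cube" by (simp add: P_def)
  show "finite_measure P"
    by (rule finite_measureI) (simp add: sp em)
  show "measure P A = (LINT x|lebQ. max 0 (f x) * indicat_real A x)" if A: "A \<in> sets borelQ"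
    unfolding measure_def em[OF A] by (simp add: integral_nonneg_AE)
  show "(LINT x|P. \<phi> x) = (LINT x|lebQ. max 0 (f x) * \<phi> x)" if \<phi>: "\<phi> \<in> test_fun"
  proof -
    have "(LINT x|P. \<phi> x) = (LINT x|density lebQ (\<lambda>x. ennreal (max 0 (f x))). \<phi> x)"
      unfolding P_def ep using id test_fun_borelQ[OF \<phi>] by (intro integral_distr) simp_all
    also have "\<dots> = (LINT x|lebQ. max 0 (f x) *\<^sub>R \<phi> x)"
      using fm test_fun_lebQ[OF \<phi>] by (intro integral_density) auto
    finally show ?thesis by simp
  qed
qed

lemma
  assumes f: "integrable lebQ f"
  shows signed_density: "signed (\<lambda>A. LINT x:A|lebesgue. f x)"
    and signed_integral_density: "\<phi> \<in> test_fun \<Longrightarrow>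
      signed_integral (\<lambda>A. LINT x:A|lebesgue. f x) \<phi> = (LINT x|lebQ. f x * \<phi> x)"
proof -
  let ?P = "distr (density lebQ (\<lambda>x. ennreal (f x))) borelQ (\<lambda>x. x)"
  let ?R = "distr (density lebQ (\<lambda>x. ennreal (- f x))) borelQ (\<lambda>x. x)"
  have f': "integrable lebQ (\<lambda>x. - f x)" using f by simp
  note P = density_part[OF f] and R = density_part[OF f']
  have split: "(LINT x|lebQ. max 0 (f x) * \<phi> x) - (LINT x|lebQ. max 0 (- f x) * \<phi> x) = (LINT x|lebQ. f x * \<phi> x)"
    if "\<phi> \<in> borel_measurable lebQ" "\<And>x. \<bar>\<phi> x\<bar> \<le> K" for \<phi> K
  proof -
    have "integrable lebQ (\<lambda>x. max 0 (f x) * \<phi> x)" "integrable lebQ (\<lambda>x. max 0 (- f x) * \<phi> x)"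
      using f that by (auto intro!: integrable_mult_bounded)
    then have "(LINT x|lebQ. max 0 (f x) * \<phi> x) - (LINT x|lebQ. max 0 (- f x) * \<phi> x)
        = (LINT x|lebQ. max 0 (f x) * \<phi> x - max 0 (- f x) * \<phi> x)"
      by (rule Bochner_Integration.integral_diff[symmetric])
    also have "\<dots> = (LINT x|lebQ. f x * \<phi> x)"
      by (intro Bochner_Integration.integral_cong) (auto simp: max_def)
    finally show ?thesis .
  qed
  have eq: "(LINT x:A|lebesgue. f x) = measure ?P A - measure ?R A" if A: "A \<in> sets borelQ" for A
  proof -
    have "A \<subseteq> cube" using A by (simp add: sets_borelQ)
    have "(LINT x:A|lebesgue. f x) = (LINT x|lebesgue. indicat_real cube x *\<^sub>R (f x * indicat_real A x))"
      unfolding set_lebesgue_integral_def using \<open>A \<subseteq> cube\<close>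
      by (intro Bochner_Integration.integral_cong) (auto simp: indicator_def)
    also have "\<dots> = (LINT x|lebQ. f x * indicat_real A x)"
      using cube_sets_lebesgue by (intro integral_restrict_space[symmetric]) simp
    also have "\<dots> = measure ?P A - measure ?R A"
      unfolding P(3)[OF A] R(3)[OF A]
      using borelQ_subset_lebQ[OF A] by (intro split[symmetric, of _ 1]) (auto simp: indicator_def)
    finally show ?thesis .
  qed
  have c: "signed (\<lambda>A. 1 * measure ?P A + (-1) * measure ?R A)"
    by (intro signed_combination signed_measure P R)
  show s: "signed (\<lambda>A. LINT x:A|lebesgue. f x)"
    unfolding signed_def
  proof (intro allI impI)
    fix A :: "nat \<Rightarrow> (real ^ 'a) set"
    assume A: "range A \<subseteq> sets borelQ" "disjoint_family A"
    then have "(\<lambda>n. measure ?P (A n) - measure ?R (A n)) sums (measure ?P (\<Union>n. A n) - measure ?R (\<Union>n. A n))"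
      using signed_sums[OF c, of A] by auto
    moreover have "(\<Union>n. A n) \<in> sets borelQ" using A by auto
    ultimately show "(\<lambda>n. LINT x:A n|lebesgue. f x) sums (LINT x:(\<Union>n. A n)|lebesgue. f x)"
      using A(1) by (simp add: eq subset_eq)
  qed
  show "signed_integral (\<lambda>A. LINT x:A|lebesgue. f x) \<phi> = (LINT x|lebQ. f x * \<phi> x)" if \<phi>: "\<phi> \<in> test_fun"
  proof -
    obtain K where K: "\<And>x. \<bar>\<phi> x\<bar> \<le> K" using test_fun_bounded[OF \<phi>] by blast
    have "signed_integral (\<lambda>A. LINT x:A|lebesgue. f x) \<phi> = (LINT x|?P. \<phi> x) - (LINT x|?R. \<phi> x)"
      by (rule signed_integral_eq[OF s P(1,2) R(1,2) eq \<phi>])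
    also have "\<dots> = (LINT x|lebQ. f x * \<phi> x)"
      unfolding P(4)[OF \<phi>] R(4)[OF \<phi>] by (rule split[OF test_fun_lebQ[OF \<phi>] K])
    finally show ?thesis .
  qed
qed

text \<open>
  Borel functions can be translated, dilated and integrated with Fubini's theorem for the Borel-Lebesgue
  measure, whereas the entries of members of \<open>L1\<close> are only Lebesgue measurable.
\<close>

lemma borel_representative:
  assumes f: "integrable lebQ f"
  shows "\<exists>f'. f' \<in> borel_measurable borel \<and> integrable lborel f' \<and> (\<forall>x. x \<notin> cube \<longrightarrow> f' x = (0::real)) \<and>
    (AE x in lebesgue. x \<in> cube \<longrightarrow> f x = f' x) \<and>
    (\<forall>\<phi>\<in>borel_measurable borel. (LINT x|lebQ. f x * \<phi> x) = (LINT x|lborel. f' x * \<phi> x))"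
proof -
  let ?g = "\<lambda>x. indicat_real cube x *\<^sub>R f x"
  have g: "integrable lebesgue ?g"
    using f cube_sets_lebesgue by (simp add: integrable_restrict_space)
  then obtain h where h: "h \<in> borel_measurable lborel" "AE x in lborel. ?g x = h x"
    using completion_ex_borel_measurable_real[of ?g lborel] by auto
  define f' where "f' x = indicat_real cube x * h x" for x
  have m: "f' \<in> borel_measurable borel" using h unfolding f'_def[abs_def] by simp
  have ae: "AE x in lborel. ?g x = f' x" using h(2) by eventually_elim (auto simp: f'_def indicator_def)
  then have ae': "AE x in lebesgue. ?g x = f' x" by (rule AE_completion)
  have ml: "f' \<in> borel_measurable lebesgue" using m by (simp add: measurable_completion)
  have "integrable lebesgue f'"
    using integrable_cong_AE_imp[OF g ml] ae' by (auto simp: eq_commute)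
  then have i: "integrable lborel f'" using m by (simp add: integrable_completion)
  have int: "(LINT x|lebQ. f x * \<phi> x) = (LINT x|lborel. f' x * \<phi> x)" if \<phi>: "\<phi> \<in> borel_measurable borel" for \<phi>
  proof -
    have "(LINT x|lebQ. f x * \<phi> x) = (LINT x|lebesgue. indicat_real cube x *\<^sub>R (f x * \<phi> x))"
      using cube_sets_lebesgue by (intro integral_restrict_space) simp
    also have "\<dots> = (LINT x|lebesgue. f' x * \<phi> x)"
    proof (rule integral_cong_AE)
      show "(\<lambda>x. indicat_real cube x *\<^sub>R (f x * \<phi> x)) \<in> borel_measurable lebesgue"
        using borel_measurable_times[OF borel_measurable_integrable[OF g] measurable_completion[of \<phi> lborel borel]] \<phi>
        by (simp add: mult.assoc)
      show "(\<lambda>x. f' x * \<phi> x) \<in> borel_measurable lebesgue"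
        using m \<phi> by (simp add: measurable_completion)
      show "AE x in lebesgue. indicat_real cube x *\<^sub>R (f x * \<phi> x) = f' x * \<phi> x"
        using ae' by eventually_elim (auto simp: indicator_def split: if_splits)
    qed
    also have "\<dots> = (LINT x|lborel. f' x * \<phi> x)"
      using m \<phi> by (intro integral_completion) simp
    finally show ?thesis .
  qed
  show ?thesis
  proof (intro exI[of _ f'] conjI m i ballI int allI impI)
    show "f' x = 0" if "x \<notin> cube" for x using that by (simp add: f'_def)
    show "AE x in lebesgue. x \<in> cube \<longrightarrow> f x = f' x"
      using ae' by eventually_elim (auto simp: indicator_def)
  qed
qed

lemma AE_lebQ_iff: "(AE x in lebQ. P x) \<longleftrightarrow> (AE x in lebesgue. x \<in> cube \<longrightarrow> P x)"
  using cube_sets_lebesgue by (subst AE_restrict_space_iff) auto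

lemma AE_eq_0_of_bumps:
  assumes f: "integrable lebQ f" and zero: "\<And>\<phi>. \<phi> \<in> bumps \<Longrightarrow> (LINT x|lebQ. f x * \<phi> x) = 0"
  shows "AE x in lebQ. f x = 0"
proof -
  from borel_representative[OF f] obtain f' where f': "f' \<in> borel_measurable borel" "integrable lborel f'"
    "\<forall>x. x \<notin> cube \<longrightarrow> f' x = 0" "AE x in lebesgue. x \<in> cube \<longrightarrow> f x = f' x"
    "\<forall>\<phi>\<in>borel_measurable borel. (LINT x|lebQ. f x * \<phi> x) = (LINT x|lborel. f' x * \<phi> x)"
    by (elim exE conjE)
  let ?m = "\<lambda>A. LINT x:A|lebesgue. f x"
  have m0: "?m A = 0" if "A \<in> sets borelQ" for A
    using signed_eq_0_of_bumps[OF signed_density[OF f] _ that]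
      signed_integral_density[OF f bumps_test_fun] zero by simp
  have "AE x in lborel. f' x = 0"
  proof (rule density_unique_real[OF f'(2)])
    show "integrable lborel (\<lambda>x. 0 :: real)" by simp
    fix A :: "(real ^ 'a) set" assume A: "A \<in> sets lborel"
    then have AQ: "A \<inter> cube \<in> sets borelQ" by (auto simp: sets_borelQ)
    have "set_lebesgue_integral lborel A f' = (LINT x|lborel. f' x * indicat_real A x)"
      by (simp add: set_lebesgue_integral_def mult.commute)
    also have "\<dots> = (LINT x|lebQ. f x * indicat_real A x)"
      using A by (intro f'(5)[rule_format, symmetric]) simp
    also have "\<dots> = (LINT x|lebesgue. indicat_real cube x *\<^sub>R (f x * indicat_real A x))"
      using cube_sets_lebesgue by (intro integral_restrict_space) simp
    also have "\<dots> = ?m (A \<inter> cube)"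
      unfolding set_lebesgue_integral_def
      by (intro Bochner_Integration.integral_cong) (auto simp: indicator_def)
    finally show "set_lebesgue_integral lborel A f' = set_lebesgue_integral lborel A (\<lambda>x. 0)"
      using m0[OF AQ] by simp
  qed
  then have "AE x in lebesgue. f' x = 0" by (rule AE_completion)
  with f'(4) show ?thesis
    unfolding AE_lebQ_iff by eventually_elim auto
qed

section \<open>The defect of a pair of fields\<close>

lemma L1D: "v \<in> L1 l \<Longrightarrow> I \<in> tidx l \<Longrightarrow> integrable lebQ (\<lambda>x. v x I)"
  by (simp add: L1_def)

lemma L1_combination: "v \<in> L1 l \<Longrightarrow> w \<in> L1 l \<Longrightarrow> (\<lambda>x I. s * v x I + t * w x I) \<in> L1 l"
  by (simp add: L1_def)

definition L1_conv :: "nat \<Rightarrow> (nat \<Rightarrow> 'n::finite tfun) \<Rightarrow> 'n tfun \<Rightarrow> bool" where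
  "L1_conv l v w \<longleftrightarrow> (\<forall>I\<in>tidx l. (\<lambda>n. LINT x|lebQ. \<bar>v n x I - w x I\<bar>) \<longlonglongrightarrow> 0)"

text \<open>
  Pointwise convergence of the coefficients; for operators it is the convergence in
  \<open>\<ell>\<^sup>\<infinity>\<close>, as there are finitely many coefficients that may differ from 0.
\<close>

definition coef_conv :: "(nat \<Rightarrow> 'n oper) \<Rightarrow> 'n oper \<Rightarrow> bool" where
  "coef_conv An A \<longleftrightarrow> (\<forall>i J I. (\<lambda>n. An n i J I) \<longlonglongrightarrow> A i J I)"

lemma L1_conv_const: "L1_conv l (\<lambda>n. v) v"
  by (simp add: L1_conv_def)

lemma coef_conv_const: "coef_conv (\<lambda>n. A) A"
  by (simp add: coef_conv_def)

lemma L1_conv_subseq: "L1_conv l v w \<Longrightarrow> strict_mono r \<Longrightarrow> L1_conv l (v \<circ> r) w"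
  unfolding L1_conv_def by (intro ballI) (drule (1) bspec, drule (1) LIMSEQ_subseq_LIMSEQ, simp add: o_def)

lemma coef_conv_subseq: "coef_conv v w \<Longrightarrow> strict_mono r \<Longrightarrow> coef_conv (v \<circ> r) w"
  unfolding coef_conv_def
  by (intro allI) (drule spec, drule spec, drule spec, drule (1) LIMSEQ_subseq_LIMSEQ, simp add: o_def)

lemma tendsto_integral_mult:
  assumes v: "\<And>n. integrable lebQ (v n)" and w: "integrable lebQ w"
    and conv: "(\<lambda>n. LINT x|lebQ. \<bar>v n x - w x\<bar>) \<longlonglongrightarrow> 0" and \<phi>: "\<phi> \<in> test_fun"
  shows "(\<lambda>n. LINT x|lebQ. v n x * \<phi> x) \<longlonglongrightarrow> (LINT x|lebQ. w x * \<phi> x)"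
proof -
  obtain K where K: "\<And>x. \<bar>\<phi> x\<bar> \<le> K" using test_fun_bounded[OF \<phi>] by blast
  have "(\<lambda>n. (LINT x|lebQ. v n x * \<phi> x) - (LINT x|lebQ. w x * \<phi> x)) \<longlonglongrightarrow> 0"
  proof (rule Lim_null_comparison)
    show "(\<lambda>n. K * (LINT x|lebQ. \<bar>v n x - w x\<bar>)) \<longlonglongrightarrow> 0" using tendsto_mult_right_zero[OF conv] .
    have "norm ((LINT x|lebQ. v n x * \<phi> x) - (LINT x|lebQ. w x * \<phi> x)) \<le> K * (LINT x|lebQ. \<bar>v n x - w x\<bar>)" for n
    proof -
      have "(LINT x|lebQ. v n x * \<phi> x) - (LINT x|lebQ. w x * \<phi> x) = (LINT x|lebQ. (v n x - w x) * \<phi> x)"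
        using v[of n] w \<phi> by (simp add: left_diff_distrib integrable_mult_test_fun)
      then show ?thesis
        using integral_mult_bound[of lebQ "\<lambda>x. v n x - w x" \<phi> K] v[of n] w test_fun_lebQ[OF \<phi>] K by simp
    qed
    then show "\<forall>\<^sub>F n in sequentially. norm ((LINT x|lebQ. v n x * \<phi> x) - (LINT x|lebQ. w x * \<phi> x))
        \<le> K * (LINT x|lebQ. \<bar>v n x - w x\<bar>)" by simp
  qed
  then show ?thesis by (rule LIM_zero_cancel)
qed

lemma tendsto_dist_op:
  assumes v: "\<And>n. v n \<in> L1 l" and w: "w \<in> L1 l" and conv: "L1_conv l v w" and A: "coef_conv An A"
    and \<phi>: "\<phi> \<in> test_fun"
  shows "(\<lambda>n. dist_op l (An n) (v n) J \<phi>) \<longlonglongrightarrow> dist_op l A w J \<phi>"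
  unfolding dist_op_def
  using conv A v w unfolding coef_conv_def L1_conv_def
  by (intro tendsto_minus tendsto_sum tendsto_mult tendsto_integral_mult test_fun_pd \<phi>) (auto intro: L1D[OF assms(1)] L1D[OF assms(2)])

lemma dist_op_combination:
  assumes v: "v \<in> L1 l" and w: "w \<in> L1 l" and \<phi>: "\<phi> \<in> test_fun"
  shows "dist_op l A (\<lambda>x I. s * v x I + t * w x I) J \<phi> = s * dist_op l A v J \<phi> + t * dist_op l A w J \<phi>"
proof -
  have "(LINT x|lebQ. (s * v x I + t * w x I) * pd i \<phi> x) =
      s * (LINT x|lebQ. v x I * pd i \<phi> x) + t * (LINT x|lebQ. w x I * pd i \<phi> x)" if "I \<in> tidx l" for I i
    using integrable_mult_test_fun[OF L1D[OF v that] test_fun_pd[OF \<phi>, of i]]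
      integrable_mult_test_fun[OF L1D[OF w that] test_fun_pd[OF \<phi>, of i]]
    by (simp add: distrib_right mult.assoc)
  then show ?thesis
    by (simp add: dist_op_def sum.distrib sum_distrib_left sum_negf algebra_simps)
qed

text \<open>
  The pairing \<open>\<langle>A w - f, \<Phi>\<rangle>\<close> in the sense of distributions.
\<close>

definition defect_pair :: "nat \<Rightarrow> 'n::finite oper \<Rightarrow> 'n tfun \<Rightarrow> 'n tfun \<Rightarrow> ('n list \<Rightarrow> real ^ 'n \<Rightarrow> real) \<Rightarrow> real" where
  "defect_pair l A w f \<Phi> = (\<Sum>J\<in>tidx (Suc l). dist_op l A w J (\<Phi> J) - (LINT x|lebQ. f x J * \<Phi> J x))"

text \<open>
  The total variation of \<open>A w - f\<close>, infinite if this distribution is not a measure. As a supremum of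
  functionals that are linear in \<open>(w, f)\<close> and continuous in \<open>(A, w, f)\<close> it is convex and lower
  semicontinuous, with no reference to the space \<open>BVB\<close> of the operator.
\<close>

definition defect :: "nat \<Rightarrow> 'n::finite oper \<Rightarrow> 'n tfun \<Rightarrow> 'n tfun \<Rightarrow> ennreal" where
  "defect l A w f = (SUP \<Phi>\<in>Collect (admissible (Suc l)). ennreal (defect_pair l A w f \<Phi>))"

lemma admissible_test_fun: "admissible l \<Phi> \<Longrightarrow> J \<in> tidx l \<Longrightarrow> \<Phi> J \<in> test_fun"
  by (simp add: admissible_def)

lemma admissible_bound:
  assumes "admissible l \<Phi>" "J \<in> tidx l"
  shows "\<bar>\<Phi> J x\<bar> \<le> 1"
proof -
  have "\<bar>\<Phi> J x\<bar> \<le> tnorm l (\<lambda>J. \<Phi> J x)" by (rule abs_le_tnorm[OF assms(2)])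
  also have "\<dots> \<le> 1" using assms(1) by (simp add: tnorm_def admissible_def)
  finally show ?thesis .
qed

lemma defect_leI:
  "(\<And>\<Phi>. admissible (Suc l) \<Phi> \<Longrightarrow> defect_pair l A w f \<Phi> \<le> c) \<Longrightarrow> defect l A w f \<le> ennreal c"
  unfolding defect_def by (intro SUP_least ennreal_leI) auto

lemma ennreal_defect_pair_le: "admissible (Suc l) \<Phi> \<Longrightarrow> ennreal (defect_pair l A w f \<Phi>) \<le> defect l A w f"
  unfolding defect_def by (rule SUP_upper) auto

lemma defect_pair_leD:
  assumes "defect l A w f \<le> ennreal c" "0 \<le> c" "admissible (Suc l) \<Phi>"
  shows "defect_pair l A w f \<Phi> \<le> c"
  using order_trans[OF ennreal_defect_pair_le[OF assms(3)] assms(1)] assms(2) by (simp add: ennreal_le_iff)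

lemma ennreal_add_le: "ennreal (a + b) \<le> ennreal a + ennreal b"
proof -
  have "ennreal (a + b) \<le> ennreal (max 0 a + max 0 b)" by (intro ennreal_leI) auto
  also have "\<dots> = ennreal a + ennreal b" by (simp add: ennreal_max_0)
  finally show ?thesis .
qed

lemma defect_pair_combination:
  assumes "v \<in> L1 l" "w \<in> L1 l" "f \<in> L1 (Suc l)" "g \<in> L1 (Suc l)" "admissible (Suc l) \<Phi>"
  shows "defect_pair l A (\<lambda>x I. s * v x I + t * w x I) (\<lambda>x I. s * f x I + t * g x I) \<Phi> =
    s * defect_pair l A v f \<Phi> + t * defect_pair l A w g \<Phi>"
proof -
  have "(LINT x|lebQ. (s * f x J + t * g x J) * \<Phi> J x) =
      s * (LINT x|lebQ. f x J * \<Phi> J x) + t * (LINT x|lebQ. g x J * \<Phi> J x)" if "J \<in> tidx (Suc l)" for J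
    using integrable_mult_test_fun[OF L1D[OF assms(3) that] admissible_test_fun[OF assms(5) that]]
      integrable_mult_test_fun[OF L1D[OF assms(4) that] admissible_test_fun[OF assms(5) that]]
    by (simp add: distrib_right mult.assoc)
  then have "defect_pair l A (\<lambda>x I. s * v x I + t * w x I) (\<lambda>x I. s * f x I + t * g x I) \<Phi> =
    (\<Sum>J\<in>tidx (Suc l). s * (dist_op l A v J (\<Phi> J) - (LINT x|lebQ. f x J * \<Phi> J x)) +
      t * (dist_op l A w J (\<Phi> J) - (LINT x|lebQ. g x J * \<Phi> J x)))"
    unfolding defect_pair_def
    using dist_op_combination[OF assms(1,2) admissible_test_fun[OF assms(5)]]
    by (intro sum.cong refl) (simp add: algebra_simps)
  then show ?thesis by (simp add: defect_pair_def sum.distrib sum_distrib_left)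
qed

text \<open>
  Sublinearity of a supremum of linear functionals.
\<close>

lemma defect_combination:
  assumes L: "v \<in> L1 l" "w \<in> L1 l" "f \<in> L1 (Suc l)" "g \<in> L1 (Suc l)" and s: "0 \<le> s" and t: "0 \<le> t"
  shows "defect l A (\<lambda>x I. s * v x I + t * w x I) (\<lambda>x I. s * f x I + t * g x I) \<le>
    ennreal s * defect l A v f + ennreal t * defect l A w g"
  unfolding defect_def[of l A "\<lambda>x I. s * v x I + t * w x I"]
proof (rule SUP_least)
  fix \<Phi> :: "'a list \<Rightarrow> real ^ 'a \<Rightarrow> real" assume "\<Phi> \<in> Collect (admissible (Suc l))"
  then have \<Phi>: "admissible (Suc l) \<Phi>" by simp
  have "ennreal (s * defect_pair l A v f \<Phi> + t * defect_pair l A w g \<Phi>) \<le>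
      ennreal (s * defect_pair l A v f \<Phi>) + ennreal (t * defect_pair l A w g \<Phi>)" by (rule ennreal_add_le)
  also have "\<dots> = ennreal s * ennreal (defect_pair l A v f \<Phi>) + ennreal t * ennreal (defect_pair l A w g \<Phi>)"
    using s t by (simp add: ennreal_mult')
  also have "\<dots> \<le> ennreal s * defect l A v f + ennreal t * defect l A w g"
    by (intro add_mono mult_left_mono ennreal_defect_pair_le \<Phi>) auto
  finally show "ennreal (defect_pair l A (\<lambda>x I. s * v x I + t * w x I) (\<lambda>x I. s * f x I + t * g x I) \<Phi>) \<le>
    ennreal s * defect l A v f + ennreal t * defect l A w g"
    unfolding defect_pair_combination[OF L \<Phi>] .
qed

text \<open>
  For each \<open>\<Phi>\<close> the pairings converge, so the bounds pass to the limit before the supremum is taken.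
  Strong \<open>L\<^sup>1\<close> convergence of the fields is paired with convergence of the constant coefficients.
\<close>

lemma defect_lsc:
  assumes v: "\<And>n. v n \<in> L1 l" "w \<in> L1 l" "L1_conv l v w"
    and f: "\<And>n. f n \<in> L1 (Suc l)" "g \<in> L1 (Suc l)" "L1_conv (Suc l) f g"
    and A: "coef_conv An A"
    and c: "\<And>n. defect l (An n) (v n) (f n) \<le> ennreal (c n)" "\<And>n. 0 \<le> c n" "c \<longlonglongrightarrow> c'"
  shows "defect l A w g \<le> ennreal c'"
proof (rule defect_leI)
  fix \<Phi> :: "'a list \<Rightarrow> real ^ 'a \<Rightarrow> real" assume \<Phi>: "admissible (Suc l) \<Phi>"
  have "(\<lambda>n. defect_pair l (An n) (v n) (f n) \<Phi>) \<longlonglongrightarrow> defect_pair l A w g \<Phi>"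
    unfolding defect_pair_def using f(3) admissible_test_fun[OF \<Phi>]
    by (intro tendsto_sum tendsto_diff tendsto_dist_op v A tendsto_integral_mult L1D[OF f(1)] L1D[OF f(2)])
      (auto simp: L1_conv_def)
  then show "defect_pair l A w g \<Phi> \<le> c'"
    using c(3) by (rule LIMSEQ_le) (use defect_pair_leD[OF c(1,2) \<Phi>] in auto)
qed

lemma defect_change_target:
  assumes f: "f \<in> L1 (Suc l)" "g \<in> L1 (Suc l)"
  shows "defect l A w f \<le> defect l A w g + ennreal (\<Sum>J\<in>tidx (Suc l). LINT x|lebQ. \<bar>f x J - g x J\<bar>)"
  unfolding defect_def[of l A w f]
proof (rule SUP_least)
  fix \<Phi> :: "'a list \<Rightarrow> real ^ 'a \<Rightarrow> real" assume "\<Phi> \<in> Collect (admissible (Suc l))"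
  then have \<Phi>: "admissible (Suc l) \<Phi>" by simp
  have "defect_pair l A w f \<Phi> \<le> defect_pair l A w g \<Phi> + (\<Sum>J\<in>tidx (Suc l). LINT x|lebQ. \<bar>f x J - g x J\<bar>)"
    unfolding defect_pair_def sum.distrib[symmetric]
  proof (rule sum_mono)
    fix J :: "'a list" assume J: "J \<in> tidx (Suc l)"
    note t = admissible_test_fun[OF \<Phi> J]
    have "(LINT x|lebQ. g x J * \<Phi> J x) - (LINT x|lebQ. f x J * \<Phi> J x) = - (LINT x|lebQ. (f x J - g x J) * \<Phi> J x)"
      using integrable_mult_test_fun[OF L1D[OF f(1) J] t] integrable_mult_test_fun[OF L1D[OF f(2) J] t]
      by (simp add: left_diff_distrib)
    also have "\<dots> \<le> \<bar>LINT x|lebQ. (f x J - g x J) * \<Phi> J x\<bar>" by simp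
    also have "\<dots> \<le> 1 * (LINT x|lebQ. \<bar>f x J - g x J\<bar>)"
      using L1D[OF f(1) J] L1D[OF f(2) J] test_fun_lebQ[OF t] admissible_bound[OF \<Phi> J]
      by (intro integral_mult_bound) auto
    finally show "dist_op l A w J (\<Phi> J) - (LINT x|lebQ. f x J * \<Phi> J x) \<le>
        dist_op l A w J (\<Phi> J) - (LINT x|lebQ. g x J * \<Phi> J x) + (LINT x|lebQ. \<bar>f x J - g x J\<bar>)" by simp
  qed
  then have "ennreal (defect_pair l A w f \<Phi>) \<le>
      ennreal (defect_pair l A w g \<Phi> + (\<Sum>J\<in>tidx (Suc l). LINT x|lebQ. \<bar>f x J - g x J\<bar>))" by (rule ennreal_leI)
  also have "\<dots> \<le> ennreal (defect_pair l A w g \<Phi>) + ennreal (\<Sum>J\<in>tidx (Suc l). LINT x|lebQ. \<bar>f x J - g x J\<bar>)"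
    by (rule ennreal_add_le)
  also have "\<dots> \<le> defect l A w g + ennreal (\<Sum>J\<in>tidx (Suc l). LINT x|lebQ. \<bar>f x J - g x J\<bar>)"
    by (intro add_right_mono ennreal_defect_pair_le \<Phi>)
  finally show "ennreal (defect_pair l A w f \<Phi>) \<le> \<dots>" .
qed

lemma integral_cong_lebQ_AE:
  assumes "AE x in lebQ. f x = (g x :: real)" "integrable lebQ f" "integrable lebQ g"
  shows "(LINT x|lebQ. f x) = (LINT x|lebQ. g x)"
  using assms by (intro integral_cong_AE) auto

text \<open>
  If \<open>w = 0\<close> the pairing is \<open>- \<integral> f \<cdot> \<Phi>\<close>; testing with small multiples of bump functions in a single entry shows
  that \<open>f\<close> is orthogonal to all of them.
\<close>

lemma target_eq_0_of_defect_0: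
  assumes w: "w \<in> L1 l" "\<And>I. I \<in> tidx l \<Longrightarrow> AE x in lebQ. w x I = 0"
    and f: "f \<in> L1 (Suc l)" and zero: "defect l A w f \<le> 0" and J: "J \<in> tidx (Suc l)"
  shows "AE x in lebQ. f x J = 0"
proof (rule AE_eq_0_of_bumps[OF L1D[OF f J]])
  fix \<phi> :: "real ^ 'a \<Rightarrow> real" assume \<phi>: "\<phi> \<in> bumps"
  have d0: "dist_op l A w J' \<psi> = 0" if \<psi>: "\<psi> \<in> test_fun" for J' \<psi>
  proof -
    have "(LINT x|lebQ. w x I * pd i \<psi> x) = 0" if I: "I \<in> tidx l" for I i
    proof (rule integral_eq_zero_AE)
      show "AE x in lebQ. w x I * pd i \<psi> x = 0" using w(2)[OF I] by eventually_elim simp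
    qed
    then show ?thesis by (simp add: dist_op_def)
  qed
  have z: "(\<lambda>x::real ^ 'a. 0 :: real) \<in> test_fun" using bumps_zero bumps_test_fun by blast
  have le: "0 \<le> (LINT x|lebQ. f x J * \<psi> x)" if \<psi>: "\<psi> \<in> bumps" "\<And>x. \<bar>\<psi> x\<bar> \<le> 1" for \<psi>
  proof -
    define \<Phi> where "\<Phi> J' = (if J' = J then \<psi> else (\<lambda>x. 0))" for J'
    have s: "(\<Sum>J'\<in>tidx (Suc l). (\<Phi> J' x)\<^sup>2) = (\<psi> x)\<^sup>2" for x
    proof -
      have "(\<Phi> J' x)\<^sup>2 = (if J' = J then (\<psi> x)\<^sup>2 else 0)" for J' by (simp add: \<Phi>_def)
      then show ?thesis using J by (simp add: sum.delta)
    qed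
    have "admissible (Suc l) \<Phi>"
      unfolding admissible_def s using \<psi> z bumps_test_fun[OF \<psi>(1)]
      by (auto simp: \<Phi>_def abs_square_le_1)
    then have "defect_pair l A w f \<Phi> \<le> 0" using zero by (intro defect_pair_leD[of l A w f 0]) auto
    moreover have "defect_pair l A w f \<Phi> = - (LINT x|lebQ. f x J * \<psi> x)"
    proof -
      have "dist_op l A w J' (\<Phi> J') - (LINT x|lebQ. f x J' * \<Phi> J' x) =
          (if J' = J then - (LINT x|lebQ. f x J * \<psi> x) else 0)" for J'
        using d0[OF bumps_test_fun[OF \<psi>(1)]] d0[OF z] by (simp add: \<Phi>_def)
      then show ?thesis unfolding defect_pair_def using J by (simp add: sum.delta)
    qed
    ultimately show ?thesis by simp
  qed
  obtain K where K: "0 \<le> K" "\<And>x. \<bar>\<phi> x\<bar> \<le> K" using test_fun_bounded[OF bumps_test_fun[OF \<phi>]] by blast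
  define c where "c = 1 / (K + 1)"
  have c: "0 < c" "\<bar>c * \<phi> x\<bar> \<le> 1" "\<bar>- c * \<phi> x\<bar> \<le> 1" for x
    using K(1) K(2)[of x] by (auto simp: c_def abs_mult)
  have "0 \<le> (LINT x|lebQ. f x J * (c * \<phi> x))" "0 \<le> (LINT x|lebQ. f x J * (- c * \<phi> x))"
    using c by (intro le bumps_mult[OF \<phi> bumpalg_const]; simp)+
  then show "(LINT x|lebQ. f x J * \<phi> x) = 0"
    using c(1) by (simp add: mult.left_commute[of _ c] zero_le_mult_iff mult_le_0_iff)
qed

lemma density_meas_Mb: "f \<in> L1 l \<Longrightarrow> density_meas f \<in> Mb l"
  unfolding Mb_iff_signed density_meas_def by (intro ballI signed_density L1D)

lemma total_variation_eq_defect: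
  assumes \<mu>: "\<mu> \<in> Mb (Suc l)"
    and eq: "\<And>J \<phi>. J \<in> tidx (Suc l) \<Longrightarrow> \<phi> \<in> test_fun \<Longrightarrow>
      signed_integral (\<lambda>S. \<mu> S J) \<phi> = dist_op l A w J \<phi> - (LINT x|lebQ. f x J * \<phi> x)"
  shows "total_variation (Suc l) \<mu> = defect l A w f"
proof -
  have "pairing (Suc l) \<mu> \<Phi> = defect_pair l A w f \<Phi>" if "admissible (Suc l) \<Phi>" for \<Phi>
    unfolding pairing_def defect_pair_def
    by (intro sum.cong refl eq) (auto intro: admissible_test_fun[OF that])
  then show ?thesis
    unfolding total_variation_eq_SUP_pairing[OF \<mu>] defect_def by (intro SUP_cong refl) auto
qed

lemma op_meas_represents: "v \<in> BVB l A \<Longrightarrow> represents l A v (op_meas l A v)"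
  unfolding op_meas_def by (rule someI_ex[of "represents l A v"]) (simp add: BVB_def)

lemma BVB_L1: "v \<in> BVB l A \<Longrightarrow> v \<in> L1 l"
  by (simp add: BVB_def)

lemma op_meas_Mb: "v \<in> BVB l A \<Longrightarrow> op_meas l A v \<in> Mb (Suc l)"
  using op_meas_represents unfolding represents_def by blast

lemma signed_integral_op_meas:
  "v \<in> BVB l A \<Longrightarrow> J \<in> tidx (Suc l) \<Longrightarrow> \<phi> \<in> test_fun \<Longrightarrow>
    signed_integral (\<lambda>S. op_meas l A v S J) \<phi> = dist_op l A v J \<phi>"
  using op_meas_represents unfolding represents_def by metis

lemma Mb_combination: "\<mu> \<in> Mb l \<Longrightarrow> \<nu> \<in> Mb l \<Longrightarrow> (\<lambda>S I. s * \<mu> S I + t * \<nu> S I) \<in> Mb l"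
  by (simp add: Mb_iff_signed signed_combination)

lemma signed_integral_combination_Mb:
  "\<mu> \<in> Mb l \<Longrightarrow> \<nu> \<in> Mb l \<Longrightarrow> J \<in> tidx l \<Longrightarrow> \<phi> \<in> test_fun \<Longrightarrow>
    signed_integral (\<lambda>S. s * \<mu> S J + t * \<nu> S J) \<phi> =
    s * signed_integral (\<lambda>S. \<mu> S J) \<phi> + t * signed_integral (\<lambda>S. \<nu> S J) \<phi>"
  by (rule signed_integral_combination) (auto simp: Mb_iff_signed)

lemma signed_integral_density_meas:
  "f \<in> L1 l \<Longrightarrow> J \<in> tidx l \<Longrightarrow> \<phi> \<in> test_fun \<Longrightarrow>
    signed_integral (\<lambda>S. density_meas f S J) \<phi> = (LINT x|lebQ. f x J * \<phi> x)"
  unfolding density_meas_def by (rule signed_integral_density[OF L1D])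

lemma op_meas_minus_density:
  assumes v: "v \<in> BVB l A" and f: "f \<in> L1 (Suc l)"
  shows "(\<lambda>S I. op_meas l A v S I - density_meas f S I) \<in> Mb (Suc l)"
    and "J \<in> tidx (Suc l) \<Longrightarrow> \<phi> \<in> test_fun \<Longrightarrow>
      signed_integral (\<lambda>S. op_meas l A v S J - density_meas f S J) \<phi> = dist_op l A v J \<phi> - (LINT x|lebQ. f x J * \<phi> x)"
  using Mb_combination[OF op_meas_Mb[OF v] density_meas_Mb[OF f], of 1 "-1"]
    signed_integral_combination_Mb[OF op_meas_Mb[OF v] density_meas_Mb[OF f], of J \<phi> 1 "-1"]
    signed_integral_op_meas[OF v, of J \<phi>] signed_integral_density_meas[OF f, of J \<phi>]
  by simp_all

lemma total_variation_op_minus_density: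
  assumes v: "v \<in> BVB l A" and f: "f \<in> L1 (Suc l)"
  shows "total_variation (Suc l) (\<lambda>S I. op_meas l A v S I - density_meas f S I) = defect l A v f"
  by (rule total_variation_eq_defect[OF op_meas_minus_density[OF v f]])

lemma total_variation_density_minus_op:
  assumes v: "v \<in> BVB l A" and f: "f \<in> L1 (Suc l)"
  shows "total_variation (Suc l) (\<lambda>S I. density_meas f S I - op_meas l A v S I) = defect l A v f"
proof -
  have "tnorm (Suc l) (\<lambda>I. density_meas f S I - op_meas l A v S I) = tnorm (Suc l) (\<lambda>I. op_meas l A v S I - density_meas f S I)" for S
    by (simp add: tnorm_def power2_commute)
  then show ?thesis
    unfolding total_variation_op_minus_density[OF v f, symmetric] total_variation_def by simp
qed

lemma total_variation_op_meas:
  assumes v: "v \<in> BVB l A"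
  shows "total_variation (Suc l) (op_meas l A v) = defect l A v (\<lambda>x I. 0)"
  using signed_integral_op_meas[OF v] by (intro total_variation_eq_defect op_meas_Mb v) auto

lemma BVB_combination:
  assumes v: "v \<in> BVB l A" and w: "w \<in> BVB l A"
  shows "(\<lambda>x I. s * v x I + t * w x I) \<in> BVB l A"
proof -
  have "represents l A (\<lambda>x I. s * v x I + t * w x I) (\<lambda>S I. s * op_meas l A v S I + t * op_meas l A w S I)"
    unfolding represents_def
    using Mb_combination[OF op_meas_Mb[OF v] op_meas_Mb[OF w]] dist_op_combination[OF BVB_L1[OF v] BVB_L1[OF w]]
      signed_integral_combination_Mb[OF op_meas_Mb[OF v] op_meas_Mb[OF w]]
      signed_integral_op_meas[OF v] signed_integral_op_meas[OF w] by simp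
  then show ?thesis using L1_combination[OF BVB_L1[OF v] BVB_L1[OF w]] unfolding BVB_def by blast
qed

text \<open>
  The measures \<open>A\<^sub>n v\<^sub>n - f\<^sub>n\<close> have bounded variation and converge as distributions to \<open>A w - g\<close>, so the
  latter is a measure by weak* compactness, and adding the density \<open>g\<close> gives the measure \<open>A w\<close>.
\<close>

lemma BVB_closed:
  assumes v: "\<And>n. v n \<in> BVB l (An n)" "w \<in> L1 l" "L1_conv l v w"
    and f: "\<And>n. f n \<in> L1 (Suc l)" "g \<in> L1 (Suc l)" "L1_conv (Suc l) f g"
    and A: "coef_conv An A" and bound: "\<And>n. defect l (An n) (v n) (f n) \<le> ennreal C"
  shows "w \<in> BVB l A"
proof -
  let ?\<mu> = "\<lambda>n S I. op_meas l (An n) (v n) S I - density_meas (f n) S I"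
  have "\<exists>\<mu>'\<in>Mb (Suc l). \<forall>J\<in>tidx (Suc l). \<forall>\<phi>\<in>test_fun. signed_integral (\<lambda>S. \<mu>' S J) \<phi> =
      dist_op l A w J \<phi> - (LINT x|lebQ. g x J * \<phi> x)"
  proof (rule Mb_weakly_compact[where \<mu> = ?\<mu>])
    show "?\<mu> n \<in> Mb (Suc l)" for n by (rule op_meas_minus_density(1)[OF v(1) f(1)])
    show "total_variation (Suc l) (?\<mu> n) \<le> ennreal C" for n
      unfolding total_variation_op_minus_density[OF v(1) f(1)] by (rule bound)
    fix J :: "'a list" and \<phi> :: "real ^ 'a \<Rightarrow> real" assume J: "J \<in> tidx (Suc l)" and \<phi>: "\<phi> \<in> test_fun"
    show "(\<lambda>n. signed_integral (\<lambda>S. ?\<mu> n S J) \<phi>) \<longlonglongrightarrow> dist_op l A w J \<phi> - (LINT x|lebQ. g x J * \<phi> x)"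
      unfolding op_meas_minus_density(2)[OF v(1) f(1) J \<phi>]
      using f(3) J by (intro tendsto_diff tendsto_dist_op v BVB_L1[OF v(1)] A \<phi> tendsto_integral_mult L1D[OF f(1) J] L1D[OF f(2) J])
        (auto simp: L1_conv_def)
  qed
  then obtain \<mu>' where \<mu>': "\<mu>' \<in> Mb (Suc l)" "\<And>J \<phi>. J \<in> tidx (Suc l) \<Longrightarrow> \<phi> \<in> test_fun \<Longrightarrow>
      signed_integral (\<lambda>S. \<mu>' S J) \<phi> = dist_op l A w J \<phi> - (LINT x|lebQ. g x J * \<phi> x)" by blast
  have "represents l A w (\<lambda>S I. 1 * \<mu>' S I + 1 * density_meas g S I)"
    unfolding represents_def
    using Mb_combination[OF \<mu>'(1) density_meas_Mb[OF f(2)], of 1 1]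
      signed_integral_combination_Mb[OF \<mu>'(1) density_meas_Mb[OF f(2)], of _ _ 1 1]
      \<mu>'(2) signed_integral_density_meas[OF f(2)] by simp
  then show ?thesis using v(2) unfolding BVB_def by blast
qed

section \<open>Dilation and mollification\<close>

lemma lborel_integral_affine:
  fixes g :: "real ^ 'n::finite \<Rightarrow> real"
  assumes g: "g \<in> borel_measurable borel" and c: "c \<noteq> 0"
  shows "(LINT x|lborel. g x) = \<bar>c\<bar> ^ CARD('n) * (LINT x|lborel. g (t + c *\<^sub>R x))"
proof -
  have "(LINT x|lborel. g x) = (LINT x|density (distr lborel borel (\<lambda>x. t + c *\<^sub>R x)) (\<lambda>_. ennreal (\<bar>c\<bar> ^ DIM(real ^ 'n))). g x)"
    using lborel_affine[OF c, of t] by metis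
  also have "\<dots> = (LINT x|distr lborel borel (\<lambda>x. t + c *\<^sub>R x). \<bar>c\<bar> ^ DIM(real ^ 'n) *\<^sub>R g x)"
    using g by (intro integral_density) auto
  also have "\<dots> = (LINT x|lborel. \<bar>c\<bar> ^ DIM(real ^ 'n) *\<^sub>R g (t + c *\<^sub>R x))"
    using g by (intro integral_distr) auto
  finally show ?thesis by simp
qed

lemma lborel_integral_translate:
  fixes g :: "real ^ 'n::finite \<Rightarrow> real"
  assumes "g \<in> borel_measurable borel"
  shows "(LINT x|lborel. g (x + t)) = (LINT x|lborel. g x)"
  using lborel_integral_affine[OF assms, of 1 t] by (simp add: add.commute)

lemma integrable_lborel_affine:
  fixes g :: "real ^ 'n::finite \<Rightarrow> real"
  assumes g: "integrable lborel g" and c: "c \<noteq> 0"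
  shows "integrable lborel (\<lambda>x. g (t + c *\<^sub>R x))"
proof -
  have m: "g \<in> borel_measurable borel" using g by auto
  have "integrable (density (distr lborel borel (\<lambda>x. t + c *\<^sub>R x)) (\<lambda>_. ennreal (\<bar>c\<bar> ^ DIM(real ^ 'n)))) g"
    using g lborel_affine[OF c, of t] by metis
  then have "integrable (distr lborel borel (\<lambda>x. t + c *\<^sub>R x)) (\<lambda>x. \<bar>c\<bar> ^ DIM(real ^ 'n) *\<^sub>R g x)"
    using m by (subst (asm) integrable_density) auto
  then have "integrable lborel (\<lambda>x. \<bar>c\<bar> ^ DIM(real ^ 'n) *\<^sub>R g (t + c *\<^sub>R x))"
    using m by (subst (asm) integrable_distr_eq) auto
  then show ?thesis using c by simp
qed

lemma continuous_compact_support_integrable: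
  fixes a :: "real ^ 'n::finite \<Rightarrow> real"
  assumes a: "continuous_on UNIV a" "\<And>x. x \<notin> cbox u v \<Longrightarrow> a x = 0"
  shows "integrable lborel a" and "(LINT x|lborel. a x) = integral (cbox u v) a"
proof -
  have i: "integrable lborel (\<lambda>x. indicator (cbox u v) x *\<^sub>R a x)"
    by (rule borel_integrable_compact[OF compact_cbox continuous_on_subset[OF a(1) subset_UNIV]])
  have eq: "(\<lambda>x. indicator (cbox u v) x *\<^sub>R a x) = a" using a(2) by (auto simp: indicator_def fun_eq_iff)
  show i': "integrable lborel a" using i unfolding eq .
  have "(a has_integral (LINT x|lborel. a x)) UNIV" by (rule has_integral_integral_lborel[OF i'])
  then have "(LINT x|lborel. a x) = integral UNIV a" by (simp add: integral_unique)
  also have "\<dots> = integral (cbox u v) a"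
  proof -
    have "a = (\<lambda>x. if x \<in> cbox u v then a x else 0)" using a(2) by auto
    then show ?thesis using integral_restrict_UNIV[of "cbox u v" a] by simp
  qed
  finally show "(LINT x|lborel. a x) = integral (cbox u v) a" .
qed

lemma blinfun_vec_nth: "blinfun_apply (Blinfun (\<lambda>v :: real ^ 'n::finite. v $ i)) v = v $ i"
  by (simp add: bounded_linear_Blinfun_apply bounded_linear_vec_nth)

text \<open>
  Differentiation under the integral sign, available for integrals over a box with continuous
  integrand; the dilation factor \<open>\<beta>\<close> comes out by the chain rule.
\<close>

lemma convolution_has_derivative:
  fixes a \<Phi> :: "real ^ 'n::finite \<Rightarrow> real" and \<alpha> \<beta> :: real
  assumes a: "continuous_on UNIV a" "\<And>x. x \<notin> cbox u v \<Longrightarrow> a x = 0" and \<Phi>: "smooth \<Phi>"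
  defines "G \<equiv> \<lambda>\<Psi> y. LINT \<zeta>|lborel. a \<zeta> * \<Psi> (\<alpha> *\<^sub>R \<zeta> + \<beta> *\<^sub>R y)"
  shows "((\<lambda>y. G \<Phi> y) has_derivative (\<lambda>w. \<Sum>i\<in>UNIV. w $ i * (\<beta> * G (pd i \<Phi>) y))) (at y)"
proof -
  have cont: "continuous_on S \<Psi>" if "smooth \<Psi>" for \<Psi> and S :: "(real ^ 'n) set" using that by (rule smooth_continuous)
  have G: "G \<Psi> y = integral (cbox u v) (\<lambda>\<zeta>. a \<zeta> * \<Psi> (\<alpha> *\<^sub>R \<zeta> + \<beta> *\<^sub>R y))" if "smooth \<Psi>" for \<Psi> y
    unfolding G_def
    by (rule continuous_compact_support_integrable(2))
      (auto intro!: continuous_intros a(1) continuous_on_compose2[OF cont[OF that, of UNIV]] simp: a(2))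
  define fx where "fx y \<zeta> = (\<Sum>i\<in>UNIV. (a \<zeta> * (\<beta> * pd i \<Phi> (\<alpha> *\<^sub>R \<zeta> + \<beta> *\<^sub>R y))) *\<^sub>R Blinfun (\<lambda>v :: real ^ 'n. v $ i))" for y \<zeta>
  have fx: "blinfun_apply (fx y \<zeta>) w = (\<Sum>i\<in>UNIV. (a \<zeta> * (\<beta> * pd i \<Phi> (\<alpha> *\<^sub>R \<zeta> + \<beta> *\<^sub>R y))) * w $ i)" for y \<zeta> w
    by (simp add: fx_def blinfun.sum_left blinfun.scaleR_left blinfun_vec_nth)
  have "((\<lambda>y. integral (cbox u v) (\<lambda>\<zeta>. a \<zeta> * \<Phi> (\<alpha> *\<^sub>R \<zeta> + \<beta> *\<^sub>R y))) has_derivative blinfun_apply (integral (cbox u v) (fx y))) (at y within UNIV)"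
  proof (rule leibniz_rule)
    fix y t :: "real ^ 'n"
    have "((\<lambda>y. a t * \<Phi> (\<alpha> *\<^sub>R t + \<beta> *\<^sub>R y)) has_derivative
        (\<lambda>w. a t * frechet_derivative \<Phi> (at (\<alpha> *\<^sub>R t + \<beta> *\<^sub>R y)) (\<beta> *\<^sub>R w))) (at y)"
      by (rule has_derivative_mult_right, rule has_derivative_compose[OF _ smooth_has_derivative[OF \<Phi>]])
        (auto intro!: derivative_eq_intros)
    moreover have "(\<lambda>w. a t * frechet_derivative \<Phi> (at (\<alpha> *\<^sub>R t + \<beta> *\<^sub>R y)) (\<beta> *\<^sub>R w)) = blinfun_apply (fx y t)"
      by (rule ext) (simp add: fx frechet_derivative_eq_sum_pd[OF smooth_differentiable[OF \<Phi>]] sum_distrib_left mult_ac)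
    ultimately show "((\<lambda>y. a t * \<Phi> (\<alpha> *\<^sub>R t + \<beta> *\<^sub>R y)) has_derivative blinfun_apply (fx y t)) (at y within UNIV)"
      by simp
  next
    show "(\<lambda>\<zeta>. a \<zeta> * \<Phi> (\<alpha> *\<^sub>R \<zeta> + \<beta> *\<^sub>R y)) integrable_on cbox u v" for y
      by (intro integrable_continuous continuous_intros continuous_on_subset[OF a(1)] continuous_on_compose2[OF cont[OF \<Phi>, of UNIV]]) auto
    show "continuous_on (UNIV \<times> cbox u v) (\<lambda>(y, \<zeta>). fx y \<zeta>)"
      unfolding fx_def case_prod_unfold
      by (intro continuous_intros continuous_on_compose2[OF a(1)] continuous_on_compose2[OF cont[OF smooth_pd[OF \<Phi>], of UNIV]]) auto
  qed auto
  moreover have "blinfun_apply (integral (cbox u v) (fx y)) = (\<lambda>w. \<Sum>i\<in>UNIV. w $ i * (\<beta> * G (pd i \<Phi>) y))"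
  proof
    fix w :: "real ^ 'n"
    have c: "continuous_on (cbox u v) (\<lambda>\<zeta>. a \<zeta> * pd i \<Phi> (\<alpha> *\<^sub>R \<zeta> + \<beta> *\<^sub>R y))" for i
      by (intro continuous_intros continuous_on_subset[OF a(1)] continuous_on_compose2[OF cont[OF smooth_pd[OF \<Phi>], of UNIV]]) auto
    have "fx y integrable_on cbox u v"
      unfolding fx_def
      by (intro integrable_continuous continuous_intros continuous_on_subset[OF a(1)] continuous_on_compose2[OF cont[OF smooth_pd[OF \<Phi>], of UNIV]]) auto
    then have "blinfun_apply (integral (cbox u v) (fx y)) w = integral (cbox u v) (\<lambda>\<zeta>. blinfun_apply (fx y \<zeta>) w)"
      by (rule blinfun_apply_integral)
    also have "\<dots> = integral (cbox u v) (\<lambda>\<zeta>. \<Sum>i\<in>UNIV. (w $ i * \<beta>) * (a \<zeta> * pd i \<Phi> (\<alpha> *\<^sub>R \<zeta> + \<beta> *\<^sub>R y)))"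
      unfolding fx by (simp add: mult_ac)
    also have "\<dots> = (\<Sum>i\<in>UNIV. integral (cbox u v) (\<lambda>\<zeta>. (w $ i * \<beta>) * (a \<zeta> * pd i \<Phi> (\<alpha> *\<^sub>R \<zeta> + \<beta> *\<^sub>R y))))"
      using c by (intro integral_sum integrable_continuous continuous_on_mult_left) auto
    also have "\<dots> = (\<Sum>i\<in>UNIV. w $ i * (\<beta> * G (pd i \<Phi>) y))"
      unfolding G[OF smooth_pd[OF \<Phi>]] by (simp add: mult.assoc)
    finally show "blinfun_apply (integral (cbox u v) (fx y)) w = (\<Sum>i\<in>UNIV. w $ i * (\<beta> * G (pd i \<Phi>) y))" .
  qed
  ultimately show ?thesis unfolding G[OF \<Phi>] by simp
qed

lemma pd_eqI:
  assumes "(f has_derivative f') (at x)"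
  shows "pd i f x = f' (axis i 1)"
  using frechet_derivative_at[OF assms] by (simp add: pd_def)

lemma convolution_pd:
  fixes a \<Phi> :: "real ^ 'n::finite \<Rightarrow> real"
  assumes a: "continuous_on UNIV a" "\<And>x. x \<notin> cbox u v \<Longrightarrow> a x = 0" and \<Phi>: "smooth \<Phi>"
  shows "pd i (\<lambda>y. LINT \<zeta>|lborel. a \<zeta> * \<Phi> (\<alpha> *\<^sub>R \<zeta> + \<beta> *\<^sub>R y)) y =
    \<beta> * (LINT \<zeta>|lborel. a \<zeta> * pd i \<Phi> (\<alpha> *\<^sub>R \<zeta> + \<beta> *\<^sub>R y))"
proof -
  have "pd i (\<lambda>y. LINT \<zeta>|lborel. a \<zeta> * \<Phi> (\<alpha> *\<^sub>R \<zeta> + \<beta> *\<^sub>R y)) y =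
     (\<Sum>j\<in>UNIV. axis i 1 $ j * (\<beta> * (LINT \<zeta>|lborel. a \<zeta> * pd j \<Phi> (\<alpha> *\<^sub>R \<zeta> + \<beta> *\<^sub>R y))))"
    by (rule pd_eqI[OF convolution_has_derivative[OF a \<Phi>]])
  also have "\<dots> = (\<Sum>j\<in>UNIV. if j = i then \<beta> * (LINT \<zeta>|lborel. a \<zeta> * pd i \<Phi> (\<alpha> *\<^sub>R \<zeta> + \<beta> *\<^sub>R y)) else 0)"
    by (intro sum.cong refl) (auto simp: axis_def)
  finally show ?thesis by simp
qed

definition unit_box :: "(real ^ 'n::finite) set" where
  "unit_box = cbox (\<chi> i. -1) (\<chi> i. 1)"

text \<open>
  Mollification at scale \<open>\<epsilon>\<close> combined with the dilation by \<open>1 + 4\<epsilon>\<close>. It acts on test functions: a support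
  in the cube is shrunk by the dilation, so that mollification cannot push it across the boundary. The kernel \<open>h\<close> lives
  in the box of radius 1, and any factor above \<open>1 + 2\<epsilon>\<close> leaves room.
\<close>

definition smoothen :: "real \<Rightarrow> (real ^ 'n::finite \<Rightarrow> real) \<Rightarrow> (real ^ 'n \<Rightarrow> real) \<Rightarrow> real ^ 'n \<Rightarrow> real" where
  "smoothen \<epsilon> h \<Phi> y = (LINT \<zeta>|lborel. h \<zeta> * \<Phi> (\<epsilon> *\<^sub>R \<zeta> + (1 + 4 * \<epsilon>) *\<^sub>R y))"

text \<open>
  The adjoint with respect to the Lebesgue measure; applied to a field it dilates the field by
  \<open>1 + 4\<epsilon>\<close> and mollifies.
\<close>

definition smoothen_adj :: "real \<Rightarrow> (real ^ 'n::finite \<Rightarrow> real) \<Rightarrow> (real ^ 'n \<Rightarrow> real) \<Rightarrow> real ^ 'n \<Rightarrow> real" where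
  "smoothen_adj \<epsilon> h f x = (LINT \<zeta>|lborel. h \<zeta> * f ((1 / (1 + 4 * \<epsilon>)) *\<^sub>R (x - \<epsilon> *\<^sub>R \<zeta>))) / (1 + 4 * \<epsilon>) ^ CARD('n)"

context
  fixes \<epsilon> :: real
  assumes \<epsilon>: "0 < \<epsilon>"
begin

lemma smoothen_pd:
  assumes "continuous_on UNIV h" "\<And>x. x \<notin> unit_box \<Longrightarrow> h x = 0" "smooth \<Phi>"
  shows "pd i (smoothen \<epsilon> h \<Phi>) = (\<lambda>y. (1 + 4 * \<epsilon>) * smoothen \<epsilon> h (pd i \<Phi>) y)"
  using convolution_pd[OF assms(1) assms(2)[unfolded unit_box_def] assms(3)]
  unfolding smoothen_def[abs_def] by (intro ext) blast

lemma smoothen_differentiable: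
  assumes "continuous_on UNIV h" "\<And>x. x \<notin> unit_box \<Longrightarrow> h x = 0" "smooth \<Phi>"
  shows "smoothen \<epsilon> h \<Phi> differentiable (at y)"
  using convolution_has_derivative[OF assms(1) assms(2)[unfolded unit_box_def] assms(3)]
  unfolding smoothen_def[abs_def] by (rule differentiableI)

lemma smoothen_smooth:
  assumes h: "continuous_on UNIV h" "\<And>x. x \<notin> unit_box \<Longrightarrow> h x = 0" and \<Phi>: "smooth \<Phi>"
  shows "smooth (smoothen \<epsilon> h \<Phi>)"
proof -
  have sm: "smooth (foldr pd is \<Phi>)" for "is" using \<Phi> by (induction "is") (auto intro: smooth_pd)
  have eq: "foldr pd is (smoothen \<epsilon> h \<Phi>) = (\<lambda>y. (1 + 4 * \<epsilon>) ^ length is * smoothen \<epsilon> h (foldr pd is \<Phi>) y)" for "is"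
  proof (induction "is")
    case (Cons i "is")
    show ?case
    proof
      fix y
      let ?g = "smoothen \<epsilon> h (foldr pd is \<Phi>)"
      have "(?g has_derivative frechet_derivative ?g (at y)) (at y)"
        using smoothen_differentiable[OF h sm] frechet_derivative_works by blast
      then have "((\<lambda>y. (1 + 4 * \<epsilon>) ^ length is * ?g y) has_derivative
          (\<lambda>w. (1 + 4 * \<epsilon>) ^ length is * frechet_derivative ?g (at y) w)) (at y)"
        by (rule has_derivative_mult_right)
      from pd_eqI[OF this, of i]
      have "pd i (\<lambda>y. (1 + 4 * \<epsilon>) ^ length is * ?g y) y = (1 + 4 * \<epsilon>) ^ length is * pd i ?g y"
        by (simp add: pd_def)
      then show "foldr pd (i # is) (smoothen \<epsilon> h \<Phi>) y =
          (1 + 4 * \<epsilon>) ^ length (i # is) * smoothen \<epsilon> h (foldr pd (i # is) \<Phi>) y"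
        by (simp add: Cons.IH smoothen_pd[OF h sm])
    qed
  qed simp
  show ?thesis
    unfolding smooth_def eq
    using smoothen_differentiable[OF h sm] by (auto intro!: differentiable_mult)
qed

text \<open>
  If \<open>y\<close> has a coordinate of modulus above \<open>(1/2 + \<epsilon>) / (1 + 4\<epsilon>)\<close>, all points at which \<open>\<Phi>\<close> is evaluated lie
  outside the cube. This bound is below \<open>1/2\<close>.
\<close>

lemma smoothen_test_fun:
  fixes \<Phi> :: "real ^ 'n::finite \<Rightarrow> real"
  assumes h: "continuous_on UNIV h" "\<And>x. x \<notin> unit_box \<Longrightarrow> h x = 0" and \<Phi>: "\<Phi> \<in> test_fun"
  shows "smoothen \<epsilon> h \<Phi> \<in> test_fun"
proof -
  define \<rho> where "\<rho> = (1/2 + \<epsilon>) / (1 + 4 * \<epsilon>)"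
  have \<rho>: "\<rho> < 1/2" using \<epsilon> by (simp add: \<rho>_def field_simps)
  let ?K = "cbox (\<chi> i. - \<rho>) (\<chi> i. \<rho>) :: (real ^ 'n) set"
  have "smoothen \<epsilon> h \<Phi> y = 0" if y: "y \<notin> ?K" for y
  proof -
    have "\<exists>i. \<not> (- \<rho> \<le> y $ i \<and> y $ i \<le> \<rho>)" using y by (simp add: mem_box_cart)
    then obtain i where "\<not> (- \<rho> \<le> y $ i \<and> y $ i \<le> \<rho>)" by (elim exE)
    then have i: "\<rho> < \<bar>y $ i\<bar>" by linarith
    have "h \<zeta> * \<Phi> (\<epsilon> *\<^sub>R \<zeta> + (1 + 4 * \<epsilon>) *\<^sub>R y) = 0" for \<zeta>
    proof (cases "\<zeta> \<in> unit_box")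
      case True
      then have "\<bar>\<zeta> $ i\<bar> \<le> 1" by (auto simp: unit_box_def mem_box_cart abs_le_iff dest!: spec[of _ i])
      then have "\<epsilon> * \<bar>\<zeta> $ i\<bar> \<le> \<epsilon>" using \<epsilon> by simp
      moreover have "1/2 + \<epsilon> < (1 + 4 * \<epsilon>) * \<bar>y $ i\<bar>"
        using i \<epsilon> by (simp add: \<rho>_def divide_less_eq mult.commute)
      moreover have "(1 + 4 * \<epsilon>) * \<bar>y $ i\<bar> = \<bar>(1 + 4 * \<epsilon>) * y $ i\<bar>" "\<epsilon> * \<bar>\<zeta> $ i\<bar> = \<bar>\<epsilon> * \<zeta> $ i\<bar>"
        using \<epsilon> by (simp_all add: abs_mult)
      ultimately have "1/2 < \<bar>(\<epsilon> *\<^sub>R \<zeta> + (1 + 4 * \<epsilon>) *\<^sub>R y) $ i\<bar>"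
        unfolding vector_add_component vector_scaleR_component real_scaleR_def by linarith
      then have "\<epsilon> *\<^sub>R \<zeta> + (1 + 4 * \<epsilon>) *\<^sub>R y \<notin> cube"
      proof (rule contrapos_pn)
        assume "\<epsilon> *\<^sub>R \<zeta> + (1 + 4 * \<epsilon>) *\<^sub>R y \<in> cube"
        then have "- 1/2 < (\<epsilon> *\<^sub>R \<zeta> + (1 + 4 * \<epsilon>) *\<^sub>R y) $ i \<and> (\<epsilon> *\<^sub>R \<zeta> + (1 + 4 * \<epsilon>) *\<^sub>R y) $ i < 1/2"
          unfolding cube_def by blast
        then show "\<not> 1/2 < \<bar>(\<epsilon> *\<^sub>R \<zeta> + (1 + 4 * \<epsilon>) *\<^sub>R y) $ i\<bar>" by linarith
      qed
      then show ?thesis using test_fun_outside[OF \<Phi>] by simp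
    qed (simp add: h(2))
    then have "(\<lambda>\<zeta>. h \<zeta> * \<Phi> (\<epsilon> *\<^sub>R \<zeta> + (1 + 4 * \<epsilon>) *\<^sub>R y)) = (\<lambda>\<zeta>. 0)" by (rule ext)
    then show ?thesis unfolding smoothen_def by (simp only: Bochner_Integration.integral_zero)
  qed
  moreover have "?K \<subseteq> cube"
  proof
    fix y assume "y \<in> ?K"
    then have *: "- \<rho> \<le> y $ i \<and> y $ i \<le> \<rho>" for i by (simp add: mem_box_cart)
    have "- 1/2 < y $ i \<and> y $ i < 1/2" for i using *[of i] \<rho> by linarith
    then show "y \<in> cube" unfolding cube_def by blast
  qed
  ultimately show ?thesis
    using smoothen_smooth[OF h, of \<Phi>] \<Phi> unfolding test_fun_def
    by (intro CollectI conjI exI[of _ ?K]) auto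
qed

text \<open>
  The derivative of \<open>\<Phi>\<close> is moved to the kernel. On the side of the adjoint this says that mollified
  fields have integrable gradients, with a bound of order \<open>1/\<epsilon>\<close>.
\<close>

lemma smoothen_integrate_by_parts:
  fixes \<Phi> :: "real ^ 'n::finite \<Rightarrow> real"
  assumes h: "smooth h" "\<And>x. x \<notin> unit_box \<Longrightarrow> h x = 0" and \<Phi>: "\<Phi> \<in> test_fun"
  shows "smoothen \<epsilon> h (pd i \<Phi>) y = - (1 / \<epsilon>) * smoothen \<epsilon> (pd i h) \<Phi> y"
proof -
  have sm: "smooth \<Phi>" using \<Phi> by (simp add: test_fun_def)
  have ch: "continuous_on UNIV h" "continuous_on UNIV (pd i h)" using h smooth_pd smooth_continuous by blast+
  have c\<Phi>: "continuous_on UNIV \<Phi>" "continuous_on UNIV (pd i \<Phi>)" using sm smooth_pd smooth_continuous by blast+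
  let ?z = "(1 + 4 * \<epsilon>) *\<^sub>R y"
  define G where "G z = (LINT \<zeta>|lborel. h \<zeta> * \<Phi> (\<epsilon> *\<^sub>R \<zeta> + 1 *\<^sub>R z))" for z
  have bm: "(\<lambda>\<zeta>. a \<zeta> * b (\<epsilon> *\<^sub>R \<zeta> + z)) \<in> borel_measurable borel"
    if "continuous_on UNIV a" "continuous_on UNIV b" for a b :: "real ^ 'n \<Rightarrow> real" and z
    by (intro borel_measurable_continuous_onI continuous_intros that continuous_on_compose2[OF that(2)]) auto
  have tr: "(LINT \<zeta>|lborel. a \<zeta> * b (\<epsilon> *\<^sub>R \<zeta> + z)) = (LINT \<zeta>|lborel. b (\<epsilon> *\<^sub>R \<zeta>) * a (1 *\<^sub>R \<zeta> + (- (1 / \<epsilon>)) *\<^sub>R z))"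
    if "continuous_on UNIV a" "continuous_on UNIV b" for a b :: "real ^ 'n \<Rightarrow> real" and z
  proof -
    have "(LINT \<zeta>|lborel. a \<zeta> * b (\<epsilon> *\<^sub>R \<zeta> + z)) =
        (LINT \<zeta>|lborel. a (\<zeta> + (- (1 / \<epsilon>)) *\<^sub>R z) * b (\<epsilon> *\<^sub>R (\<zeta> + (- (1 / \<epsilon>)) *\<^sub>R z) + z))"
      by (rule lborel_integral_translate[OF bm[OF that], symmetric])
    also have "\<dots> = (LINT \<zeta>|lborel. b (\<epsilon> *\<^sub>R \<zeta>) * a (1 *\<^sub>R \<zeta> + (- (1 / \<epsilon>)) *\<^sub>R z))"
      using \<epsilon> by (intro Bochner_Integration.integral_cong) (auto simp: algebra_simps)
    finally show ?thesis .
  qed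
  have "pd i G ?z = 1 * (LINT \<zeta>|lborel. h \<zeta> * pd i \<Phi> (\<epsilon> *\<^sub>R \<zeta> + 1 *\<^sub>R ?z))"
    unfolding G_def[abs_def] by (rule convolution_pd[OF ch(1) h(2)[unfolded unit_box_def] sm])
  moreover have "pd i G ?z = - (1 / \<epsilon>) * (LINT \<zeta>|lborel. \<Phi> (\<epsilon> *\<^sub>R \<zeta>) * pd i h (1 *\<^sub>R \<zeta> + (- (1 / \<epsilon>)) *\<^sub>R ?z))"
  proof -
    have "G = (\<lambda>z. LINT \<zeta>|lborel. \<Phi> (\<epsilon> *\<^sub>R \<zeta>) * h (1 *\<^sub>R \<zeta> + (- (1 / \<epsilon>)) *\<^sub>R z))"
      unfolding G_def[abs_def] using tr[OF ch(1) c\<Phi>(1)] by simp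
    moreover have "\<Phi> (\<epsilon> *\<^sub>R \<zeta>) = 0" if "\<zeta> \<notin> cbox (\<chi> i. - (1 / \<epsilon>)) (\<chi> i. 1 / \<epsilon>)" for \<zeta>
    proof (rule test_fun_outside[OF \<Phi>], rule notI)
      assume "\<epsilon> *\<^sub>R \<zeta> \<in> cube"
      then have "- 1 / 2 < \<epsilon> * \<zeta> $ j \<and> \<epsilon> * \<zeta> $ j < 1 / 2" for j by (auto simp: cube_def)
      then have "- 1 \<le> \<epsilon> * \<zeta> $ j \<and> \<epsilon> * \<zeta> $ j \<le> 1" for j by (smt (verit) field_sum_of_halves)
      then have "- (1 / \<epsilon>) \<le> \<zeta> $ j \<and> \<zeta> $ j \<le> 1 / \<epsilon>" for j
        using \<epsilon> by (simp add: field_simps minus_le_iff)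
      then show False using that by (simp add: mem_box_cart)
    qed
    moreover have "continuous_on UNIV (\<lambda>\<zeta>. \<Phi> (\<epsilon> *\<^sub>R \<zeta>))"
      by (intro continuous_on_compose2[OF c\<Phi>(1)] continuous_intros) auto
    ultimately show ?thesis
      using convolution_pd[of "\<lambda>\<zeta>. \<Phi> (\<epsilon> *\<^sub>R \<zeta>)" "\<chi> i. - (1 / \<epsilon>)" "\<chi> i. 1 / \<epsilon>" h i 1 "- (1 / \<epsilon>)" ?z, OF _ _ h(1)]
      by simp
  qed
  ultimately show ?thesis
    using tr[OF ch(2) c\<Phi>(1), of ?z] by (simp add: smoothen_def)
qed

text \<open>
  The integrability needed for Fubini's theorem in the duality between \<open>smoothen\<close> and its
  adjoint.
\<close>

lemma smoothen_kernel_integrable: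
  fixes f h :: "real ^ 'n::finite \<Rightarrow> real"
  assumes h: "integrable lborel h" and f: "integrable lborel f"
  shows "integrable (lborel \<Otimes>\<^sub>M lborel) (\<lambda>(\<zeta>, x). h \<zeta> * f ((1 / (1 + 4 * \<epsilon>)) *\<^sub>R (x - \<epsilon> *\<^sub>R \<zeta>)))"
    and "(LINT x|lborel. LINT \<zeta>|lborel. \<bar>h \<zeta> * f ((1 / (1 + 4 * \<epsilon>)) *\<^sub>R (x - \<epsilon> *\<^sub>R \<zeta>))\<bar>) =
      (1 + 4 * \<epsilon>) ^ CARD('n) * ((LINT \<zeta>|lborel. \<bar>h \<zeta>\<bar>) * (LINT x|lborel. \<bar>f x\<bar>))"
proof -
  let ?s = "1 + 4 * \<epsilon>"
  let ?F = "\<lambda>\<zeta> x. h \<zeta> * f ((1 / ?s) *\<^sub>R (x - \<epsilon> *\<^sub>R \<zeta>))"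
  have s: "0 < ?s" using \<epsilon> by simp
  have [measurable]: "h \<in> borel_measurable borel" "f \<in> borel_measurable borel" using h f by auto
  have m: "(\<lambda>(\<zeta>, x). ?F \<zeta> x) \<in> borel_measurable (lborel \<Otimes>\<^sub>M lborel)" by measurable
  have arg: "(1 / ?s) *\<^sub>R (x - \<epsilon> *\<^sub>R \<zeta>) = - (\<epsilon> / ?s) *\<^sub>R \<zeta> + (1 / ?s) *\<^sub>R x" for x \<zeta> :: "real ^ 'n"
    by (simp add: algebra_simps)
  have i: "integrable lborel (\<lambda>x. f ((1 / ?s) *\<^sub>R (x - \<epsilon> *\<^sub>R \<zeta>)))" for \<zeta>
    unfolding arg using s by (intro integrable_lborel_affine f) simp
  have inner: "(LINT x|lborel. \<bar>f ((1 / ?s) *\<^sub>R (x - \<epsilon> *\<^sub>R \<zeta>))\<bar>) = ?s ^ CARD('n) * (LINT x|lborel. \<bar>f x\<bar>)" for \<zeta>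
  proof -
    have "(LINT x|lborel. \<bar>f x\<bar>) = \<bar>1 / ?s\<bar> ^ CARD('n) * (LINT x|lborel. \<bar>f (- (\<epsilon> / ?s) *\<^sub>R \<zeta> + (1 / ?s) *\<^sub>R x)\<bar>)"
      using s by (intro lborel_integral_affine) auto
    then show ?thesis unfolding arg using s by (simp add: power_divide)
  qed
  have inner': "(LINT x|lborel. norm (?F \<zeta> x)) = \<bar>h \<zeta>\<bar> * (?s ^ CARD('n) * (LINT x|lborel. \<bar>f x\<bar>))" for \<zeta>
    using inner[of \<zeta>] by (simp add: abs_mult)
  show int: "integrable (lborel \<Otimes>\<^sub>M lborel) (\<lambda>(\<zeta>, x). ?F \<zeta> x)"
  proof (rule lborel_pair.Fubini_integrable[OF m])
    show "integrable lborel (\<lambda>\<zeta>. LINT x|lborel. norm (case (\<zeta>, x) of (\<zeta>, x) \<Rightarrow> ?F \<zeta> x))"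
      unfolding prod.case inner' using h by (intro integrable_mult_left integrable_abs)
    show "AE \<zeta> in lborel. integrable lborel (\<lambda>x. case (\<zeta>, x) of (\<zeta>, x) \<Rightarrow> ?F \<zeta> x)"
      using i by simp
  qed
  have "integrable (lborel \<Otimes>\<^sub>M lborel) (\<lambda>(\<zeta>, x). \<bar>?F \<zeta> x\<bar>)"
    using integrable_abs[OF int] by (simp add: case_prod_unfold)
  then have "(LINT x|lborel. LINT \<zeta>|lborel. \<bar>?F \<zeta> x\<bar>) = (LINT \<zeta>|lborel. LINT x|lborel. \<bar>?F \<zeta> x\<bar>)"
    by (rule lborel_pair.Fubini_integral)
  also have "\<dots> = (LINT \<zeta>|lborel. \<bar>h \<zeta>\<bar> * (?s ^ CARD('n) * (LINT x|lborel. \<bar>f x\<bar>)))"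
    using inner' by simp
  finally show "(LINT x|lborel. LINT \<zeta>|lborel. \<bar>?F \<zeta> x\<bar>) = ?s ^ CARD('n) * ((LINT \<zeta>|lborel. \<bar>h \<zeta>\<bar>) * (LINT x|lborel. \<bar>f x\<bar>))"
    by (simp add: mult_ac)
qed

lemma smoothen_adj_integrable:
  fixes f h :: "real ^ 'n::finite \<Rightarrow> real"
  assumes h: "integrable lborel h" and f: "integrable lborel f"
  shows "integrable lborel (smoothen_adj \<epsilon> h f)"
    and "(LINT x|lborel. \<bar>smoothen_adj \<epsilon> h f x\<bar>) \<le> (LINT \<zeta>|lborel. \<bar>h \<zeta>\<bar>) * (LINT x|lborel. \<bar>f x\<bar>)"
proof -
  let ?s = "1 + 4 * \<epsilon>"
  let ?F = "\<lambda>\<zeta> x. h \<zeta> * f ((1 / ?s) *\<^sub>R (x - \<epsilon> *\<^sub>R \<zeta>))"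
  have s: "0 < ?s" using \<epsilon> by simp
  note F = smoothen_kernel_integrable[OF h f]
  have abs: "integrable (lborel \<Otimes>\<^sub>M lborel) (\<lambda>(\<zeta>, x). \<bar>?F \<zeta> x\<bar>)"
    using integrable_abs[OF F(1)] by (simp add: case_prod_unfold)
  have 1: "integrable lborel (\<lambda>x. LINT \<zeta>|lborel. ?F \<zeta> x)"
    by (rule lborel_pair.integrable_snd[OF F(1)])
  have 2: "integrable lborel (\<lambda>x. LINT \<zeta>|lborel. \<bar>?F \<zeta> x\<bar>)"
    by (rule lborel_pair.integrable_snd[OF abs])
  show "integrable lborel (smoothen_adj \<epsilon> h f)"
    unfolding smoothen_adj_def[abs_def] using 1 by simp
  have "(LINT x|lborel. \<bar>smoothen_adj \<epsilon> h f x\<bar>) = (LINT x|lborel. \<bar>LINT \<zeta>|lborel. ?F \<zeta> x\<bar>) / ?s ^ CARD('n)"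
    using s by (simp add: smoothen_adj_def abs_divide)
  also have "\<dots> \<le> (LINT x|lborel. LINT \<zeta>|lborel. \<bar>?F \<zeta> x\<bar>) / ?s ^ CARD('n)"
    using s 1 2 by (intro divide_right_mono integral_mono integrable_abs integral_abs_bound) auto
  also have "\<dots> = (LINT \<zeta>|lborel. \<bar>h \<zeta>\<bar>) * (LINT x|lborel. \<bar>f x\<bar>)"
    unfolding F(2) using s by simp
  finally show "(LINT x|lborel. \<bar>smoothen_adj \<epsilon> h f x\<bar>) \<le> (LINT \<zeta>|lborel. \<bar>h \<zeta>\<bar>) * (LINT x|lborel. \<bar>f x\<bar>)" .
qed

lemma smoothen_adjoint:
  fixes f h \<Phi> :: "real ^ 'n::finite \<Rightarrow> real"
  assumes h: "integrable lborel h" and f: "integrable lborel f"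
    and \<Phi>: "\<Phi> \<in> borel_measurable borel" "\<And>x. \<bar>\<Phi> x\<bar> \<le> K"
  shows "(LINT y|lborel. f y * smoothen \<epsilon> h \<Phi> y) = (LINT x|lborel. smoothen_adj \<epsilon> h f x * \<Phi> x)"
proof -
  let ?s = "1 + 4 * \<epsilon>"
  have s: "0 < ?s" using \<epsilon> by simp
  have [measurable]: "h \<in> borel_measurable borel" "f \<in> borel_measurable borel" "\<Phi> \<in> borel_measurable borel"
    using h f \<Phi> by auto
  have i1: "integrable (lborel \<Otimes>\<^sub>M lborel) (\<lambda>(\<zeta>, y). (h \<zeta> * f y) * \<Phi> (\<epsilon> *\<^sub>R \<zeta> + ?s *\<^sub>R y))"
  proof -
    have "integrable (lborel \<Otimes>\<^sub>M lborel) (\<lambda>(\<zeta>, y). h \<zeta> * f y)"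
      by (rule lborel_pair.Fubini_integrable) (use h f in \<open>auto simp: abs_mult\<close>)
    then have "integrable (lborel \<Otimes>\<^sub>M lborel) (\<lambda>z. (case z of (\<zeta>, y) \<Rightarrow> h \<zeta> * f y) * (case z of (\<zeta>, y) \<Rightarrow> \<Phi> (\<epsilon> *\<^sub>R \<zeta> + ?s *\<^sub>R y)))"
      by (rule integrable_mult_bounded[where K = K]) (auto split: prod.split simp: \<Phi>(2))
    then show ?thesis by (simp add: case_prod_unfold)
  qed
  have i2: "integrable (lborel \<Otimes>\<^sub>M lborel) (\<lambda>(\<zeta>, x). (h \<zeta> * f ((1 / ?s) *\<^sub>R (x - \<epsilon> *\<^sub>R \<zeta>))) * \<Phi> x)"
  proof -
    have "integrable (lborel \<Otimes>\<^sub>M lborel) (\<lambda>z. (case z of (\<zeta>, x) \<Rightarrow> h \<zeta> * f ((1 / ?s) *\<^sub>R (x - \<epsilon> *\<^sub>R \<zeta>))) * (case z of (\<zeta>, x) \<Rightarrow> \<Phi> x))"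
      using smoothen_kernel_integrable(1)[OF h f]
      by (rule integrable_mult_bounded[where K = K]) (auto split: prod.split simp: \<Phi>(2))
    then show ?thesis by (simp add: case_prod_unfold)
  qed
  have "(LINT y|lborel. f y * smoothen \<epsilon> h \<Phi> y) = (LINT y|lborel. LINT \<zeta>|lborel. (h \<zeta> * f y) * \<Phi> (\<epsilon> *\<^sub>R \<zeta> + ?s *\<^sub>R y))"
    unfolding smoothen_def by (simp add: mult_ac flip: integral_mult_right_zero)
  also have "\<dots> = (LINT \<zeta>|lborel. LINT y|lborel. (h \<zeta> * f y) * \<Phi> (\<epsilon> *\<^sub>R \<zeta> + ?s *\<^sub>R y))"
    by (rule lborel_pair.Fubini_integral[OF i1])
  also have "\<dots> = (LINT \<zeta>|lborel. LINT x|lborel. ((h \<zeta> * f ((1 / ?s) *\<^sub>R (x - \<epsilon> *\<^sub>R \<zeta>))) * \<Phi> x) / ?s ^ CARD('n))"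
  proof (rule Bochner_Integration.integral_cong[OF refl])
    fix \<zeta> :: "real ^ 'n"
    have "(LINT y|lborel. (h \<zeta> * f y) * \<Phi> (\<epsilon> *\<^sub>R \<zeta> + ?s *\<^sub>R y)) =
        \<bar>1 / ?s\<bar> ^ CARD('n) * (LINT x|lborel. (h \<zeta> * f (- (\<epsilon> / ?s) *\<^sub>R \<zeta> + (1 / ?s) *\<^sub>R x)) *
          \<Phi> (\<epsilon> *\<^sub>R \<zeta> + ?s *\<^sub>R (- (\<epsilon> / ?s) *\<^sub>R \<zeta> + (1 / ?s) *\<^sub>R x)))"
      using s by (intro lborel_integral_affine) auto
    also have "\<dots> = \<bar>1 / ?s\<bar> ^ CARD('n) * (LINT x|lborel. (h \<zeta> * f ((1 / ?s) *\<^sub>R (x - \<epsilon> *\<^sub>R \<zeta>))) * \<Phi> x)"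
    proof -
      have 1: "- (\<epsilon> / ?s) *\<^sub>R \<zeta> + (1 / ?s) *\<^sub>R x = (1 / ?s) *\<^sub>R (x - \<epsilon> *\<^sub>R \<zeta>)" for x :: "real ^ 'n"
        by (simp add: algebra_simps)
      have 2: "\<epsilon> *\<^sub>R \<zeta> + ?s *\<^sub>R ((1 / ?s) *\<^sub>R (x - \<epsilon> *\<^sub>R \<zeta>)) = x" for x :: "real ^ 'n"
        using s by simp
      show ?thesis unfolding 1 2 ..
    qed
    also have "\<dots> = (LINT x|lborel. ((h \<zeta> * f ((1 / ?s) *\<^sub>R (x - \<epsilon> *\<^sub>R \<zeta>))) * \<Phi> x) / ?s ^ CARD('n))"
      using s by (simp add: power_divide)
    finally show "(LINT y|lborel. (h \<zeta> * f y) * \<Phi> (\<epsilon> *\<^sub>R \<zeta> + ?s *\<^sub>R y)) = \<dots>" .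
  qed
  also have "\<dots> = (LINT x|lborel. LINT \<zeta>|lborel. (h \<zeta> * f ((1 / ?s) *\<^sub>R (x - \<epsilon> *\<^sub>R \<zeta>))) * \<Phi> x) / ?s ^ CARD('n)"
    using lborel_pair.Fubini_integral[OF i2] by simp
  also have "\<dots> = (LINT x|lborel. smoothen_adj \<epsilon> h f x * \<Phi> x)"
    by (simp add: smoothen_adj_def)
  finally show ?thesis .
qed

end

section \<open>Convergence of the mollified fields\<close>

text \<open>
  An integrable function is approximated by simple functions, and their indicators by bump functions.
\<close>

lemma L1_dense_bumps:
  fixes f :: "real ^ 'n::finite \<Rightarrow> real"
  assumes f: "integrable lborel f" "\<And>x. x \<notin> cube \<Longrightarrow> f x = 0" and e: "0 < e"
  shows "\<exists>g\<in>bumps. (LINT x|lborel. \<bar>f x - g x\<bar>) < e"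
proof -
  let ?M = "restrict_space lborel (cube :: (real ^ 'n) set)"
  have sets: "sets ?M = sets borelQ" by (simp add: borelQ_def sets_restrict_space)
  have fin: "finite_measure ?M"
  proof (rule finite_measureI)
    have "emeasure lborel (cube :: (real ^ 'n) set) < \<infinity>"
      unfolding cube_eq_box by (rule emeasure_lborel_box_finite)
    then show "emeasure ?M (space ?M) \<noteq> \<infinity>"
      by (simp add: emeasure_restrict_space space_restrict_space less_top)
  qed
  have sp: "space ?M = cube" by (simp add: space_restrict_space)
  have bi: "integrable ?M g" if "g \<in> bumps" for g
    by (rule test_fun_integrable[OF bumps_test_fun[OF that] sets fin])
  have "integrable ?M f"
    using f by (simp add: integrable_restrict_space)
      (smt (verit, best) Bochner_Integration.integrable_cong indicator_simps(1,2) mult_cancel_right1 mult_eq_0_iff)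
  then have "\<exists>g\<in>bumps. (LINT x|?M. \<bar>f x - g x\<bar>) < e" using e
  proof (induction arbitrary: e rule: integrable_induct)
    case (base A c)
    have "0 < e / (\<bar>c\<bar> + 1)" using base by simp
    then obtain \<phi> where \<phi>: "\<phi> \<in> bumps" "(LINT x|?M. \<bar>\<phi> x - indicat_real A x\<bar>) < e / (\<bar>c\<bar> + 1)"
      using bumps_approx_indicator[of "{()}" "\<lambda>_. ?M" A "e / (\<bar>c\<bar> + 1)"] fin sets base(1) by auto
    have "(LINT x|?M. \<bar>indicat_real A x *\<^sub>R c - c * \<phi> x\<bar>) = (LINT x|?M. \<bar>c\<bar> * \<bar>\<phi> x - indicat_real A x\<bar>)"
      by (intro Bochner_Integration.integral_cong refl)
        (simp add: abs_mult[symmetric] abs_minus_commute right_diff_distrib mult.commute)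
    also have "\<dots> = \<bar>c\<bar> * (LINT x|?M. \<bar>\<phi> x - indicat_real A x\<bar>)" by simp
    also have "\<dots> \<le> \<bar>c\<bar> * (e / (\<bar>c\<bar> + 1))" using \<phi>(2) by (intro mult_left_mono) auto
    also have "\<dots> < e" using base(3) by (simp add: field_simps)
    finally show ?case using bumps_mult[OF \<phi>(1) bumpalg_const] by (intro bexI[of _ "\<lambda>x. c * \<phi> x"])
  next
    case (add f1 f2)
    obtain g1 where g1: "g1 \<in> bumps" "(LINT x|?M. \<bar>f1 x - g1 x\<bar>) < e / 2" using add.IH(1)[of "e/2"] add.prems by auto
    obtain g2 where g2: "g2 \<in> bumps" "(LINT x|?M. \<bar>f2 x - g2 x\<bar>) < e / 2" using add.IH(2)[of "e/2"] add.prems by auto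
    have i: "integrable ?M (\<lambda>x. \<bar>f1 x - g1 x\<bar>)" "integrable ?M (\<lambda>x. \<bar>f2 x - g2 x\<bar>)"
      using add.hyps bi[OF g1(1)] bi[OF g2(1)] by auto
    have "(LINT x|?M. \<bar>f1 x + f2 x - (g1 x + g2 x)\<bar>) \<le> (LINT x|?M. \<bar>f1 x - g1 x\<bar> + \<bar>f2 x - g2 x\<bar>)"
      using add.hyps bi[OF g1(1)] bi[OF g2(1)] by (intro integral_mono) auto
    also have "\<dots> = (LINT x|?M. \<bar>f1 x - g1 x\<bar>) + (LINT x|?M. \<bar>f2 x - g2 x\<bar>)"
      by (rule Bochner_Integration.integral_add[OF i])
    also have "\<dots> < e" using g1(2) g2(2) by simp
    finally show ?case using bumps_add[OF g1(1) g2(1)] by (intro bexI[of _ "\<lambda>x. g1 x + g2 x"])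
  next
    case (lim f' s)
    have "(\<lambda>i. LINT x|?M. \<bar>f' x - s i x\<bar>) \<longlonglongrightarrow> (LINT x|?M. 0)"
    proof (rule integral_dominated_convergence[where w = "\<lambda>x. 3 * \<bar>f' x\<bar>"])
      show "integrable ?M (\<lambda>x. 3 * \<bar>f' x\<bar>)" using lim.hyps(4) by simp
      show "(\<lambda>x. \<bar>f' x - s i x\<bar>) \<in> borel_measurable ?M" for i using lim.hyps(4) lim.hyps(1)[of i] by auto
      show "AE x in ?M. (\<lambda>i. \<bar>f' x - s i x\<bar>) \<longlonglongrightarrow> 0"
      proof (rule AE_I2)
        fix x assume "x \<in> space ?M"
        then have "(\<lambda>i. f' x - s i x) \<longlonglongrightarrow> f' x - f' x" by (intro tendsto_intros lim.hyps(2))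
        then show "(\<lambda>i. \<bar>f' x - s i x\<bar>) \<longlonglongrightarrow> 0" using tendsto_rabs_zero by fastforce
      qed
      show "AE x in ?M. norm \<bar>f' x - s i x\<bar> \<le> 3 * \<bar>f' x\<bar>" for i
      proof (rule AE_I2)
        fix x assume "x \<in> space ?M"
        then have "\<bar>s i x\<bar> \<le> 2 * \<bar>f' x\<bar>" using lim.hyps(3)[of x i] by simp
        then show "norm \<bar>f' x - s i x\<bar> \<le> 3 * \<bar>f' x\<bar>" by simp
      qed
    qed simp
    then have "\<forall>\<^sub>F i in sequentially. (LINT x|?M. \<bar>f' x - s i x\<bar>) < e / 2"
      using lim.prems by (intro order_tendstoD(2)[of _ 0]) auto
    then obtain i where i: "(LINT x|?M. \<bar>f' x - s i x\<bar>) < e / 2" using eventually_happens'[OF sequentially_bot] by blast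
    obtain g where g: "g \<in> bumps" "(LINT x|?M. \<bar>s i x - g x\<bar>) < e / 2" using lim.IH[of "e/2" i] lim.prems by auto
    have "(LINT x|?M. \<bar>f' x - g x\<bar>) \<le> (LINT x|?M. \<bar>f' x - s i x\<bar> + \<bar>s i x - g x\<bar>)"
      using lim.hyps(1)[of i] lim.hyps(4) bi[OF g(1)] by (intro integral_mono) auto
    also have "\<dots> = (LINT x|?M. \<bar>f' x - s i x\<bar>) + (LINT x|?M. \<bar>s i x - g x\<bar>)"
      using lim.hyps(1)[of i] lim.hyps(4) bi[OF g(1)] by (intro Bochner_Integration.integral_add) auto
    also have "\<dots> < e" using i g(2) by simp
    finally show ?case using g(1) by (rule bexI)
  qed
  then obtain g where g: "g \<in> bumps" "(LINT x|?M. \<bar>f x - g x\<bar>) < e" by blast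
  have "(LINT x|?M. \<bar>f x - g x\<bar>) = (LINT x|lborel. indicat_real cube x *\<^sub>R \<bar>f x - g x\<bar>)"
    by (rule integral_restrict_space) simp
  also have "\<dots> = (LINT x|lborel. \<bar>f x - g x\<bar>)"
    using f(2) test_fun_outside[OF bumps_test_fun[OF g(1)]]
    by (intro Bochner_Integration.integral_cong) (auto simp: indicator_def)
  finally show ?thesis using g by auto
qed

definition bump_kernel :: "real ^ 'n::finite \<Rightarrow> real" where
  "bump_kernel x = (1 / (LINT y|lborel. box_bump (\<chi> i. -1) (\<chi> i. 1) (y :: real ^ 'n))) * box_bump (\<chi> i. -1) (\<chi> i. 1) x"

lemma box_bump_integral_pos:
  "0 < (LINT y|lborel. box_bump (\<chi> i. -1) (\<chi> i. 1) (y :: real ^ 'n::finite))"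
  and box_bump_integrable: "integrable lborel (box_bump (\<chi> i. -1) (\<chi> i. (1 :: real)) :: real ^ 'n::finite \<Rightarrow> real)"
proof -
  let ?b = "box_bump (\<chi> i. -1) (\<chi> i. 1) :: real ^ 'n \<Rightarrow> real"
  have z: "?b x = 0" if "x \<notin> cbox (\<chi> i. -1) (\<chi> i. 1)" for x
  proof -
    have "x \<notin> box (\<chi> i. -1) (\<chi> i. 1)" using that box_subset_cbox by blast
    then show ?thesis using box_bump_pos[of "\<chi> i. -1" "\<chi> i. 1" x] box_bump_nonneg[of "\<chi> i. -1" "\<chi> i. 1" x] by simp
  qed
  show i: "integrable lborel ?b"
    using continuous_compact_support_integrable(1)[OF smooth_continuous[OF bumpalg_smooth[OF bumpalg_box_bump]] z] .
  show "0 < (LINT y|lborel. ?b y)"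
  proof (rule ccontr)
    assume "\<not> 0 < (LINT y|lborel. ?b y)"
    moreover have "0 \<le> (LINT y|lborel. ?b y)" by (intro integral_nonneg_AE) (simp add: box_bump_nonneg)
    ultimately have "(LINT y|lborel. ?b y) = 0" by simp
    then have "AE y in lborel. ?b y = 0"
      using integral_nonneg_eq_0_iff_AE[OF i] by (simp add: box_bump_nonneg)
    then have "AE y :: real ^ 'n in lborel. y \<notin> box (\<chi> i. -1) (\<chi> i. (1 :: real))"
    proof eventually_elim
      case (elim y)
      then show ?case using box_bump_pos[of "\<chi> i. -1" "\<chi> i. 1" y] by auto
    qed
    then have "box (\<chi> i. -1) (\<chi> i. (1 :: real)) \<in> null_sets (lborel :: (real ^ 'n) measure)"
      by (subst AE_iff_null_sets) auto
    then have "negligible (box (\<chi> i. -1) (\<chi> i. 1) :: (real ^ 'n) set)"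
      by (simp add: negligible_iff_null_sets null_sets_completionI)
    then have "box (\<chi> i. -1) (\<chi> i. 1) = ({} :: (real ^ 'n) set)"
      using negligible_interval(2) by blast
    moreover have "0 \<in> box (\<chi> i. -1) (\<chi> i. (1 :: real)) " by (simp add: mem_box_cart)
    ultimately show False by blast
  qed
qed

lemma bump_kernel:
  shows "bumpalg bump_kernel" "0 \<le> bump_kernel x" "x \<notin> unit_box \<Longrightarrow> bump_kernel x = 0"
    "integrable lborel (bump_kernel :: real ^ 'n::finite \<Rightarrow> real)" "(LINT x|lborel. bump_kernel (x :: real ^ 'n)) = 1"
proof -
  show "bumpalg bump_kernel" unfolding bump_kernel_def[abs_def] by (intro bumpalg_mult bumpalg_const bumpalg_box_bump)
  show "0 \<le> bump_kernel x" unfolding bump_kernel_def 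
    by (intro mult_nonneg_nonneg divide_nonneg_nonneg box_bump_nonneg less_imp_le[OF box_bump_integral_pos]) simp
  show "bump_kernel x = 0" if "x \<notin> unit_box"
  proof -
    have "x \<notin> box (\<chi> i. -1) (\<chi> i. 1)" using that box_subset_cbox unfolding unit_box_def by blast
    then show ?thesis using box_bump_pos[of "\<chi> i. -1" "\<chi> i. 1" x] box_bump_nonneg[of "\<chi> i. -1" "\<chi> i. 1" x]
      by (simp add: bump_kernel_def)
  qed
  show "integrable lborel (bump_kernel :: real ^ 'n \<Rightarrow> real)"
    unfolding bump_kernel_def[abs_def] by (intro integrable_mult_right box_bump_integrable)
  show "(LINT x|lborel. bump_kernel (x :: real ^ 'n)) = 1"
    unfolding bump_kernel_def using box_bump_integral_pos[where 'n = 'n] by simp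
qed

text \<open>
  Averages of vectors of norm at most 1 have norm at most 1; this is the point where a probability
  density is needed as kernel. Hence the adjoint does not increase defects.
\<close>

lemma smoothen_kernel_admissible:
  fixes \<Phi> :: "'n::finite list \<Rightarrow> real ^ 'n \<Rightarrow> real"
  assumes \<epsilon>: "0 < \<epsilon>" and \<Phi>: "admissible l \<Phi>"
  shows "admissible l (\<lambda>J. smoothen \<epsilon> bump_kernel (\<Phi> J))"
  unfolding admissible_def
proof (intro conjI ballI allI)
  have ck: "continuous_on UNIV (bump_kernel :: real ^ 'n \<Rightarrow> real)"
    by (intro smooth_continuous bumpalg_smooth bump_kernel)
  show "smoothen \<epsilon> bump_kernel (\<Phi> J) \<in> test_fun" if "J \<in> tidx l" for J
    by (rule smoothen_test_fun[OF \<epsilon> ck bump_kernel(3) admissible_test_fun[OF \<Phi> that]])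
  fix y
  let ?z = "\<lambda>J. smoothen \<epsilon> bump_kernel (\<Phi> J) y"
  let ?\<Phi> = "\<lambda>J \<zeta>. \<Phi> J (\<epsilon> *\<^sub>R \<zeta> + (1 + 4 * \<epsilon>) *\<^sub>R y)"
  have m: "?\<Phi> J \<in> borel_measurable lborel" if "J \<in> tidx l" for J
    using test_fun_borel[OF admissible_test_fun[OF \<Phi> that]] by simp
  have i: "integrable lborel (\<lambda>\<zeta>. bump_kernel \<zeta> * ?\<Phi> J \<zeta>)" if "J \<in> tidx l" for J
    by (rule integrable_mult_bounded[OF bump_kernel(4) m[OF that] admissible_bound[OF \<Phi> that]])
  have "(tnorm l ?z)\<^sup>2 = (\<Sum>J\<in>tidx l. ?z J * ?z J)"
    by (simp add: tnorm_def sum_nonneg power2_eq_square)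
  also have "\<dots> = (\<Sum>J\<in>tidx l. LINT \<zeta>|lborel. ?z J * (bump_kernel \<zeta> * ?\<Phi> J \<zeta>))"
    by (simp add: smoothen_def)
  also have "\<dots> = (LINT \<zeta>|lborel. (\<Sum>J\<in>tidx l. ?z J * (bump_kernel \<zeta> * ?\<Phi> J \<zeta>)))"
    using i by (intro Bochner_Integration.integral_sum[symmetric]) auto
  also have "\<dots> \<le> (LINT \<zeta>|lborel. bump_kernel (\<zeta> :: real ^ 'n) * tnorm l ?z)"
  proof (rule integral_mono)
    show "integrable lborel (\<lambda>\<zeta>. (\<Sum>J\<in>tidx l. ?z J * (bump_kernel \<zeta> * ?\<Phi> J \<zeta>)))"
      using i by (intro Bochner_Integration.integrable_sum integrable_mult_right) auto
    show "integrable lborel (\<lambda>\<zeta> :: real ^ 'n. bump_kernel \<zeta> * tnorm l ?z)"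
      by (intro integrable_mult_left bump_kernel(4))
    fix \<zeta> :: "real ^ 'n"
    have "tnorm l (\<lambda>J. ?\<Phi> J \<zeta>) \<le> 1" using \<Phi> by (simp add: tnorm_def admissible_def)
    then have "(\<Sum>J\<in>tidx l. ?z J * ?\<Phi> J \<zeta>) \<le> tnorm l ?z * 1"
      using tnorm_Cauchy_Schwarz[of ?z "\<lambda>J. ?\<Phi> J \<zeta>" l] tnorm_nonneg[of l ?z] by (meson mult_left_mono order_trans)
    then have "bump_kernel \<zeta> * (\<Sum>J\<in>tidx l. ?z J * ?\<Phi> J \<zeta>) \<le> bump_kernel \<zeta> * (tnorm l ?z * 1)"
      by (rule mult_left_mono) (rule bump_kernel(2))
    then show "(\<Sum>J\<in>tidx l. ?z J * (bump_kernel \<zeta> * ?\<Phi> J \<zeta>)) \<le> bump_kernel \<zeta> * tnorm l ?z"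
      by (simp add: sum_distrib_left mult_ac)
  qed
  also have "\<dots> = tnorm l ?z" by (simp add: bump_kernel(5))
  finally have "tnorm l ?z * tnorm l ?z \<le> 1 * tnorm l ?z" by (simp add: power2_eq_square)
  then have "tnorm l ?z \<le> 1"
    using tnorm_nonneg[of l ?z] by (cases "tnorm l ?z = 0") (auto simp: mult_le_cancel_right)
  then show "(\<Sum>J\<in>tidx l. (?z J)\<^sup>2) \<le> 1" by (simp add: tnorm_def)
qed

lemma integral_lebQ_lborel:
  fixes F :: "real ^ 'n::finite \<Rightarrow> real"
  assumes F: "integrable lborel F"
  shows "integrable lebQ F" "(LINT x|lebQ. \<bar>F x\<bar>) \<le> (LINT x|lborel. \<bar>F x\<bar>)"
proof -
  have m: "F \<in> borel_measurable borel" using F by auto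
  have il: "integrable lebesgue F" using F m by (simp add: integrable_completion)
  then have i2: "integrable lebesgue (\<lambda>x. indicat_real cube x *\<^sub>R F x)"
    using cube_sets_lebesgue by (intro integrable_mult_indicator) auto
  then show "integrable lebQ F"
    using cube_sets_lebesgue by (simp add: integrable_restrict_space)
  have "(LINT x|lebQ. \<bar>F x\<bar>) = (LINT x|lebesgue. indicat_real cube x *\<^sub>R \<bar>F x\<bar>)"
    using cube_sets_lebesgue by (intro integral_restrict_space) simp
  also have "\<dots> \<le> (LINT x|lebesgue. \<bar>F x\<bar>)"
    using il cube_sets_lebesgue by (intro integral_mono integrable_mult_indicator) (auto simp: indicator_def)
  also have "\<dots> = (LINT x|lborel. \<bar>F x\<bar>)" using m by (simp add: integral_completion)
  finally show "(LINT x|lebQ. \<bar>F x\<bar>) \<le> (LINT x|lborel. \<bar>F x\<bar>)" .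
qed

text \<open>
  For a continuous function with compact support the integrands converge pointwise and are bounded.
\<close>

lemma smoothen_adj_bump_tendsto:
  fixes g :: "real ^ 'n::finite \<Rightarrow> real"
  assumes g: "g \<in> test_fun" and \<epsilon>: "\<And>m. 0 < \<epsilon> m" "\<epsilon> \<longlonglongrightarrow> 0"
  shows "(\<lambda>m. LINT x|lebQ. \<bar>smoothen_adj (\<epsilon> m) bump_kernel g x - g x\<bar>) \<longlonglongrightarrow> 0"
proof -
  obtain K where K: "0 \<le> K" "\<And>x. \<bar>g x\<bar> \<le> K" using test_fun_bounded[OF g] by blast
  let ?s = "\<lambda>m. 1 + 4 * \<epsilon> m"
  let ?a = "\<lambda>m \<zeta> x. bump_kernel \<zeta> * g ((1 / ?s m) *\<^sub>R (x - \<epsilon> m *\<^sub>R \<zeta>))"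
  have s: "1 \<le> ?s m" for m using \<epsilon>(1)[of m] by simp
  have slim: "?s \<longlonglongrightarrow> 1" using tendsto_add[OF tendsto_const tendsto_mult[OF tendsto_const \<epsilon>(2)], of 1 4] by simp
  have [measurable]: "g \<in> borel_measurable borel" "(bump_kernel :: real ^ 'n \<Rightarrow> real) \<in> borel_measurable borel"
    using test_fun_borel[OF g] bump_kernel(4) by auto
  have ia: "integrable lborel (\<lambda>\<zeta>. ?a m \<zeta> x)" for m x
    by (rule integrable_mult_bounded[OF bump_kernel(4) _ K(2)]) simp
  have gint: "integrable lborel g"
  proof -
    obtain C where C: "compact C" "\<And>x. x \<notin> C \<Longrightarrow> g x = 0" using g by (auto simp: test_fun_def)
    have "integrable lborel (\<lambda>x. indicator C x *\<^sub>R g x)"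
      by (rule borel_integrable_compact[OF C(1) test_fun_continuous[OF g]])
    moreover have "(\<lambda>x. indicator C x *\<^sub>R g x) = g" using C(2) by (auto simp: indicator_def fun_eq_iff)
    ultimately show ?thesis by simp
  qed
  have iT: "integrable lebQ (smoothen_adj (\<epsilon> m) bump_kernel g)" for m
    by (rule integral_lebQ_lborel(1)[OF smoothen_adj_integrable(1)[OF \<epsilon>(1) bump_kernel(4) gint]])
  have ig: "integrable lebQ g" by (rule integral_lebQ_lborel(1)[OF gint])
  have bound: "\<bar>smoothen_adj (\<epsilon> m) bump_kernel g x\<bar> \<le> K" for m x
  proof -
    have "\<bar>LINT \<zeta>|lborel. ?a m \<zeta> x\<bar> \<le> K * (LINT \<zeta>|lborel. \<bar>bump_kernel (\<zeta> :: real ^ 'n)\<bar>)"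
      by (rule integral_mult_bound[OF bump_kernel(4) _ K(2)]) simp
    also have "\<dots> = K" by (simp add: bump_kernel(2,5))
    finally have "\<bar>LINT \<zeta>|lborel. ?a m \<zeta> x\<bar> \<le> K" .
    moreover have "1 \<le> ?s m ^ CARD('n)" using s by (rule one_le_power)
    ultimately have "\<bar>LINT \<zeta>|lborel. ?a m \<zeta> x\<bar> / ?s m ^ CARD('n) \<le> K / 1"
      using K(1) by (intro frac_le) auto
    then show ?thesis using s[of m] by (simp add: smoothen_adj_def abs_divide)
  qed
  have pt: "(\<lambda>m. smoothen_adj (\<epsilon> m) bump_kernel g x) \<longlonglongrightarrow> g x" for x
  proof -
    have "(\<lambda>m. LINT \<zeta>|lborel. ?a m \<zeta> x) \<longlonglongrightarrow> (LINT \<zeta>|lborel. bump_kernel (\<zeta> :: real ^ 'n) * g x)"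
    proof (rule integral_dominated_convergence[where w = "\<lambda>\<zeta>. K * bump_kernel \<zeta>"])
      show "integrable lborel (\<lambda>\<zeta> :: real ^ 'n. K * bump_kernel \<zeta>)"
        by (intro integrable_mult_right bump_kernel(4))
      show "AE \<zeta> in lborel. (\<lambda>m. ?a m \<zeta> x) \<longlonglongrightarrow> bump_kernel \<zeta> * g x"
      proof (rule AE_I2)
        fix \<zeta> :: "real ^ 'n"
        have "(\<lambda>m. (1 / ?s m) *\<^sub>R (x - \<epsilon> m *\<^sub>R \<zeta>)) \<longlonglongrightarrow> (1 / 1) *\<^sub>R (x - 0 *\<^sub>R \<zeta>)"
          by (intro tendsto_intros slim \<epsilon>) simp
        then have "(\<lambda>m. (1 / ?s m) *\<^sub>R (x - \<epsilon> m *\<^sub>R \<zeta>)) \<longlonglongrightarrow> x" by simp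
        moreover have "isCont g x" using test_fun_continuous[OF g, of UNIV] by (simp add: continuous_on_eq_continuous_at)
        ultimately show "(\<lambda>m. ?a m \<zeta> x) \<longlonglongrightarrow> bump_kernel \<zeta> * g x"
          by (intro tendsto_mult[OF tendsto_const] isCont_tendsto_compose[of x g])
      qed
      show "AE \<zeta> in lborel. norm (?a m \<zeta> x) \<le> K * bump_kernel \<zeta>" for m
      proof (rule AE_I2)
        fix \<zeta> :: "real ^ 'n"
        have "norm (?a m \<zeta> x) = bump_kernel \<zeta> * \<bar>g ((1 / ?s m) *\<^sub>R (x - \<epsilon> m *\<^sub>R \<zeta>))\<bar>"
          by (simp only: real_norm_def abs_mult abs_of_nonneg[OF bump_kernel(2)])
        also have "\<dots> \<le> bump_kernel \<zeta> * K" by (intro mult_left_mono K bump_kernel(2))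
        finally show "norm (?a m \<zeta> x) \<le> K * bump_kernel \<zeta>" by (simp only: mult.commute)
      qed
    qed simp_all
    also have "(LINT \<zeta>|lborel. bump_kernel (\<zeta> :: real ^ 'n) * g x) = g x" by (simp add: bump_kernel(5))
    finally have "(\<lambda>m. (LINT \<zeta>|lborel. ?a m \<zeta> x) / ?s m ^ CARD('n)) \<longlonglongrightarrow> g x / 1 ^ CARD('n)"
      by (intro tendsto_divide tendsto_power slim) auto
    then show ?thesis by (simp add: smoothen_adj_def)
  qed
  have "(\<lambda>m. LINT x|lebQ. \<bar>smoothen_adj (\<epsilon> m) bump_kernel g x - g x\<bar>) \<longlonglongrightarrow> (LINT x|(lebQ :: (real ^ 'n) measure). 0)"
  proof (rule integral_dominated_convergence[where w = "\<lambda>x. 2 * K"])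
    show "integrable lebQ (\<lambda>x :: real ^ 'n. 2 * K)" by (rule finite_measure.integrable_const[OF finite_lebQ])
    show "AE x in lebQ. (\<lambda>m. \<bar>smoothen_adj (\<epsilon> m) bump_kernel g x - g x\<bar>) \<longlonglongrightarrow> 0"
      using tendsto_rabs_zero[OF LIM_zero[OF pt]] by (intro AE_I2)
    show "AE x in lebQ. norm \<bar>smoothen_adj (\<epsilon> m) bump_kernel g x - g x\<bar> \<le> 2 * K" for m
    proof (rule AE_I2)
      fix x show "norm \<bar>smoothen_adj (\<epsilon> m) bump_kernel g x - g x\<bar> \<le> 2 * K"
        using bound[of m x] K(2)[of x] by simp
    qed
    show "(\<lambda>x. \<bar>smoothen_adj (\<epsilon> m) bump_kernel g x - g x\<bar>) \<in> borel_measurable lebQ" for m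
      using iT[of m] ig by auto
  qed simp
  then show ?thesis by simp
qed

text \<open>
  Uniform boundedness of the adjoints on \<open>L\<^sup>1\<close> and density of bump functions.
\<close>

lemma smoothen_adj_tendsto:
  fixes f :: "real ^ 'n::finite \<Rightarrow> real"
  assumes f: "integrable lborel f" "\<And>x. x \<notin> cube \<Longrightarrow> f x = 0" and \<epsilon>: "\<And>m. 0 < \<epsilon> m" "\<epsilon> \<longlonglongrightarrow> 0"
  shows "(\<lambda>m. LINT x|lebQ. \<bar>smoothen_adj (\<epsilon> m) bump_kernel f x - f x\<bar>) \<longlonglongrightarrow> 0"
proof (rule LIMSEQ_I)
  fix r :: real assume "0 < r"
  then have "0 < r / 3" by simp
  then obtain g where g: "g \<in> bumps" "(LINT x|lborel. \<bar>f x - g x\<bar>) < r / 3" using L1_dense_bumps[OF f] by blast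
  have tg: "g \<in> test_fun" by (rule bumps_test_fun[OF g(1)])
  obtain C where C: "compact C" "\<And>x. x \<notin> C \<Longrightarrow> g x = 0" using tg by (auto simp: test_fun_def)
  have gint: "integrable lborel g"
  proof -
    have "integrable lborel (\<lambda>x. indicator C x *\<^sub>R g x)"
      by (rule borel_integrable_compact[OF C(1) test_fun_continuous[OF tg]])
    moreover have "(\<lambda>x. indicator C x *\<^sub>R g x) = g" using C(2) by (auto simp: indicator_def fun_eq_iff)
    ultimately show ?thesis by simp
  qed
  have d: "integrable lborel (\<lambda>x. f x - g x)" using f gint by simp
  let ?T = "\<lambda>m. smoothen_adj (\<epsilon> m) bump_kernel"
  obtain M where M: "\<And>m. M \<le> m \<Longrightarrow> (LINT x|lebQ. \<bar>?T m g x - g x\<bar>) < r / 3"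
    using LIMSEQ_D[OF smoothen_adj_bump_tendsto[OF tg \<epsilon>] \<open>0 < r / 3\<close>] by auto
  have "norm ((LINT x|lebQ. \<bar>?T m f x - f x\<bar>) - 0) < r" if "M \<le> m" for m
  proof -
    have iT: "integrable lborel (?T m h)" if "integrable lborel h" for h
      by (rule smoothen_adj_integrable(1)[OF \<epsilon>(1) bump_kernel(4) that])
    note iQ = integral_lebQ_lborel(1)
    have [measurable]: "g \<in> borel_measurable borel" "f \<in> borel_measurable borel" using f gint by auto
    have split: "AE x in lborel. ?T m f x = ?T m (\<lambda>x. f x - g x) x + ?T m g x"
    proof -
      have *: "AE x in lborel. integrable lborel (\<lambda>\<zeta>. bump_kernel \<zeta> * h ((1 / (1 + 4 * \<epsilon> m)) *\<^sub>R (x - \<epsilon> m *\<^sub>R \<zeta>)))"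
        if h: "integrable lborel h" for h :: "real ^ 'n \<Rightarrow> real"
        using lborel_pair.AE_integrable_snd[OF smoothen_kernel_integrable(1)[OF \<epsilon>(1) bump_kernel(4) h]] by simp
      show ?thesis
        using *[OF f(1)] *[OF gint]
        by eventually_elim (simp add: smoothen_adj_def right_diff_distrib diff_divide_distrib)
    qed
    have splitQ: "AE x in lebQ. \<bar>?T m f x - f x\<bar> \<le> \<bar>?T m (\<lambda>x. f x - g x) x\<bar> + (\<bar>?T m g x - g x\<bar> + \<bar>f x - g x\<bar>)"
      unfolding AE_lebQ_iff using AE_completion[OF split] by eventually_elim auto
    have "(LINT x|lebQ. \<bar>?T m f x - f x\<bar>) \<le>
        (LINT x|lebQ. \<bar>?T m (\<lambda>x. f x - g x) x\<bar> + (\<bar>?T m g x - g x\<bar> + \<bar>f x - g x\<bar>))"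
      by (intro integral_mono_AE splitQ integrable_abs Bochner_Integration.integrable_add Bochner_Integration.integrable_diff iQ iT d f(1) gint)
    also have "\<dots> = (LINT x|lebQ. \<bar>?T m (\<lambda>x. f x - g x) x\<bar>) + ((LINT x|lebQ. \<bar>?T m g x - g x\<bar>) + (LINT x|lebQ. \<bar>f x - g x\<bar>))"
      by (subst Bochner_Integration.integral_add, (intro integrable_abs Bochner_Integration.integrable_add Bochner_Integration.integrable_diff iQ iT d f(1) gint)+,
        subst Bochner_Integration.integral_add, (intro integrable_abs Bochner_Integration.integrable_add Bochner_Integration.integrable_diff iQ iT d f(1) gint)+, rule refl)
    also have "(LINT x|lebQ. \<bar>?T m (\<lambda>x. f x - g x) x\<bar>) \<le> (LINT x|lborel. \<bar>f x - g x\<bar>)"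
    proof -
      have "(LINT x|lebQ. \<bar>?T m (\<lambda>x. f x - g x) x\<bar>) \<le> (LINT x|lborel. \<bar>?T m (\<lambda>x. f x - g x) x\<bar>)"
        by (rule integral_lebQ_lborel(2)[OF iT[OF d]])
      also have "\<dots> \<le> (LINT \<zeta>|lborel. \<bar>bump_kernel (\<zeta> :: real ^ 'n)\<bar>) * (LINT x|lborel. \<bar>f x - g x\<bar>)"
        by (rule smoothen_adj_integrable(2)[OF \<epsilon>(1) bump_kernel(4) d])
      also have "\<dots> = (LINT x|lborel. \<bar>f x - g x\<bar>)" by (simp add: bump_kernel(2,5))
      finally show ?thesis .
    qed
    also have "(LINT x|lebQ. \<bar>f x - g x\<bar>) \<le> (LINT x|lborel. \<bar>f x - g x\<bar>)" by (rule integral_lebQ_lborel(2)[OF d])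
    finally have "(LINT x|lebQ. \<bar>?T m f x - f x\<bar>) < r" using M[OF that] g(2) by linarith
    moreover have "0 \<le> (LINT x|lebQ. \<bar>?T m f x - f x\<bar>)" by (intro integral_nonneg_AE) simp
    ultimately show ?thesis by simp
  qed
  then show "\<exists>no. \<forall>n\<ge>no. norm ((LINT x|lebQ. \<bar>?T n f x - f x\<bar>) - 0) < r" by blast
qed

section \<open>Recovery fields\<close>

text \<open>
  Such a field belongs to \<open>BVB l A\<close> for every operator \<open>A\<close>, with an integrable density
  that depends continuously on the coefficients of \<open>A\<close>.
\<close>

definition weak_gradient :: "nat \<Rightarrow> 'n::finite tfun \<Rightarrow> ('n \<Rightarrow> 'n tfun) \<Rightarrow> bool" where
  "weak_gradient l w g \<longleftrightarrow> w \<in> L1 l \<and> (\<forall>i. g i \<in> L1 l) \<and>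
    (\<forall>i. \<forall>I\<in>tidx l. \<forall>\<phi>\<in>test_fun. (LINT x|lebQ. w x I * pd i \<phi> x) = - (LINT x|lebQ. g i x I * \<phi> x))"

lemma dist_op_weak_gradient:
  assumes "weak_gradient l w g" "\<phi> \<in> test_fun"
  shows "dist_op l A w J \<phi> = (\<Sum>i\<in>UNIV. \<Sum>I\<in>tidx l. A i J I * (LINT x|lebQ. g i x I * \<phi> x))"
  using assms by (simp add: dist_op_def weak_gradient_def sum_negf)

lemma weak_gradient_BVB:
  assumes w: "weak_gradient l w g"
  shows "w \<in> BVB l A"
proof -
  define f where "f x J = (\<Sum>i\<in>UNIV. \<Sum>I\<in>tidx l. A i J I * g i x I)" for x J
  have g: "integrable lebQ (\<lambda>x. g i x I)" if "I \<in> tidx l" for i I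
    using w that L1D[of "g i" l] by (simp add: weak_gradient_def)
  have f: "f \<in> L1 (Suc l)"
    unfolding L1_def f_def using g
    by (intro CollectI ballI Bochner_Integration.integrable_sum integrable_mult_right) auto
  have "represents l A w (density_meas f)"
    unfolding represents_def
  proof (intro conjI ballI density_meas_Mb f)
    fix J :: "'a list" and \<phi> :: "real ^ 'a \<Rightarrow> real" assume J: "J \<in> tidx (Suc l)" and \<phi>: "\<phi> \<in> test_fun"
    have i: "integrable lebQ (\<lambda>x. A i J I * (g i x I * \<phi> x))" if "I \<in> tidx l" for i I
      using integrable_mult_test_fun[OF g[OF that] \<phi>] by simp
    have "signed_integral (\<lambda>S. density_meas f S J) \<phi> = (LINT x|lebQ. f x J * \<phi> x)"
      by (rule signed_integral_density_meas[OF f J \<phi>])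
    also have "\<dots> = (LINT x|lebQ. (\<Sum>i\<in>UNIV. \<Sum>I\<in>tidx l. A i J I * (g i x I * \<phi> x)))"
      by (simp add: f_def sum_distrib_right mult.assoc)
    also have "\<dots> = (\<Sum>i\<in>UNIV. LINT x|lebQ. (\<Sum>I\<in>tidx l. A i J I * (g i x I * \<phi> x)))"
      using i by (intro Bochner_Integration.integral_sum Bochner_Integration.integrable_sum) auto
    also have "\<dots> = (\<Sum>i\<in>UNIV. \<Sum>I\<in>tidx l. LINT x|lebQ. A i J I * (g i x I * \<phi> x))"
      using i by (intro sum.cong refl Bochner_Integration.integral_sum) auto
    finally show "dist_op l A w J \<phi> = signed_integral (\<lambda>S. density_meas f S J) \<phi>"
      by (simp add: dist_op_weak_gradient[OF w \<phi>])
  qed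
  then show ?thesis using w unfolding BVB_def weak_gradient_def by blast
qed

lemma defect_change_operator:
  assumes w: "weak_gradient l w g"
  shows "defect l A' w f \<le> defect l A w f +
    ennreal (\<Sum>J\<in>tidx (Suc l). \<Sum>i\<in>UNIV. \<Sum>I\<in>tidx l. \<bar>A' i J I - A i J I\<bar> * (LINT x|lebQ. \<bar>g i x I\<bar>))"
  unfolding defect_def[of l A' w f]
proof (rule SUP_least)
  fix \<Phi> :: "'a list \<Rightarrow> real ^ 'a \<Rightarrow> real" assume "\<Phi> \<in> Collect (admissible (Suc l))"
  then have \<Phi>: "admissible (Suc l) \<Phi>" by simp
  let ?c = "\<Sum>J\<in>tidx (Suc l). \<Sum>i\<in>UNIV. \<Sum>I\<in>tidx l. \<bar>A' i J I - A i J I\<bar> * (LINT x|lebQ. \<bar>g i x I\<bar>)"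
  have "defect_pair l A' w f \<Phi> \<le> defect_pair l A w f \<Phi> + ?c"
    unfolding defect_pair_def sum.distrib[symmetric]
  proof (rule sum_mono)
    fix J :: "'a list" assume J: "J \<in> tidx (Suc l)"
    note t = admissible_test_fun[OF \<Phi> J]
    have "dist_op l A' w J (\<Phi> J) - dist_op l A w J (\<Phi> J) =
        (\<Sum>i\<in>UNIV. \<Sum>I\<in>tidx l. (A' i J I - A i J I) * (LINT x|lebQ. g i x I * \<Phi> J x))"
      by (simp add: dist_op_weak_gradient[OF w t] sum_subtractf left_diff_distrib)
    also have "\<dots> \<le> (\<Sum>i\<in>UNIV. \<Sum>I\<in>tidx l. \<bar>A' i J I - A i J I\<bar> * (LINT x|lebQ. \<bar>g i x I\<bar>))"
    proof (intro sum_mono)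
      fix i and I :: "'a list" assume I: "I \<in> tidx l"
      have "integrable lebQ (\<lambda>x. g i x I)" using w I L1D[of "g i" l] by (simp add: weak_gradient_def)
      then have "\<bar>LINT x|lebQ. g i x I * \<Phi> J x\<bar> \<le> 1 * (LINT x|lebQ. \<bar>g i x I\<bar>)"
        using test_fun_lebQ[OF t] admissible_bound[OF \<Phi> J] by (rule integral_mult_bound)
      then have "\<bar>A' i J I - A i J I\<bar> * \<bar>LINT x|lebQ. g i x I * \<Phi> J x\<bar> \<le> \<bar>A' i J I - A i J I\<bar> * (LINT x|lebQ. \<bar>g i x I\<bar>)"
        by (intro mult_left_mono) auto
      then show "(A' i J I - A i J I) * (LINT x|lebQ. g i x I * \<Phi> J x) \<le> \<bar>A' i J I - A i J I\<bar> * (LINT x|lebQ. \<bar>g i x I\<bar>)"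
        unfolding abs_mult[symmetric] by linarith
    qed
    finally show "dist_op l A' w J (\<Phi> J) - (LINT x|lebQ. f x J * \<Phi> J x) \<le>
        dist_op l A w J (\<Phi> J) - (LINT x|lebQ. f x J * \<Phi> J x) +
        (\<Sum>i\<in>UNIV. \<Sum>I\<in>tidx l. \<bar>A' i J I - A i J I\<bar> * (LINT x|lebQ. \<bar>g i x I\<bar>))" by simp
  qed
  then have "ennreal (defect_pair l A' w f \<Phi>) \<le> ennreal (defect_pair l A w f \<Phi> + ?c)" by (rule ennreal_leI)
  also have "\<dots> \<le> ennreal (defect_pair l A w f \<Phi>) + ennreal ?c" by (rule ennreal_add_le)
  also have "\<dots> \<le> defect l A w f + ennreal ?c"
    by (intro add_right_mono ennreal_defect_pair_le \<Phi>)
  finally show "ennreal (defect_pair l A' w f \<Phi>) \<le> \<dots>" .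
qed

definition borel_rep :: "(real ^ 'n::finite \<Rightarrow> real) \<Rightarrow> (real ^ 'n \<Rightarrow> real)" where
  "borel_rep f = (SOME f'. f' \<in> borel_measurable borel \<and> integrable lborel f' \<and> (\<forall>x. x \<notin> cube \<longrightarrow> f' x = (0::real)) \<and>
    (AE x in lebesgue. x \<in> cube \<longrightarrow> f x = f' x) \<and>
    (\<forall>\<phi>\<in>borel_measurable borel. (LINT x|lebQ. f x * \<phi> x) = (LINT x|lborel. f' x * \<phi> x)))"

lemma borel_rep:
  assumes "integrable lebQ f"
  shows "integrable lborel (borel_rep f)" "x \<notin> cube \<Longrightarrow> borel_rep f x = 0"
    "AE x in lebQ. f x = borel_rep f x"
    "\<phi> \<in> borel_measurable borel \<Longrightarrow> (LINT x|lebQ. f x * \<phi> x) = (LINT x|lborel. borel_rep f x * \<phi> x)"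
  using someI_ex[OF borel_representative[OF assms], folded borel_rep_def] unfolding AE_lebQ_iff by blast+

lemma lborel_lebQ_mult:
  assumes F: "integrable lborel F" and \<phi>: "\<phi> \<in> test_fun"
  shows "(LINT x|lborel. F x * \<phi> x) = (LINT x|lebQ. F x * \<phi> x)"
proof -
  have m: "(\<lambda>x. F x * \<phi> x) \<in> borel_measurable borel" using F test_fun_borel[OF \<phi>] by auto
  have "(LINT x|lebQ. F x * \<phi> x) = (LINT x|lebesgue. indicat_real cube x *\<^sub>R (F x * \<phi> x))"
    using cube_sets_lebesgue by (intro integral_restrict_space) simp
  also have "\<dots> = (LINT x|lebesgue. F x * \<phi> x)"
    using test_fun_outside[OF \<phi>] by (intro Bochner_Integration.integral_cong) (auto simp: indicator_def)
  also have "\<dots> = (LINT x|lborel. F x * \<phi> x)" using m by (intro integral_completion) simp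
  finally show ?thesis by simp
qed

text \<open>
  With \<open>T\<close> the map \<open>smoothen\<close> and \<open>s = 1 + 4\<epsilon>\<close>, one has \<open>\<partial>\<^sub>i (T \<Phi>) = s T (\<partial>\<^sub>i \<Phi>)\<close>, hence
  \<open>\<langle>A (s T\<^sup>* w), \<Phi>\<rangle> = \<langle>A w, T \<Phi>\<rangle>\<close>. So for the field \<open>s T\<^sup>* w\<close> the defect with target \<open>T\<^sup>* f\<close> is at most
  the defect of \<open>w\<close> with target \<open>f\<close>, for all \<open>A\<close> at once, and \<open>T\<^sup>* f\<close> is close to \<open>f\<close> in \<open>L\<^sup>1\<close>.
\<close>

lemma smooth_competitor:
  fixes w f :: "'n::finite tfun"
  assumes w: "w \<in> L1 l" and f: "f \<in> L1 (Suc l)" and e: "0 < e"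
  shows "\<exists>w' g. weak_gradient l w' g \<and> (\<forall>I\<in>tidx l. (LINT x|lebQ. \<bar>w' x I - w x I\<bar>) < e) \<and>
    (\<forall>A. defect l A w' f \<le> defect l A w f + ennreal e)"
proof -
  define \<epsilon> where "\<epsilon> m = 1 / real (Suc m)" for m
  have \<epsilon>: "0 < \<epsilon> m" "\<epsilon> \<longlonglongrightarrow> 0" for m
    using LIMSEQ_inverse_real_of_nat by (auto simp: \<epsilon>_def[abs_def] inverse_eq_divide)
  let ?T = "\<lambda>m h. smoothen_adj (\<epsilon> m) bump_kernel (borel_rep h)"
  let ?s = "\<lambda>m. 1 + 4 * \<epsilon> m"
  have iT: "integrable lborel (?T m h)" if "integrable lebQ h" for m h
    by (rule smoothen_adj_integrable(1)[OF \<epsilon>(1) bump_kernel(4) borel_rep(1)[OF that]])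
  have iTQ: "integrable lebQ (?T m h)" if "integrable lebQ h" for m h
    by (rule integral_lebQ_lborel(1)[OF iT[OF that]])
  have T: "(\<lambda>m. LINT x|lebQ. \<bar>?T m h x - h x\<bar>) \<longlonglongrightarrow> 0" if h: "integrable lebQ h" for h
  proof -
    have "(LINT x|lebQ. \<bar>?T m h x - h x\<bar>) = (LINT x|lebQ. \<bar>?T m h x - borel_rep h x\<bar>)" for m
    proof (rule integral_cong_lebQ_AE)
      show "AE x in lebQ. \<bar>?T m h x - h x\<bar> = \<bar>?T m h x - borel_rep h x\<bar>"
        using borel_rep(3)[OF h] by eventually_elim simp
    qed (use iTQ[OF h] h integral_lebQ_lborel(1)[OF borel_rep(1)[OF h]] in auto)
    then show ?thesis using smoothen_adj_tendsto[OF borel_rep(1,2)[OF h] \<epsilon>] by simp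
  qed
  have sT: "(\<lambda>m. LINT x|lebQ. \<bar>?s m * ?T m h x - h x\<bar>) \<longlonglongrightarrow> 0" if h: "integrable lebQ h" for h
  proof (rule tendsto_sandwich[OF _ _ tendsto_const])
    show "(\<lambda>m. ?s m * (LINT x|lebQ. \<bar>?T m h x - h x\<bar>) + 4 * \<epsilon> m * (LINT x|lebQ. \<bar>h x\<bar>)) \<longlonglongrightarrow> 0"
      using tendsto_add[OF tendsto_mult[OF tendsto_add[OF tendsto_const tendsto_mult[OF tendsto_const \<epsilon>(2)]] T[OF h]]
          tendsto_mult[OF tendsto_mult[OF tendsto_const \<epsilon>(2)] tendsto_const], of 1 4 4] by simp
    have "(LINT x|lebQ. \<bar>?s m * ?T m h x - h x\<bar>) \<le> ?s m * (LINT x|lebQ. \<bar>?T m h x - h x\<bar>) + 4 * \<epsilon> m * (LINT x|lebQ. \<bar>h x\<bar>)" for m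
    proof -
      have i: "integrable lebQ (\<lambda>x. \<bar>?T m h x - h x\<bar>)" "integrable lebQ (\<lambda>x. \<bar>h x\<bar>)" using iTQ[OF h, of m] h by auto
      have "(LINT x|lebQ. \<bar>?s m * ?T m h x - h x\<bar>) \<le> (LINT x|lebQ. ?s m * \<bar>?T m h x - h x\<bar> + 4 * \<epsilon> m * \<bar>h x\<bar>)"
      proof (rule integral_mono)
        show "integrable lebQ (\<lambda>x. \<bar>?s m * ?T m h x - h x\<bar>)" using iTQ[OF h, of m] h by auto
        show "integrable lebQ (\<lambda>x. ?s m * \<bar>?T m h x - h x\<bar> + 4 * \<epsilon> m * \<bar>h x\<bar>)" using i by auto
        fix x
        have "?s m * ?T m h x - h x = ?s m * (?T m h x - h x) + 4 * \<epsilon> m * h x" by (simp add: algebra_simps)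
        also have "\<bar>\<dots>\<bar> \<le> \<bar>?s m * (?T m h x - h x)\<bar> + \<bar>4 * \<epsilon> m * h x\<bar>" by (rule abs_triangle_ineq)
        also have "\<dots> = ?s m * \<bar>?T m h x - h x\<bar> + 4 * \<epsilon> m * \<bar>h x\<bar>" using \<epsilon>(1)[of m] by (simp add: abs_mult)
        finally show "\<bar>?s m * ?T m h x - h x\<bar> \<le> ?s m * \<bar>?T m h x - h x\<bar> + 4 * \<epsilon> m * \<bar>h x\<bar>" .
      qed
      also have "\<dots> = ?s m * (LINT x|lebQ. \<bar>?T m h x - h x\<bar>) + 4 * \<epsilon> m * (LINT x|lebQ. \<bar>h x\<bar>)"
        using i by (subst Bochner_Integration.integral_add) auto
      finally show ?thesis .
    qed
    then show "\<forall>\<^sub>F m in sequentially. (LINT x|lebQ. \<bar>?s m * ?T m h x - h x\<bar>) \<le>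
        ?s m * (LINT x|lebQ. \<bar>?T m h x - h x\<bar>) + 4 * \<epsilon> m * (LINT x|lebQ. \<bar>h x\<bar>)" by simp
    show "\<forall>\<^sub>F m in sequentially. 0 \<le> (LINT x|lebQ. \<bar>?s m * ?T m h x - h x\<bar>)"
      by (intro always_eventually allI integral_nonneg_AE) simp
  qed
  have "\<forall>\<^sub>F m in sequentially. \<forall>I\<in>tidx l. (LINT x|lebQ. \<bar>?s m * ?T m (\<lambda>x. w x I) x - w x I\<bar>) < e"
    by (intro eventually_ball_finite finite_tidx ballI order_tendstoD(2)[OF sT[OF L1D[OF w]] e])
  moreover have "\<forall>\<^sub>F m in sequentially. (\<Sum>J\<in>tidx (Suc l). LINT x|lebQ. \<bar>?T m (\<lambda>x. f x J) x - f x J\<bar>) < e"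
  proof (rule order_tendstoD(2)[OF _ e])
    have "(\<lambda>m. \<Sum>J\<in>tidx (Suc l). LINT x|lebQ. \<bar>?T m (\<lambda>x. f x J) x - f x J\<bar>) \<longlonglongrightarrow> (\<Sum>J\<in>(tidx (Suc l) :: 'n list set). 0)"
      by (intro tendsto_sum T L1D[OF f])
    then show "(\<lambda>m. \<Sum>J\<in>tidx (Suc l). LINT x|lebQ. \<bar>?T m (\<lambda>x. f x J) x - f x J\<bar>) \<longlonglongrightarrow> 0" by simp
  qed
  ultimately have "\<forall>\<^sub>F m in sequentially. (\<forall>I\<in>tidx l. (LINT x|lebQ. \<bar>?s m * ?T m (\<lambda>x. w x I) x - w x I\<bar>) < e) \<and>
     (\<Sum>J\<in>tidx (Suc l). LINT x|lebQ. \<bar>?T m (\<lambda>x. f x J) x - f x J\<bar>) < e"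
    by (rule eventually_conj)
  then obtain m where m: "\<And>I. I \<in> tidx l \<Longrightarrow> (LINT x|lebQ. \<bar>?s m * ?T m (\<lambda>x. w x I) x - w x I\<bar>) < e"
    "(\<Sum>J\<in>tidx (Suc l). LINT x|lebQ. \<bar>?T m (\<lambda>x. f x J) x - f x J\<bar>) < e"
    using eventually_happens'[OF sequentially_bot] by blast
  let ?\<epsilon> = "\<epsilon> m" and ?S = "?s m"
  have sk: "smooth (bump_kernel :: real ^ 'n \<Rightarrow> real)" by (intro bumpalg_smooth bump_kernel)
  have ck: "continuous_on UNIV (bump_kernel :: real ^ 'n \<Rightarrow> real)" by (rule smooth_continuous[OF sk])
  have pk0: "pd i bump_kernel x = 0" if "x \<notin> unit_box" for i and x :: "real ^ 'n"
  proof (rule pd_eq_0_outside[OF _ bump_kernel(3) that])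
    show "closed (unit_box :: (real ^ 'n) set)" by (simp add: unit_box_def closed_cbox)
  qed
  have pk: "integrable lborel (pd i bump_kernel :: real ^ 'n \<Rightarrow> real)" for i
    using continuous_compact_support_integrable(1)[OF smooth_continuous[OF smooth_pd[OF sk]] pk0[unfolded unit_box_def]] .
  have adj: "(LINT x|lebQ. h x * smoothen ?\<epsilon> k \<phi> x) = (LINT x|lebQ. smoothen_adj ?\<epsilon> k (borel_rep h) x * \<phi> x)"
    if h: "integrable lebQ h" and k: "integrable lborel k" and \<phi>: "\<phi> \<in> test_fun"
      and sm: "smoothen ?\<epsilon> k \<phi> \<in> borel_measurable borel" for h k \<phi>
  proof -
    obtain K where K: "\<And>x. \<bar>\<phi> x\<bar> \<le> K" using test_fun_bounded[OF \<phi>] by blast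
    have "(LINT x|lebQ. h x * smoothen ?\<epsilon> k \<phi> x) = (LINT x|lborel. borel_rep h x * smoothen ?\<epsilon> k \<phi> x)"
      by (rule borel_rep(4)[OF h sm])
    also have "\<dots> = (LINT x|lborel. smoothen_adj ?\<epsilon> k (borel_rep h) x * \<phi> x)"
      by (rule smoothen_adjoint[OF \<epsilon>(1) k borel_rep(1)[OF h] test_fun_borel[OF \<phi>] K])
    also have "\<dots> = (LINT x|lebQ. smoothen_adj ?\<epsilon> k (borel_rep h) x * \<phi> x)"
      by (rule lborel_lebQ_mult[OF smoothen_adj_integrable(1)[OF \<epsilon>(1) k borel_rep(1)[OF h]] \<phi>])
    finally show ?thesis .
  qed
  have smb: "smoothen ?\<epsilon> bump_kernel \<phi> \<in> borel_measurable borel" if "\<phi> \<in> test_fun" for \<phi> :: "real ^ 'n \<Rightarrow> real"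
    by (rule test_fun_borel[OF smoothen_test_fun[OF \<epsilon>(1) ck bump_kernel(3) that]])
  have smp: "smoothen ?\<epsilon> (pd i bump_kernel) \<phi> \<in> borel_measurable borel" if "\<phi> \<in> test_fun" for i and \<phi> :: "real ^ 'n \<Rightarrow> real"
    by (rule test_fun_borel[OF smoothen_test_fun[OF \<epsilon>(1) smooth_continuous[OF smooth_pd[OF sk]] pk0 that]])
  define w' where "w' x I = ?S * ?T m (\<lambda>x. w x I) x" for x I
  define g where "g i x I = (?S / ?\<epsilon>) * smoothen_adj ?\<epsilon> (pd i bump_kernel) (borel_rep (\<lambda>x. w x I)) x" for i x I
  have pair: "(LINT x|lebQ. w' x I * \<phi> x) = ?S * (LINT x|lebQ. w x I * smoothen ?\<epsilon> bump_kernel \<phi> x)"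
    if I: "I \<in> tidx l" and \<phi>: "\<phi> \<in> test_fun" for I \<phi>
    unfolding w'_def mult.assoc adj[OF L1D[OF w I] bump_kernel(4) \<phi> smb[OF \<phi>]] by simp
  have wg: "weak_gradient l w' g"
    unfolding weak_gradient_def
  proof (intro conjI allI ballI)
    show "w' \<in> L1 l" unfolding L1_def w'_def using iTQ[OF L1D[OF w]] by auto
    show "g i \<in> L1 l" for i
      unfolding L1_def g_def
      using integral_lebQ_lborel(1)[OF smoothen_adj_integrable(1)[OF \<epsilon>(1) pk borel_rep(1)[OF L1D[OF w]]]] by auto
    fix i and I :: "'n list" and \<phi> :: "real ^ 'n \<Rightarrow> real" assume I: "I \<in> tidx l" and \<phi>: "\<phi> \<in> test_fun"
    have "(LINT x|lebQ. w' x I * pd i \<phi> x) = ?S * (LINT x|lebQ. w x I * smoothen ?\<epsilon> bump_kernel (pd i \<phi>) x)"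
      by (rule pair[OF I test_fun_pd[OF \<phi>]])
    also have "\<dots> = ?S * (LINT x|lebQ. - (1 / ?\<epsilon>) * (w x I * smoothen ?\<epsilon> (pd i bump_kernel) \<phi> x))"
    proof (intro arg_cong[of _ _ "(*) ?S"] Bochner_Integration.integral_cong refl)
      fix x
      have "smoothen ?\<epsilon> bump_kernel (pd i \<phi>) x = - (1 / ?\<epsilon>) * smoothen ?\<epsilon> (pd i bump_kernel) \<phi> x"
        by (rule smoothen_integrate_by_parts[OF \<epsilon>(1) sk bump_kernel(3) \<phi>])
      then show "w x I * smoothen ?\<epsilon> bump_kernel (pd i \<phi>) x = - (1 / ?\<epsilon>) * (w x I * smoothen ?\<epsilon> (pd i bump_kernel) \<phi> x)"
        by simp
    qed
    also have "\<dots> = - (?S / ?\<epsilon>) * (LINT x|lebQ. w x I * smoothen ?\<epsilon> (pd i bump_kernel) \<phi> x)" by simp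
    also have "\<dots> = - (LINT x|lebQ. g i x I * \<phi> x)"
      unfolding g_def mult.assoc adj[OF L1D[OF w I] pk \<phi> smp[OF \<phi>]] by simp
    finally show "(LINT x|lebQ. w' x I * pd i \<phi> x) = - (LINT x|lebQ. g i x I * \<phi> x)" .
  qed
  have def: "defect l A w' f \<le> defect l A w f + ennreal e" for A
    unfolding defect_def[of l A w' f]
  proof (rule SUP_least)
    fix \<Phi> :: "'n list \<Rightarrow> real ^ 'n \<Rightarrow> real" assume "\<Phi> \<in> Collect (admissible (Suc l))"
    then have \<Phi>: "admissible (Suc l) \<Phi>" by simp
    let ?\<Psi> = "\<lambda>J. smoothen ?\<epsilon> bump_kernel (\<Phi> J)"
    have \<Psi>: "admissible (Suc l) ?\<Psi>" by (rule smoothen_kernel_admissible[OF \<epsilon>(1) \<Phi>])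
    have "defect_pair l A w' f \<Phi> \<le> defect_pair l A w f ?\<Psi> + (\<Sum>J\<in>tidx (Suc l). LINT x|lebQ. \<bar>?T m (\<lambda>x. f x J) x - f x J\<bar>)"
      unfolding defect_pair_def sum.distrib[symmetric]
    proof (rule sum_mono)
      fix J :: "'n list" assume J: "J \<in> tidx (Suc l)"
      note t = admissible_test_fun[OF \<Phi> J]
      have sm: "smooth (\<Phi> J)" using t by (simp add: test_fun_def)
      have spd: "pd i (?\<Psi> J) = (\<lambda>y. ?S * smoothen ?\<epsilon> bump_kernel (pd i (\<Phi> J)) y)" for i
        by (rule smoothen_pd[OF \<epsilon>(1) ck bump_kernel(3) sm])
      have "dist_op l A w' J (\<Phi> J) = - (\<Sum>i\<in>UNIV. \<Sum>I\<in>tidx l. A i J I * (?S * (LINT x|lebQ. w x I * smoothen ?\<epsilon> bump_kernel (pd i (\<Phi> J)) x)))"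
        unfolding dist_op_def using pair[OF _ test_fun_pd[OF t]] by simp
      also have "\<dots> = dist_op l A w J (?\<Psi> J)"
        unfolding dist_op_def spd by (simp add: mult.left_commute[of _ ?S])
      finally have 1: "dist_op l A w' J (\<Phi> J) = dist_op l A w J (?\<Psi> J)" .
      have 2: "(LINT x|lebQ. f x J * ?\<Psi> J x) = (LINT x|lebQ. ?T m (\<lambda>x. f x J) x * \<Phi> J x)"
        by (rule adj[OF L1D[OF f J] bump_kernel(4) t smb[OF t]])
      have "(LINT x|lebQ. ?T m (\<lambda>x. f x J) x * \<Phi> J x) - (LINT x|lebQ. f x J * \<Phi> J x)
          = (LINT x|lebQ. (?T m (\<lambda>x. f x J) x - f x J) * \<Phi> J x)"
        using integrable_mult_test_fun[OF iTQ[OF L1D[OF f J]] t] integrable_mult_test_fun[OF L1D[OF f J] t]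
        by (simp add: left_diff_distrib)
      also have "\<dots> \<le> \<bar>LINT x|lebQ. (?T m (\<lambda>x. f x J) x - f x J) * \<Phi> J x\<bar>" by simp
      also have "\<dots> \<le> 1 * (LINT x|lebQ. \<bar>?T m (\<lambda>x. f x J) x - f x J\<bar>)"
        using iTQ[OF L1D[OF f J], of m] L1D[OF f J] test_fun_lebQ[OF t] admissible_bound[OF \<Phi> J]
        by (intro integral_mult_bound) auto
      finally show "dist_op l A w' J (\<Phi> J) - (LINT x|lebQ. f x J * \<Phi> J x) \<le>
          dist_op l A w J (?\<Psi> J) - (LINT x|lebQ. f x J * ?\<Psi> J x) + (LINT x|lebQ. \<bar>?T m (\<lambda>x. f x J) x - f x J\<bar>)"
        unfolding 1 2 by simp
    qed
    then have "ennreal (defect_pair l A w' f \<Phi>) \<le> ennreal (defect_pair l A w f ?\<Psi> + e)"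
      using m(2) by (intro ennreal_leI) linarith
    also have "\<dots> \<le> ennreal (defect_pair l A w f ?\<Psi>) + ennreal e" by (rule ennreal_add_le)
    also have "\<dots> \<le> defect l A w f + ennreal e"
      by (intro add_right_mono ennreal_defect_pair_le \<Psi>)
    finally show "ennreal (defect_pair l A w' f \<Phi>) \<le> defect l A w f + ennreal e" .
  qed
  show ?thesis
    using wg def m(1) by (intro exI[of _ w'] exI[of _ g]) (simp add: w'_def)
qed

text \<open>
  The field depends neither on the limit operator nor on the sequence, so that it can be used
  for all members of a sequence of operators.
\<close>

theorem recovery_competitor:
  fixes w f :: "'n::finite tfun"
  assumes w: "w \<in> L1 l" and f: "f \<in> L1 (Suc l)" and e: "0 < e"
  shows "\<exists>w'. (\<forall>A. w' \<in> BVB l A) \<and> (\<forall>I\<in>tidx l. (LINT x|lebQ. \<bar>w' x I - w x I\<bar>) < e) \<and>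
    (\<forall>An A. coef_conv An A \<longrightarrow> (\<forall>\<^sub>F n in sequentially. defect l (An n) w' f \<le> defect l A w f + ennreal e))"
proof -
  have "0 < e / 2" using e by simp
  then obtain w' g where wg: "weak_gradient l w' g" and close: "\<forall>I\<in>tidx l. (LINT x|lebQ. \<bar>w' x I - w x I\<bar>) < e / 2"
    and def: "\<And>A. defect l A w' f \<le> defect l A w f + ennreal (e / 2)"
    using smooth_competitor[OF w f] by blast
  have "\<forall>\<^sub>F n in sequentially. defect l (An n) w' f \<le> defect l A w f + ennreal e" if conv: "coef_conv An A" for An A
  proof -
    let ?c = "\<lambda>n. \<Sum>J\<in>tidx (Suc l). \<Sum>i\<in>UNIV. \<Sum>I\<in>tidx l. \<bar>An n i J I - A i J I\<bar> * (LINT x|lebQ. \<bar>g i x I\<bar>)"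
    have "(\<lambda>n. \<bar>An n i J I - A i J I\<bar>) \<longlonglongrightarrow> 0" for i J I
      using conv unfolding coef_conv_def by (intro tendsto_rabs_zero LIM_zero) blast
    then have "?c \<longlonglongrightarrow> (\<Sum>J\<in>(tidx (Suc l) :: 'n list set). \<Sum>i\<in>(UNIV :: 'n set). \<Sum>I\<in>(tidx l :: 'n list set). 0)"
      by (intro tendsto_sum tendsto_mult_left_zero)
    then have "?c \<longlonglongrightarrow> 0" by simp
    then have "\<forall>\<^sub>F n in sequentially. ?c n < e / 2" using e by (intro order_tendstoD(2)) auto
    then show ?thesis
    proof eventually_elim
      case (elim n)
      have "defect l (An n) w' f \<le> defect l A w' f + ennreal (?c n)" by (rule defect_change_operator[OF wg])
      also have "\<dots> \<le> (defect l A w f + ennreal (e / 2)) + ennreal (e / 2)"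
        using elim by (intro add_mono def ennreal_leI) simp
      also have "\<dots> = defect l A w f + ennreal e"
        using e by (simp add: add.assoc ennreal_plus[symmetric] del: ennreal_plus)
      finally show ?case .
    qed
  qed
  moreover have "(LINT x|lebQ. \<bar>w' x I - w x I\<bar>) < e" if "I \<in> tidx l" for I
    using bspec[OF close that] e by linarith
  ultimately show ?thesis using weak_gradient_BVB[OF wg] by (intro exI[of _ w']) blast
qed

section \<open>Subsequences\<close>

text \<open>
  The indices are treated one after the other; what was reached for earlier indices survives later
  extractions by stability.
\<close>

lemma common_subsequence:
  fixes P :: "'i \<Rightarrow> (nat \<Rightarrow> nat) \<Rightarrow> bool"
  assumes "finite I"
    and stable: "\<And>i r r'. i \<in> I \<Longrightarrow> strict_mono r \<Longrightarrow> strict_mono r' \<Longrightarrow> P i r \<Longrightarrow> P i (r \<circ> (r' :: nat \<Rightarrow> nat))"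
    and ex: "\<And>i (r :: nat \<Rightarrow> nat). i \<in> I \<Longrightarrow> strict_mono r \<Longrightarrow> \<exists>r'. strict_mono r' \<and> P i (r \<circ> r')"
  shows "\<exists>r :: nat \<Rightarrow> nat. strict_mono r \<and> (\<forall>i\<in>I. P i r)"
proof -
  have "J \<subseteq> I \<Longrightarrow> \<exists>r. strict_mono r \<and> (\<forall>i\<in>J. P i r)" if "finite J" for J
    using that
  proof (induction J rule: finite_induct)
    case empty
    have "strict_mono (id :: nat \<Rightarrow> nat)" by (simp add: strict_mono_def)
    then show ?case by auto
  next
    case (insert i J)
    then obtain r where r: "strict_mono r" "\<forall>j\<in>J. P j r" by auto
    obtain r' where r': "strict_mono r'" "P i (r \<circ> r')" using ex[of i r] r(1) insert.prems by auto
    have "P j (r \<circ> r')" if "j \<in> J" for j using stable[of j r r'] r r'(1) that insert.prems by auto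
    with r' r(1) have "strict_mono (r \<circ> r')" "\<forall>j\<in>insert i J. P j (r \<circ> r')"
      by (auto intro: strict_mono_o simp del: o_apply)
    then show ?case by blast
  qed
  then show ?thesis using assms(1) by blast
qed

section \<open>Square integrable functions and convex sets\<close>

lemma L2_sq_cong_AE: "AE x in lebQ. f x = g x \<Longrightarrow> L2_sq f = L2_sq g"
  unfolding L2_sq_def by (intro nn_integral_cong_AE) (erule AE_mp, simp)

lemma ennreal_half_sum:
  assumes "0 \<le> X" "0 \<le> Y"
  shows "ennreal (1/2) * ennreal X + ennreal (1/2) * ennreal Y = ennreal (X / 2 + Y / 2)"
proof -
  have "ennreal (X / 2 + Y / 2) = ennreal (1/2 * X) + ennreal (1/2 * Y)"
    using assms by (subst ennreal_plus[symmetric]) auto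
  also have "\<dots> = ennreal (1/2) * ennreal X + ennreal (1/2) * ennreal Y"
    by (subst (1 2) ennreal_mult') auto
  finally show ?thesis ..
qed

lemma L2_parallelogram:
  assumes [measurable]: "f \<in> borel_measurable lebQ" "g \<in> borel_measurable lebQ"
  shows "L2_sq (\<lambda>x. (f x + g x) / 2) + L2_sq (\<lambda>x. (f x - g x) / 2) = ennreal (1/2) * L2_sq f + ennreal (1/2) * L2_sq g"
proof -
  have "L2_sq (\<lambda>x. (f x + g x) / 2) + L2_sq (\<lambda>x. (f x - g x) / 2) =
      (\<integral>\<^sup>+ x. ennreal (((f x + g x) / 2)\<^sup>2) + ennreal (((f x - g x) / 2)\<^sup>2) \<partial>lebQ)"
    unfolding L2_sq_def by (intro nn_integral_add[symmetric]) auto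
  also have "\<dots> = (\<integral>\<^sup>+ x. ennreal (1/2) * ennreal ((f x)\<^sup>2) + ennreal (1/2) * ennreal ((g x)\<^sup>2) \<partial>lebQ)"
  proof (intro nn_integral_cong)
    fix x
    have "((f x + g x) / 2)\<^sup>2 + ((f x - g x) / 2)\<^sup>2 = 1/2 * (f x)\<^sup>2 + 1/2 * (g x)\<^sup>2"
      by (simp add: power2_eq_square field_simps)
    then have "ennreal (((f x + g x) / 2)\<^sup>2 + ((f x - g x) / 2)\<^sup>2) = ennreal (1/2 * (f x)\<^sup>2 + 1/2 * (g x)\<^sup>2)" by simp
    then show "ennreal (((f x + g x) / 2)\<^sup>2) + ennreal (((f x - g x) / 2)\<^sup>2) =
        ennreal (1/2) * ennreal ((f x)\<^sup>2) + ennreal (1/2) * ennreal ((g x)\<^sup>2)"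
      by (subst (asm) (1 2) ennreal_plus) (auto simp: ennreal_mult simp del: times_divide_eq_left)
  qed
  also have "\<dots> = ennreal (1/2) * L2_sq f + ennreal (1/2) * L2_sq g"
    unfolding L2_sq_def by (subst nn_integral_add) (auto simp: nn_integral_cmult)
  finally show ?thesis .
qed

lemma L2_sq_half: "f \<in> borel_measurable lebQ \<Longrightarrow> L2_sq (\<lambda>x. f x / 2) = ennreal (1/4) * L2_sq f"
proof -
  assume [measurable]: "f \<in> borel_measurable lebQ"
  have "ennreal ((f x / 2)\<^sup>2) = ennreal (1/4) * ennreal ((f x)\<^sup>2)" for x
    by (simp add: power_divide ennreal_mult'[symmetric] del: ennreal_mult')
  then show ?thesis unfolding L2_sq_def by (simp add: nn_integral_cmult)
qed

lemma L2_convex: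
  assumes "f \<in> borel_measurable lebQ" "g \<in> borel_measurable lebQ"
    and "L2_sq f \<le> c" "L2_sq g \<le> c"
  shows "L2_sq (\<lambda>x. (f x + g x) / 2) \<le> c"
proof -
  have "L2_sq (\<lambda>x. (f x + g x) / 2) \<le> ennreal (1/2) * L2_sq f + ennreal (1/2) * L2_sq g"
    unfolding L2_parallelogram[OF assms(1,2), symmetric] by simp
  also have "\<dots> \<le> ennreal (1/2) * c + ennreal (1/2) * c"
    using assms by (intro add_mono mult_left_mono) auto
  also have "\<dots> = ennreal (1/2 + 1/2) * c" by (subst ennreal_plus) (auto simp: distrib_right)
  finally show ?thesis by simp
qed

lemma L2_Fatou:
  assumes g: "\<And>j. g j \<in> borel_measurable lebQ" and \<eta>: "\<eta> \<in> borel_measurable lebQ"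
    and lim: "AE x in lebQ. (\<lambda>j. g j x) \<longlonglongrightarrow> u x"
    and bound: "\<And>j. L2_sq (\<lambda>x. g j x - \<eta> x) \<le> b j" and b: "b \<longlonglongrightarrow> c"
  shows "L2_sq (\<lambda>x. u x - \<eta> x) \<le> c"
proof -
  have [measurable]: "\<And>j. g j \<in> borel_measurable lebQ" "\<eta> \<in> borel_measurable lebQ" by fact+
  have "L2_sq (\<lambda>x. u x - \<eta> x) = (\<integral>\<^sup>+ x. liminf (\<lambda>j. ennreal ((g j x - \<eta> x)\<^sup>2)) \<partial>lebQ)"
    unfolding L2_sq_def
  proof (intro nn_integral_cong_AE)
    show "AE x in lebQ. ennreal ((u x - \<eta> x)\<^sup>2) = liminf (\<lambda>j. ennreal ((g j x - \<eta> x)\<^sup>2))"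
      using lim
    proof eventually_elim
      case (elim x)
      then have "(\<lambda>j. ennreal ((g j x - \<eta> x)\<^sup>2)) \<longlonglongrightarrow> ennreal ((u x - \<eta> x)\<^sup>2)"
        by (intro tendsto_ennrealI tendsto_intros)
      then show ?case by (intro lim_imp_Liminf[symmetric]) auto
    qed
  qed
  also have "\<dots> \<le> liminf (\<lambda>j. \<integral>\<^sup>+ x. ennreal ((g j x - \<eta> x)\<^sup>2) \<partial>lebQ)"
    by (rule nn_integral_liminf) auto
  also have "\<dots> \<le> liminf b"
    using bound by (intro Liminf_mono always_eventually) (auto simp: L2_sq_def)
  also have "\<dots> = c" using b by (intro lim_imp_Liminf) auto
  finally show ?thesis .
qed

text \<open>
  Completeness of \<open>L\<^sup>2\<close>, in a form that gives convergence almost everywhere and in \<open>L\<^sup>1\<close>. The sequence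
  itself is assumed in \<open>L\<^sup>1\<close> only; its differences are in \<open>L\<^sup>2\<close>.
\<close>

lemma L2_Cauchy_subsequence:
  fixes g :: "nat \<Rightarrow> real ^ 'n::finite \<Rightarrow> real"
  assumes g: "\<And>n. integrable lebQ (g n)"
    and Cauchy: "\<And>e::real. 0 < e \<Longrightarrow> \<exists>M. \<forall>m\<ge>M. \<forall>n\<ge>M. L2_sq (\<lambda>x. g m x - g n x) \<le> ennreal e"
  shows "\<exists>r u. strict_mono r \<and> integrable lebQ u \<and> (AE x in lebQ. (\<lambda>j. g (r j) x) \<longlonglongrightarrow> u x) \<and>
    (\<lambda>j. LINT x|lebQ. \<bar>g (r j) x - u x\<bar>) \<longlonglongrightarrow> 0"
proof -
  have "\<forall>j. \<exists>M. \<forall>m\<ge>M. \<forall>n\<ge>M. L2_sq (\<lambda>x. g m x - g n x) \<le> ennreal ((1/4) ^ j)"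
    using Cauchy by simp
  then obtain M where M: "\<And>j m n. M j \<le> m \<Longrightarrow> M j \<le> n \<Longrightarrow> L2_sq (\<lambda>x. g m x - g n x) \<le> ennreal ((1/4) ^ j)"
    by metis
  define r where "r j = j + (\<Sum>i\<le>j. M i)" for j
  have r: "strict_mono r" by (rule strict_monoI_Suc) (simp add: r_def)
  have Mr: "M j \<le> r j" for j
    using member_le_sum[of j "{..j}" M] by (simp add: r_def)
  define d where "d j x = g (r (Suc j)) x - g (r j) x" for j x
  have gm [measurable]: "g n \<in> borel_measurable lebQ" for n using g[of n] by auto
  have di: "integrable lebQ (d j)" for j unfolding d_def[abs_def] using g by auto
  then have dm [measurable]: "d j \<in> borel_measurable lebQ" for j by auto
  interpret finite_measure "lebQ :: (real ^ 'n) measure" by (rule finite_lebQ)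
  define V where "V = measure (lebQ :: (real ^ 'n) measure) cube"
  have dL2: "L2_sq (d j) \<le> ennreal ((1/4) ^ j)" for j
  proof -
    have "M j \<le> r (Suc j)" using Mr[of j] strict_monoD[OF r, of j "Suc j"] by simp
    then show ?thesis unfolding d_def[abs_def] using M[of j] Mr[of j] by simp
  qed
  have dL1: "(\<integral>\<^sup>+ x. ennreal \<bar>d j x\<bar> \<partial>lebQ) \<le> ennreal ((1 + V) * (1/2) ^ j)" for j
  proof -
    have "(\<integral>\<^sup>+ x. ennreal \<bar>d j x\<bar> \<partial>lebQ) \<le> (\<integral>\<^sup>+ x. ennreal (2 ^ j) * ennreal ((d j x)\<^sup>2) + ennreal ((1/2) ^ j) \<partial>lebQ)"
    proof (rule nn_integral_mono)
      fix x
      define a where "a = 2 ^ j * \<bar>d j x\<bar>"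
      have "0 \<le> (a - 1)\<^sup>2" by simp
      then have "2 * a \<le> a\<^sup>2 + 1" by (simp add: power2_diff)
      moreover have "a\<^sup>2 = 2 ^ j * 2 ^ j * (d j x)\<^sup>2"
        by (simp add: a_def power_mult_distrib power2_eq_square[of "2 ^ j"])
      ultimately have "2 ^ j * \<bar>d j x\<bar> \<le> 2 ^ j * 2 ^ j * (d j x)\<^sup>2 + 1"
      proof -
        have "0 \<le> a" by (simp add: a_def)
        then show ?thesis using \<open>2 * a \<le> a\<^sup>2 + 1\<close> \<open>a\<^sup>2 = 2 ^ j * 2 ^ j * (d j x)\<^sup>2\<close> unfolding a_def by linarith
      qed
      moreover have "y \<le> p * z + 1 / p" if "p * y \<le> p * p * z + 1" "0 < p" for p y z :: real
        using that by (simp add: field_simps)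
      ultimately have "\<bar>d j x\<bar> \<le> 2 ^ j * (d j x)\<^sup>2 + 1 / 2 ^ j" by simp
      then have "\<bar>d j x\<bar> \<le> 2 ^ j * (d j x)\<^sup>2 + (1/2) ^ j" by (simp add: power_one_over)
      then have "ennreal \<bar>d j x\<bar> \<le> ennreal (2 ^ j * (d j x)\<^sup>2 + (1/2) ^ j)" by (rule ennreal_leI)
      also have "\<dots> = ennreal (2 ^ j) * ennreal ((d j x)\<^sup>2) + ennreal ((1/2) ^ j)"
        by (subst ennreal_plus) (auto simp: ennreal_mult)
      finally show "ennreal \<bar>d j x\<bar> \<le> ennreal (2 ^ j) * ennreal ((d j x)\<^sup>2) + ennreal ((1/2) ^ j)" .
    qed
    also have "\<dots> = ennreal (2 ^ j) * L2_sq (d j) + ennreal ((1/2) ^ j) * emeasure lebQ (cube :: (real ^ 'n) set)"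
      unfolding L2_sq_def by (subst nn_integral_add) (auto simp: nn_integral_cmult)
    also have "\<dots> \<le> ennreal (2 ^ j) * ennreal ((1/4) ^ j) + ennreal ((1/2) ^ j) * ennreal V"
      unfolding V_def emeasure_eq_measure by (intro add_mono mult_left_mono dL2) auto
    also have "\<dots> = ennreal ((2 ^ j) * ((1/4) ^ j) + (1/2) ^ j * V)"
      by (subst ennreal_plus) (auto simp: ennreal_mult V_def)
    also have "(2 ^ j) * ((1/4) ^ j) = ((1/2) ^ j :: real)" by (simp add: power_mult_distrib[symmetric])
    finally show ?thesis by (simp add: distrib_right mult.commute)
  qed
  have sV: "summable (\<lambda>j. (1 + V) * (1/2) ^ j)" by (intro summable_mult summable_geometric) simp
  have "(\<integral>\<^sup>+ x. (\<Sum>j. ennreal \<bar>d j x\<bar>) \<partial>lebQ) = (\<Sum>j. \<integral>\<^sup>+ x. ennreal \<bar>d j x\<bar> \<partial>lebQ)"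
    by (rule nn_integral_suminf) simp
  also have "\<dots> \<le> (\<Sum>j. ennreal ((1 + V) * (1/2) ^ j))"
    by (intro suminf_le dL1 summableI)
  also have "\<dots> = ennreal (\<Sum>j. (1 + V) * (1/2) ^ j)"
    using sV by (intro suminf_ennreal2) (auto simp: V_def)
  also have "\<dots> < \<infinity>" by simp
  finally have fin: "(\<integral>\<^sup>+ x. (\<Sum>j. ennreal \<bar>d j x\<bar>) \<partial>lebQ) < \<infinity>" .
  have AEfin: "AE x in lebQ. (\<Sum>j. ennreal \<bar>d j x\<bar>) \<noteq> \<infinity>"
    using fin by (intro nn_integral_noteq_infinite) auto
  then have AEs: "AE x in lebQ. summable (\<lambda>j. \<bar>d j x\<bar>)"
  proof eventually_elim
    case (elim x)
    then show ?case by (intro summable_suminf_not_top) auto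
  qed
  define W where "W x = (\<Sum>j. \<bar>d j x\<bar>)" for x
  have Wm [measurable]: "W \<in> borel_measurable lebQ" unfolding W_def[abs_def] by measurable
  have W: "integrable lebQ W"
  proof (rule integrableI_bounded[OF Wm])
    have "(\<integral>\<^sup>+ x. ennreal (norm (W x)) \<partial>lebQ) = (\<integral>\<^sup>+ x. (\<Sum>j. ennreal \<bar>d j x\<bar>) \<partial>lebQ)"
    proof (intro nn_integral_cong_AE)
      show "AE x in lebQ. ennreal (norm (W x)) = (\<Sum>j. ennreal \<bar>d j x\<bar>)"
        using AEs
      proof eventually_elim
        case (elim x)
        then show ?case unfolding W_def by (subst suminf_ennreal2) (auto simp: suminf_nonneg)
      qed
    qed
    then show "(\<integral>\<^sup>+ x. ennreal (norm (W x)) \<partial>lebQ) < \<infinity>" using fin by simp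
  qed
  define u where "u x = g (r 0) x + (\<Sum>j. d j x)" for x
  have um: "u \<in> borel_measurable lebQ" unfolding u_def[abs_def] by measurable
  have tele: "g (r j) x = g (r 0) x + (\<Sum>i<j. d i x)" for j x
    by (induction j) (auto simp: d_def)
  have conv: "AE x in lebQ. (\<lambda>j. g (r j) x) \<longlonglongrightarrow> u x"
    using AEs
  proof eventually_elim
    case (elim x)
    then have "summable (\<lambda>j. d j x)" by (rule summable_rabs_cancel)
    then have "(\<lambda>j. g (r 0) x + (\<Sum>i<j. d i x)) \<longlonglongrightarrow> u x"
      unfolding u_def by (intro tendsto_add tendsto_const summable_LIMSEQ)
    moreover have "(\<lambda>j. g (r j) x) = (\<lambda>j. g (r 0) x + (\<Sum>i<j. d i x))" by (rule ext) (rule tele)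
    ultimately show ?case by (simp only:)
  qed
  have dom: "AE x in lebQ. \<forall>j. \<bar>g (r j) x - u x\<bar> \<le> W x"
    using AEs
  proof eventually_elim
    case (elim x)
    have s: "summable (\<lambda>j. d j x)" using elim by (rule summable_rabs_cancel)
    show ?case
    proof
      fix j
      have "u x - g (r j) x = (\<Sum>i. d (i + j) x)"
        unfolding u_def tele[of j] suminf_split_initial_segment[OF s, of j] by simp
      then have "\<bar>g (r j) x - u x\<bar> = \<bar>\<Sum>i. d (i + j) x\<bar>" by (metis abs_minus_commute)
      also have "\<dots> \<le> (\<Sum>i. \<bar>d (i + j) x\<bar>)"
        using summable_ignore_initial_segment[OF elim, of j] by (rule summable_rabs)
      also have "\<dots> \<le> W x"
        unfolding W_def suminf_split_initial_segment[OF elim, of j] by (simp add: sum_nonneg)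
      finally show "\<bar>g (r j) x - u x\<bar> \<le> W x" .
    qed
  qed
  have ui: "integrable lebQ u"
  proof (rule Bochner_Integration.integrable_bound[OF _ um])
    show "integrable lebQ (\<lambda>x. \<bar>g (r 0) x\<bar> + W x)" using g W by auto
    show "AE x in lebQ. norm (u x) \<le> norm (\<bar>g (r 0) x\<bar> + W x)"
      using dom
    proof eventually_elim
      case (elim x)
      then have "\<bar>g (r 0) x - u x\<bar> \<le> W x" by blast
      then show ?case by simp
    qed
  qed
  have "(\<lambda>j. LINT x|lebQ. \<bar>g (r j) x - u x\<bar>) \<longlonglongrightarrow> (LINT x|(lebQ :: (real ^ 'n) measure). 0)"
  proof (rule integral_dominated_convergence[OF _ _ W])
    show "AE x in lebQ. (\<lambda>j. \<bar>g (r j) x - u x\<bar>) \<longlonglongrightarrow> 0"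
      using conv by eventually_elim (intro tendsto_rabs_zero LIM_zero)
    show "AE x in lebQ. norm \<bar>g (r j) x - u x\<bar> \<le> W x" for j
      using dom by eventually_elim simp
  qed (use um in auto)
  then show ?thesis using r ui conv by (intro exI[of _ r] exI[of _ u]) simp
qed

text \<open>
  A substitute for weak compactness in \<open>L\<^sup>2\<close>. Let \<open>d\<^sub>m\<close> be the infimum of the squared distance to \<open>\<eta>\<close> over
  \<open>K\<^sub>m\<close>. These numbers increase and are bounded, and for almost minimizers the parallelogram identity
  bounds the squared distance of \<open>g\<^sub>m\<close> and \<open>g\<^sub>n\<close> by the increments of \<open>d\<close> plus small errors, since their
  midpoint lies in the larger of the two sets.
\<close>

lemma nested_midpoint_convex_Cauchy:
  fixes K :: "nat \<Rightarrow> (real ^ 'n::finite \<Rightarrow> real) set"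
  assumes dec: "\<And>m. K (Suc m) \<subseteq> K m" and ne: "\<And>m. K m \<noteq> {}"
    and mid: "\<And>m f g. f \<in> K m \<Longrightarrow> g \<in> K m \<Longrightarrow> (\<lambda>x. (f x + g x) / 2) \<in> K m"
    and meas: "\<And>m f. f \<in> K m \<Longrightarrow> f \<in> borel_measurable lebQ" and \<eta>: "\<eta> \<in> borel_measurable lebQ"
    and bound: "\<And>m f. f \<in> K m \<Longrightarrow> L2_sq (\<lambda>x. f x - \<eta> x) \<le> ennreal C"
  shows "\<exists>g. (\<forall>m. g m \<in> K m) \<and>
    (\<forall>e::real. 0 < e \<longrightarrow> (\<exists>M. \<forall>m\<ge>M. \<forall>n\<ge>M. L2_sq (\<lambda>x. g m x - g n x) \<le> ennreal e))"
proof -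
  let ?Q = "\<lambda>f. L2_sq (\<lambda>x. f x - \<eta> x)"
  define d where "d m = (INF f\<in>K m. ?Q f)" for m
  have dle: "d m \<le> ?Q f" if "f \<in> K m" for m f unfolding d_def using that by (rule INF_lower)
  have dC: "d m \<le> ennreal C" for m
  proof -
    obtain f where "f \<in> K m" using ne by blast
    then show ?thesis using dle bound by (meson order_trans)
  qed
  have dfin: "d m \<noteq> \<infinity>" for m using dC[of m] by (auto simp: top_unique)
  define D where "D m = enn2real (d m)" for m
  have D: "d m = ennreal (D m)" "0 \<le> D m" for m using dfin by (auto simp: D_def less_top)
  have Kanti: "K n \<subseteq> K m" if "m \<le> n" for m n
    using that by (rule lift_Suc_antimono_le[of K, OF dec])
  have Dmono: "D m \<le> D n" if "m \<le> n" for m n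
  proof -
    have "d m \<le> d n" unfolding d_def using Kanti[OF that] by (rule INF_superset_mono) simp
    then show ?thesis using D by simp
  qed
  have "D m \<le> max C 0" for m using dC[of m] D[of m] by (auto simp: ennreal_le_iff2)
  then obtain L where "D \<longlonglongrightarrow> L"
    using incseq_convergent[of D "max C 0"] Dmono unfolding incseq_def by metis
  then have DC: "Cauchy D" by (rule LIMSEQ_imp_Cauchy)
  have "\<forall>m. \<exists>f\<in>K m. ?Q f \<le> ennreal (D m + 1 / real (Suc m))"
  proof
    fix m
    have "d m < ennreal (D m + 1 / real (Suc m))"
      unfolding D(1)[of m] using D(2)[of m] by (intro ennreal_lessI) (auto intro: add_nonneg_pos)
    then obtain f where "f \<in> K m" "?Q f < ennreal (D m + 1 / real (Suc m))"
      unfolding d_def INF_less_iff by blast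
    then show "\<exists>f\<in>K m. ?Q f \<le> ennreal (D m + 1 / real (Suc m))" by (intro bexI[of _ f]) auto
  qed
  then obtain g where g: "\<And>m. g m \<in> K m" "\<And>m. ?Q (g m) \<le> ennreal (D m + 1 / real (Suc m))" by metis
  have key: "L2_sq (\<lambda>x. g m x - g n x) \<le> ennreal (2 * (D n - D m) + 2 * (1 / real (Suc m)) + 2 * (1 / real (Suc n)))" if mn: "m \<le> n" for m n
  proof -
    have gm: "g m \<in> K m" "g n \<in> K m" using g(1) Kanti[OF mn] by auto
    have me: "(\<lambda>x. g m x - \<eta> x) \<in> borel_measurable lebQ" "(\<lambda>x. g n x - \<eta> x) \<in> borel_measurable lebQ"
      using meas[OF gm(1)] meas[OF gm(2)] \<eta> by auto
    have a: "(\<lambda>x. ((g m x - \<eta> x) + (g n x - \<eta> x)) / 2) = (\<lambda>x. (g m x + g n x) / 2 - \<eta> x)"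
      "(\<lambda>x. ((g m x - \<eta> x) - (g n x - \<eta> x)) / 2) = (\<lambda>x. (g m x - g n x) / 2)"
      by (auto simp: field_simps)
    have "ennreal (D m) + ennreal (1/4) * L2_sq (\<lambda>x. g m x - g n x)
        \<le> ?Q (\<lambda>x. (g m x + g n x) / 2) + L2_sq (\<lambda>x. (g m x - g n x) / 2)"
      using dle[OF mid[OF gm]] meas[OF gm(1)] meas[OF gm(2)] unfolding D(1)
      by (subst L2_sq_half) (auto intro: add_right_mono)
    also have "\<dots> = ennreal (1/2) * ?Q (g m) + ennreal (1/2) * ?Q (g n)"
      using L2_parallelogram[OF me] unfolding a .
    also have "\<dots> \<le> ennreal (1/2) * ennreal (D m + 1 / real (Suc m)) + ennreal (1/2) * ennreal (D n + 1 / real (Suc n))"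
      by (intro add_mono mult_left_mono g(2)) auto
    also have "\<dots> = ennreal ((D m + 1 / real (Suc m)) / 2 + (D n + 1 / real (Suc n)) / 2)"
      using D(2) by (intro ennreal_half_sum) auto
    finally have le: "ennreal (D m) + ennreal (1/4) * L2_sq (\<lambda>x. g m x - g n x)
        \<le> ennreal ((D m + 1 / real (Suc m)) / 2 + (D n + 1 / real (Suc n)) / 2)" .
    then have "ennreal (1/4) * L2_sq (\<lambda>x. g m x - g n x) \<noteq> \<infinity>" by (auto simp: top_unique)
    then have "L2_sq (\<lambda>x. g m x - g n x) \<noteq> \<infinity>" by (auto simp: ennreal_mult_eq_top_iff)
    then obtain q where q: "L2_sq (\<lambda>x. g m x - g n x) = ennreal q" "0 \<le> q"
      by (cases "L2_sq (\<lambda>x. g m x - g n x)") auto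
    have "ennreal (D m + 1/4 * q) \<le> ennreal ((D m + 1 / real (Suc m)) / 2 + (D n + 1 / real (Suc n)) / 2)"
      using le D(2)[of m] q(2) unfolding q(1) by (simp add: ennreal_mult'[symmetric] ennreal_plus[symmetric] del: ennreal_plus)
    moreover have "0 \<le> (D m + 1 / real (Suc m)) / 2 + (D n + 1 / real (Suc n)) / 2" using D(2) by simp
    ultimately have "D m + 1/4 * q \<le> (D m + 1 / real (Suc m)) / 2 + (D n + 1 / real (Suc n)) / 2"
      by (simp only: ennreal_le_iff)
    then have "q \<le> 2 * (D n - D m) + 2 * (1 / real (Suc m)) + 2 * (1 / real (Suc n))" by argo
    then show ?thesis unfolding q(1) by (rule ennreal_leI)
  qed
  have sym: "L2_sq (\<lambda>x. g m x - g n x) = L2_sq (\<lambda>x. g n x - g m x)" for m n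
    by (simp add: L2_sq_def power2_commute)
  have "\<exists>M. \<forall>m\<ge>M. \<forall>n\<ge>M. L2_sq (\<lambda>x. g m x - g n x) \<le> ennreal e" if e: "0 < e" for e :: real
  proof -
    have e6: "0 < e / 6" using e by simp
    obtain M1 where M1: "\<And>m n. M1 \<le> m \<Longrightarrow> M1 \<le> n \<Longrightarrow> \<bar>D m - D n\<bar> < e / 6"
      using metric_CauchyD[OF DC e6] by (auto simp: dist_real_def)
    obtain M2 where M2: "1 / real (Suc M2) < e / 6" using nat_approx_posE[OF e6] by blast
    have small: "1 / real (Suc m) < e / 6" if "M2 \<le> m" for m
    proof -
      have "1 / real (Suc m) \<le> 1 / real (Suc M2)" using that by (intro divide_left_mono) auto
      then show ?thesis using M2 by linarith
    qed
    have half: "L2_sq (\<lambda>x. g m x - g n x) \<le> ennreal e" if mn: "max M1 M2 \<le> m" "m \<le> n" for m n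
    proof -
      have "2 * (D n - D m) + 2 * (1 / real (Suc m)) + 2 * (1 / real (Suc n)) \<le> e"
      proof -
        have le: "M1 \<le> m" "M1 \<le> n" "M2 \<le> m" "M2 \<le> n" using mn by auto
        have arith: "2 * (y - x) + 2 * b + 2 * c \<le> e" if "\<bar>x - y\<bar> < e / 6" "b < e / 6" "c < e / 6" for x y b c :: real
          using that by argo
        show ?thesis by (rule arith[OF M1[OF le(1,2)] small[OF le(3)] small[OF le(4)]])
      qed
      then have "ennreal (2 * (D n - D m) + 2 * (1 / real (Suc m)) + 2 * (1 / real (Suc n))) \<le> ennreal e" by (rule ennreal_leI)
      with key[OF mn(2)] show ?thesis by (rule order_trans)
    qed
    have "L2_sq (\<lambda>x. g m x - g n x) \<le> ennreal e" if "max M1 M2 \<le> m" "max M1 M2 \<le> n" for m n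
    proof (cases "m \<le> n")
      case True then show ?thesis using half that by blast
    next
      case False
      then have "L2_sq (\<lambda>x. g n x - g m x) \<le> ennreal e" using half[of n m] that by simp
      then show ?thesis unfolding sym[of m n] .
    qed
    then show ?thesis by blast
  qed
  then show ?thesis using g(1) by (intro exI[of _ g]) blast
qed

section \<open>The regularizer as a chain\<close>

text \<open>
  A norm equivalent to the \<open>L\<^sup>1\<close> norm that is additive in the entries.
\<close>

definition L1_sum :: "nat \<Rightarrow> 'n::finite tfun \<Rightarrow> real" where
  "L1_sum l v = (\<Sum>I\<in>tidx l. LINT x|lebQ. \<bar>v x I\<bar>)"

text \<open>
  The chain \<open>u, v\<^sub>0, \<dots>, v\<^sub>k\<^sub>-\<^sub>1, 0\<close>: its \<open>l\<close>-th member is a tensor field of order \<open>l\<close>, and appending 0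
  gives all \<open>k + 1\<close> terms of the regularizer the same form.
\<close>

definition chain_field :: "nat \<Rightarrow> (real ^ 'n::finite \<Rightarrow> real) \<Rightarrow> (nat \<Rightarrow> 'n tfun) \<Rightarrow> nat \<Rightarrow> 'n tfun" where
  "chain_field k u v l = (case l of 0 \<Rightarrow> scalar u | Suc j \<Rightarrow> if j < k then v j else (\<lambda>x I. 0))"

definition chain_op :: "(nat \<Rightarrow> 'n::finite oper) \<Rightarrow> nat \<Rightarrow> 'n oper" where
  "chain_op B l = (case l of 0 \<Rightarrow> grad_op | Suc j \<Rightarrow> B j)"

definition chain_cost :: "nat \<Rightarrow> (nat \<Rightarrow> real) \<Rightarrow> (nat \<Rightarrow> 'n::finite oper) \<Rightarrow> (nat \<Rightarrow> 'n tfun) \<Rightarrow> ennreal" where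
  "chain_cost k \<alpha> B w = (\<Sum>l\<le>k. ennreal (\<alpha> l) * defect l (chain_op B l) (w l) (w (Suc l)))"

lemma chain_simps [simp]:
  "chain_field k u v 0 = scalar u" "chain_op B 0 = grad_op" "chain_op B (Suc j) = B j"
  "j < k \<Longrightarrow> chain_field k u v (Suc j) = v j" "chain_field k u v (Suc k) = (\<lambda>x I. 0)"
  by (auto simp: chain_field_def chain_op_def)

lemma zero_L1: "(\<lambda>x I. 0) \<in> L1 l"
  by (simp add: L1_def)

lemma zero_BVB: "(\<lambda>x I. 0) \<in> BVB l A"
proof -
  have "represents l A (\<lambda>x I. 0) (density_meas (\<lambda>x I. 0))"
    unfolding represents_def
    using density_meas_Mb[OF zero_L1] signed_integral_density_meas[OF zero_L1] by (auto simp: dist_op_def)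
  then show ?thesis unfolding BVB_def using zero_L1 by blast
qed

definition competitors :: "nat \<Rightarrow> (nat \<Rightarrow> 'n::finite oper) \<Rightarrow> (nat \<Rightarrow> 'n tfun) set" where
  "competitors k B = {v. \<forall>l<k. v l \<in> BVB (Suc l) (B l)}"

lemma chain_field_BVB:
  assumes "u \<in> BV" "v \<in> competitors k B" "l \<le> k"
  shows "chain_field k u v l \<in> BVB l (chain_op B l)"
  using assms by (cases l) (auto simp: BV_def competitors_def)

lemma chain_field_L1:
  assumes "u \<in> BV" "v \<in> competitors k B" "l \<le> Suc k"
  shows "chain_field k u v l \<in> L1 l"
proof (cases "l = Suc k")
  case True
  then show ?thesis by (simp add: zero_L1)
next
  case False
  then show ?thesis using chain_field_BVB[OF assms(1,2), of l] assms(3) BVB_L1 by force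
qed

text \<open>
  The three kinds of terms in the definition of \<open>PGV\<close> become terms of one sum, because the total variation
  of a difference of measures does not depend on the sign of the difference.
\<close>

lemma PGV_eq_chain_cost:
  assumes k: "1 \<le> k" and u: "u \<in> BV"
  shows "PGV k \<alpha> B u = (INF v\<in>competitors k B. chain_cost k \<alpha> B (chain_field k u v))"
proof -
  have "ennreal (\<alpha> 0) * total_variation 1 (\<lambda>A I. op_meas 0 grad_op (scalar u) A I - density_meas (v 0) A I)
      + (\<Sum>l = 1..k - 1. ennreal (\<alpha> l) * total_variation (Suc l)
           (\<lambda>A I. density_meas (v l) A I - op_meas l (B (l - 1)) (v (l - 1)) A I))
      + ennreal (\<alpha> k) * total_variation (Suc k) (op_meas k (B (k - 1)) (v (k - 1)))
      = chain_cost k \<alpha> B (chain_field k u v)" if v: "v \<in> competitors k B" for v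
  proof -
    let ?w = "chain_field k u v"
    let ?c = "\<lambda>l. ennreal (\<alpha> l) * defect l (chain_op B l) (?w l) (?w (Suc l))"
    have b: "?w l \<in> BVB l (chain_op B l)" if "l \<le> k" for l by (rule chain_field_BVB[OF u v that])
    have L: "?w l \<in> L1 l" if "l \<le> Suc k" for l by (rule chain_field_L1[OF u v that])
    have 0: "total_variation 1 (\<lambda>A I. op_meas 0 grad_op (scalar u) A I - density_meas (v 0) A I) =
        defect 0 (chain_op B 0) (?w 0) (?w (Suc 0))"
      using total_variation_op_minus_density[OF b[of 0] L[of "Suc 0"]] k by simp
    have m: "total_variation (Suc l) (\<lambda>A I. density_meas (v l) A I - op_meas l (B (l - 1)) (v (l - 1)) A I) =
        defect l (chain_op B l) (?w l) (?w (Suc l))" if l: "l \<in> {1..k - 1}" for l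
    proof -
      obtain j where j: "l = Suc j" "j < k" "l < k" using l by (cases l) auto
      then show ?thesis using total_variation_density_minus_op[OF b[of l] L[of "Suc l"]] by simp
    qed
    have e: "total_variation (Suc k) (op_meas k (B (k - 1)) (v (k - 1))) = defect k (chain_op B k) (?w k) (?w (Suc k))"
    proof -
      obtain j where j: "k = Suc j" using k by (cases k) auto
      then show ?thesis using total_variation_op_meas[OF b[of k]] by simp
    qed
    have set: "{..k} = insert 0 (insert k {1..k - 1})" using k by auto
    have "chain_cost k \<alpha> B ?w = ?c 0 + (?c k + (\<Sum>l = 1..k - 1. ?c l))"
      unfolding chain_cost_def set using k by (subst sum.insert, simp, force, subst sum.insert) auto
    also have "\<dots> = ?c 0 + (\<Sum>l = 1..k - 1. ?c l) + ?c k" by (simp add: add_ac)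
    finally have cost: "chain_cost k \<alpha> B ?w = ?c 0 + (\<Sum>l = 1..k - 1. ?c l) + ?c k" .
    have s: "(\<Sum>l = 1..k - 1. ennreal (\<alpha> l) * total_variation (Suc l)
           (\<lambda>A I. density_meas (v l) A I - op_meas l (B (l - 1)) (v (l - 1)) A I)) = (\<Sum>l = 1..k - 1. ?c l)"
      by (intro sum.cong refl) (simp only: m)
    show ?thesis unfolding cost s 0 e ..
  qed
  note eq = this
  show ?thesis
    unfolding PGV_def
  proof (subst if_not_P)
    show "\<not> u \<notin> BV" using u by simp
  qed (unfold competitors_def[symmetric], rule INF_cong[OF refl eq])
qed

lemma L1_sum_nonneg: "0 \<le> L1_sum l v"
  unfolding L1_sum_def by (intro sum_nonneg integral_nonneg_AE) simp

lemma integral_abs_le_L1_sum: "I \<in> tidx l \<Longrightarrow> (LINT x|lebQ. \<bar>v x I\<bar>) \<le> L1_sum l v"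
  unfolding L1_sum_def
  by (rule member_le_sum) (auto intro!: integral_nonneg_AE)

section \<open>Compactness of chains\<close>

lemma L1_norm_le_L1_sum:
  assumes v: "v \<in> L1 l"
  shows "L1_norm l v \<le> ennreal (L1_sum l v)"
proof -
  have "L1_norm l v \<le> (\<integral>\<^sup>+ x. ennreal (\<Sum>I\<in>tidx l. \<bar>v x I\<bar>) \<partial>lebQ)"
    unfolding L1_norm_def by (intro nn_integral_mono ennreal_leI tnorm_le_sum_abs)
  also have "\<dots> = ennreal (LINT x|lebQ. (\<Sum>I\<in>tidx l. \<bar>v x I\<bar>))"
    using L1D[OF v] by (intro nn_integral_eq_integral) (auto simp: sum_nonneg)
  also have "(LINT x|lebQ. (\<Sum>I\<in>tidx l. \<bar>v x I\<bar>)) = L1_sum l v"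
    unfolding L1_sum_def using L1D[OF v] by (intro Bochner_Integration.integral_sum) auto
  finally show ?thesis .
qed

lemma L1_conv_of_L1_norm:
  assumes v: "\<And>n. v n \<in> L1 l" "w \<in> L1 l" and lim: "(\<lambda>n. L1_norm l (\<lambda>x I. v n x I - w x I)) \<longlonglongrightarrow> 0"
  shows "L1_conv l v w"
  unfolding L1_conv_def
proof
  fix I :: "'a list" assume I: "I \<in> tidx l"
  have i: "integrable lebQ (\<lambda>x. \<bar>v n x I - w x I\<bar>)" for n using L1D[OF v(1) I] L1D[OF v(2) I] by auto
  have "(\<lambda>n. ennreal (LINT x|lebQ. \<bar>v n x I - w x I\<bar>)) \<longlonglongrightarrow> 0"
  proof (rule tendsto_sandwich[OF _ _ tendsto_const lim])
    have "ennreal (LINT x|lebQ. \<bar>v n x I - w x I\<bar>) \<le> L1_norm l (\<lambda>x I. v n x I - w x I)" for n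
    proof -
      have "ennreal (LINT x|lebQ. \<bar>v n x I - w x I\<bar>) = (\<integral>\<^sup>+ x. ennreal \<bar>v n x I - w x I\<bar> \<partial>lebQ)"
        using i by (intro nn_integral_eq_integral[symmetric]) auto
      also have "\<dots> \<le> L1_norm l (\<lambda>x I. v n x I - w x I)"
        unfolding L1_norm_def
        using abs_le_tnorm[OF I, of "\<lambda>I. v n _ I - w _ I"] by (intro nn_integral_mono ennreal_leI) auto
      finally show ?thesis .
    qed
    then show "\<forall>\<^sub>F n in sequentially. ennreal (LINT x|lebQ. \<bar>v n x I - w x I\<bar>) \<le> L1_norm l (\<lambda>x I. v n x I - w x I)" by simp
  qed simp
  then show "(\<lambda>n. LINT x|lebQ. \<bar>v n x I - w x I\<bar>) \<longlonglongrightarrow> 0"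
    by (subst (asm) ennreal_0[symmetric], subst (asm) tendsto_ennreal_iff) (auto intro!: always_eventually integral_nonneg_AE)
qed

text \<open>
  Property (C) in terms of the defect: a bound on the defect and on the target bounds the norm of \<open>v\<close> in
  \<open>BVB\<close>, and the operators of a training set are bounded.
\<close>

lemma training_set_compact:
  fixes S :: "(nat \<Rightarrow> 'n::finite oper) set" and Bn :: "nat \<Rightarrow> nat \<Rightarrow> 'n oper"
    and v f :: "nat \<Rightarrow> 'n tfun"
  assumes S: "training_set k S" and Bn: "\<And>n. Bn n \<in> S" and l: "l < k"
    and v: "\<And>n. v n \<in> BVB (Suc l) (Bn n l)" "\<And>n. L1_sum (Suc l) (v n) \<le> M"
    and f: "\<And>n. f n \<in> L1 (Suc (Suc l))" "\<And>n. L1_sum (Suc (Suc l)) (f n) \<le> M"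
    and d: "\<And>n. defect (Suc l) (Bn n l) (v n) (f n) \<le> ennreal M"
  shows "\<exists>r w. strict_mono r \<and> w \<in> L1 (Suc l) \<and> L1_conv (Suc l) (v \<circ> r) w"
proof -
  obtain C where C: "\<And>B. B \<in> S \<Longrightarrow> op_norm (Suc l) (B l) \<le> C"
    using S l unfolding training_set_def bounded_tuples_def by blast
  have "0 \<le> M" using L1_sum_nonneg v(2) by (rule order_trans)
  have on: "0 \<le> op_norm (Suc l) (Bn n l)" for n
    unfolding op_norm_def by (intro sum_nonneg real_sqrt_ge_zero zero_le_power2)
  have tv: "total_variation (Suc (Suc l)) (op_meas (Suc l) (Bn n l) (v n)) \<le> ennreal (M + M)" for n
  proof -
    have "total_variation (Suc (Suc l)) (op_meas (Suc l) (Bn n l) (v n)) = defect (Suc l) (Bn n l) (v n) (\<lambda>x I. 0)"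
      by (rule total_variation_op_meas[OF v(1)])
    also have "\<dots> \<le> defect (Suc l) (Bn n l) (v n) (f n) + ennreal (\<Sum>J\<in>tidx (Suc (Suc l)). LINT x|lebQ. \<bar>0 - f n x J\<bar>)"
      by (rule defect_change_target[OF zero_L1 f(1)])
    also have "\<dots> \<le> ennreal M + ennreal M"
      using f(2)[of n] d[of n] by (intro add_mono ennreal_leI) (auto simp: L1_sum_def)
    also have "\<dots> = ennreal (M + M)" using \<open>0 \<le> M\<close> by (intro ennreal_plus[symmetric])
    finally show ?thesis .
  qed
  have "ennreal (op_norm (Suc l) (Bn n l)) + BVB_norm (Suc l) (Bn n l) (v n) \<le> ennreal (C + (M + (M + M)))" for n
  proof -
    have "0 \<le> C" using on[of n] C[OF Bn[of n]] by linarith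
    have "ennreal (op_norm (Suc l) (Bn n l)) + BVB_norm (Suc l) (Bn n l) (v n) \<le> ennreal C + (ennreal M + ennreal (M + M))"
      unfolding BVB_norm_def
      using order_trans[OF L1_norm_le_L1_sum[OF BVB_L1[OF v(1)[of n]]] ennreal_leI[OF v(2)[of n]]]
      by (intro add_mono ennreal_leI C Bn tv)
    also have "\<dots> = ennreal C + ennreal (M + (M + M))" using \<open>0 \<le> M\<close> by (subst ennreal_plus[symmetric]) auto
    also have "\<dots> = ennreal (C + (M + (M + M)))" using \<open>0 \<le> C\<close> \<open>0 \<le> M\<close> by (intro ennreal_plus[symmetric]) auto
    finally show ?thesis .
  qed
  then have "(SUP n. ennreal (op_norm (Suc l) (Bn n l)) + BVB_norm (Suc l) (Bn n l) (v n)) \<le> ennreal (C + (M + (M + M)))"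
    by (intro SUP_least)
  also have "\<dots> < \<infinity>" by simp
  finally have sup: "(SUP n. ennreal (op_norm (Suc l) (Bn n l)) + BVB_norm (Suc l) (Bn n l) (v n)) < \<infinity>" .
  have "property_C (Suc l) (\<lambda>n. Bn n l)" using S Bn l unfolding training_set_def by blast
  then obtain B w r where w: "w \<in> BVB (Suc l) B" and r: "strict_mono r"
    and lim: "(\<lambda>n. L1_norm (Suc l) (\<lambda>x I. v (r n) x I - w x I)) \<longlonglongrightarrow> 0"
    using v(1) sup unfolding property_C_def by blast
  have "L1_conv (Suc l) (v \<circ> r) w"
    using lim by (intro L1_conv_of_L1_norm) (auto intro: BVB_L1[OF v(1)] BVB_L1[OF w])
  then show ?thesis using r BVB_L1[OF w] by blast
qed

lemma L1_sum_tendsto: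
  assumes v: "\<And>n. v n \<in> L1 l" "w \<in> L1 l" and lim: "L1_conv l v w"
  shows "(\<lambda>n. L1_sum l (v n)) \<longlonglongrightarrow> L1_sum l w"
  unfolding L1_sum_def
proof (rule tendsto_sum)
  fix I :: "'a list" assume I: "I \<in> tidx l"
  have "(\<lambda>n. (LINT x|lebQ. \<bar>v n x I\<bar>) - (LINT x|lebQ. \<bar>w x I\<bar>)) \<longlonglongrightarrow> 0"
  proof (rule Lim_null_comparison)
    show "(\<lambda>n. LINT x|lebQ. \<bar>v n x I - w x I\<bar>) \<longlonglongrightarrow> 0" using lim I by (simp add: L1_conv_def)
    have "norm ((LINT x|lebQ. \<bar>v n x I\<bar>) - (LINT x|lebQ. \<bar>w x I\<bar>)) \<le> (LINT x|lebQ. \<bar>v n x I - w x I\<bar>)" for n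
    proof -
      note i = L1D[OF v(1)[of n] I] L1D[OF v(2) I]
      have "(LINT x|lebQ. \<bar>v n x I\<bar>) - (LINT x|lebQ. \<bar>w x I\<bar>) = (LINT x|lebQ. \<bar>v n x I\<bar> - \<bar>w x I\<bar>)"
        using i by simp
      also have "\<bar>\<dots>\<bar> \<le> (LINT x|lebQ. \<bar>\<bar>v n x I\<bar> - \<bar>w x I\<bar>\<bar>)" by (rule integral_abs_bound)
      also have "\<dots> \<le> (LINT x|lebQ. \<bar>v n x I - w x I\<bar>)" using i by (intro integral_mono) auto
      finally show ?thesis by simp
    qed
    then show "\<forall>\<^sub>F n in sequentially. norm ((LINT x|lebQ. \<bar>v n x I\<bar>) - (LINT x|lebQ. \<bar>w x I\<bar>)) \<le> (LINT x|lebQ. \<bar>v n x I - w x I\<bar>)" by simp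
  qed
  then show "(\<lambda>n. LINT x|lebQ. \<bar>v n x I\<bar>) \<longlonglongrightarrow> (LINT x|lebQ. \<bar>w x I\<bar>)" by (rule LIM_zero_cancel)
qed

definition chain_conv :: "nat \<Rightarrow> (nat \<Rightarrow> nat \<Rightarrow> 'n::finite oper) \<Rightarrow> (nat \<Rightarrow> 'n oper) \<Rightarrow> bool" where
  "chain_conv k Bn B \<longleftrightarrow> (\<forall>l\<le>k. coef_conv (\<lambda>n. chain_op (Bn n) l) (chain_op B l))"

lemma chain_conv_subseq: "chain_conv k Bn B \<Longrightarrow> strict_mono r \<Longrightarrow> chain_conv k (Bn \<circ> r) B"
  unfolding chain_conv_def using coef_conv_subseq[of "\<lambda>n. chain_op (Bn n) _" _ r] by (simp add: o_def)

text \<open>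
  The subsequence is chosen for all inner fields at once. The last field vanishes, and the first is
  excluded since (C) says nothing about the gradient.
\<close>

lemma chain_compact:
  fixes S :: "(nat \<Rightarrow> 'n::finite oper) set" and w :: "nat \<Rightarrow> nat \<Rightarrow> 'n tfun"
  assumes S: "training_set k S" and Bn: "\<And>n. Bn n \<in> S"
    and w: "\<And>n l. l \<le> k \<Longrightarrow> w n l \<in> BVB l (chain_op (Bn n) l)" "\<And>n. w n (Suc k) = (\<lambda>x I. 0)"
    and M: "\<And>n l. 1 \<le> l \<Longrightarrow> l \<le> k \<Longrightarrow> L1_sum l (w n l) \<le> M"
      "\<And>n l. l \<le> k \<Longrightarrow> defect l (chain_op (Bn n) l) (w n l) (w n (Suc l)) \<le> ennreal M"
  shows "\<exists>r \<omega>. strict_mono r \<and> \<omega> (Suc k) = (\<lambda>x I. 0) \<and>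
    (\<forall>l\<in>{1..Suc k}. \<omega> l \<in> L1 l \<and> L1_conv l (\<lambda>n. w (r n) l) (\<omega> l))"
proof -
  define M' where "M' = max M 0"
  have wL: "w n l \<in> L1 l" if "l \<le> Suc k" for n l
    using w(1)[of l n] w(2)[of n] that BVB_L1 zero_L1 by (cases "l = Suc k") auto
  have M': "L1_sum l (w n l) \<le> M'" if "1 \<le> l" "l \<le> Suc k" for n l
    using M(1)[of l n] w(2)[of n] that by (cases "l = Suc k") (auto simp: M'_def L1_sum_def)
  have "\<exists>r. strict_mono r \<and> (\<forall>l\<in>{1..k}. \<exists>\<omega>\<in>L1 l. L1_conv l ((\<lambda>n. w n l) \<circ> r) \<omega>)"
  proof (rule common_subsequence)
    fix l and r r' :: "nat \<Rightarrow> nat" assume "l \<in> {1..k}" "strict_mono r" "strict_mono r'"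
      "\<exists>\<omega>\<in>L1 l. L1_conv l ((\<lambda>n. w n l) \<circ> r) \<omega>"
    then show "\<exists>\<omega>\<in>L1 l. L1_conv l ((\<lambda>n. w n l) \<circ> (r \<circ> r')) \<omega>"
      using L1_conv_subseq[of l "(\<lambda>n. w n l) \<circ> r" _ r'] by (auto simp: o_assoc)
  next
    fix l and r :: "nat \<Rightarrow> nat" assume l: "l \<in> {1..k}" and r: "strict_mono r"
    then obtain j where j: "l = Suc j" "j < k" by (cases l) auto
    have "\<exists>r' \<omega>. strict_mono r' \<and> \<omega> \<in> L1 (Suc j) \<and> L1_conv (Suc j) ((\<lambda>n. w (r n) (Suc j)) \<circ> r') \<omega>"
    proof (rule training_set_compact[OF S _ j(2), where Bn = "\<lambda>n. Bn (r n)" and f = "\<lambda>n. w (r n) (Suc (Suc j))" and M = M'])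
      show "w (r n) (Suc j) \<in> BVB (Suc j) (Bn (r n) j)" for n using w(1)[of "Suc j" "r n"] j by simp
      show "defect (Suc j) (Bn (r n) j) (w (r n) (Suc j)) (w (r n) (Suc (Suc j))) \<le> ennreal M'" for n
        using M(2)[of "Suc j" "r n"] j by (auto simp: M'_def intro: order_trans ennreal_leI)
    qed (use Bn wL M' j in auto)
    then show "\<exists>r'. strict_mono r' \<and> (\<exists>\<omega>\<in>L1 l. L1_conv l ((\<lambda>n. w n l) \<circ> (r \<circ> r')) \<omega>)"
      unfolding j(1) by (auto simp: o_def)
  qed simp
  then obtain r where r: "strict_mono r" "\<forall>l\<in>{1..k}. \<exists>\<omega>\<in>L1 l. L1_conv l ((\<lambda>n. w n l) \<circ> r) \<omega>" by blast
  then obtain \<omega> where \<omega>: "\<And>l. l \<in> {1..k} \<Longrightarrow> \<omega> l \<in> L1 l \<and> L1_conv l ((\<lambda>n. w n l) \<circ> r) (\<omega> l)" by metis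
  let ?\<omega> = "\<lambda>l. if l = Suc k then (\<lambda>x I. 0) else \<omega> l"
  have "?\<omega> l \<in> L1 l \<and> L1_conv l (\<lambda>n. w (r n) l) (?\<omega> l)" if "l \<in> {1..Suc k}" for l
    using that \<omega>[of l] zero_L1 w(2) by (cases "l = Suc k") (auto simp: o_def L1_conv_const)
  then show ?thesis using r(1) by (intro exI[of _ r] exI[of _ ?\<omega>]) simp
qed

lemma defect_scale:
  assumes "v \<in> L1 l" "f \<in> L1 (Suc l)" "0 \<le> s"
  shows "defect l A (\<lambda>x I. s * v x I) (\<lambda>x I. s * f x I) \<le> ennreal s * defect l A v f"
  using defect_combination[OF assms(1,1,2,2,3), of 0 A] by simp

lemma BVB_scale: "v \<in> BVB l A \<Longrightarrow> (\<lambda>x I. s * v x I) \<in> BVB l A"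
  using BVB_combination[of v l A v s 0] by simp

lemma L1_sum_scale: "0 \<le> s \<Longrightarrow> L1_sum l (\<lambda>x I. s * v x I) = s * L1_sum l v"
  by (simp add: L1_sum_def abs_mult sum_distrib_left)

text \<open>
  Only the first field and the defects are assumed bounded. If the norms of the others were
  unbounded, the chains divided by their total norm \<open>T\<close> would have, along a subsequence, a limit \<open>\<omega>\<close> with
  \<open>\<omega>\<^sub>0 = 0\<close>, zero defects and total norm 1. Zero defect and \<open>\<omega>\<^sub>l = 0\<close> imply \<open>\<omega>\<^sub>l\<^sub>+\<^sub>1 = 0\<close>, so \<open>\<omega>\<close>
  vanishes altogether.
\<close>

theorem chain_bounded:
  fixes S :: "(nat \<Rightarrow> 'n::finite oper) set" and w :: "nat \<Rightarrow> nat \<Rightarrow> 'n tfun"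
  assumes S: "training_set k S" and Bn: "\<And>n. Bn n \<in> S" and conv: "chain_conv k Bn B"
    and w: "\<And>n l. l \<le> k \<Longrightarrow> w n l \<in> BVB l (chain_op (Bn n) l)" "\<And>n. w n (Suc k) = (\<lambda>x I. 0)"
    and C: "\<And>n. L1_sum 0 (w n 0) \<le> C"
      "\<And>n l. l \<le> k \<Longrightarrow> defect l (chain_op (Bn n) l) (w n l) (w n (Suc l)) \<le> ennreal C"
  shows "\<exists>M. \<forall>n. \<forall>l\<in>{1..k}. L1_sum l (w n l) \<le> M"
proof (rule ccontr)
  assume neg: "\<not> ?thesis"
  \<comment> \<open>the inner fields are normalized by their total norm\<close>
  define T where "T n = (\<Sum>l\<in>{1..k}. L1_sum l (w n l))" for n
  have T0: "0 \<le> T n" for n unfolding T_def by (intro sum_nonneg L1_sum_nonneg)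
  have le_T: "L1_sum l (w n l) \<le> T n" if "l \<in> {1..k}" for n l
    unfolding T_def using that L1_sum_nonneg by (intro member_le_sum) auto
  have "0 \<le> C" using L1_sum_nonneg C(1) by (rule order_trans)
  have wL: "w n l \<in> L1 l" if "l \<le> Suc k" for n l
    using w(1)[of l n] w(2)[of n] that BVB_L1 zero_L1 by (cases "l = Suc k") auto
  have "\<exists>n\<ge>j. real (Suc j) < T n" for j
  proof (rule ccontr)
    assume "\<not> (\<exists>n\<ge>j. real (Suc j) < T n)"
    then have 1: "T n \<le> real (Suc j)" if "j \<le> n" for n using that by (meson not_le)
    have "T n \<le> real (Suc j) + (\<Sum>n<j. T n)" for n
    proof (cases "j \<le> n")
      case True
      then show ?thesis using 1[of n] sum_nonneg[of "{..<j}" T] T0 by (simp add: add_increasing2)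
    next
      case False
      then have "T n \<le> (\<Sum>n<j. T n)" using T0 by (intro member_le_sum) auto
      then show ?thesis by simp
    qed
    then have "L1_sum l (w n l) \<le> real (Suc j) + (\<Sum>n<j. T n)" if "l \<in> {1..k}" for n l
      using le_T[OF that] by (rule order_trans[rotated])
    then show False using neg by blast
  qed
  then obtain \<sigma> where \<sigma>: "\<And>j. j \<le> \<sigma> j" "\<And>j. real (Suc j) < T (\<sigma> j)" by metis
  have Tpos: "1 < T (\<sigma> j)" for j using \<sigma>(2)[of j] by simp
  have \<sigma>inf: "filterlim \<sigma> at_top sequentially"
    by (rule filterlim_at_top_mono[OF filterlim_ident]) (simp add: \<sigma>(1))
  have invT: "(\<lambda>j. 1 / T (\<sigma> j)) \<longlonglongrightarrow> 0"
  proof (rule tendsto_sandwich[OF _ _ tendsto_const])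
    show "(\<lambda>j. 1 / real (Suc j)) \<longlonglongrightarrow> 0" using LIMSEQ_inverse_real_of_nat by (simp add: inverse_eq_divide)
    show "\<forall>\<^sub>F j in sequentially. 1 / T (\<sigma> j) \<le> 1 / real (Suc j)"
    proof (intro always_eventually allI divide_left_mono)
      fix j
      show "real (Suc j) \<le> T (\<sigma> j)" using \<sigma>(2)[of j] by simp
      show "0 < T (\<sigma> j) * real (Suc j)" using Tpos[of j] by (intro mult_pos_pos) auto
    qed simp
    show "\<forall>\<^sub>F j in sequentially. 0 \<le> 1 / T (\<sigma> j)" using T0 by simp
  qed
  define w' where "w' j l = (\<lambda>x I. (1 / T (\<sigma> j)) * w (\<sigma> j) l x I)" for j l
  have w'B: "w' j l \<in> BVB l (chain_op (Bn (\<sigma> j)) l)" if "l \<le> k" for j l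
    unfolding w'_def by (rule BVB_scale[OF w(1)[OF that]])
  have w'L: "w' j l \<in> L1 l" if "l \<le> Suc k" for j l
    using L1_combination[OF wL[OF that] wL[OF that], of "1 / T (\<sigma> j)" _ 0] by (simp add: w'_def)
  have w'k: "w' j (Suc k) = (\<lambda>x I. 0)" for j by (simp add: w'_def w(2))
  have w's: "L1_sum l (w' j l) = L1_sum l (w (\<sigma> j) l) / T (\<sigma> j)" for j l
    unfolding w'_def using T0[of "\<sigma> j"] by (subst L1_sum_scale) auto
  have w'd: "defect l (chain_op (Bn (\<sigma> j)) l) (w' j l) (w' j (Suc l)) \<le> ennreal (C * (1 / T (\<sigma> j)))" if l: "l \<le> k" for j l
  proof -
    have "defect l (chain_op (Bn (\<sigma> j)) l) (w' j l) (w' j (Suc l)) \<le>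
        ennreal (1 / T (\<sigma> j)) * defect l (chain_op (Bn (\<sigma> j)) l) (w (\<sigma> j) l) (w (\<sigma> j) (Suc l))"
      unfolding w'_def using l T0 by (intro defect_scale wL) auto
    also have "\<dots> \<le> ennreal (1 / T (\<sigma> j)) * ennreal C" by (intro mult_left_mono C(2) l) simp
    also have "\<dots> = ennreal (C * (1 / T (\<sigma> j)))" using T0[of "\<sigma> j"] \<open>0 \<le> C\<close> by (simp add: ennreal_mult[symmetric] mult.commute)
    finally show ?thesis .
  qed
  have "\<exists>r \<omega>. strict_mono r \<and> \<omega> (Suc k) = (\<lambda>x I. 0) \<and>
    (\<forall>l\<in>{1..Suc k}. \<omega> l \<in> L1 l \<and> L1_conv l (\<lambda>n. w' (r n) l) (\<omega> l))"
  proof (rule chain_compact[OF S, where Bn = "\<lambda>j. Bn (\<sigma> j)" and M = "max 1 C"])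
    fix j l assume "1 \<le> l" "l \<le> k"
    then have "L1_sum l (w' j l) \<le> 1" using le_T[of l "\<sigma> j"] Tpos[of j] by (simp add: w's)
    then show "L1_sum l (w' j l) \<le> max 1 C" by simp
  next
    fix j l assume "l \<le> k"
    note w'd[OF this, of j]
    also have "ennreal (C * (1 / T (\<sigma> j))) \<le> ennreal (max 1 C)"
    proof (rule ennreal_leI)
      have "C * (1 / T (\<sigma> j)) \<le> C * 1" using \<open>0 \<le> C\<close> Tpos[of j] by (intro mult_left_mono) auto
      then show "C * (1 / T (\<sigma> j)) \<le> max 1 C" by simp
    qed
    finally show "defect l (chain_op (Bn (\<sigma> j)) l) (w' j l) (w' j (Suc l)) \<le> ennreal (max 1 C)" .
  qed (use Bn w'B w'k in auto)
  then obtain r \<omega>0 where r: "strict_mono r" and \<omega>k: "\<omega>0 (Suc k) = (\<lambda>x I. 0)"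
    and \<omega>0: "\<And>l. l \<in> {1..Suc k} \<Longrightarrow> \<omega>0 l \<in> L1 l \<and> L1_conv l (\<lambda>n. w' (r n) l) (\<omega>0 l)" by blast
  define \<omega> where "\<omega> l = (if l = 0 then (\<lambda>x I. 0) else \<omega>0 l)" for l
  have invTr: "(\<lambda>n. C * (1 / T (\<sigma> (r n)))) \<longlonglongrightarrow> 0"
    using tendsto_mult_right_zero[OF LIMSEQ_subseq_LIMSEQ[OF invT r], of C] by (simp add: o_def)
  have \<omega>: "\<omega> l \<in> L1 l \<and> L1_conv l (\<lambda>n. w' (r n) l) (\<omega> l)" if "l \<le> Suc k" for l
  proof (cases "l = 0")
    case True
    have "(\<lambda>n. LINT x|lebQ. \<bar>w' (r n) 0 x I - 0\<bar>) \<longlonglongrightarrow> 0" if I: "I \<in> tidx 0" for I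
    proof (rule tendsto_sandwich[OF _ _ tendsto_const invTr])
      have "(LINT x|lebQ. \<bar>w' j 0 x I - 0\<bar>) \<le> C * (1 / T (\<sigma> j))" for j
      proof -
        have "(LINT x|lebQ. \<bar>w' j 0 x I - 0\<bar>) \<le> L1_sum 0 (w' j 0)" using integral_abs_le_L1_sum[OF I, of "w' j 0"] by simp
        also have "\<dots> \<le> C * (1 / T (\<sigma> j))" unfolding w's using C(1)[of "\<sigma> j"] T0[of "\<sigma> j"] by (simp add: divide_right_mono)
        finally show ?thesis .
      qed
      then show "\<forall>\<^sub>F n in sequentially. (LINT x|lebQ. \<bar>w' (r n) 0 x I - 0\<bar>) \<le> C * (1 / T (\<sigma> (r n)))" by simp
      show "\<forall>\<^sub>F n in sequentially. 0 \<le> (LINT x|lebQ. \<bar>w' (r n) 0 x I - 0\<bar>)"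
        by (intro always_eventually allI integral_nonneg_AE) simp
    qed
    then show ?thesis using True by (simp add: \<omega>_def L1_conv_def zero_L1)
  next
    case False
    then show ?thesis using \<omega>0[of l] that by (simp add: \<omega>_def)
  qed
  have opc: "coef_conv (\<lambda>n. chain_op (Bn (\<sigma> (r n))) l) (chain_op B l)" if "l \<le> k" for l
  proof -
    have "filterlim (\<lambda>n. \<sigma> (r n)) at_top sequentially"
      by (rule filterlim_compose[OF \<sigma>inf filterlim_subseq[OF r]])
    note lim = this
    show ?thesis
      unfolding coef_conv_def
    proof (intro allI)
      fix i J I
      have "(\<lambda>n. chain_op (Bn n) l i J I) \<longlonglongrightarrow> chain_op B l i J I"
        using conv that unfolding chain_conv_def coef_conv_def by blast
      from filterlim_compose[OF this lim]
      show "(\<lambda>n. chain_op (Bn (\<sigma> (r n))) l i J I) \<longlonglongrightarrow> chain_op B l i J I" .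
    qed
  qed
  have d0: "defect l (chain_op B l) (\<omega> l) (\<omega> (Suc l)) \<le> 0" if l: "l \<le> k" for l
  proof -
    have "defect l (chain_op B l) (\<omega> l) (\<omega> (Suc l)) \<le> ennreal 0"
    proof (rule defect_lsc[where v = "\<lambda>n. w' (r n) l" and f = "\<lambda>n. w' (r n) (Suc l)" and An = "\<lambda>n. chain_op (Bn (\<sigma> (r n))) l"
          and c = "\<lambda>n. C * (1 / T (\<sigma> (r n)))"])
      show "0 \<le> C * (1 / T (\<sigma> (r n)))" for n using \<open>0 \<le> C\<close> T0 by simp
    qed (use l w'L \<omega>[of l] \<omega>[of "Suc l"] opc w'd invTr in auto)
    then show ?thesis by simp
  qed
  have zero: "AE x in lebQ. \<omega> l x I = 0" if "l \<le> Suc k" "I \<in> tidx l" for l I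
    using that
  proof (induction l arbitrary: I)
    case 0
    then show ?case by (simp add: \<omega>_def)
  next
    case (Suc l)
    show ?case
    proof (rule target_eq_0_of_defect_0[of "\<omega> l" l "\<omega> (Suc l)" "chain_op B l" I])
      show "\<omega> l \<in> L1 l" "\<omega> (Suc l) \<in> L1 (Suc l)" using \<omega>[of l] \<omega>[of "Suc l"] Suc.prems by auto
      show "defect l (chain_op B l) (\<omega> l) (\<omega> (Suc l)) \<le> 0" using d0[of l] Suc.prems by simp
      show "AE x in lebQ. \<omega> l x I = 0" if "I \<in> tidx l" for I using Suc.IH[of I] Suc.prems that by simp
    qed (use Suc.prems in auto)
  qed
  have \<omega>s: "L1_sum l (\<omega> l) = 0" if "l \<le> Suc k" for l
    unfolding L1_sum_def
  proof (rule sum.neutral, rule ballI)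
    fix I :: "'n list" assume "I \<in> tidx l"
    then show "(LINT x|lebQ. \<bar>\<omega> l x I\<bar>) = 0"
      using zero[OF that, of I] by (intro integral_eq_zero_AE) simp
  qed
  have "(\<lambda>n. \<Sum>l\<in>{1..k}. L1_sum l (w' (r n) l)) \<longlonglongrightarrow> (\<Sum>l\<in>{1..k}. L1_sum l (\<omega> l))"
    using \<omega> w'L by (intro tendsto_sum L1_sum_tendsto) auto
  also have "(\<Sum>l\<in>{1..k}. L1_sum l (\<omega> l)) = 0" using \<omega>s by (intro sum.neutral) auto
  finally have "(\<lambda>n. \<Sum>l\<in>{1..k}. L1_sum l (w' (r n) l)) \<longlonglongrightarrow> 0" .
  moreover have "(\<Sum>l\<in>{1..k}. L1_sum l (w' j l)) = 1" for j
    unfolding w's sum_divide_distrib[symmetric] using Tpos[of j] by (simp add: T_def)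
  ultimately show False by (simp add: LIMSEQ_const_iff)
qed

section \<open>Convexity, and uniqueness on the second level\<close>

lemma tidx_0 [simp]: "tidx 0 = {[]}"
  by (auto simp: tidx_def)

lemma BV_integrable: "u \<in> BV \<Longrightarrow> integrable lebQ u"
  using BVB_L1[of "scalar u" 0 grad_op] by (simp add: BV_def L1_def scalar_def)

lemma BV_measurable: "u \<in> BV \<Longrightarrow> u \<in> borel_measurable lebQ"
  using BV_integrable by auto

lemma scalar_L1: "integrable lebQ u \<Longrightarrow> scalar u \<in> L1 0"
  by (simp add: L1_def scalar_def)

lemma scalar_midpoint: "scalar (\<lambda>x. (u x + w x) / 2) = (\<lambda>x I. 1/2 * scalar u x I + 1/2 * scalar w x I)"
  by (simp add: scalar_def field_simps)

lemma BV_midpoint: "u \<in> BV \<Longrightarrow> w \<in> BV \<Longrightarrow> (\<lambda>x. (u x + w x) / 2) \<in> BV"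
  unfolding BV_def mem_Collect_eq scalar_midpoint by (rule BVB_combination)

lemma ennreal_halves: "ennreal (1/2) * c + ennreal (1/2) * c = c"
proof -
  have "ennreal (1/2) * c + ennreal (1/2) * c = ennreal (1/2 + 1/2) * c"
    by (subst ennreal_plus) (auto simp: distrib_right)
  then show ?thesis by simp
qed

lemma defect_midpoint_le:
  assumes "v \<in> L1 l" "w \<in> L1 l" "f \<in> L1 (Suc l)" "g \<in> L1 (Suc l)"
    and "defect l A v f \<le> c" "defect l A w g \<le> c"
  shows "defect l A (\<lambda>x I. 1/2 * v x I + 1/2 * w x I) (\<lambda>x I. 1/2 * f x I + 1/2 * g x I) \<le> c"
proof -
  have "defect l A (\<lambda>x I. 1/2 * v x I + 1/2 * w x I) (\<lambda>x I. 1/2 * f x I + 1/2 * g x I) \<le>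
      ennreal (1/2) * defect l A v f + ennreal (1/2) * defect l A w g"
    using assms(1-4) by (rule defect_combination) auto
  also have "\<dots> \<le> ennreal (1/2) * c + ennreal (1/2) * c"
    using assms(5,6) by (intro add_mono mult_left_mono) auto
  finally show ?thesis unfolding ennreal_halves .
qed

lemma chain_field_midpoint:
  "chain_field k (\<lambda>x. (u x + w x) / 2) (\<lambda>j x I. 1/2 * v j x I + 1/2 * v' j x I) l =
    (\<lambda>x I. 1/2 * chain_field k u v l x I + 1/2 * chain_field k w v' l x I)"
  unfolding chain_field_def scalar_midpoint by (auto split: nat.split)

text \<open>
  The competitors of \<open>u\<close> and \<open>w\<close> are averaged together with \<open>u\<close> and \<open>w\<close>; the infimum of a jointly
  convex functional is convex.
\<close>

lemma chain_cost_midpoint: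
  assumes u: "u \<in> BV" "w \<in> BV" and v: "v \<in> competitors k B" "v' \<in> competitors k B"
  shows "chain_cost k \<alpha> B (chain_field k (\<lambda>x. (u x + w x) / 2) (\<lambda>j x I. 1/2 * v j x I + 1/2 * v' j x I)) \<le>
    ennreal (1/2) * chain_cost k \<alpha> B (chain_field k u v) + ennreal (1/2) * chain_cost k \<alpha> B (chain_field k w v')"
  unfolding chain_cost_def sum_distrib_left sum.distrib[symmetric]
proof (rule sum_mono)
  fix l assume "l \<in> {..k}"
  then have L: "l \<le> Suc k" "Suc l \<le> Suc k" by auto
  have "ennreal (\<alpha> l) * defect l (chain_op B l)
      (chain_field k (\<lambda>x. (u x + w x) / 2) (\<lambda>j x I. 1/2 * v j x I + 1/2 * v' j x I) l)
      (chain_field k (\<lambda>x. (u x + w x) / 2) (\<lambda>j x I. 1/2 * v j x I + 1/2 * v' j x I) (Suc l)) \<le>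
    ennreal (\<alpha> l) * (ennreal (1/2) * defect l (chain_op B l) (chain_field k u v l) (chain_field k u v (Suc l)) +
      ennreal (1/2) * defect l (chain_op B l) (chain_field k w v' l) (chain_field k w v' (Suc l)))"
    unfolding chain_field_midpoint
    by (intro mult_left_mono defect_combination chain_field_L1[OF u(1) v(1)] chain_field_L1[OF u(2) v(2)] L) auto
  then show "ennreal (\<alpha> l) * defect l (chain_op B l)
      (chain_field k (\<lambda>x. (u x + w x) / 2) (\<lambda>j x I. 1/2 * v j x I + 1/2 * v' j x I) l)
      (chain_field k (\<lambda>x. (u x + w x) / 2) (\<lambda>j x I. 1/2 * v j x I + 1/2 * v' j x I) (Suc l)) \<le>
    ennreal (1/2) * (ennreal (\<alpha> l) * defect l (chain_op B l) (chain_field k u v l) (chain_field k u v (Suc l))) +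
    ennreal (1/2) * (ennreal (\<alpha> l) * defect l (chain_op B l) (chain_field k w v' l) (chain_field k w v' (Suc l)))"
    by (simp only: distrib_left mult.left_commute)
qed

lemma competitors_midpoint:
  "v \<in> competitors k B \<Longrightarrow> v' \<in> competitors k B \<Longrightarrow> (\<lambda>j x I. 1/2 * v j x I + 1/2 * v' j x I) \<in> competitors k B"
  unfolding competitors_def using BVB_combination by blast

lemma PGV_near_optimal:
  assumes k: "1 \<le> k" and u: "u \<in> BV" and fin: "PGV k \<alpha> B u \<noteq> \<infinity>" and e: "0 < e"
  obtains v where "v \<in> competitors k B" "chain_cost k \<alpha> B (chain_field k u v) \<le> PGV k \<alpha> B u + ennreal e"
proof -
  have "PGV k \<alpha> B u < PGV k \<alpha> B u + ennreal e"
    using fin e ennreal_add_left_cancel_less[of "PGV k \<alpha> B u" 0 "ennreal e"] by simp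
  then obtain v where "v \<in> competitors k B" "chain_cost k \<alpha> B (chain_field k u v) < PGV k \<alpha> B u + ennreal e"
    by (subst (asm) (1) PGV_eq_chain_cost[OF k u]) (auto simp: INF_less_iff)
  then show ?thesis using that by (auto intro: less_imp_le)
qed

lemma PGV_le_chain_cost:
  "1 \<le> k \<Longrightarrow> u \<in> BV \<Longrightarrow> v \<in> competitors k B \<Longrightarrow> PGV k \<alpha> B u \<le> chain_cost k \<alpha> B (chain_field k u v)"
  unfolding PGV_eq_chain_cost by (rule INF_lower)

lemma PGV_midpoint:
  assumes k: "1 \<le> k" and u: "u \<in> BV" "w \<in> BV"
  shows "PGV k \<alpha> B (\<lambda>x. (u x + w x) / 2) \<le> ennreal (1/2) * PGV k \<alpha> B u + ennreal (1/2) * PGV k \<alpha> B w"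
proof (cases "PGV k \<alpha> B u = \<infinity> \<or> PGV k \<alpha> B w = \<infinity>")
  case True
  then show ?thesis by (auto simp: ennreal_mult_top)
next
  case False
  show ?thesis
  proof (rule ennreal_le_epsilon)
    fix e :: real assume e: "0 < e"
    obtain v where v: "v \<in> competitors k B" "chain_cost k \<alpha> B (chain_field k u v) \<le> PGV k \<alpha> B u + ennreal e"
      using PGV_near_optimal[OF k u(1) _ e] False by blast
    obtain v' where v': "v' \<in> competitors k B" "chain_cost k \<alpha> B (chain_field k w v') \<le> PGV k \<alpha> B w + ennreal e"
      using PGV_near_optimal[OF k u(2) _ e] False by blast
    have "PGV k \<alpha> B (\<lambda>x. (u x + w x) / 2) \<le>
        chain_cost k \<alpha> B (chain_field k (\<lambda>x. (u x + w x) / 2) (\<lambda>j x I. 1/2 * v j x I + 1/2 * v' j x I))"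
      by (rule PGV_le_chain_cost[OF k BV_midpoint[OF u] competitors_midpoint[OF v(1) v'(1)]])
    also have "\<dots> \<le> ennreal (1/2) * chain_cost k \<alpha> B (chain_field k u v) + ennreal (1/2) * chain_cost k \<alpha> B (chain_field k w v')"
      by (rule chain_cost_midpoint[OF u v(1) v'(1)])
    also have "\<dots> \<le> ennreal (1/2) * (PGV k \<alpha> B u + ennreal e) + ennreal (1/2) * (PGV k \<alpha> B w + ennreal e)"
      by (intro add_mono mult_left_mono v v') auto
    also have "\<dots> = ennreal (1/2) * PGV k \<alpha> B u + ennreal (1/2) * PGV k \<alpha> B w + (ennreal (1/2) * ennreal e + ennreal (1/2) * ennreal e)"
      by (simp only: distrib_left add_ac)
    finally show "PGV k \<alpha> B (\<lambda>x. (u x + w x) / 2) \<le> ennreal (1/2) * PGV k \<alpha> B u + ennreal (1/2) * PGV k \<alpha> B w + ennreal e"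
      unfolding ennreal_halves .
  qed
qed

definition energy :: "nat \<Rightarrow> (real ^ 'n::finite \<Rightarrow> real) \<Rightarrow> (nat \<Rightarrow> real) \<Rightarrow> (nat \<Rightarrow> 'n oper) \<Rightarrow> (real ^ 'n \<Rightarrow> real) \<Rightarrow> ennreal" where
  "energy k \<eta> \<alpha> B u = L2_sq (\<lambda>x. u x - \<eta> x) + PGV k \<alpha> B u"

lemma level2_iff: "u \<in> level2 \<eta> k \<alpha> B \<longleftrightarrow> u \<in> BV \<and> (\<forall>w\<in>BV. energy k \<eta> \<alpha> B u \<le> energy k \<eta> \<alpha> B w)"
  by (simp add: level2_def energy_def)

lemma zero_BV: "(\<lambda>x. 0) \<in> BV"
  using zero_BVB[of 0 grad_op] by (simp add: BV_def scalar_def)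

lemma energy_zero:
  assumes k: "1 \<le> k"
  shows "energy k \<eta> \<alpha> B (\<lambda>x. 0) \<le> L2_sq \<eta>"
proof -
  have v: "(\<lambda>j x I. 0) \<in> competitors k B" by (simp add: competitors_def zero_BVB)
  have f: "chain_field k (\<lambda>x. 0) (\<lambda>j x I. 0) l = (\<lambda>x I. 0)" for l
    by (auto simp: chain_field_def scalar_def split: nat.split)
  have "defect l A (\<lambda>x I. 0) (\<lambda>x I. 0) \<le> ennreal 0" for l A
    by (rule defect_leI) (simp add: defect_pair_def dist_op_def)
  then have d: "defect l A (\<lambda>x I. 0) (\<lambda>x I. 0) = 0" for l A by simp
  have "PGV k \<alpha> B (\<lambda>x. 0) \<le> chain_cost k \<alpha> B (chain_field k (\<lambda>x. 0) (\<lambda>j x I. 0))"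
    by (rule PGV_le_chain_cost[OF k zero_BV v])
  also have "\<dots> = 0" by (simp add: chain_cost_def f d)
  finally show ?thesis by (simp add: energy_def L2_sq_def)
qed

text \<open>
  By the parallelogram identity the midpoint of two minimizers has an energy that is smaller by
  the squared norm of half their difference. Energies must be finite here, which the competitor 0 ensures.
\<close>

lemma level2_unique:
  assumes k: "1 \<le> k" and \<eta>: "\<eta> \<in> L2" and u: "u \<in> level2 \<eta> k \<alpha> B" "w \<in> level2 \<eta> k \<alpha> B"
  shows "AE x in lebQ. w x = u x"
proof -
  have [measurable]: "\<eta> \<in> borel_measurable lebQ" using \<eta> by (simp add: L2_def)
  have BV: "u \<in> BV" "w \<in> BV" using u by (auto simp: level2_iff)
  have [measurable]: "u \<in> borel_measurable lebQ" "w \<in> borel_measurable lebQ" using BV BV_measurable by auto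
  let ?m = "\<lambda>x. (u x + w x) / 2"
  define E where "E = energy k \<eta> \<alpha> B u"
  have Ew: "energy k \<eta> \<alpha> B w = E" unfolding E_def using u by (intro antisym) (auto simp: level2_iff)
  have "E \<le> energy k \<eta> \<alpha> B (\<lambda>x. 0)"
    unfolding E_def by (rule bspec[OF conjunct2[OF u(1)[unfolded level2_iff]] zero_BV])
  also have "\<dots> \<le> L2_sq \<eta>" by (rule energy_zero[OF k])
  also have "\<dots> < \<infinity>" using \<eta> by (simp add: L2_def)
  finally have fin: "E \<noteq> \<infinity>" by simp
  have a: "(\<lambda>x. ((u x - \<eta> x) + (w x - \<eta> x)) / 2) = (\<lambda>x. ?m x - \<eta> x)"
      "(\<lambda>x. ((u x - \<eta> x) - (w x - \<eta> x)) / 2) = (\<lambda>x. (u x - w x) / 2)"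
    by (auto simp: field_simps)
  have par: "L2_sq (\<lambda>x. ?m x - \<eta> x) + L2_sq (\<lambda>x. (u x - w x) / 2) =
      ennreal (1/2) * L2_sq (\<lambda>x. u x - \<eta> x) + ennreal (1/2) * L2_sq (\<lambda>x. w x - \<eta> x)"
    using L2_parallelogram[of "\<lambda>x. u x - \<eta> x" "\<lambda>x. w x - \<eta> x"] unfolding a by simp
  have "E + L2_sq (\<lambda>x. (u x - w x) / 2) \<le> energy k \<eta> \<alpha> B ?m + L2_sq (\<lambda>x. (u x - w x) / 2)"
    unfolding E_def
    by (intro add_right_mono bspec[OF conjunct2[OF u(1)[unfolded level2_iff]] BV_midpoint[OF BV]])
  also have "\<dots> = (L2_sq (\<lambda>x. ?m x - \<eta> x) + L2_sq (\<lambda>x. (u x - w x) / 2)) + PGV k \<alpha> B ?m"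
    by (simp only: energy_def add_ac)
  also have "\<dots> \<le> (ennreal (1/2) * L2_sq (\<lambda>x. u x - \<eta> x) + ennreal (1/2) * L2_sq (\<lambda>x. w x - \<eta> x)) +
      (ennreal (1/2) * PGV k \<alpha> B u + ennreal (1/2) * PGV k \<alpha> B w)"
    unfolding par by (intro add_left_mono PGV_midpoint[OF k BV])
  also have "\<dots> = ennreal (1/2) * energy k \<eta> \<alpha> B u + ennreal (1/2) * energy k \<eta> \<alpha> B w"
    by (simp only: energy_def distrib_left add_ac)
  also have "\<dots> = E" unfolding Ew E_def[symmetric] by (rule ennreal_halves)
  finally have "E + L2_sq (\<lambda>x. (u x - w x) / 2) \<le> E + 0" by simp
  then have "L2_sq (\<lambda>x. (u x - w x) / 2) = 0" using fin by (simp add: ennreal_add_left_cancel_le)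
  then have "AE x in lebQ. ennreal (((u x - w x) / 2)\<^sup>2) = 0"
    unfolding L2_sq_def by (subst (asm) nn_integral_0_iff_AE) auto
  then show ?thesis
  proof eventually_elim
    case (elim x)
    then have "((u x - w x) / 2)\<^sup>2 \<le> 0" by simp
    then show ?case by simp
  qed
qed

section \<open>Upper semicontinuity in the parameters\<close>

lemma ennreal_weighted_sum:
  assumes "\<And>l. l \<in> I \<Longrightarrow> 0 \<le> a l" "\<And>l. l \<in> I \<Longrightarrow> 0 \<le> b l"
  shows "(\<Sum>l\<in>I. ennreal (a l) * ennreal (b l)) = ennreal (\<Sum>l\<in>I. a l * b l)"
proof -
  have "(\<Sum>l\<in>I. ennreal (a l) * ennreal (b l)) = (\<Sum>l\<in>I. ennreal (a l * b l))"
    using assms by (intro sum.cong refl) (simp add: ennreal_mult)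
  also have "\<dots> = ennreal (\<Sum>l\<in>I. a l * b l)"
    using assms by (intro sum_ennreal) auto
  finally show ?thesis .
qed

text \<open>
  The inner fields of an almost optimal chain for the limit operators are replaced by recovery fields. Each
  defect involves two neighbouring fields: the first is covered by \<open>recovery_competitor\<close>, and replacing the second costs
  its \<open>L\<^sup>1\<close> distance.
\<close>

theorem PGV_limsup:
  fixes \<alpha>n :: "nat \<Rightarrow> nat \<Rightarrow> real" and Bn :: "nat \<Rightarrow> nat \<Rightarrow> 'n::finite oper"
  assumes k: "1 \<le> k" and z: "z \<in> BV" and conv: "chain_conv k Bn B"
    and \<alpha>: "\<And>l. l \<le> k \<Longrightarrow> (\<lambda>n. \<alpha>n n l) \<longlonglongrightarrow> \<alpha> l" "\<And>n l. l \<le> k \<Longrightarrow> 0 \<le> \<alpha>n n l" "\<And>l. l \<le> k \<Longrightarrow> 0 < \<alpha> l"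
    and e: "0 < e"
  shows "\<forall>\<^sub>F n in sequentially. PGV k (\<alpha>n n) (Bn n) z \<le> PGV k \<alpha> B z + ennreal e"
proof (cases "PGV k \<alpha> B z = \<infinity>")
  case False
  have e3: "0 < e / 3" using e by simp
  obtain v where v: "v \<in> competitors k B" and cost: "chain_cost k \<alpha> B (chain_field k z v) \<le> PGV k \<alpha> B z + ennreal (e / 3)"
    using PGV_near_optimal[OF k z False e3] by blast
  define w where "w = chain_field k z v"
  have wL: "w l \<in> L1 l" if "l \<le> Suc k" for l unfolding w_def by (rule chain_field_L1[OF z v that])
  let ?D = "\<lambda>l. defect l (chain_op B l) (w l) (w (Suc l))"
  have cfin: "chain_cost k \<alpha> B w \<noteq> \<infinity>" using cost False unfolding w_def by (auto simp: top_unique)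
  have Dfin: "?D l \<noteq> \<infinity>" if l: "l \<le> k" for l
  proof -
    have "ennreal (\<alpha> l) * ?D l \<le> chain_cost k \<alpha> B w"
      unfolding chain_cost_def using l by (intro member_le_sum) auto
    then have "ennreal (\<alpha> l) * ?D l \<noteq> \<infinity>" using cfin by (auto simp: top_unique)
    then show ?thesis using \<alpha>(3)[OF l] by (auto simp: ennreal_mult_eq_top_iff)
  qed
  define d where "d l = enn2real (?D l)" for l
  have d: "?D l = ennreal (d l)" "0 \<le> d l" if "l \<le> k" for l
    using Dfin[OF that] by (auto simp: d_def less_top)
  \<comment> \<open>\<open>\<tau> * N l\<close> bounds the growth of the \<open>l\<close>-th defect: \<open>\<tau>\<close> for the field, \<open>\<tau>\<close> for each entry of the target\<close>
  define N where "N l = 1 + (\<Sum>J\<in>(tidx (Suc l) :: 'n list set). (1::real))" for l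
  have N: "1 \<le> N l" for l by (simp add: N_def)
  \<comment> \<open>chosen such that the growth of all defects together costs less than \<open>e / 3\<close>\<close>
  define \<tau> where "\<tau> = e / (3 * (1 + (\<Sum>l\<le>k. \<alpha> l * N l)))"
  have sN: "0 \<le> (\<Sum>l\<le>k. \<alpha> l * N l)" using \<alpha>(3) N by (intro sum_nonneg mult_nonneg_nonneg) (auto intro: less_imp_le order_trans[OF _ N])
  have \<tau>: "0 < \<tau>" using e sN by (simp add: \<tau>_def)
  have \<tau>s: "\<tau> * (\<Sum>l\<le>k. \<alpha> l * N l) < e / 3 + 0"
  proof -
    have "\<tau> * (\<Sum>l\<le>k. \<alpha> l * N l) < \<tau> * (1 + (\<Sum>l\<le>k. \<alpha> l * N l))" using \<tau> by (intro mult_strict_left_mono) auto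
    also have "\<dots> = e / 3" using sN by (simp add: \<tau>_def field_simps)
    finally show ?thesis by simp
  qed
  let ?P = "\<lambda>l w'. (\<forall>A. w' \<in> BVB l A) \<and> (\<forall>I\<in>tidx l. (LINT x|lebQ. \<bar>w' x I - w l x I\<bar>) < \<tau>) \<and>
    (\<forall>An A. coef_conv An A \<longrightarrow> (\<forall>\<^sub>F n in sequentially. defect l (An n) w' (w (Suc l)) \<le> defect l A (w l) (w (Suc l)) + ennreal \<tau>))"
  have "\<forall>l\<in>{1..k}. \<exists>w'. ?P l w'"
  proof
    fix l assume "l \<in> {1..k}"
    then have L: "l \<le> Suc k" "Suc l \<le> Suc k" by auto
    show "\<exists>w'. ?P l w'" by (rule recovery_competitor[OF wL[OF L(1)] wL[OF L(2)] \<tau>])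
  qed
  from bchoice[OF this] obtain y where y0: "\<forall>l\<in>{1..k}. ?P l (y l)" ..
  have y: "y l \<in> BVB l A" "I \<in> tidx l \<Longrightarrow> (LINT x|lebQ. \<bar>y l x I - w l x I\<bar>) < \<tau>"
    "coef_conv An A' \<Longrightarrow> \<forall>\<^sub>F n in sequentially. defect l (An n) (y l) (w (Suc l)) \<le> defect l A' (w l) (w (Suc l)) + ennreal \<tau>"
    if l: "l \<in> {1..k}" for l I A An A'
  proof -
    note P = bspec[OF y0 l]
    show "y l \<in> BVB l A" using conjunct1[OF P] by (rule spec)
    show "I \<in> tidx l \<Longrightarrow> (LINT x|lebQ. \<bar>y l x I - w l x I\<bar>) < \<tau>"
      by (rule bspec[OF conjunct1[OF conjunct2[OF P]]])
    show "coef_conv An A' \<Longrightarrow> \<forall>\<^sub>F n in sequentially. defect l (An n) (y l) (w (Suc l)) \<le> defect l A' (w l) (w (Suc l)) + ennreal \<tau>"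
      by (rule mp[OF spec[OF spec[OF conjunct2[OF conjunct2[OF P]]]]])
  qed
  define v' where "v' j = y (Suc j)" for j
  have v': "v' \<in> competitors k A" for A using y(1) by (simp add: competitors_def v'_def)
  define w' where "w' = chain_field k z v'"
  have w'0: "w' 0 = w 0" "w' (Suc k) = w (Suc k)" by (simp_all add: w'_def w_def)
  have w'y: "w' l = y l" if "l \<in> {1..k}" for l
    using that by (cases l) (auto simp: w'_def v'_def)
  have w'L: "w' l \<in> L1 l" if "l \<le> Suc k" for l unfolding w'_def by (rule chain_field_L1[OF z v' that])
  have close: "(\<Sum>J\<in>tidx l. LINT x|lebQ. \<bar>w' l x J - w l x J\<bar>) \<le> (\<Sum>J\<in>(tidx l :: 'n list set). \<tau>)" if "l \<le> Suc k" for l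
  proof (rule sum_mono)
    fix J :: "'n list" assume J: "J \<in> tidx l"
    show "(LINT x|lebQ. \<bar>w' l x J - w l x J\<bar>) \<le> \<tau>"
      using y(2)[of l J] J that w'y[of l] w'0 \<tau> by (cases "l = 0"; cases "l = Suc k") auto
  qed
  have ev: "\<forall>\<^sub>F n in sequentially. \<forall>l\<in>{..k}. defect l (chain_op (Bn n) l) (w' l) (w (Suc l)) \<le> ?D l + ennreal \<tau>"
  proof (intro eventually_ball_finite finite_atMost ballI)
    fix l assume l: "l \<in> {..k}"
    show "\<forall>\<^sub>F n in sequentially. defect l (chain_op (Bn n) l) (w' l) (w (Suc l)) \<le> ?D l + ennreal \<tau>"
    proof (cases "l = 0")
      case True
      then show ?thesis by (simp add: w'0)
    next
      case False
      then have l1: "l \<in> {1..k}" using l by auto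
      show ?thesis unfolding w'y[OF l1]
        using conv l by (intro y(3)[OF l1]) (auto simp: chain_conv_def)
    qed
  qed
  have lim: "(\<lambda>n. \<Sum>l\<le>k. \<alpha>n n l * (d l + \<tau> * N l)) \<longlonglongrightarrow> (\<Sum>l\<le>k. \<alpha> l * (d l + \<tau> * N l))"
    by (intro tendsto_sum tendsto_mult \<alpha>(1) tendsto_const) auto
  have "(\<Sum>l\<le>k. \<alpha> l * (d l + \<tau> * N l)) = (\<Sum>l\<le>k. \<alpha> l * d l) + \<tau> * (\<Sum>l\<le>k. \<alpha> l * N l)"
    by (simp add: distrib_left sum.distrib sum_distrib_left mult_ac)
  then have "(\<Sum>l\<le>k. \<alpha> l * (d l + \<tau> * N l)) < (\<Sum>l\<le>k. \<alpha> l * d l) + e / 3" using \<tau>s by simp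
  then have "\<forall>\<^sub>F n in sequentially. (\<Sum>l\<le>k. \<alpha>n n l * (d l + \<tau> * N l)) < (\<Sum>l\<le>k. \<alpha> l * d l) + e / 3"
    by (rule order_tendstoD(2)[OF lim])
  with ev show ?thesis
  proof eventually_elim
    case (elim n)
    have nd: "0 \<le> d l + \<tau> * N l" if "l \<le> k" for l
      using d(2)[OF that] \<tau> N[of l] by (intro add_nonneg_nonneg mult_nonneg_nonneg) auto
    have "PGV k (\<alpha>n n) (Bn n) z \<le> chain_cost k (\<alpha>n n) (Bn n) w'"
      unfolding w'_def by (rule PGV_le_chain_cost[OF k z v'])
    also have "\<dots> \<le> (\<Sum>l\<le>k. ennreal (\<alpha>n n l) * ennreal (d l + \<tau> * N l))"
      unfolding chain_cost_def
    proof (intro sum_mono mult_left_mono)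
      fix l assume l: "l \<in> {..k}"
      have "defect l (chain_op (Bn n) l) (w' l) (w' (Suc l)) \<le> defect l (chain_op (Bn n) l) (w' l) (w (Suc l)) +
          ennreal (\<Sum>J\<in>tidx (Suc l). LINT x|lebQ. \<bar>w' (Suc l) x J - w (Suc l) x J\<bar>)"
        using l by (intro defect_change_target w'L wL) auto
      also have "\<dots> \<le> (ennreal (d l) + ennreal \<tau>) + ennreal (\<Sum>J\<in>(tidx (Suc l) :: 'n list set). \<tau>)"
        using bspec[OF elim(1) l] d(1)[of l] close[of "Suc l"] l by (intro add_mono ennreal_leI) auto
      also have "\<dots> = ennreal (d l + \<tau>) + ennreal (\<Sum>J\<in>(tidx (Suc l) :: 'n list set). \<tau>)"
        using d(2)[of l] \<tau> l by (subst ennreal_plus) auto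
      also have "\<dots> = ennreal (d l + \<tau> + (\<Sum>J\<in>(tidx (Suc l) :: 'n list set). \<tau>))"
        using d(2)[of l] \<tau> l by (intro ennreal_plus[symmetric]) (auto intro: add_nonneg_nonneg)
      also have "d l + \<tau> + (\<Sum>J\<in>(tidx (Suc l) :: 'n list set). \<tau>) = d l + \<tau> * N l"
        by (simp add: N_def distrib_left)
      finally show "defect l (chain_op (Bn n) l) (w' l) (w' (Suc l)) \<le> ennreal (d l + \<tau> * N l)" .
    qed simp
    also have "\<dots> = ennreal (\<Sum>l\<le>k. \<alpha>n n l * (d l + \<tau> * N l))"
      using \<alpha>(2) nd by (intro ennreal_weighted_sum) auto
    also have "\<dots> \<le> ennreal ((\<Sum>l\<le>k. \<alpha> l * d l) + e / 3)" using elim(2) by (intro ennreal_leI) simp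
    also have "\<dots> = ennreal (\<Sum>l\<le>k. \<alpha> l * d l) + ennreal (e / 3)"
      using d(2) \<alpha>(3) e3 by (intro ennreal_plus sum_nonneg mult_nonneg_nonneg) (auto intro: less_imp_le)
    also have "ennreal (\<Sum>l\<le>k. \<alpha> l * d l) = chain_cost k \<alpha> B w"
      unfolding chain_cost_def using d \<alpha>(3)
      by (subst ennreal_weighted_sum[symmetric]) (auto intro: less_imp_le)
    also have "chain_cost k \<alpha> B w + ennreal (e / 3) \<le> (PGV k \<alpha> B z + ennreal (e / 3)) + ennreal (e / 3)"
      using cost unfolding w_def by (rule add_right_mono)
    also have "\<dots> = PGV k \<alpha> B z + ennreal (e / 3 + e / 3)"
      using e3 by (subst ennreal_plus) (auto simp: add.assoc)
    also have "\<dots> \<le> PGV k \<alpha> B z + ennreal e" using e by (intro add_left_mono ennreal_leI) simp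
    finally show ?case .
  qed
qed simp

section \<open>Compactness of images with bounded energy\<close>

lemma real_common_subsequence:
  fixes X :: "'i \<Rightarrow> nat \<Rightarrow> real"
  assumes "finite I" and X: "\<And>i n. i \<in> I \<Longrightarrow> \<bar>X i n\<bar> \<le> C"
  shows "\<exists>r x. strict_mono r \<and> (\<forall>i\<in>I. (\<lambda>n. X i (r n)) \<longlonglongrightarrow> x i)"
proof -
  have "\<exists>r :: nat \<Rightarrow> nat. strict_mono r \<and> (\<forall>i\<in>I. convergent (X i \<circ> r))"
  proof (rule common_subsequence[OF assms(1)])
    fix i and r r' :: "nat \<Rightarrow> nat" assume "strict_mono r'" "convergent (X i \<circ> r)"
    then show "convergent (X i \<circ> (r \<circ> r'))"
      unfolding o_assoc by (intro convergent_subseq_convergent[of "X i \<circ> r" r'])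
  next
    fix i and r :: "nat \<Rightarrow> nat" assume i: "i \<in> I"
    have "bounded (range (X i \<circ> r))" using X[OF i] by (intro boundedI[where B = C]) auto
    then obtain l r' where "strict_mono r'" "((X i \<circ> r) \<circ> r') \<longlonglongrightarrow> l"
      using bounded_imp_convergent_subsequence by blast
    then show "\<exists>r'. strict_mono r' \<and> convergent (X i \<circ> (r \<circ> r'))"
      unfolding o_assoc by (auto simp: convergent_def)
  qed
  then obtain r where r: "strict_mono r" "\<forall>i\<in>I. convergent (X i \<circ> r)" by blast
  have "\<forall>i\<in>I. (\<lambda>n. X i (r n)) \<longlonglongrightarrow> lim (X i \<circ> r)"
    using r(2) by (auto simp: convergent_LIMSEQ_iff o_def)
  then show ?thesis using r(1) by (intro exI[of _ r] exI[of _ "\<lambda>i. lim (X i \<circ> r)"]) auto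
qed

text \<open>
  From \<open>|a| \<le> (a - b)\<^sup>2 + b\<^sup>2 + 2\<close>, integrated.
\<close>

lemma integral_abs_le_L2_sq:
  fixes u \<eta> :: "real ^ 'n::finite \<Rightarrow> real"
  assumes u: "integrable lebQ u" and [measurable]: "\<eta> \<in> borel_measurable lebQ"
  shows "ennreal (LINT x|lebQ. \<bar>u x\<bar>) \<le> L2_sq (\<lambda>x. u x - \<eta> x) + L2_sq \<eta> + 2 * emeasure (lebQ :: (real ^ 'n) measure) cube"
proof -
  have [measurable]: "u \<in> borel_measurable lebQ" using u by auto
  have le: "\<bar>a\<bar> \<le> (a - b)\<^sup>2 + b\<^sup>2 + 2" for a b :: real
  proof -
    have "\<bar>a - b\<bar> \<le> (a - b)\<^sup>2 + 1" "\<bar>b\<bar> \<le> b\<^sup>2 + 1"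
      using zero_le_power2[of "\<bar>a - b\<bar> - 1/2"] zero_le_power2[of "\<bar>b\<bar> - 1/2"]
      by (auto simp: power2_diff power_divide)
    then show ?thesis by linarith
  qed
  have "ennreal (LINT x|lebQ. \<bar>u x\<bar>) = (\<integral>\<^sup>+ x. ennreal \<bar>u x\<bar> \<partial>lebQ)"
    using u by (intro nn_integral_eq_integral[symmetric]) auto
  also have "\<dots> \<le> (\<integral>\<^sup>+ x. ennreal ((u x - \<eta> x)\<^sup>2) + ennreal ((\<eta> x)\<^sup>2) + ennreal 2 \<partial>lebQ)"
  proof (rule nn_integral_mono)
    fix x
    have "ennreal \<bar>u x\<bar> \<le> ennreal ((u x - \<eta> x)\<^sup>2 + (\<eta> x)\<^sup>2 + 2)" by (rule ennreal_leI[OF le])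
    also have "\<dots> = ennreal ((u x - \<eta> x)\<^sup>2) + ennreal ((\<eta> x)\<^sup>2) + ennreal 2"
      by (subst ennreal_plus) auto
    finally show "ennreal \<bar>u x\<bar> \<le> \<dots>" .
  qed
  also have "\<dots> = L2_sq (\<lambda>x. u x - \<eta> x) + L2_sq \<eta> + (\<integral>\<^sup>+ x. ennreal 2 \<partial>(lebQ :: (real ^ 'n) measure))"
    unfolding L2_sq_def by (simp add: nn_integral_add)
  also have "(\<integral>\<^sup>+ x. ennreal 2 \<partial>(lebQ :: (real ^ 'n) measure)) = 2 * emeasure (lebQ :: (real ^ 'n) measure) cube"
    by simp
  finally show ?thesis .
qed

lemma L2_sq_minus_commute: "L2_sq (\<lambda>x. f x - g x) = L2_sq (\<lambda>x. g x - f x)"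
  by (simp add: L2_sq_def power2_commute)

lemma eventually_le_ennreal_limit:
  fixes F :: ennreal
  assumes "Fb \<longlonglongrightarrow> F" "0 < \<delta>"
  shows "\<forall>\<^sub>F n in sequentially. Fb n \<le> F + ennreal \<delta>"
proof (cases "F = \<infinity>")
  case False
  then have "F < F + ennreal \<delta>"
    using assms(2) ennreal_add_left_cancel_less[of F 0 "ennreal \<delta>"] by simp
  from order_tendstoD(2)[OF assms(1) this] show ?thesis by (rule eventually_mono) simp
qed simp

text \<open>
  The sets \<open>K\<^sub>m\<close> collect the functions satisfying the three limit bounds up to \<open>1 / (m + 1)\<close>. They are convex
  since all three functionals are, they contain \<open>u\<^sub>n\<close> for large \<open>n\<close>, and the bounds are stable under the strong
  convergence provided by \<open>nested_midpoint_convex_Cauchy\<close>. The infinite value of \<open>F\<close> is allowed, so that the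
  bound on the distance to \<open>u\<^sub>c\<close> can be void.
\<close>

lemma BV_limit:
  fixes un :: "nat \<Rightarrow> real ^ 'n::finite \<Rightarrow> real"
  assumes un: "\<And>n. un n \<in> BV" and \<eta>: "\<eta> \<in> borel_measurable lebQ" and uc: "uc \<in> borel_measurable lebQ"
    and h: "h \<in> L1 1"
    and a: "\<And>n. L2_sq (\<lambda>x. un n x - \<eta> x) \<le> ennreal (an n)" "an \<longlonglongrightarrow> a" "0 \<le> a"
    and F: "\<And>n. L2_sq (\<lambda>x. uc x - un n x) \<le> Fb n" "Fb \<longlonglongrightarrow> F"
    and \<rho>: "\<And>n. defect 0 grad_op (scalar (un n)) h \<le> ennreal (\<rho>n n)" "\<rho>n \<longlonglongrightarrow> \<rho>" "0 \<le> \<rho>"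
  shows "\<exists>u\<in>BV. L2_sq (\<lambda>x. u x - \<eta> x) \<le> ennreal a \<and> L2_sq (\<lambda>x. uc x - u x) \<le> F \<and>
    defect 0 grad_op (scalar u) h \<le> ennreal \<rho>"
proof -
  define \<delta> where "\<delta> m = inverse (real (Suc m))" for m
  have \<delta>: "0 < \<delta> m" "\<delta> (Suc m) \<le> \<delta> m" for m by (auto simp: \<delta>_def)
  have \<delta>0: "\<delta> \<longlonglongrightarrow> 0" unfolding \<delta>_def by (rule LIMSEQ_inverse_real_of_nat)
  define K where "K m = {g \<in> BV. L2_sq (\<lambda>x. g x - \<eta> x) \<le> ennreal (a + \<delta> m) \<and>
    L2_sq (\<lambda>x. g x - uc x) \<le> F + ennreal (\<delta> m) \<and> defect 0 grad_op (scalar g) h \<le> ennreal (\<rho> + \<delta> m)}" for m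
  have KD: "g \<in> BV" "L2_sq (\<lambda>x. g x - \<eta> x) \<le> ennreal (a + \<delta> m)" "L2_sq (\<lambda>x. g x - uc x) \<le> F + ennreal (\<delta> m)"
    "defect 0 grad_op (scalar g) h \<le> ennreal (\<rho> + \<delta> m)" if "g \<in> K m" for g m
    using that by (simp_all add: K_def)
  have KI: "g \<in> K m" if "g \<in> BV" "L2_sq (\<lambda>x. g x - \<eta> x) \<le> ennreal (a + \<delta> m)" "L2_sq (\<lambda>x. g x - uc x) \<le> F + ennreal (\<delta> m)"
    "defect 0 grad_op (scalar g) h \<le> ennreal (\<rho> + \<delta> m)" for g m
    using that by (simp add: K_def)
  have "\<exists>g. (\<forall>m. g m \<in> K m) \<and>
    (\<forall>e::real. 0 < e \<longrightarrow> (\<exists>M. \<forall>m\<ge>M. \<forall>n\<ge>M. L2_sq (\<lambda>x. g m x - g n x) \<le> ennreal e))"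
  proof (rule nested_midpoint_convex_Cauchy[OF _ _ _ _ \<eta>])
    fix m
    show "K (Suc m) \<subseteq> K m"
    proof
      fix g assume g: "g \<in> K (Suc m)"
      note d = \<delta>(2)[of m]
      show "g \<in> K m"
      proof (rule KI[OF KD(1)[OF g]])
        show "L2_sq (\<lambda>x. g x - \<eta> x) \<le> ennreal (a + \<delta> m)"
          using KD(2)[OF g] by (rule order_trans) (use d in \<open>simp add: ennreal_leI\<close>)
        show "L2_sq (\<lambda>x. g x - uc x) \<le> F + ennreal (\<delta> m)"
          using KD(3)[OF g] by (rule order_trans) (intro add_left_mono ennreal_leI d)
        show "defect 0 grad_op (scalar g) h \<le> ennreal (\<rho> + \<delta> m)"
          using KD(4)[OF g] by (rule order_trans) (use d in \<open>simp add: ennreal_leI\<close>)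
      qed
    qed
    have "\<forall>\<^sub>F n in sequentially. an n < a + \<delta> m" using a(2) \<delta>(1)[of m] by (intro order_tendstoD(2)) auto
    moreover have "\<forall>\<^sub>F n in sequentially. Fb n \<le> F + ennreal (\<delta> m)" by (rule eventually_le_ennreal_limit[OF F(2) \<delta>(1)])
    moreover have "\<forall>\<^sub>F n in sequentially. \<rho>n n < \<rho> + \<delta> m" using \<rho>(2) \<delta>(1)[of m] by (intro order_tendstoD(2)) auto
    ultimately have "\<forall>\<^sub>F n in sequentially. un n \<in> K m"
    proof eventually_elim
      case (elim n)
      show ?case
      proof (rule KI[OF un])
        show "L2_sq (\<lambda>x. un n x - \<eta> x) \<le> ennreal (a + \<delta> m)"
          using a(1)[of n] by (rule order_trans) (use elim(1) in \<open>simp add: ennreal_leI\<close>)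
        show "L2_sq (\<lambda>x. un n x - uc x) \<le> F + ennreal (\<delta> m)"
          using order_trans[OF F(1) elim(2)] by (subst L2_sq_minus_commute)
        show "defect 0 grad_op (scalar (un n)) h \<le> ennreal (\<rho> + \<delta> m)"
          using \<rho>(1)[of n] by (rule order_trans) (use elim(3) in \<open>simp add: ennreal_leI\<close>)
      qed
    qed
    then show "K m \<noteq> {}" unfolding eventually_sequentially by blast
    show "(\<lambda>x. (f x + g x) / 2) \<in> K m" if f: "f \<in> K m" and g: "g \<in> K m" for f g
    proof (rule KI[OF BV_midpoint[OF KD(1)[OF f] KD(1)[OF g]]])
      have [measurable]: "f \<in> borel_measurable lebQ" "g \<in> borel_measurable lebQ"
        using KD(1)[OF f] KD(1)[OF g] BV_measurable by auto
      have eq: "(\<lambda>x. (f x + g x) / 2 - \<zeta> x) = (\<lambda>x. ((f x - \<zeta> x) + (g x - \<zeta> x)) / 2)" for \<zeta>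
        by (simp add: field_simps)
      show "L2_sq (\<lambda>x. (f x + g x) / 2 - \<eta> x) \<le> ennreal (a + \<delta> m)"
        unfolding eq using \<eta> KD(2)[OF f] KD(2)[OF g] by (intro L2_convex) auto
      show "L2_sq (\<lambda>x. (f x + g x) / 2 - uc x) \<le> F + ennreal (\<delta> m)"
        unfolding eq using uc KD(3)[OF f] KD(3)[OF g] by (intro L2_convex) auto
      have "h \<in> L1 (Suc 0)" using h by simp
      from defect_midpoint_le[OF scalar_L1[OF BV_integrable[OF KD(1)[OF f]]] scalar_L1[OF BV_integrable[OF KD(1)[OF g]]]
          this this KD(4)[OF f] KD(4)[OF g]]
      show "defect 0 grad_op (scalar (\<lambda>x. (f x + g x) / 2)) h \<le> ennreal (\<rho> + \<delta> m)"
        unfolding scalar_midpoint by simp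
    qed
    show "f \<in> borel_measurable lebQ" if "f \<in> K m" for f by (rule BV_measurable[OF KD(1)[OF that]])
    show "L2_sq (\<lambda>x. f x - \<eta> x) \<le> ennreal (a + 1)" if "f \<in> K m" for f
      using KD(2)[OF that] by (rule order_trans) (auto simp: \<delta>_def field_simps intro!: ennreal_leI)
  qed
  then obtain g where g: "\<And>m. g m \<in> K m"
    and C: "\<And>e::real. 0 < e \<Longrightarrow> \<exists>M. \<forall>m\<ge>M. \<forall>n\<ge>M. L2_sq (\<lambda>x. g m x - g n x) \<le> ennreal e" by blast
  have gi: "integrable lebQ (g m)" for m by (rule BV_integrable[OF KD(1)[OF g]])
  obtain r u where r: "strict_mono r" and u: "integrable lebQ u" and ae: "AE x in lebQ. (\<lambda>j. g (r j) x) \<longlonglongrightarrow> u x"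
    and lim: "(\<lambda>j. LINT x|lebQ. \<bar>g (r j) x - u x\<bar>) \<longlonglongrightarrow> 0"
    using L2_Cauchy_subsequence[OF gi C] by blast
  have gm: "g m \<in> borel_measurable lebQ" for m using gi by auto
  have \<delta>r: "(\<lambda>j. \<delta> (r j)) \<longlonglongrightarrow> 0" using LIMSEQ_subseq_LIMSEQ[OF \<delta>0 r] by (simp add: o_def)
  have conv: "L1_conv 0 (\<lambda>j. scalar (g (r j))) (scalar u)" using lim by (simp add: L1_conv_def scalar_def)
  have h': "h \<in> L1 (Suc 0)" using h by simp
  have lima: "(\<lambda>j. ennreal (a + \<delta> (r j))) \<longlonglongrightarrow> ennreal a"
    using tendsto_add[OF tendsto_const \<delta>r] by (intro tendsto_ennrealI) simp
  have limF: "(\<lambda>j. F + ennreal (\<delta> (r j))) \<longlonglongrightarrow> F"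
    using tendsto_add[OF tendsto_const tendsto_ennrealI[OF \<delta>r]] by simp
  have lim\<rho>: "(\<lambda>j. \<rho> + \<delta> (r j)) \<longlonglongrightarrow> \<rho>" using tendsto_add[OF tendsto_const \<delta>r] by simp
  show ?thesis
  proof (intro bexI[of _ u] conjI)
    show "L2_sq (\<lambda>x. u x - \<eta> x) \<le> ennreal a" by (rule L2_Fatou[OF gm \<eta> ae KD(2)[OF g] lima])
    show "L2_sq (\<lambda>x. uc x - u x) \<le> F"
      by (subst L2_sq_minus_commute) (rule L2_Fatou[OF gm uc ae KD(3)[OF g] limF])
    show "defect 0 grad_op (scalar u) h \<le> ennreal \<rho>"
      by (rule defect_lsc[OF scalar_L1[OF gi] scalar_L1[OF u] conv h' h' L1_conv_const coef_conv_const KD(4)[OF g] _ lim\<rho>])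
        (use \<delta>(1) \<rho>(3) in \<open>auto intro: add_nonneg_nonneg less_imp_le\<close>)
    have b: "defect 0 grad_op (scalar (g (r j))) h \<le> ennreal (\<rho> + 1)" for j
      using KD(4)[OF g] by (rule order_trans) (auto simp: \<delta>_def field_simps intro!: ennreal_leI)
    show "u \<in> BV" unfolding BV_def mem_Collect_eq
      by (rule BVB_closed[OF KD(1)[OF g, unfolded BV_def mem_Collect_eq] scalar_L1[OF u] conv h' h' L1_conv_const coef_conv_const b])
  qed
qed

text \<open>
  Sequential compactness together with lower semicontinuity, along varying parameters. The bound
  on the distance to \<open>u\<^sub>c\<close> is carried along because the limit \<open>u\<close> is not a limit of the \<open>u\<^sub>n\<close> in a topology for which
  it could be recovered afterwards.
\<close>

theorem energy_compact:
  fixes S :: "(nat \<Rightarrow> 'n::finite oper) set" and un :: "nat \<Rightarrow> real ^ 'n \<Rightarrow> real"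
  assumes k: "1 \<le> k" and S: "training_set k S" and Bn: "\<And>n. Bn n \<in> S" and conv: "chain_conv k Bn B"
    and \<theta>: "0 < \<theta>" and \<alpha>: "\<And>l. l \<le> k \<Longrightarrow> (\<lambda>n. \<alpha>n n l) \<longlonglongrightarrow> \<alpha> l" "\<And>n l. l \<le> k \<Longrightarrow> \<theta> \<le> \<alpha>n n l"
    and \<eta>: "\<eta> \<in> L2" and uc: "uc \<in> borel_measurable lebQ" and un: "\<And>n. un n \<in> BV"
    and E: "\<And>n. energy k \<eta> (\<alpha>n n) (Bn n) (un n) \<le> ennreal (En n)" "\<And>n. 0 \<le> En n" "En \<longlonglongrightarrow> e"
    and F: "\<And>n. L2_sq (\<lambda>x. uc x - un n x) \<le> Fb n" "Fb \<longlonglongrightarrow> F"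
  shows "\<exists>u\<in>BV. energy k \<eta> \<alpha> B u \<le> ennreal e \<and> L2_sq (\<lambda>x. uc x - u x) \<le> F"
proof -
  have \<eta>m: "\<eta> \<in> borel_measurable lebQ" using \<eta> by (simp add: L2_def)
  obtain C where C: "\<And>n. En n \<le> C"
  proof -
    have "Bseq En" using E(3) by (intro convergent_imp_Bseq) (auto simp: convergent_def)
    then show ?thesis using that by (auto simp: Bseq_def abs_le_iff)
  qed
  have C0: "0 \<le> C" using C[of 0] E(2)[of 0] by linarith
  define \<delta> where "\<delta> n = inverse (real (Suc n))" for n
  have \<delta>: "0 < \<delta> n" "\<delta> n \<le> 1" for n by (auto simp: \<delta>_def field_simps)
  have \<delta>0: "\<delta> \<longlonglongrightarrow> 0" unfolding \<delta>_def by (rule LIMSEQ_inverse_real_of_nat)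
  have \<alpha>0: "0 \<le> \<alpha>n n l" if "l \<le> k" for n l using \<alpha>(2)[OF that, of n] \<theta> by linarith
  have \<alpha>l0: "0 \<le> \<alpha> l" if "l \<le> k" for l
    using \<alpha>(1)[OF that] by (rule LIMSEQ_le_const) (use \<alpha>0[OF that] in auto)
  have fin: "PGV k (\<alpha>n n) (Bn n) (un n) \<noteq> \<infinity>" for n
    using E(1)[of n] unfolding energy_def by (auto simp: top_unique)
  have "\<forall>n. \<exists>v. v \<in> competitors k (Bn n) \<and>
      chain_cost k (\<alpha>n n) (Bn n) (chain_field k (un n) v) \<le> PGV k (\<alpha>n n) (Bn n) (un n) + ennreal (\<delta> n)"
  proof
    fix n
    obtain v where "v \<in> competitors k (Bn n)"
      "chain_cost k (\<alpha>n n) (Bn n) (chain_field k (un n) v) \<le> PGV k (\<alpha>n n) (Bn n) (un n) + ennreal (\<delta> n)"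
      by (rule PGV_near_optimal[OF k un fin \<delta>(1)])
    then show "\<exists>v. v \<in> competitors k (Bn n) \<and>
      chain_cost k (\<alpha>n n) (Bn n) (chain_field k (un n) v) \<le> PGV k (\<alpha>n n) (Bn n) (un n) + ennreal (\<delta> n)"
      by (intro exI[of _ v] conjI)
  qed
  from choice[OF this] obtain v where v: "\<And>n. v n \<in> competitors k (Bn n)"
    and cost: "\<And>n. chain_cost k (\<alpha>n n) (Bn n) (chain_field k (un n) (v n)) \<le> PGV k (\<alpha>n n) (Bn n) (un n) + ennreal (\<delta> n)"
    by blast
  define w where "w n = chain_field k (un n) (v n)" for n
  have w0: "w n 0 = scalar (un n)" "w n (Suc k) = (\<lambda>x I. 0)" for n by (simp_all add: w_def)
  have wB: "w n l \<in> BVB l (chain_op (Bn n) l)" if "l \<le> k" for n l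
    unfolding w_def by (rule chain_field_BVB[OF un v that])
  have wL: "w n l \<in> L1 l" if "l \<le> Suc k" for n l unfolding w_def by (rule chain_field_L1[OF un v that])
  let ?D = "\<lambda>n l. defect l (chain_op (Bn n) l) (w n l) (w n (Suc l))"
  define A where "A n = enn2real (L2_sq (\<lambda>x. un n x - \<eta> x))" for n
  \<comment> \<open>finite, since the weights are at least \<open>\<theta>\<close> and the costs are finite\<close>
  define R where "R n l = enn2real (?D n l)" for n l
  have total: "L2_sq (\<lambda>x. un n x - \<eta> x) + chain_cost k (\<alpha>n n) (Bn n) (w n) \<le> ennreal (En n + \<delta> n)" for n
  proof -
    have "L2_sq (\<lambda>x. un n x - \<eta> x) + chain_cost k (\<alpha>n n) (Bn n) (w n) \<le>
        L2_sq (\<lambda>x. un n x - \<eta> x) + (PGV k (\<alpha>n n) (Bn n) (un n) + ennreal (\<delta> n))"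
      unfolding w_def by (intro add_left_mono cost)
    also have "\<dots> = energy k \<eta> (\<alpha>n n) (Bn n) (un n) + ennreal (\<delta> n)" by (simp add: energy_def add_ac)
    also have "\<dots> \<le> ennreal (En n) + ennreal (\<delta> n)" by (intro add_right_mono E(1))
    also have "\<dots> = ennreal (En n + \<delta> n)" using E(2) \<delta>(1)[of n] by (subst ennreal_plus) auto
    finally show ?thesis .
  qed
  have fin': "L2_sq (\<lambda>x. un n x - \<eta> x) \<noteq> \<infinity>" "chain_cost k (\<alpha>n n) (Bn n) (w n) \<noteq> \<infinity>" for n
    using total[of n] by (auto simp: top_unique)
  have A: "L2_sq (\<lambda>x. un n x - \<eta> x) = ennreal (A n)" "0 \<le> A n" for n
    using fin'(1)[of n] by (auto simp: A_def less_top)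
  have R: "?D n l = ennreal (R n l)" "0 \<le> R n l" if l: "l \<le> k" for n l
  proof -
    have "ennreal (\<alpha>n n l) * ?D n l \<le> chain_cost k (\<alpha>n n) (Bn n) (w n)"
      unfolding chain_cost_def using l by (intro member_le_sum) auto
    then have "ennreal (\<alpha>n n l) * ?D n l \<noteq> \<infinity>" using fin'(2)[of n] by (auto simp: top_unique)
    moreover have "0 < \<alpha>n n l" using \<alpha>(2)[OF l, of n] \<theta> by linarith
    ultimately have "?D n l \<noteq> \<infinity>" by (auto simp: ennreal_mult_eq_top_iff)
    then show "?D n l = ennreal (R n l)" "0 \<le> R n l" by (auto simp: R_def less_top)
  qed
  have sum0: "0 \<le> (\<Sum>l\<le>k. \<alpha>n n l * R n l)" for n using \<alpha>0 R(2) by (intro sum_nonneg mult_nonneg_nonneg) auto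
  have totalR: "A n + (\<Sum>l\<le>k. \<alpha>n n l * R n l) \<le> En n + \<delta> n" for n
  proof -
    have "chain_cost k (\<alpha>n n) (Bn n) (w n) = ennreal (\<Sum>l\<le>k. \<alpha>n n l * R n l)"
      unfolding chain_cost_def using R \<alpha>0 by (subst ennreal_weighted_sum[symmetric]) auto
    then have "ennreal (A n + (\<Sum>l\<le>k. \<alpha>n n l * R n l)) \<le> ennreal (En n + \<delta> n)"
      using total[of n] A sum0[of n] by (simp add: ennreal_plus)
    then show ?thesis using E(2)[of n] \<delta>(1)[of n] by (subst (asm) ennreal_le_iff) auto
  qed
  define C' where "C' = (C + 1) + (C + 1) / \<theta>"
  have A': "A n \<le> C + 1" for n using totalR[of n] sum0[of n] C[of n] \<delta>(2)[of n] by linarith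
  have R': "R n l \<le> (C + 1) / \<theta>" if l: "l \<le> k" for n l
  proof -
    have "\<theta> * R n l \<le> \<alpha>n n l * R n l" by (rule mult_right_mono[OF \<alpha>(2)[OF l] R(2)[OF l]])
    also have "\<dots> \<le> (\<Sum>l\<le>k. \<alpha>n n l * R n l)"
      using l \<alpha>0 R(2) by (intro member_le_sum mult_nonneg_nonneg) auto
    also have "\<dots> \<le> C + 1" using totalR[of n] A(2)[of n] C[of n] \<delta>(2)[of n] by linarith
    finally show ?thesis using \<theta> by (simp add: field_simps)
  qed
  have C'0: "C + 1 \<le> C'" "(C + 1) / \<theta> \<le> C'" using C0 \<theta> by (auto simp: C'_def)
  have A'': "A n \<le> C'" and R'': "l \<le> k \<Longrightarrow> R n l \<le> C'" for n l
    using A'[of n] R'[of l n] C'0 by linarith+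
  obtain C1 where C1: "\<And>n. L1_sum 0 (w n 0) \<le> C1"
  proof -
    let ?X = "ennreal (C + 1) + L2_sq \<eta> + 2 * emeasure lebQ (cube :: (real ^ 'n) set)"
    have X: "?X \<noteq> \<infinity>"
      using \<eta> finite_measure.emeasure_finite[OF finite_lebQ, of cube] by (auto simp: L2_def less_top ennreal_mult_eq_top_iff)
    have "L1_sum 0 (w n 0) \<le> enn2real ?X" for n
    proof -
      have "ennreal (LINT x|lebQ. \<bar>un n x\<bar>) \<le> L2_sq (\<lambda>x. un n x - \<eta> x) + L2_sq \<eta> + 2 * emeasure lebQ (cube :: (real ^ 'n) set)"
        by (rule integral_abs_le_L2_sq[OF BV_integrable[OF un] \<eta>m])
      also have "\<dots> \<le> ?X" unfolding A(1) by (intro add_right_mono ennreal_leI A')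
      finally have "enn2real (ennreal (LINT x|lebQ. \<bar>un n x\<bar>)) \<le> enn2real ?X" using X by (intro enn2real_mono) (auto simp: less_top)
      then show ?thesis by (simp add: L1_sum_def w0 scalar_def)
    qed
    then show ?thesis by (rule that)
  qed
  have D1: "?D n l \<le> ennreal (max C1 C')" if "l \<le> k" for n l
    unfolding R(1)[OF that] using R''[OF that, of n] by (intro ennreal_leI) auto
  obtain M where M: "\<And>n l. l \<in> {1..k} \<Longrightarrow> L1_sum l (w n l) \<le> M"
    using chain_bounded[OF S Bn conv wB w0(2) _ D1] C1 by (metis max.coboundedI1)
  have D2: "?D n l \<le> ennreal (max M C')" if "l \<le> k" for n l
    unfolding R(1)[OF that] using R''[OF that, of n] by (intro ennreal_leI) auto
  have M2: "L1_sum l (w n l) \<le> max M C'" if "1 \<le> l" "l \<le> k" for n l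
    using M[of l n] that by auto
  have "\<exists>r \<omega>. strict_mono r \<and> \<omega> (Suc k) = (\<lambda>x I. 0) \<and>
      (\<forall>l\<in>{1..Suc k}. \<omega> l \<in> L1 l \<and> L1_conv l (\<lambda>n. w (r n) l) (\<omega> l))"
    by (rule chain_compact[where w = w and Bn = Bn, OF S Bn wB w0(2) M2 D2])
  then obtain r1 \<omega> where r1: "strict_mono r1" and \<omega>k: "\<omega> (Suc k) = (\<lambda>x I. 0)"
    and \<omega>: "\<And>l. l \<in> {1..Suc k} \<Longrightarrow> \<omega> l \<in> L1 l" "\<And>l. l \<in> {1..Suc k} \<Longrightarrow> L1_conv l (\<lambda>n. w (r1 n) l) (\<omega> l)"
    by (elim exE conjE) blast
  \<comment> \<open>the index \<open>Suc k\<close> stands for the data term, so that one subsequence serves all real sequences\<close>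
  define X where "X l n = (if l \<le> k then R (r1 n) l else A (r1 n))" for l n
  have X: "\<bar>X l n\<bar> \<le> C'" if "l \<in> {..Suc k}" for l n
    using A''[of "r1 n"] R''[of l "r1 n"] A(2)[of "r1 n"] R(2)[of l "r1 n"] by (auto simp: X_def)
  have "\<exists>r x. strict_mono r \<and> (\<forall>l\<in>{..Suc k}. (\<lambda>n. X l (r n)) \<longlonglongrightarrow> x l)"
    by (rule real_common_subsequence[OF finite_atMost X])
  then obtain r2 x where r2: "strict_mono r2" and x: "\<And>l. l \<in> {..Suc k} \<Longrightarrow> (\<lambda>n. X l (r2 n)) \<longlonglongrightarrow> x l"
    by (elim exE conjE) blast
  define r where "r n = r1 (r2 n)" for n
  have r: "strict_mono r" using strict_mono_o[OF r1 r2] by (simp add: r_def[abs_def] o_def)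
  have Rlim: "(\<lambda>n. R (r n) l) \<longlonglongrightarrow> x l" if "l \<le> k" for l using x[of l] that by (simp add: X_def r_def)
  have Alim: "(\<lambda>n. A (r n)) \<longlonglongrightarrow> x (Suc k)" using x[of "Suc k"] by (simp add: X_def r_def)
  have x0: "0 \<le> x l" if "l \<le> Suc k" for l
  proof (cases "l \<le> k")
    case True
    show ?thesis using Rlim[OF True] by (rule LIMSEQ_le_const) (use R(2)[OF True] in auto)
  next
    case False
    then show ?thesis using LIMSEQ_le_const[OF Alim, of 0] A(2) that by (cases "l = Suc k") auto
  qed
  have wlim: "L1_conv l (\<lambda>n. w (r n) l) (\<omega> l)" if "l \<in> {1..Suc k}" for l
    using L1_conv_subseq[OF \<omega>(2)[OF that] r2] by (simp add: o_def r_def)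
  have coef: "coef_conv (\<lambda>n. chain_op (Bn (r n)) l) (chain_op B l)" if "l \<le> k" for l
    using chain_conv_subseq[OF conv r] that by (simp add: chain_conv_def)
  have s1: "Suc 0 \<in> {1..Suc k}" by simp
  have \<omega>1: "\<omega> (Suc 0) \<in> L1 1" using \<omega>(1)[OF s1] by simp
  let ?d = "\<lambda>n. \<Sum>J\<in>tidx (Suc 0). LINT x|lebQ. \<bar>\<omega> (Suc 0) x J - w (r n) (Suc 0) x J\<bar>"
  have dlim: "?d \<longlonglongrightarrow> (\<Sum>J\<in>(tidx (Suc 0) :: 'n list set). 0)"
    using wlim[OF s1] by (intro tendsto_sum) (simp add: L1_conv_def abs_minus_commute)
  have d0: "0 \<le> ?d n" for n by (intro sum_nonneg integral_nonneg_AE) auto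
  have "\<exists>u\<in>BV. L2_sq (\<lambda>x. u x - \<eta> x) \<le> ennreal (x (Suc k)) \<and> L2_sq (\<lambda>x. uc x - u x) \<le> F \<and>
    defect 0 grad_op (scalar u) (\<omega> (Suc 0)) \<le> ennreal (x 0)"
  proof (rule BV_limit[where un = "\<lambda>n. un (r n)", OF un \<eta>m uc \<omega>1 _ Alim _ F(1) LIMSEQ_subseq_LIMSEQ[OF F(2) r, unfolded o_def]])
    show "L2_sq (\<lambda>x. un (r n) x - \<eta> x) \<le> ennreal (A (r n))" for n by (simp add: A(1))
    show "(\<lambda>n. R (r n) 0 + ?d n) \<longlonglongrightarrow> x 0" using tendsto_add[OF Rlim[of 0] dlim] by simp
    show "0 \<le> x (Suc k)" "0 \<le> x 0" using x0 by auto
    show "defect 0 grad_op (scalar (un (r n))) (\<omega> (Suc 0)) \<le> ennreal (R (r n) 0 + ?d n)" for n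
    proof -
      have "defect 0 grad_op (scalar (un (r n))) (\<omega> (Suc 0)) \<le> defect 0 grad_op (scalar (un (r n))) (w (r n) (Suc 0)) + ennreal (?d n)"
        by (rule defect_change_target[OF \<omega>(1)[OF s1] wL]) simp
      also have "defect 0 grad_op (scalar (un (r n))) (w (r n) (Suc 0)) = ennreal (R (r n) 0)"
        using R(1)[of 0 "r n"] by (simp add: w0)
      finally show ?thesis using R(2)[of 0 "r n"] d0[of n] by simp
    qed
  qed
  then obtain u where u: "u \<in> BV" "L2_sq (\<lambda>x. u x - \<eta> x) \<le> ennreal (x (Suc k))" "L2_sq (\<lambda>x. uc x - u x) \<le> F"
    "defect 0 grad_op (scalar u) (\<omega> (Suc 0)) \<le> ennreal (x 0)" by blast
  have \<omega>D: "\<omega> l \<in> BVB l (chain_op B l)" "defect l (chain_op B l) (\<omega> l) (\<omega> (Suc l)) \<le> ennreal (x l)" if l: "l \<in> {1..k}" for l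
  proof -
    have l': "l \<le> k" "l \<le> Suc k" "Suc l \<le> Suc k" "l \<in> {1..Suc k}" "Suc l \<in> {1..Suc k}" using l by auto
    have b: "?D (r n) l \<le> ennreal C'" for n unfolding R(1)[OF l'(1)] by (rule ennreal_leI[OF R''[OF l'(1)]])
    show "\<omega> l \<in> BVB l (chain_op B l)"
      by (rule BVB_closed[OF wB[OF l'(1)] \<omega>(1)[OF l'(4)] wlim[OF l'(4)] wL[OF l'(3)] \<omega>(1)[OF l'(5)] wlim[OF l'(5)] coef[OF l'(1)] b])
    have "?D (r n) l \<le> ennreal (R (r n) l)" for n by (simp only: R(1)[OF l'(1)])
    from defect_lsc[OF wL[OF l'(2)] \<omega>(1)[OF l'(4)] wlim[OF l'(4)] wL[OF l'(3)] \<omega>(1)[OF l'(5)] wlim[OF l'(5)] coef[OF l'(1)] this R(2)[OF l'(1)] Rlim[OF l'(1)]]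
    show "defect l (chain_op B l) (\<omega> l) (\<omega> (Suc l)) \<le> ennreal (x l)" .
  qed
  define v' where "v' j = \<omega> (Suc j)" for j
  have v': "v' \<in> competitors k B"
    unfolding competitors_def mem_Collect_eq
  proof (intro allI impI)
    fix l assume "l < k"
    then show "v' l \<in> BVB (Suc l) (B l)" using \<omega>D(1)[of "Suc l"] by (simp add: v'_def)
  qed
  have f: "chain_field k u v' l = \<omega> l" if "l \<in> {1..Suc k}" for l
    using that \<omega>k by (cases "l = Suc k"; cases l) (auto simp: v'_def)
  have "PGV k \<alpha> B u \<le> chain_cost k \<alpha> B (chain_field k u v')" by (rule PGV_le_chain_cost[OF k u(1) v'])
  also have "\<dots> \<le> (\<Sum>l\<le>k. ennreal (\<alpha> l) * ennreal (x l))"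
    unfolding chain_cost_def
  proof (intro sum_mono mult_left_mono)
    fix l assume l: "l \<in> {..k}"
    show "defect l (chain_op B l) (chain_field k u v' l) (chain_field k u v' (Suc l)) \<le> ennreal (x l)"
    proof (cases "l = 0")
      case True
      then show ?thesis using u(4) f[of "Suc 0"] by simp
    next
      case False
      then have "l \<in> {1..k}" using l by auto
      then show ?thesis using \<omega>D(2)[of l] f[of l] f[of "Suc l"] by simp
    qed
  qed simp
  also have "\<dots> = ennreal (\<Sum>l\<le>k. \<alpha> l * x l)" using \<alpha>l0 x0 by (intro ennreal_weighted_sum) auto
  finally have pgv: "PGV k \<alpha> B u \<le> ennreal (\<Sum>l\<le>k. \<alpha> l * x l)" .
  have "energy k \<eta> \<alpha> B u \<le> ennreal (x (Suc k)) + ennreal (\<Sum>l\<le>k. \<alpha> l * x l)"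
    unfolding energy_def by (rule add_mono[OF u(2) pgv])
  also have "\<dots> = ennreal (x (Suc k) + (\<Sum>l\<le>k. \<alpha> l * x l))"
    using x0 \<alpha>l0 by (intro ennreal_plus[symmetric] sum_nonneg mult_nonneg_nonneg) auto
  also have "\<dots> \<le> ennreal e"
  proof (rule ennreal_leI, rule LIMSEQ_le)
    show "(\<lambda>n. A (r n) + (\<Sum>l\<le>k. \<alpha>n (r n) l * R (r n) l)) \<longlonglongrightarrow> x (Suc k) + (\<Sum>l\<le>k. \<alpha> l * x l)"
      by (intro tendsto_add Alim tendsto_sum tendsto_mult Rlim LIMSEQ_subseq_LIMSEQ[OF \<alpha>(1) r, unfolded o_def]) auto
    show "(\<lambda>n. En (r n) + \<delta> (r n)) \<longlonglongrightarrow> e"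
      using tendsto_add[OF LIMSEQ_subseq_LIMSEQ[OF E(3) r] LIMSEQ_subseq_LIMSEQ[OF \<delta>0 r]] by (simp add: o_def)
  qed (use totalR in auto)
  finally show ?thesis using u by blast
qed

section \<open>Existence on both levels\<close>

text \<open>
  A minimizing sequence, with constant parameters; the infimum is finite because the energy of 0 is
  the squared norm of the datum.
\<close>

lemma level2_nonempty:
  fixes S :: "(nat \<Rightarrow> 'n::finite oper) set"
  assumes k: "1 \<le> k" and S: "training_set k S" and B: "B \<in> S"
    and \<theta>: "0 < \<theta>" and \<alpha>: "\<And>l. l \<le> k \<Longrightarrow> \<theta> \<le> \<alpha> l" and \<eta>: "\<eta> \<in> L2"
  shows "level2 \<eta> k \<alpha> B \<noteq> {}"
proof -
  define m where "m = (INF u\<in>BV. energy k \<eta> \<alpha> B u)"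
  have m_le: "m \<le> energy k \<eta> \<alpha> B u" if "u \<in> BV" for u unfolding m_def by (rule INF_lower[OF that])
  have "m \<le> L2_sq \<eta>" by (rule order_trans[OF m_le[OF zero_BV] energy_zero[OF k]])
  also have "\<dots> < \<infinity>" using \<eta> by (simp add: L2_def)
  finally have fin: "m < \<infinity>" .
  then have m: "ennreal (enn2real m) = m" by simp
  define \<delta> where "\<delta> n = inverse (real (Suc n))" for n
  have \<delta>: "0 < \<delta> n" for n by (auto simp: \<delta>_def)
  have lim: "(\<lambda>n. enn2real m + \<delta> n) \<longlonglongrightarrow> enn2real m"
    using tendsto_add[OF tendsto_const LIMSEQ_inverse_real_of_nat, of "enn2real m"] by (simp add: \<delta>_def)
  have "\<forall>n. \<exists>u. u \<in> BV \<and> energy k \<eta> \<alpha> B u \<le> ennreal (enn2real m + \<delta> n)"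
  proof
    fix n
    have "m < m + ennreal (\<delta> n)" using fin \<delta> ennreal_add_left_cancel_less[of m 0 "ennreal (\<delta> n)"] by simp
    also have "\<dots> = ennreal (enn2real m + \<delta> n)" using \<delta>[of n] m by (subst ennreal_plus) auto
    finally have "\<exists>u\<in>BV. energy k \<eta> \<alpha> B u < ennreal (enn2real m + \<delta> n)"
      unfolding m_def INF_less_iff .
    then show "\<exists>u. u \<in> BV \<and> energy k \<eta> \<alpha> B u \<le> ennreal (enn2real m + \<delta> n)"
      by (auto intro: less_imp_le)
  qed
  from choice[OF this] obtain un where un: "\<And>n. un n \<in> BV" "\<And>n. energy k \<eta> \<alpha> B (un n) \<le> ennreal (enn2real m + \<delta> n)"
    by blast
  have conv: "chain_conv k (\<lambda>n. B) B" by (simp add: chain_conv_def coef_conv_const)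
  have \<eta>m: "\<eta> \<in> borel_measurable lebQ" using \<eta> by (simp add: L2_def)
  have "\<exists>u\<in>BV. energy k \<eta> \<alpha> B u \<le> ennreal (enn2real m) \<and> L2_sq (\<lambda>x. \<eta> x - u x) \<le> \<infinity>"
  proof (rule energy_compact[OF k S B conv \<theta> tendsto_const \<alpha> \<eta> \<eta>m un _ lim])
    show "0 \<le> enn2real m + \<delta> n" for n using \<delta>[of n] by (simp add: add_nonneg_nonneg)
    show "(\<lambda>n::nat. \<infinity> :: ennreal) \<longlonglongrightarrow> \<infinity>" by (rule tendsto_const)
  qed auto
  then obtain u where u: "u \<in> BV" "energy k \<eta> \<alpha> B u \<le> m" unfolding m by blast
  have "u \<in> level2 \<eta> k \<alpha> B"
    unfolding level2_iff using u(1) order_trans[OF u(2) m_le] by blast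
  then show ?thesis by blast
qed

lemma coef_le_op_norm:
  assumes "J \<in> tidx (Suc l)" "I \<in> tidx l"
  shows "\<bar>A i J I\<bar> \<le> op_norm l A"
proof -
  have "(A i J I)\<^sup>2 \<le> (\<Sum>I\<in>tidx l. (A i J I)\<^sup>2)" using assms(2) by (intro member_le_sum) auto
  also have "\<dots> \<le> (\<Sum>J\<in>tidx (Suc l). \<Sum>I\<in>tidx l. (A i J I)\<^sup>2)"
    using assms(1) by (intro member_le_sum[of J _ "\<lambda>J. \<Sum>I\<in>tidx l. (A i J I)\<^sup>2"] sum_nonneg) auto
  finally have "\<bar>A i J I\<bar> \<le> sqrt (\<Sum>J\<in>tidx (Suc l). \<Sum>I\<in>tidx l. (A i J I)\<^sup>2)"
    by (simp add: real_le_rsqrt)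
  also have "\<dots> \<le> op_norm l A"
    unfolding op_norm_def by (intro member_le_sum) (auto intro!: sum_nonneg)
  finally show ?thesis .
qed

text \<open>
  All weights and all coefficients lie in a bounded interval, so the theorem of Bolzano and Weierstrass applies to
  finitely many real sequences.
\<close>

lemma parameters_compact:
  fixes S :: "(nat \<Rightarrow> 'n::finite oper) set" and Bn :: "nat \<Rightarrow> nat \<Rightarrow> 'n oper" and \<alpha>n :: "nat \<Rightarrow> nat \<Rightarrow> real"
  assumes S: "training_set k S" and Bn: "\<And>n. Bn n \<in> S" and \<alpha>n: "\<And>n. \<alpha>n n \<in> param_box \<theta> k"
  shows "\<exists>r \<alpha> B. strict_mono r \<and> \<alpha> \<in> param_box \<theta> k \<and> B \<in> S \<and>
    (\<forall>l\<le>k. (\<lambda>n. \<alpha>n (r n) l) \<longlonglongrightarrow> \<alpha> l) \<and> chain_conv k (\<lambda>n. Bn (r n)) B"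
proof -
  obtain C where C: "\<And>B l. B \<in> S \<Longrightarrow> l < k \<Longrightarrow> op_norm (Suc l) (B l) \<le> C"
    using S unfolding training_set_def bounded_tuples_def by blast
  have op: "Bn n l \<in> operators (Suc l)" if "l < k" for n l
  proof -
    have "Bn n \<in> Pi_tuple k" using S Bn[of n] by (auto simp: training_set_def)
    then show ?thesis using that by (auto simp: Pi_tuple_def Pi_op_def PiE_def)
  qed
  define X where "X p n = (case p of Inl l \<Rightarrow> \<alpha>n n l | Inr (l, i, J, I) \<Rightarrow> Bn n l i J I)"
    for p :: "nat + nat \<times> 'n \<times> 'n list \<times> 'n list" and n
  define P where "P = {..k} <+> (SIGMA l:{..<k}. (UNIV :: 'n set) \<times> (tidx (Suc (Suc l)) :: 'n list set) \<times> (tidx (Suc l) :: 'n list set))"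
  have fP: "finite P" unfolding P_def by (intro finite_Plus finite_SigmaI finite_cartesian_product) auto
  have XC: "\<bar>X p n\<bar> \<le> max \<bar>C\<bar> (\<bar>\<theta>\<bar> + \<bar>1 / \<theta>\<bar>)" if "p \<in> P" for p n
    using that unfolding P_def
  proof (rule PlusE)
    fix l assume l: "l \<in> {..k}" "p = Inl l"
    then have "\<alpha>n n l \<in> {\<theta>..1/\<theta>}" using \<alpha>n[of n] by (auto simp: param_box_def PiE_def Pi_def)
    then have "\<bar>\<alpha>n n l\<bar> \<le> \<bar>\<theta>\<bar> + \<bar>1 / \<theta>\<bar>" unfolding atLeastAtMost_iff by linarith
    then show ?thesis using l by (simp add: X_def)
  next
    fix q assume q: "q \<in> (SIGMA l:{..<k}. (UNIV :: 'n set) \<times> (tidx (Suc (Suc l)) :: 'n list set) \<times> (tidx (Suc l) :: 'n list set))" "p = Inr q"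
    then obtain l i J I where "q = (l, i, J, I)" "l < k" "J \<in> tidx (Suc (Suc l))" "I \<in> tidx (Suc l)" by auto
    then show ?thesis
      using coef_le_op_norm[of J "Suc l" I "Bn n l" i] C[OF Bn[of n], of l] q(2) by (simp add: X_def)
  qed
  have "\<exists>r x. strict_mono r \<and> (\<forall>p\<in>P. (\<lambda>n. X p (r n)) \<longlonglongrightarrow> x p)"
    by (rule real_common_subsequence[OF fP XC])
  then obtain r x where r: "strict_mono r" and x: "\<And>p. p \<in> P \<Longrightarrow> (\<lambda>n. X p (r n)) \<longlonglongrightarrow> x p" by blast
  define \<alpha> where "\<alpha> = (\<lambda>l\<in>{..k}. x (Inl l))"
  define B where "B = (\<lambda>l\<in>{..<k}. \<lambda>i J I. if J \<in> tidx (Suc (Suc l)) \<and> I \<in> tidx (Suc l) then x (Inr (l, i, J, I)) else 0)"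
  have \<alpha>lim: "(\<lambda>n. \<alpha>n (r n) l) \<longlonglongrightarrow> \<alpha> l" if "l \<le> k" for l
    using x[of "Inl l"] that by (simp add: P_def X_def \<alpha>_def InlI)
  have \<alpha>: "\<alpha> \<in> param_box \<theta> k"
    unfolding param_box_def
  proof (rule PiE_I)
    fix l assume l: "l \<in> {..k}"
    have "\<alpha>n (r n) l \<in> {\<theta>..1/\<theta>}" for n using \<alpha>n[of "r n"] l by (auto simp: param_box_def PiE_def Pi_def)
    moreover have "(\<lambda>n. \<alpha>n (r n) l) \<longlonglongrightarrow> \<alpha> l" using l by (intro \<alpha>lim) simp
    ultimately show "\<alpha> l \<in> {\<theta>..1/\<theta>}" by (rule closed_sequentially[OF closed_atLeastAtMost])
  qed (simp add: \<alpha>_def)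
  have Bop: "B \<in> (\<Pi>\<^sub>E l\<in>{..<k}. operators (Suc l))"
    by (rule PiE_I) (auto simp: B_def operators_def)
  have Blim: "(\<lambda>n. Bn (r n) l i J I) \<longlonglongrightarrow> B l i J I" if l: "l < k" for l i J I
  proof (cases "J \<in> tidx (Suc (Suc l)) \<and> I \<in> tidx (Suc l)")
    case True
    then show ?thesis using x[of "Inr (l, i, J, I)"] l by (simp add: P_def X_def B_def InrI)
  next
    case False
    have "Bn n l i J I = 0" for n using op[OF l, of n] False by (simp add: operators_def)
    moreover have "B l i J I = 0" unfolding B_def using l False by auto
    ultimately show ?thesis by simp
  qed
  have "(\<lambda>n. op_norm (Suc l) (\<lambda>i J I. Bn (r n) l i J I - B l i J I)) \<longlonglongrightarrow> 0" if l: "l < k" for l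
  proof -
    have "(\<lambda>n. op_norm (Suc l) (\<lambda>i J I. Bn (r n) l i J I - B l i J I)) \<longlonglongrightarrow>
        op_norm (Suc l) (\<lambda>i J I. B l i J I - B l i J I)"
      unfolding op_norm_def
      by (intro tendsto_sum tendsto_real_sqrt tendsto_power tendsto_diff Blim[OF l] tendsto_const)
    then show ?thesis by (simp add: op_norm_def)
  qed
  then have oplim: "\<forall>l<k. (\<lambda>n. op_norm (Suc l) (\<lambda>i J I. Bn (r n) l i J I - B l i J I)) \<longlonglongrightarrow> 0" by simp
  have "closed_tuples k S" using S by (simp add: training_set_def)
  from mp[OF mp[OF bspec[OF spec[OF this[unfolded closed_tuples_def], of "\<lambda>n. Bn (r n)"] Bop]] oplim]
  have BS: "B \<in> S" using Bn by simp
  have "chain_conv k (\<lambda>n. Bn (r n)) B"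
    unfolding chain_conv_def
  proof (intro allI impI)
    fix l assume "l \<le> k"
    then show "coef_conv (\<lambda>n. chain_op (Bn (r n)) l) (chain_op B l)"
      by (cases l) (auto simp: coef_conv_const, simp add: coef_conv_def Blim)
  qed
  then show ?thesis using r \<alpha> BS \<alpha>lim by blast
qed

text \<open>
  Limits of minimizers minimize: the energy of the limit is at most the limit of the energies, and each of
  those is at most the energy of a fixed \<open>z\<close>, which is upper semicontinuous in the parameters.
\<close>

lemma level2_closed:
  fixes S :: "(nat \<Rightarrow> 'n::finite oper) set" and un :: "nat \<Rightarrow> real ^ 'n \<Rightarrow> real"
  assumes k: "1 \<le> k" and S: "training_set k S" and Bn: "\<And>n. Bn n \<in> S" and conv: "chain_conv k Bn B"
    and \<theta>: "0 < \<theta>" and \<alpha>: "\<And>l. l \<le> k \<Longrightarrow> (\<lambda>n. \<alpha>n n l) \<longlonglongrightarrow> \<alpha> l" "\<And>n l. l \<le> k \<Longrightarrow> \<theta> \<le> \<alpha>n n l"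
    and \<eta>: "\<eta> \<in> L2" and uc: "uc \<in> borel_measurable lebQ"
    and un: "\<And>n. un n \<in> level2 \<eta> k (\<alpha>n n) (Bn n)"
    and F: "\<And>n. L2_sq (\<lambda>x. uc x - un n x) \<le> Fb n" "Fb \<longlonglongrightarrow> F"
  shows "\<exists>u\<in>level2 \<eta> k \<alpha> B. L2_sq (\<lambda>x. uc x - u x) \<le> F"
proof -
  have unBV: "un n \<in> BV" and min: "z \<in> BV \<Longrightarrow> energy k \<eta> (\<alpha>n n) (Bn n) (un n) \<le> energy k \<eta> (\<alpha>n n) (Bn n) z" for n z
    using un[of n] by (auto simp: level2_iff)
  have \<alpha>0: "0 \<le> \<alpha>n n l" if "l \<le> k" for n l using \<alpha>(2)[OF that, of n] \<theta> by linarith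
  have \<alpha>l: "0 < \<alpha> l" if "l \<le> k" for l
  proof -
    have "\<theta> \<le> \<alpha> l" using \<alpha>(1)[OF that] by (rule LIMSEQ_le_const) (use \<alpha>(2)[OF that] in auto)
    then show ?thesis using \<theta> by linarith
  qed
  define En where "En n = enn2real (energy k \<eta> (\<alpha>n n) (Bn n) (un n))" for n
  have L: "L2_sq \<eta> < \<infinity>" using \<eta> by (simp add: L2_def)
  have le: "energy k \<eta> (\<alpha>n n) (Bn n) (un n) \<le> L2_sq \<eta>" for n
    by (rule order_trans[OF min[OF zero_BV] energy_zero[OF k]])
  have En: "energy k \<eta> (\<alpha>n n) (Bn n) (un n) = ennreal (En n)" for n
    using le[of n] L by (auto simp: En_def)
  have "\<bar>En n\<bar> \<le> enn2real (L2_sq \<eta>)" for n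
  proof -
    have "En n \<le> enn2real (L2_sq \<eta>)" unfolding En_def using le L by (intro enn2real_mono) auto
    then show ?thesis by (simp add: En_def)
  qed
  then have "\<exists>r x. strict_mono r \<and> (\<forall>i\<in>{()}. (\<lambda>n. En (r n)) \<longlonglongrightarrow> x i)"
    by (intro real_common_subsequence[where X = "\<lambda>_. En"]) auto
  then obtain r e where r: "strict_mono r" and e: "(\<lambda>n. En (r n)) \<longlonglongrightarrow> e" by blast
  have conv': "chain_conv k (\<lambda>n. Bn (r n)) B" using chain_conv_subseq[OF conv r] by (simp add: o_def)
  have \<alpha>': "(\<lambda>n. \<alpha>n (r n) l) \<longlonglongrightarrow> \<alpha> l" if "l \<le> k" for l
    using LIMSEQ_subseq_LIMSEQ[OF \<alpha>(1)[OF that] r] by (simp add: o_def)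
  have "\<exists>u\<in>BV. energy k \<eta> \<alpha> B u \<le> ennreal e \<and> L2_sq (\<lambda>x. uc x - u x) \<le> F"
  proof (rule energy_compact[OF k S Bn conv' \<theta> \<alpha>' \<alpha>(2) \<eta> uc unBV _ _ e F(1)])
    show "(\<lambda>n. Fb (r n)) \<longlonglongrightarrow> F" using LIMSEQ_subseq_LIMSEQ[OF F(2) r] by (simp add: o_def)
  qed (auto simp: En, simp add: En_def)
  then obtain u where u: "u \<in> BV" "energy k \<eta> \<alpha> B u \<le> ennreal e" "L2_sq (\<lambda>x. uc x - u x) \<le> F" by blast
  have "energy k \<eta> \<alpha> B u \<le> energy k \<eta> \<alpha> B z" if z: "z \<in> BV" for z
  proof (rule ennreal_le_epsilon)
    fix \<epsilon> :: real assume \<epsilon>: "0 < \<epsilon>"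
    have ev: "\<forall>\<^sub>F n in sequentially. ennreal (En (r n)) \<le> energy k \<eta> \<alpha> B z + ennreal \<epsilon>"
      using PGV_limsup[OF k z conv' \<alpha>' \<alpha>0 \<alpha>l \<epsilon>]
    proof (rule eventually_mono)
      fix n assume "PGV k (\<alpha>n (r n)) (Bn (r n)) z \<le> PGV k \<alpha> B z + ennreal \<epsilon>"
      then have "energy k \<eta> (\<alpha>n (r n)) (Bn (r n)) z \<le> energy k \<eta> \<alpha> B z + ennreal \<epsilon>"
        unfolding energy_def add.assoc by (rule add_left_mono)
      then show "ennreal (En (r n)) \<le> energy k \<eta> \<alpha> B z + ennreal \<epsilon>"
        using min[OF z, of "r n"] unfolding En by (rule order_trans[rotated])
    qed
    have "ennreal e \<le> energy k \<eta> \<alpha> B z + ennreal \<epsilon>"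
      by (rule tendsto_upperbound[OF tendsto_ennrealI[OF e] ev]) simp
    then show "energy k \<eta> \<alpha> B u \<le> energy k \<eta> \<alpha> B z + ennreal \<epsilon>" by (rule order_trans[OF u(2)])
  qed
  then show ?thesis using u(1,3) by (intro bexI[of _ u]) (simp_all add: level2_iff)
qed

theorem theorem5p4:
  fixes \<theta> :: real and k :: nat
    and u\<^sub>\<eta> u\<^sub>c :: "real ^ 'n::finite \<Rightarrow> real"
    and \<Sigma> :: "(nat \<Rightarrow> 'n oper) set"
  assumes "0 < \<theta>" "\<theta> < 1" "1 \<le> k"
    and "u\<^sub>\<eta> \<in> L2" "u\<^sub>c \<in> BV"
    and "training_set k \<Sigma>" "\<Sigma> \<noteq> {}"
  shows "(\<forall>\<alpha>\<in>param_box \<theta> k. \<forall>B\<in>\<Sigma>. \<exists>u\<in>level2 u\<^sub>\<eta> k \<alpha> B.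
            \<forall>w\<in>level2 u\<^sub>\<eta> k \<alpha> B. AE x in lebesgue_on cube. w x = u x) \<and>
         (\<exists>(\<alpha>, B) \<in> level1 u\<^sub>c u\<^sub>\<eta> \<theta> k \<Sigma>. \<exists>u\<in>BV. u \<in> level2 u\<^sub>\<eta> k \<alpha> B)"
proof
  have box: "\<theta> \<le> \<alpha> l" if "\<alpha> \<in> param_box \<theta> k" "l \<le> k" for \<alpha> l
    using that by (auto simp: param_box_def PiE_def Pi_def)
  have ne: "level2 u\<^sub>\<eta> k \<alpha> B \<noteq> {}" if "\<alpha> \<in> param_box \<theta> k" "B \<in> \<Sigma>" for \<alpha> B
    by (rule level2_nonempty[OF assms(3,6) that(2) assms(1) box[OF that(1)] assms(4)])
  show "\<forall>\<alpha>\<in>param_box \<theta> k. \<forall>B\<in>\<Sigma>. \<exists>u\<in>level2 u\<^sub>\<eta> k \<alpha> B.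
      \<forall>w\<in>level2 u\<^sub>\<eta> k \<alpha> B. AE x in lebesgue_on cube. w x = u x"
  proof (intro ballI)
    fix \<alpha> B assume "\<alpha> \<in> param_box \<theta> k" "B \<in> \<Sigma>"
    then obtain u where u: "u \<in> level2 u\<^sub>\<eta> k \<alpha> B" using ne by blast
    then show "\<exists>u\<in>level2 u\<^sub>\<eta> k \<alpha> B. \<forall>w\<in>level2 u\<^sub>\<eta> k \<alpha> B. AE x in lebesgue_on cube. w x = u x"
      by (intro bexI[OF _ u] ballI level2_unique[OF assms(3,4) u])
  qed
  \<comment> \<open>minimizing over triples avoids choosing representatives of the reconstructed images\<close>
  define T where "T = (SIGMA p:param_box \<theta> k \<times> \<Sigma>. level2 u\<^sub>\<eta> k (fst p) (snd p))"
  have TD: "fst (fst t) \<in> param_box \<theta> k" "snd (fst t) \<in> \<Sigma>" "snd t \<in> level2 u\<^sub>\<eta> k (fst (fst t)) (snd (fst t))"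
    if "t \<in> T" for t using that by (auto simp: T_def)
  define \<Phi> where "\<Phi> = (INF t\<in>T. L2_sq (\<lambda>x. u\<^sub>c x - snd t x))"
  have \<Phi>_le: "\<Phi> \<le> L2_sq (\<lambda>x. u\<^sub>c x - u x)" if "\<alpha> \<in> param_box \<theta> k" "B \<in> \<Sigma>" "u \<in> level2 u\<^sub>\<eta> k \<alpha> B" for \<alpha> B u
  proof -
    have "((\<alpha>, B), u) \<in> T" using that by (simp add: T_def)
    from INF_lower[OF this, of "\<lambda>t. L2_sq (\<lambda>x. u\<^sub>c x - snd t x)"] show ?thesis by (simp add: \<Phi>_def)
  qed
  have T: "T \<noteq> {}"
  proof -
    have "(\<lambda>l\<in>{..k}. 1) \<in> param_box \<theta> k" using assms(1,2) by (auto simp: param_box_def field_simps)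
    moreover obtain B where "B \<in> \<Sigma>" using assms(7) by blast
    moreover from calculation obtain u where "u \<in> level2 u\<^sub>\<eta> k (\<lambda>l\<in>{..k}. 1) B" using ne by blast
    ultimately have "(((\<lambda>l\<in>{..k}. 1), B), u) \<in> T" by (simp add: T_def)
    then show ?thesis by blast
  qed
  define \<delta> where "\<delta> n = inverse (real (Suc n))" for n
  have \<delta>: "0 < \<delta> n" for n by (auto simp: \<delta>_def)
  have lim: "(\<lambda>n. \<Phi> + ennreal (\<delta> n)) \<longlonglongrightarrow> \<Phi>"
    using tendsto_add[OF tendsto_const tendsto_ennrealI[OF LIMSEQ_inverse_real_of_nat], of \<Phi>] by (simp add: \<delta>_def)
  have "\<forall>n. \<exists>t. t \<in> T \<and> L2_sq (\<lambda>x. u\<^sub>c x - snd t x) \<le> \<Phi> + ennreal (\<delta> n)"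
  proof
    fix n
    show "\<exists>t. t \<in> T \<and> L2_sq (\<lambda>x. u\<^sub>c x - snd t x) \<le> \<Phi> + ennreal (\<delta> n)"
    proof (cases "\<Phi> = \<infinity>")
      case True
      then show ?thesis using T by auto
    next
      case False
      then have "\<Phi> < \<Phi> + ennreal (\<delta> n)" using \<delta> ennreal_add_left_cancel_less[of \<Phi> 0 "ennreal (\<delta> n)"] by simp
      then obtain t where "t \<in> T" "L2_sq (\<lambda>x. u\<^sub>c x - snd t x) < \<Phi> + ennreal (\<delta> n)"
        by (subst (asm) (1) \<Phi>_def) (auto simp: INF_less_iff)
      then show ?thesis by (intro exI[of _ t]) (simp add: less_imp_le)
    qed
  qed
  from choice[OF this] obtain t where t: "\<And>n. t n \<in> T" "\<And>n. L2_sq (\<lambda>x. u\<^sub>c x - snd (t n) x) \<le> \<Phi> + ennreal (\<delta> n)"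
    by blast
  have "\<exists>r \<alpha> B. strict_mono r \<and> \<alpha> \<in> param_box \<theta> k \<and> B \<in> \<Sigma> \<and>
      (\<forall>l\<le>k. (\<lambda>n. fst (fst (t (r n))) l) \<longlonglongrightarrow> \<alpha> l) \<and> chain_conv k (\<lambda>n. snd (fst (t (r n)))) B"
    by (rule parameters_compact[where \<alpha>n = "\<lambda>n. fst (fst (t n))" and Bn = "\<lambda>n. snd (fst (t n))",
          OF assms(6) TD(2)[OF t(1)] TD(1)[OF t(1)]])
  then obtain r \<alpha> B where r: "strict_mono r" and \<alpha>B: "\<alpha> \<in> param_box \<theta> k" "B \<in> \<Sigma>"
    and \<alpha>lim: "\<And>l. l \<le> k \<Longrightarrow> (\<lambda>n. fst (fst (t (r n))) l) \<longlonglongrightarrow> \<alpha> l" and conv: "chain_conv k (\<lambda>n. snd (fst (t (r n)))) B"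
    by (elim exE conjE) blast
  have "\<exists>u\<in>level2 u\<^sub>\<eta> k \<alpha> B. L2_sq (\<lambda>x. u\<^sub>c x - u x) \<le> \<Phi>"
  proof (rule level2_closed[OF assms(3,6) TD(2)[OF t(1)] conv assms(1) \<alpha>lim box[OF TD(1)[OF t(1)]] assms(4)
        BV_measurable[OF assms(5)] TD(3)[OF t(1)] t(2)])
    show "(\<lambda>n. \<Phi> + ennreal (\<delta> (r n))) \<longlonglongrightarrow> \<Phi>" using LIMSEQ_subseq_LIMSEQ[OF lim r] by (simp add: o_def)
  qed
  then obtain u where u: "u \<in> level2 u\<^sub>\<eta> k \<alpha> B" "L2_sq (\<lambda>x. u\<^sub>c x - u x) \<le> \<Phi>" by blast
  have opt: "L2_sq (\<lambda>x. u\<^sub>c x - w x) \<le> \<Phi>" if w: "w \<in> level2 u\<^sub>\<eta> k \<alpha> B" for w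
  proof -
    have "AE x in lebQ. u\<^sub>c x - w x = u\<^sub>c x - u x"
      using level2_unique[OF assms(3,4) u(1) w] by eventually_elim simp
    from L2_sq_cong_AE[OF this] show ?thesis using u(2) by simp
  qed
  have "(\<alpha>, B) \<in> level1 u\<^sub>c u\<^sub>\<eta> \<theta> k \<Sigma>"
    using \<alpha>B by (auto simp: level1_def intro: order_trans[OF opt \<Phi>_le])
  moreover have "u \<in> BV" using u(1) by (simp add: level2_iff)
  ultimately show "\<exists>(\<alpha>, B) \<in> level1 u\<^sub>c u\<^sub>\<eta> \<theta> k \<Sigma>. \<exists>u\<in>BV. u \<in> level2 u\<^sub>\<eta> k \<alpha> B"
    using u(1) by (intro bexI[of _ "(\<alpha>, B)"]) auto
qed

end
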